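(* Let $c\ge0$ and $\theta\in[0,\infty)^2$. The martingale problem $(\mathcal{G}^{c,\theta},V)$ is well posed and its unique solution is the infinite rate mutually catalytic branching process $X^{c,\theta}$ with parameters $(c,\theta)$.
   Context: Let $E:=[0,\infty)^2\setminus(0,\infty)^2$. For $x\in[0,\infty)^2$, let $B$ be a standard planar Brownian motion started at $x$, $\tau=\inf\{t>0: B_t\notin(0,\infty)^2\}$, and let $Q_x$ be the law of $B_\tau$ (a probability measure on $E$; $Q_x=\delta_x$ if $x\in E$). The infinite rate mutually catalytic branching process $X^{c,\theta}$ is the Markov process with state space $E$, càdlàg paths and transition kernels $p_t(x,\cdot)=Q_{e^{-ct}x+(1-e^{-ct})\theta}$. For $x,y\in\mathbb{R}^2$ let $x\diamond y:=-(x_1+x_2)(y_1+y_2)+i(x_1-x_2)(y_1-y_2)$ (with $i=\sqrt{-1}$) and $F(x,y)=\exp(x\diamond y)$. $V$ is the complex vector space of functions on $E$ spanned by $\{F(\cdot,z): z\in E\}$, and $\mathcal{G}^{c,\theta}$ is the linear operator on $V$ determined by $\mathcal{G}^{c,\theta}F(\cdot,z)(x)=\big(c(\theta-x)\diamond z\big)F(x,z)$ for $z\in E$. A solution of the $(\mathcal{G}^{c,\theta},V)$ martingale problem is an $E$-valued measurable stochastic process $X$ such that for every $z\in E$ $$M_t:=F(X_t,z)-\int_0^t\big(c(\theta-X_s)\diamond z\big)F(X_s,z)\,ds$$ is a ($\mathbb{C}$-valued) martingale. The martingale problem is well posed if for every probability measure $\mu$ on $E$ there exists a solution $X$ with $\mathcal{L}[X_0]=\mu$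 (existence), and any two solutions with the same initial law have the same finite-dimensional distributions (uniqueness). *)

theory Defs
  imports "HOL-Probability.Probability"
begin

definition quadrant :: "(real \<times> real) set" where
  "quadrant = {0..} \<times> {0..}"

definition open_quadrant :: "(real \<times> real) set" where
  "open_quadrant = {0<..} \<times> {0<..}"

definition E :: "(real \<times> real) set" where
  "E = quadrant - open_quadrant"

text \<open>Probability measures on \<^term>\<open>E\<close> are Borel probability measures on the plane that
  give the closed set \<^term>\<open>E\<close> full mass.\<close>

definition prob_on_E :: "(real \<times> real) measure \<Rightarrow> bool" where
  "prob_on_E \<mu> \<longleftrightarrow> prob_space \<mu> \<and> sets \<mu> = sets borel \<and> emeasure \<mu> E = 1"

text \<open>Processes are indexed by \<^typ>\<open>real\<close>; only the values at times \<open>t \<ge> 0\<close> matter.\<close>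

definition planar_BM ::
  "'a measure \<Rightarrow> (real \<Rightarrow> 'a \<Rightarrow> real \<times> real) \<Rightarrow> real \<times> real \<Rightarrow> bool" where
  "planar_BM M B x \<longleftrightarrow>
     prob_space M \<and>
     (\<forall>t\<ge>0. B t \<in> borel_measurable M) \<and>
     (\<forall>\<omega>\<in>space M. B 0 \<omega> = x \<and> continuous_on {0..} (\<lambda>t. B t \<omega>)) \<and>
     (\<forall>s t. 0 \<le> s \<and> s < t \<longrightarrow>
        distr M borel (\<lambda>\<omega>. B t \<omega> - B s \<omega>) =
          density lborel (normal_density 0 (sqrt (t - s))) \<Otimes>\<^sub>M
          density lborel (normal_density 0 (sqrt (t - s)))) \<and>
     (\<forall>(n::nat) (t :: nat \<Rightarrow> real). 0 \<le> t 0 \<and> (\<forall>i<n. t i \<le> t (Suc i)) \<longrightarrow>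
        prob_space.indep_vars M (\<lambda>_. borel) (\<lambda>i \<omega>. B (t (Suc i)) \<omega> - B (t i) \<omega>) {..<n})"

text \<open>The value \<open>0\<close> for a path that never leaves the open quadrant is a convention; for planar
  Brownian motion this is a null event.\<close>

definition exit_time :: "(real \<Rightarrow> real \<times> real) \<Rightarrow> real" where
  "exit_time b =
     (if \<exists>t>0. b t \<notin> open_quadrant then Inf {t. 0 < t \<and> b t \<notin> open_quadrant} else 0)"

text \<open>The law of \<open>B\<^sub>\<tau>\<close>. It does not depend on the Brownian motion that is chosen, so it is
  enough to let the Brownian motion range over probability spaces whose sample points are
  paths.\<close>

type_synonym path = "real \<Rightarrow> real \<times> real"

definition Q :: "real \<times> real \<Rightarrow> (real \<times> real) measure" where
  "Q x = (THE \<nu>. \<exists>(M :: path measure) B. planar_BM M B x \<and>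
            \<nu> = distr M borel (\<lambda>\<omega>. B (exit_time (\<lambda>t. B t \<omega>)) \<omega>))"

definition kernel ::
  "real \<Rightarrow> real \<times> real \<Rightarrow> real \<Rightarrow> real \<times> real \<Rightarrow> (real \<times> real) measure" where
  "kernel c \<theta> t x = Q (exp (- c * t) *\<^sub>R x + (1 - exp (- c * t)) *\<^sub>R \<theta>)"

definition nat_filtration ::
  "'a measure \<Rightarrow> (real \<Rightarrow> 'a \<Rightarrow> real \<times> real) \<Rightarrow> real \<Rightarrow> 'a measure" where
  "nat_filtration M X t =
     sigma (space M) {X s -` A \<inter> space M | s A. 0 \<le> s \<and> s \<le> t \<and> A \<in> sets borel}"

definition cadlag :: "(real \<Rightarrow> real \<times> real) \<Rightarrow> bool" where
  "cadlag w \<longleftrightarrow>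
     (\<forall>t\<ge>0. continuous (at_right t) w) \<and> (\<forall>t>0. \<exists>l. (w \<longlongrightarrow> l) (at_left t))"

definition infinite_rate_MCB ::
  "real \<Rightarrow> real \<times> real \<Rightarrow> 'a measure \<Rightarrow> (real \<Rightarrow> 'a \<Rightarrow> real \<times> real) \<Rightarrow> bool" where
  "infinite_rate_MCB c \<theta> M X \<longleftrightarrow>
     prob_space M \<and>
     (\<forall>t\<ge>0. X t \<in> borel_measurable M) \<and>
     (\<forall>t\<ge>0. \<forall>\<omega>\<in>space M. X t \<omega> \<in> E) \<and>
     (\<forall>\<omega>\<in>space M. cadlag (\<lambda>t. X t \<omega>)) \<and>
     (\<forall>s t. 0 \<le> s \<and> s \<le> t \<longrightarrow> (\<forall>A\<in>sets borel.
        AE \<omega> in M. real_cond_exp M (nat_filtration M X s) (\<lambda>\<omega>'. indicator A (X t \<omega>')) \<omega>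
                    = measure (kernel c \<theta> (t - s) (X s \<omega>)) A))"

definition diamond :: "real \<times> real \<Rightarrow> real \<times> real \<Rightarrow> complex" (infixl "\<diamondop>" 70) where
  "x \<diamondop> y = - of_real ((fst x + snd x) * (fst y + snd y))
            + \<i> * of_real ((fst x - snd x) * (fst y - snd y))"

definition F :: "real \<times> real \<Rightarrow> real \<times> real \<Rightarrow> complex" where
  "F x y = exp (x \<diamondop> y)"

text \<open>\<open>genF c \<theta> z\<close> is the image of the basis function \<open>F(\<cdot>, z)\<close> of \<open>V\<close> under the operator
  \<open>\<G>\<close> with parameters \<open>c\<close>, \<open>\<theta>\<close>.\<close>

definition genF ::
  "real \<Rightarrow> real \<times> real \<Rightarrow> real \<times> real \<Rightarrow> real \<times> real \<Rightarrow> complex" where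
  "genF c \<theta> z x = ((c *\<^sub>R (\<theta> - x)) \<diamondop> z) * F x z"

text \<open>The canonical filtration of the theory of martingale problems (Ethier and Kurtz): for a
  process that is only jointly measurable, \<open>\<integral>\<^sub>0\<^sup>s h(X\<^sub>u) du\<close> need not be measurable with
  respect to \<open>\<sigma>(X\<^sub>r, r \<le> s)\<close>, so these integrals are added to the generators.
  For progressively measurable (in particular cadlag) processes nothing is added.\<close>

definition mp_filtration ::
  "'a measure \<Rightarrow> (real \<Rightarrow> 'a \<Rightarrow> real \<times> real) \<Rightarrow> real \<Rightarrow> 'a measure" where
  "mp_filtration M X t =
     sigma (space M)
       ({X s -` A \<inter> space M | s A. 0 \<le> s \<and> s \<le> t \<and> A \<in> sets borel} \<union>
        {(\<lambda>\<omega>. LINT u:{0..s}|lborel. h (X u \<omega>)) -` A \<inter> space M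
          | s (h :: real \<times> real \<Rightarrow> real) A.
            0 \<le> s \<and> s \<le> t \<and> h \<in> borel_measurable borel \<and> bounded (range h) \<and> A \<in> sets borel})"

definition filtration :: "'a measure \<Rightarrow> (real \<Rightarrow> 'a measure) \<Rightarrow> bool" where
  "filtration M \<F> \<longleftrightarrow>
     (\<forall>t\<ge>0. subalgebra M (\<F> t)) \<and> (\<forall>s t. 0 \<le> s \<and> s \<le> t \<longrightarrow> sets (\<F> s) \<subseteq> sets (\<F> t))"

definition real_martingale ::
  "'a measure \<Rightarrow> (real \<Rightarrow> 'a measure) \<Rightarrow> (real \<Rightarrow> 'a \<Rightarrow> real) \<Rightarrow> bool" where
  "real_martingale M \<F> Y \<longleftrightarrow>
     filtration M \<F> \<and>
     (\<forall>t\<ge>0. Y t \<in> borel_measurable (\<F> t) \<and> integrable M (Y t)) \<and>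
     (\<forall>s t. 0 \<le> s \<and> s \<le> t \<longrightarrow> (AE \<omega> in M. real_cond_exp M (\<F> s) (Y t) \<omega> = Y s \<omega>))"

definition complex_martingale ::
  "'a measure \<Rightarrow> (real \<Rightarrow> 'a measure) \<Rightarrow> (real \<Rightarrow> 'a \<Rightarrow> complex) \<Rightarrow> bool" where
  "complex_martingale M \<F> Y \<longleftrightarrow>
     real_martingale M \<F> (\<lambda>t \<omega>. Re (Y t \<omega>)) \<and> real_martingale M \<F> (\<lambda>t \<omega>. Im (Y t \<omega>))"

definition mp_solution ::
  "real \<Rightarrow> real \<times> real \<Rightarrow> 'a measure \<Rightarrow> (real \<Rightarrow> 'a \<Rightarrow> real \<times> real) \<Rightarrow> bool" where
  "mp_solution c \<theta> M X \<longleftrightarrow>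
     prob_space M \<and>
     (\<lambda>(t, \<omega>). X t \<omega>) \<in> borel_measurable (restrict_space borel {0..} \<Otimes>\<^sub>M M) \<and>
     (\<forall>t\<ge>0. \<forall>\<omega>\<in>space M. X t \<omega> \<in> E) \<and>
     (\<forall>z\<in>E. complex_martingale M (mp_filtration M X)
        (\<lambda>t \<omega>. F (X t \<omega>) z - (LINT s:{0..t}|lborel. genF c \<theta> z (X s \<omega>))))"

definition same_fdd ::
  "'a measure \<Rightarrow> (real \<Rightarrow> 'a \<Rightarrow> real \<times> real) \<Rightarrow> 'b measure \<Rightarrow> (real \<Rightarrow> 'b \<Rightarrow> real \<times> real) \<Rightarrow> bool"
where
  "same_fdd M X N Y \<longleftrightarrow>
     (\<forall>J. finite J \<and> J \<subseteq> {0..} \<longrightarrow>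
        distr M (PiM J (\<lambda>_. borel)) (\<lambda>\<omega>. \<lambda>t\<in>J. X t \<omega>) =
        distr N (PiM J (\<lambda>_. borel)) (\<lambda>\<omega>. \<lambda>t\<in>J. Y t \<omega>))"

text \<open>HOL cannot quantify over types inside a formula, so the sample space types of the two
  solutions compared in the uniqueness part are parameters, to be left as arbitrary type
  variables. The solution in the existence part lives on a space of paths.\<close>

definition mp_well_posed ::
  "'a itself \<Rightarrow> 'b itself \<Rightarrow> real \<Rightarrow> real \<times> real \<Rightarrow> bool" where
  "mp_well_posed (_ :: 'a itself) (_ :: 'b itself) c \<theta> \<longleftrightarrow>
     (\<forall>\<mu>. prob_on_E \<mu> \<longrightarrow>
        (\<exists>(M :: path measure) X. mp_solution c \<theta> M X \<and> distr M borel (X 0) = \<mu>)) \<and>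
     (\<forall>(M :: 'a measure) X (N :: 'b measure) Y.
        mp_solution c \<theta> M X \<and> mp_solution c \<theta> N Y \<and>
        distr M borel (X 0) = distr N borel (Y 0) \<longrightarrow> same_fdd M X N Y)"

end

theory Submission
  imports Defs "HOL-Complex_Analysis.Complex_Analysis" "HOL-Library.Nat_Bijection"
begin

text \<open>For \<open>z \<in> E\<close> the function \<open>F(\<cdot>, z)\<close> is harmonic, and bounded on the quadrant, so that
  \<open>\<integral> F(\<cdot>, z) dQ\<^sub>x = F(x, z)\<close>; moreover these functions separate measures on \<open>E\<close>: the two
  edges of \<open>E\<close> contribute Laplace transforms along the rays \<open>arg = \<plusminus> pi/4\<close>, which are holomorphic in the sector
  and can therefore be told apart. The Markov property of the process is
  thus equivalent to the identities \<open>E[1\<^sub>A F(X\<^sub>t, z)] = E[1\<^sub>A F(m(X\<^sub>s), z)]\<close> for events \<open>A\<close> of the past of \<open>s\<close>, where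
  \<open>m(x)\<close> is the weighted mean \<open>e\<^sup>-\<^sup>c\<^sup>(\<^sup>t\<^sup>-\<^sup>s\<^sup>) x + (1 - e\<^sup>-\<^sup>c\<^sup>(\<^sup>t\<^sup>-\<^sup>s\<^sup>)) \<theta>\<close>. For a solution of the martingale problem
  \<open>E[1\<^sub>A F(X\<^sub>t, l z)]\<close> solves, up to a factor, a first order transport equation in \<open>(t, l)\<close>, whose
  characteristics yield these identities; conversely the identities differentiate to the martingale property.
  A process that satisfies them is obtained from one Brownian motion by optional stopping at its exit
  times from a quadrant whose corner moves with \<open>t\<close>.\<close>

section \<open>Complex weights with vanishing characteristic functions\<close>

text \<open>The test functions do not form an algebra: \<open>F x z * F x z'\<close> is the
  exponential of \<open>x \<diamondop> (z + z')\<close>, and z + z' leaves E as soon as z and z' are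
  nonzero points of different axes. Separation of measures therefore goes through analytic
  continuation instead of an approximation theorem. It is always formulated with a complex
  integrable weight Z, so that one statement covers laws, laws restricted to a past event, and
  differences of two laws. A solution is merely measurable in time, so regularity cannot be taken
  from its paths. It comes from the decay of F: for l > 0 the derivatives of F x (l z) in l are
  bounded uniformly in x, because exponential decay in x beats the polynomial factors. The kernels
  are handled through the translates of one fixed Brownian motion. A mixture of kernels then is a
  law on a product space, and measurability in the starting point is a case of Fubini's theorem.
  Fine properties of Brownian paths at the boundary are avoided throughout, since equality of
  transforms already gives equality of laws.\<close>

lemma integrable_mult_bounded:
  fixes f g :: "'a \<Rightarrow> 'b::{real_normed_field, banach, second_countable_topology}"
  assumes "integrable M f" "g \<in> borel_measurable M" "\<And>x. x \<in> space M \<Longrightarrow> norm (g x) \<le> C"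
  shows "integrable M (\<lambda>x. f x * g x)"
proof (rule Bochner_Integration.integrable_bound)
  show "integrable M (\<lambda>x. C * norm (f x))" using assms(1) by simp
  show "AE x in M. norm (f x * g x) \<le> norm (C * norm (f x))"
  proof (rule AE_I2)
    fix x assume "x \<in> space M"
    then have "norm (g x) * norm (f x) \<le> C * norm (f x)"
      by (intro mult_right_mono assms) auto
    then show "norm (f x * g x) \<le> norm (C * norm (f x))"
      by (simp add: norm_mult mult.commute) 
  qed
qed (use assms in auto)

lemma integrable_mult_cexp:
  fixes Z :: "'a \<Rightarrow> complex" and Y :: "'a \<Rightarrow> real"
  assumes "integrable M Z" "Y \<in> borel_measurable M"
  shows "integrable M (\<lambda>w. Z w * iexp (Y w))"
  by (rule integrable_mult_bounded[where C=1]) (use assms in auto)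

lemma integrable_mult_indicator_comp:
  fixes Z :: "'a \<Rightarrow> 'b::{real_normed_field, banach, second_countable_topology}"
  assumes "integrable M Z" "Y \<in> measurable M N" "A \<in> sets N"
  shows "integrable M (\<lambda>w. Z w * indicator A (Y w))"
  by (rule integrable_mult_bounded[where C=1]) (use assms in \<open>auto simp: indicator_def\<close>)

text \<open>Taking v = 0 shows that the positive and the negative part of Z have the same mass m. If
  m > 0, both become probability densities after division by m, the laws of Y under them have the
  same characteristic function, and Levy's uniqueness theorem applies. If m = 0, Z vanishes almost
  everywhere.\<close>

lemma weighted_char_zero_real:
  fixes Z Y :: "'a \<Rightarrow> real"
  assumes Z: "integrable M Z" and Y[measurable]: "Y \<in> borel_measurable M"
    and zero: "\<And>v. (CLINT w|M. complex_of_real (Z w) * iexp (v * Y w)) = 0"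
    and A: "A \<in> sets borel"
  shows "(LINT w|M. Z w * indicator A (Y w)) = 0"
proof -
  have Zm[measurable]: "Z \<in> borel_measurable M" using Z by auto
  define P where "P = (\<lambda>w. max 0 (Z w))"
  define N where "N = (\<lambda>w. max 0 (- Z w))"
  have P: "integrable M P" and N: "integrable M N" using Z unfolding P_def N_def by auto
  have [measurable]: "P \<in> borel_measurable M" "N \<in> borel_measurable M" using P N by auto
  have ZPN: "Z w = P w - N w" for w unfolding P_def N_def by auto
  have P0: "P w \<ge> 0" and N0: "N w \<ge> 0" for w unfolding P_def N_def by auto
  have "complex_of_real (LINT w|M. Z w) = 0" using zero[of 0] by simp
  then have eq: "(LINT w|M. P w) = (LINT w|M. N w)" using P N ZPN by simp
  define m where "m = (LINT w|M. P w)"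
  show ?thesis
  proof (cases "m = 0")
    case True
    have "AE w in M. P w = 0" "AE w in M. N w = 0"
      using integral_nonneg_eq_0_iff_AE[OF P] integral_nonneg_eq_0_iff_AE[OF N] P0 N0 True eq
      unfolding m_def by auto
    then have "AE w in M. Z w * indicator A (Y w) = 0" by eventually_elim (simp add: ZPN)
    then show ?thesis by (subst integral_cong_AE[where g="\<lambda>_. 0"]) (use A in auto)
  next
    case False
    then have m: "m > 0" using P0 unfolding m_def by (simp add: less_le integral_nonneg_AE)
    have *: "real_distribution (distr (density M (\<lambda>w. ennreal (f w / m))) borel Y) \<and>
       char (distr (density M (\<lambda>w. ennreal (f w / m))) borel Y) v =
        (CLINT w|M. complex_of_real (f w) * iexp (v * Y w)) / m \<and>
       measure (distr (density M (\<lambda>w. ennreal (f w / m))) borel Y) A = 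
        (LINT w|M. f w * indicator A (Y w)) / m"
      if f: "integrable M f" "\<And>w. f w \<ge> 0" "(LINT w|M. f w) = m" for f v
    proof -
      have [measurable]: "f \<in> borel_measurable M" using f by auto
      let ?D = "density M (\<lambda>w. ennreal (f w / m))"
      have "emeasure ?D (space ?D) = (\<integral>\<^sup>+w. ennreal (f w / m) \<partial>M)"
        by (simp add: emeasure_density cong: nn_integral_cong)
      also have "\<dots> = ennreal (LINT w|M. f w / m)"
        by (rule nn_integral_eq_integral) (use f m in auto)
      also have "\<dots> = 1" using f m by simp
      finally interpret D: prob_space ?D by (rule prob_spaceI)
      have 1: "real_distribution (distr ?D borel Y)" by (rule D.real_distribution_distr) simp
      have 2: "char (distr ?D borel Y) v = (CLINT w|M. complex_of_real (f w) * iexp (v * Y w)) / m"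
        unfolding char_def using f m
        by (simp add: integral_distr integral_density scaleR_conv_of_real divide_simps mult_ac)
      interpret PD: prob_space "distr ?D borel Y" by (rule D.prob_space_distr) simp
      have "measure (distr ?D borel Y) A = (LINT x|distr ?D borel Y. indicator A x)" using A by simp
      also have "\<dots> = (LINT w|M. f w * indicator A (Y w)) / m"
        by (subst integral_distr) (use A f m in \<open>auto simp: integral_density\<close>)
      finally show ?thesis using 1 2 by simp
    qed
    have "(CLINT w|M. complex_of_real (P w) * iexp (v * Y w)) = 
      (CLINT w|M. complex_of_real (N w) * iexp (v * Y w))" for v
    proof -
      have i: "integrable M (\<lambda>w. complex_of_real (P w) * iexp (v * Y w))"
         "integrable M (\<lambda>w. complex_of_real (N w) * iexp (v * Y w))"
        using P N by (intro integrable_mult_cexp; simp)+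
      have "(CLINT w|M. complex_of_real (P w) * iexp (v * Y w)) -
         (CLINT w|M. complex_of_real (N w) * iexp (v * Y w)) = 0"
        using zero[of v] by (subst Bochner_Integration.integral_diff[symmetric, OF i])
          (simp add: ZPN left_diff_distrib)
      then show ?thesis by simp
    qed
    then have "distr (density M (\<lambda>w. ennreal (P w / m))) borel Y = 
      distr (density M (\<lambda>w. ennreal (N w / m))) borel Y"
      using *[of P] *[of N] P N P0 N0 eq m_def by (intro Levy_uniqueness ext) auto
    then have "(LINT w|M. P w * indicator A (Y w)) = (LINT w|M. N w * indicator A (Y w))"
      using *[of P] *[of N] P N P0 N0 eq m m_def by auto
    moreover have "integrable M (\<lambda>w. P w * indicator A (Y w))" "integrable M (\<lambda>w. N w * indicator A (Y w))"
      by (rule integrable_mult_indicator_comp[OF _ Y A], use P N in auto)+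
    ultimately show ?thesis by (simp add: ZPN left_diff_distrib)
  qed
qed

text \<open>Conjugating the hypothesis at -v gives it for the weight cnj Z as well, hence for Re Z
  and Im Z, to which the real case applies.\<close>

lemma weighted_char_zero:
  fixes Z :: "'a \<Rightarrow> complex" and Y :: "'a \<Rightarrow> real"
  assumes Z: "integrable M Z" and Y[measurable]: "Y \<in> borel_measurable M"
    and zero: "\<And>v. (CLINT w|M. Z w * iexp (v * Y w)) = 0"
    and A: "A \<in> sets borel"
  shows "(CLINT w|M. Z w * indicator A (Y w)) = 0"
proof -
  have Zm[measurable]: "Z \<in> borel_measurable M" using Z by auto
  have i: "integrable M (\<lambda>w. Z w * iexp (v * Y w))" for v
    by (rule integrable_mult_cexp) (use Z in auto)
  have j: "integrable M (\<lambda>w. cnj (Z w) * iexp (v * Y w))" for v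
    by (rule integrable_mult_cexp) (use Z in auto)
  have cz: "(CLINT w|M. cnj (Z w) * iexp (v * Y w)) = 0" for v
  proof -
    have "(CLINT w|M. cnj (Z w) * iexp (v * Y w)) = cnj (CLINT w|M. Z w * iexp ((-v) * Y w))"
      by (subst Bochner_Integration.integral_cnj[symmetric]) (simp add: exp_cnj)
    then show ?thesis using zero[of "-v"] by simp
  qed
  have re: "(LINT w|M. Re (Z w) * indicator A (Y w)) = 0"
  proof (rule weighted_char_zero_real[OF _ Y _ A])
    fix v
    have "complex_of_real (Re z) * c = (z * c + cnj z * c) / 2" for z c :: complex
      by (simp add: distrib_right[symmetric] complex_add_cnj)
    then have "(CLINT w|M. complex_of_real (Re (Z w)) * iexp (v * Y w)) =
       (CLINT w|M. (Z w * iexp (v * Y w) + cnj (Z w) * iexp (v * Y w)) / 2)"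
      by presburger
    then show "(CLINT w|M. complex_of_real (Re (Z w)) * iexp (v * Y w)) = 0"
      using i j zero cz by simp
  qed (use Z in auto)
  have im: "(LINT w|M. Im (Z w) * indicator A (Y w)) = 0"
  proof (rule weighted_char_zero_real[OF _ Y _ A])
    fix v
    have "complex_of_real (Im z) * c * (2 * \<i>) = z * c - cnj z * c" for z c :: complex
      by (simp add: complex_eq_iff algebra_simps)
    then have "complex_of_real (Im z) * c = (z * c - cnj z * c) / (2 * \<i>)" for z c :: complex
      by (metis complex_i_not_zero mult_eq_0_iff nonzero_mult_div_cancel_right zero_neq_numeral)
    then have "(CLINT w|M. complex_of_real (Im (Z w)) * iexp (v * Y w)) =
       (CLINT w|M. (Z w * iexp (v * Y w) - cnj (Z w) * iexp (v * Y w)) / (2 * \<i>))"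
      by presburger
    also have "\<dots> = 0"
      using i j zero cz by (subst integral_divide_zero, subst Bochner_Integration.integral_diff) simp_all
    finally show "(CLINT w|M. complex_of_real (Im (Z w)) * iexp (v * Y w)) = 0" .
  qed (use Z in auto)
  have int: "integrable M (\<lambda>w. Z w * indicator A (Y w))"
    by (rule integrable_mult_indicator_comp[OF Z Y A])
  have "Re (CLINT w|M. Z w * indicator A (Y w)) = (LINT w|M. Re (Z w) * indicator A (Y w))"
    by (subst integral_Re[OF int, symmetric]) (rule Bochner_Integration.integral_cong, auto simp: indicator_def)
  moreover have "Im (CLINT w|M. Z w * indicator A (Y w)) = (LINT w|M. Im (Z w) * indicator A (Y w))"
    by (subst integral_Im[OF int, symmetric]) (rule Bochner_Integration.integral_cong, auto simp: indicator_def)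
  ultimately show ?thesis using re im by (simp add: complex_eq_iff)
qed

text \<open>Exponentials are traded for indicators one variable at a time: the indicators already
  gained and the remaining exponential form the new weight. That exponential must be arbitrary in
  the induction, because it supplies the vanishing transform in the next variable.\<close>

lemma weighted_char_zero_prod:
  fixes Z :: "'a \<Rightarrow> complex" and Y :: "'i \<Rightarrow> 'a \<Rightarrow> real"
  assumes Z: "integrable M Z" and Y: "\<And>i. i \<in> I \<Longrightarrow> Y i \<in> borel_measurable M"
    and zero: "\<And>J v. finite J \<Longrightarrow> J \<subseteq> I \<Longrightarrow> (CLINT w|M. Z w * iexp (\<Sum>j\<in>J. v j * Y j w)) = 0"
    and K: "finite K" "K \<subseteq> I" and B: "\<And>k. k \<in> K \<Longrightarrow> B k \<in> sets borel"
    and J: "finite J" "J \<subseteq> I"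
  shows "(CLINT w|M. Z w * (\<Prod>k\<in>K. indicator (B k) (Y k w)) * iexp (\<Sum>j\<in>J. v j * Y j w)) = 0"
  using K B J
proof (induction K arbitrary: J v)
  case empty
  then show ?case using zero by simp
next
  case (insert k K)
  have [measurable]: "Y i \<in> borel_measurable M" if "i \<in> I" for i using Y that by auto
  have intp: "integrable M (\<lambda>w. Z w * (\<Prod>k\<in>K. indicator (B k) (Y k w)))"
  proof (rule integrable_mult_bounded[OF Z, where C=1])
    have m: "(\<lambda>w. indicator (B k) (Y k w) :: complex) \<in> borel_measurable M" if "k \<in> K" for k
      by (rule measurable_compose[of "Y k" M borel]) (use insert that in auto)
    show "(\<lambda>w. (\<Prod>k\<in>K. indicator (B k) (Y k w)) :: complex) \<in> borel_measurable M"
      by (rule borel_measurable_prod) (rule m)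
    show "norm ((\<Prod>k\<in>K. indicator (B k) (Y k w)) :: complex) \<le> 1" for w
      unfolding prod_norm[symmetric] by (rule prod_le_1) (auto simp: indicator_def)
  qed
  have int: "integrable M (\<lambda>w. Z w * (\<Prod>k\<in>K. indicator (B k) (Y k w)) * iexp (\<Sum>j\<in>J. v j * Y j w))"
    by (rule integrable_mult_cexp[OF intp]) (rule borel_measurable_sum, use insert in auto)
  have "(CLINT w|M. (Z w * (\<Prod>k\<in>K. indicator (B k) (Y k w)) * iexp (\<Sum>j\<in>J. v j * Y j w)) * 
      indicator (B k) (Y k w)) = 0"
  proof (rule weighted_char_zero[OF int])
    show "Y k \<in> borel_measurable M" "B k \<in> sets borel" using insert by auto
    fix c
    \<comment> \<open>k may already occur in J, so c is added to its coefficient instead of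
      replacing it.\<close>
    let ?v = "\<lambda>j. (if j \<in> J then v j else 0) + (if j = k then c else 0)"
    have "(\<Sum>j\<in>J. v j * Y j w) + c * Y k w = (\<Sum>j\<in>insert k J. ?v j * Y j w)" for w
    proof -
      have "(\<Sum>j\<in>insert k J. ?v j * Y j w) = (\<Sum>j\<in>insert k J. (if j \<in> J then v j else 0) * Y j w) +
         (\<Sum>j\<in>insert k J. (if j = k then c else 0) * Y j w)"
        by (simp add: sum.distrib distrib_right)
      also have "(\<Sum>j\<in>insert k J. (if j \<in> J then v j else 0) * Y j w) = (\<Sum>j\<in>J. v j * Y j w)"
        by (rule sum.mono_neutral_cong_right) (use insert in auto)
      also have "(\<Sum>j\<in>insert k J. (if j = k then c else 0) * Y j w) = c * Y k w"
        using insert by (subst sum.remove[of _ k]) (auto intro!: sum.neutral)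
      finally show ?thesis by simp
    qed
    then have "(CLINT w|M. Z w * (\<Prod>k\<in>K. indicator (B k) (Y k w)) * iexp (\<Sum>j\<in>J. v j * Y j w) * iexp (c * Y k w))
      = (CLINT w|M. Z w * (\<Prod>k\<in>K. indicator (B k) (Y k w)) * iexp (\<Sum>j\<in>insert k J. ?v j * Y j w))"
      by (simp add: exp_add[symmetric] mult.assoc distrib_left[symmetric] of_real_add[symmetric]
          del: of_real_add of_real_sum of_real_mult)
    also have "\<dots> = 0" by (rule insert.IH) (use insert in auto)
    finally show "(CLINT w|M. Z w * (\<Prod>k\<in>K. indicator (B k) (Y k w)) * iexp (\<Sum>j\<in>J. v j * Y j w) * iexp (c * Y k w)) = 0" .
  qed
  then show ?case using insert by (simp add: mult_ac)
qed

text \<open>Finite intersections of preimages form an intersection-stable generator. On it the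
  product lemma applies with an empty exponential, and the Dynkin argument extends the identity.
  Complements require total weight 0, which is the hypothesis for the empty J.\<close>

lemma weighted_char_zero_sigma:
  fixes Z :: "'a \<Rightarrow> complex" and Y :: "'i \<Rightarrow> 'a \<Rightarrow> real"
  assumes Z: "integrable M Z" and Y: "\<And>i. i \<in> I \<Longrightarrow> Y i \<in> borel_measurable M"
    and zero: "\<And>J v. finite J \<Longrightarrow> J \<subseteq> I \<Longrightarrow> (CLINT w|M. Z w * iexp (\<Sum>j\<in>J. v j * Y j w)) = 0"
    and A: "A \<in> sigma_sets (space M) {Y i -` B \<inter> space M | i B. i \<in> I \<and> B \<in> sets borel}"
  shows "(CLINT w|M. Z w * indicator A w) = 0"
proof -
  define G where "G = {{w\<in>space M. \<forall>k\<in>K. Y k w \<in> B k} | K B. finite K \<and> K \<subseteq> I \<and> (\<forall>k\<in>K. B k \<in> sets (borel::real measure))}"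
  have GM: "G \<subseteq> sets M"
  proof
    fix X assume "X \<in> G"
    then obtain K B where KB: "X = {w\<in>space M. \<forall>k\<in>K. Y k w \<in> B k}" "finite K" "K \<subseteq> I" "\<forall>k\<in>K. B k \<in> sets borel"
      unfolding G_def by auto
    have "{w\<in>space M. \<forall>k\<in>K. Y k w \<in> B k} \<in> sets M"
      by (rule sets.sets_Collect_finite_All) (use KB Y in \<open>auto intro: measurable_sets_Collect\<close>)
    then show "X \<in> sets M" using KB by simp
  qed
  have Gp: "G \<subseteq> Pow (space M)" unfolding G_def by auto
  have "Int_stable G"
  proof (rule Int_stableI)
    fix a b assume "a \<in> G" "b \<in> G"
    then obtain K B L C where KB: "a = {w\<in>space M. \<forall>k\<in>K. Y k w \<in> B k}" "finite K" "K \<subseteq> I" "\<forall>k\<in>K. B k \<in> sets borel"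
      "b = {w\<in>space M. \<forall>k\<in>L. Y k w \<in> C k}" "finite L" "L \<subseteq> I" "\<forall>k\<in>L. C k \<in> sets borel"
      unfolding G_def by blast
    have "a \<inter> b = {w\<in>space M. \<forall>k\<in>K \<union> L. Y k w \<in> (if k \<in> K then B k else UNIV) \<inter> (if k \<in> L then C k else UNIV)}"
      unfolding KB by auto
    moreover have "finite (K \<union> L) \<and> K \<union> L \<subseteq> I \<and> (\<forall>k\<in>K\<union>L. (if k \<in> K then B k else UNIV) \<inter> (if k \<in> L then C k else UNIV) \<in> sets borel)"
      using KB by auto
    ultimately show "a \<inter> b \<in> G" unfolding G_def
      by (intro CollectI exI[of _ "K \<union> L"] exI[of _ "\<lambda>k. (if k \<in> K then B k else UNIV) \<inter> (if k \<in> L then C k else UNIV)"] conjI) auto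
  qed
  have sub: "{Y i -` B \<inter> space M | i B. i \<in> I \<and> B \<in> sets borel} \<subseteq> G"
  proof safe
    fix i B assume "i \<in> I" "B \<in> sets (borel::real measure)"
    then show "Y i -` B \<inter> space M \<in> G"
      unfolding G_def by (intro CollectI exI[of _ "{i}"] exI[of _ "\<lambda>_. B"]) auto
  qed
  have A': "A \<in> sigma_sets (space M) G" using A sigma_sets_mono'[OF sub] by auto
  have GsM: "sigma_sets (space M) G \<subseteq> sets M" by (rule sets.sigma_sets_subset[OF GM])
  have ind: "integrable M (\<lambda>w. Z w * indicator S w)" if "S \<in> sets M" for S
    using integrable_mult_indicator_comp[OF Z measurable_ident[of M] that] by simp
  have Z0: "(CLINT w|M. Z w) = 0" using zero[of "{}"] by simp
  show ?thesis using \<open>Int_stable G\<close> Gp A'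
  proof (induction rule: sigma_sets_induct_disjoint[consumes 3, case_names basic empty compl union])
    case (basic A)
    then obtain K B where KB: "A = {w\<in>space M. \<forall>k\<in>K. Y k w \<in> B k}" "finite K" "K \<subseteq> I" "\<forall>k\<in>K. B k \<in> sets borel"
      unfolding G_def by auto
    have "indicator A w = (\<Prod>k\<in>K. indicator (B k) (Y k w) :: complex)" if "w \<in> space M" for w
      using KB that by (auto simp: indicator_def prod_zero_iff split: if_splits)
    then have "(CLINT w|M. Z w * indicator A w) = (CLINT w|M. Z w * (\<Prod>k\<in>K. indicator (B k) (Y k w)) * iexp (\<Sum>j\<in>{}. 0 * Y j w))"
      by (intro Bochner_Integration.integral_cong) auto
    also have "\<dots> = 0" by (rule weighted_char_zero_prod[OF Z Y zero]) (use KB in auto)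
    finally show ?case .
  next
    case empty then show ?case by simp
  next
    case (compl A)
    then have "A \<in> sets M" using GsM by auto
    have "(CLINT w|M. Z w * indicator (space M - A) w) = (CLINT w|M. Z w - Z w * indicator A w)"
      by (intro Bochner_Integration.integral_cong) (auto simp: indicator_def)
    then show ?case using compl Z0 ind[OF \<open>A \<in> sets M\<close>] Z by simp
  next
    case (union F)
    have FM: "F i \<in> sets M" for i using union GsM by auto
    have "(\<lambda>i. CLINT w|M. Z w * indicator (F i) w) sums (CLINT w|M. Z w * indicator (\<Union>i. F i) w)"
    proof -
      have 1: "(\<lambda>n. CLINT w|M. Z w * indicator (\<Union>i<n. F i) w) \<longlonglongrightarrow> (CLINT w|M. Z w * indicator (\<Union>i. F i) w)"
      proof (rule integral_dominated_convergence[where w="\<lambda>w. norm (Z w)"])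
        show "AE w in M. (\<lambda>n. Z w * indicator (\<Union>i<n. F i) w) \<longlonglongrightarrow> Z w * indicator (\<Union>i. F i) w"
        proof (intro AE_I2 tendsto_mult tendsto_const)
          fix w
          show "(\<lambda>n. indicator (\<Union>i<n. F i) w :: complex) \<longlonglongrightarrow> indicator (\<Union>i. F i) w"
            by (rule LIMSEQ_indicator_UN)
        qed
      qed (use Z FM in \<open>auto simp: indicator_def norm_mult\<close>)
      have "(CLINT w|M. Z w * indicator (\<Union>i<n. F i) w) = (\<Sum>i<n. CLINT w|M. Z w * indicator (F i) w)" for n
      proof -
        have "(indicator (\<Union>i<n. F i) w :: complex) = (\<Sum>i<n. indicator (F i) w)" for w
          by (rule indicator_UN_disjoint) (use union in \<open>auto simp: disjoint_family_on_def\<close>)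
        then have "(CLINT w|M. Z w * indicator (\<Union>i<n. F i) w) = (CLINT w|M. (\<Sum>i<n. Z w * indicator (F i) w))"
          by (simp only: sum_distrib_left)
        also have "\<dots> = (\<Sum>i<n. CLINT w|M. Z w * indicator (F i) w)"
          by (rule Bochner_Integration.integral_sum) (rule ind[OF FM])
        finally show ?thesis .
      qed
      then show ?thesis using 1 unfolding sums_def by simp
    qed
    then show ?case using union by (simp add: sums_iff)
  qed
qed

section \<open>The functions F separate measures on E\<close>

lemma measurable_pair_measure_countable_bool:
  assumes "\<And>b. (\<lambda>x. f (x, b)) \<in> measurable M N"
  shows "f \<in> measurable (M \<Otimes>\<^sub>M count_space (UNIV :: bool set)) N"
proof -
  have "f = (\<lambda>x. if snd x then f (fst x, True) else f (fst x, False))"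
    by (auto simp: fun_eq_iff split: prod.split)
  also have "\<dots> \<in> measurable (M \<Otimes>\<^sub>M count_space UNIV) N"
    by (intro measurable_If measurable_compose[OF measurable_fst assms]) (auto simp: pred_def)
  finally show ?thesis .
qed

text \<open>The factor \<open>bool\<close> carries a sign. It merges two weighted laws into one on a
  doubled space, so that equality of two transforms becomes vanishing of a single one.\<close>

lemma integral_pair_bool:
  fixes f :: "'a \<times> bool \<Rightarrow> complex"
  assumes "finite_measure M" and f: "\<And>b. integrable M (\<lambda>w. f (w, b))"
  shows "integrable (M \<Otimes>\<^sub>M count_space UNIV) f"
    and "integral\<^sup>L (M \<Otimes>\<^sub>M count_space UNIV) f = (CLINT w|M. f (w, True)) + (CLINT w|M. f (w, False))"
proof -
  interpret M: finite_measure M by fact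
  interpret B: finite_measure "count_space (UNIV :: bool set)" by (rule finite_measure_count_space) simp
  interpret P: pair_sigma_finite M "count_space (UNIV :: bool set)" ..
  have m[measurable]: "f \<in> borel_measurable (M \<Otimes>\<^sub>M count_space UNIV)"
    by (rule measurable_pair_measure_countable_bool) (use f in auto)
  show i: "integrable (M \<Otimes>\<^sub>M count_space UNIV) f"
  proof (rule P.Fubini_integrable)
    show "integrable M (\<lambda>x. LINT y|count_space UNIV. norm (f (x, y)))"
      using f by (simp add: lebesgue_integral_count_space_finite UNIV_bool)
    show "AE x in M. integrable (count_space UNIV) (\<lambda>y. f (x, y))"
      by (rule AE_I2) (simp add: integrable_count_space)
  qed (rule m)
  have "integral\<^sup>L (M \<Otimes>\<^sub>M count_space UNIV) f = (CLINT x|M. CLINT y|count_space UNIV. f (x, y))"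
    by (rule P.integral_fst'[symmetric, OF i])
  also have "\<dots> = (CLINT w|M. f (w, True) + f (w, False))"
    by (simp add: lebesgue_integral_count_space_finite UNIV_bool add.commute)
  finally show "integral\<^sup>L (M \<Otimes>\<^sub>M count_space UNIV) f = (CLINT w|M. f (w, True)) + (CLINT w|M. f (w, False))"
    using f by simp
qed

text \<open>The derivative of exp(-a u) in a has modulus u exp(-u Re a), at most 1/d for Re a >= d
  whatever u >= 0 is. Difference quotients of a Laplace transform are thus dominated without any
  moment assumption.\<close>

lemma exp_diff_le:
  fixes s t :: complex and u d :: real
  assumes "d > 0" "u \<ge> 0" "Re s \<ge> d" "Re t \<ge> d"
  shows "norm (exp (- s * u) - exp (- t * u)) \<le> (1 / d) * norm (s - t)"
proof (rule field_differentiable_bound[where f="\<lambda>a. exp (- a * complex_of_real u)" and S="{z. Re z \<ge> d}" and f'="\<lambda>z. - complex_of_real u * exp (- z * u)"])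
  show "convex {z. Re z \<ge> d}" by (rule convex_halfspace_Re_ge)
  fix z assume z: "z \<in> {z. Re z \<ge> d}"
  show "((\<lambda>a. exp (- a * complex_of_real u)) has_field_derivative - complex_of_real u * exp (- z * u)) (at z within {z. d \<le> Re z})"
    by (auto intro!: derivative_eq_intros)
  have "d * u \<le> exp (d * u)" using exp_ge_add_one_self[of "d * u"] by linarith
  also have "\<dots> \<le> exp (Re z * u)" using z assms by (auto intro: mult_right_mono)
  finally have le: "d * u \<le> exp (Re z * u)" .
  show "norm (- complex_of_real u * exp (- z * u)) \<le> 1 / d"
  proof -
    have "norm (- complex_of_real u * exp (- z * u)) = u * exp (- (Re z * u))"
      using assms by (simp add: norm_mult)
    also have "\<dots> \<le> 1 / d" using le assms by (simp add: exp_minus field_simps)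
    finally show ?thesis .
  qed
qed (use assms in auto)

section \<open>Laplace transforms of complex weights\<close>

context
  fixes M :: "'a measure" and W :: "'a \<Rightarrow> complex" and U :: "'a \<Rightarrow> real" and L :: "complex \<Rightarrow> complex"
  assumes W: "integrable M W" and U[measurable]: "U \<in> borel_measurable M"
    and U0: "\<And>w. w \<in> space M \<Longrightarrow> U w \<ge> 0"
  defines "L \<equiv> (\<lambda>s. CLINT w|M. W w * exp (- s * complex_of_real (U w)))"
begin

lemma laplace_integrable: "Re s \<ge> 0 \<Longrightarrow> integrable M (\<lambda>w. W w * exp (- s * complex_of_real (U w)))"
  by (rule integrable_mult_bounded[OF W, where C=1]) (use U0 in auto)

lemma laplace_continuous: "continuous_on {s. Re s \<ge> 0} L"
  unfolding continuous_on_sequentially comp_def L_def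
proof (intro allI ballI impI, elim conjE)
  fix x a assume x: "\<forall>n. x n \<in> {s. 0 \<le> Re s}" and lim: "x \<longlonglongrightarrow> a" and a: "a \<in> {s. 0 \<le> Re s}"
  show "(\<lambda>n. CLINT w|M. W w * exp (- x n * complex_of_real (U w))) \<longlonglongrightarrow> (CLINT w|M. W w * exp (- a * complex_of_real (U w)))"
  proof (rule integral_dominated_convergence[where w="\<lambda>w. norm (W w)"])
    show "AE w in M. (\<lambda>n. W w * exp (- x n * complex_of_real (U w))) \<longlonglongrightarrow> W w * exp (- a * complex_of_real (U w))"
      by (intro AE_I2 tendsto_intros lim)
    show "AE w in M. norm (W w * exp (- x n * complex_of_real (U w))) \<le> norm (W w)" for n
      using x U0 by (intro AE_I2) (auto simp: norm_mult mult_left_le)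
  qed (use W in auto)
qed

text \<open>Differentiation under the integral sign; on Re z >= d the difference quotients are
  bounded by norm W / d thanks to \<open>exp_diff_le\<close>.\<close>

lemma laplace_holomorphic: "L holomorphic_on {s. Re s > 0}"
proof (rule holomorphic_onI)
  fix s assume "s \<in> {s. Re s > 0}"
  \<comment> \<open>Half of Re s puts s into the interior of the half-plane on which the quotients
    are dominated.\<close>
  define d where "d = Re s / 2"
  have d: "d > 0" "Re s > d" using \<open>s \<in> _\<close> by (auto simp: d_def)
  let ?S = "{z. Re z \<ge> d}"
  have "(L has_field_derivative (CLINT w|M. W w * (- U w * exp (- s * complex_of_real (U w))))) (at s within ?S)"
    unfolding has_field_derivative_iff tendsto_at_iff_sequentially comp_def
  proof (intro allI impI)
    fix x :: "nat \<Rightarrow> complex" assume x: "\<forall>i. x i \<in> ?S - {s}" and lim: "x \<longlonglongrightarrow> s"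
    have "(\<lambda>n. CLINT w|M. W w * ((exp (- x n * complex_of_real (U w)) - exp (- s * complex_of_real (U w))) / (x n - s)))
       \<longlonglongrightarrow> (CLINT w|M. W w * (- U w * exp (- s * complex_of_real (U w))))"
    proof (rule integral_dominated_convergence[where w="\<lambda>w. norm (W w) * (1 / d)"])
      show "AE w in M. (\<lambda>n. W w * ((exp (- x n * complex_of_real (U w)) - exp (- s * complex_of_real (U w))) / (x n - s)))
         \<longlonglongrightarrow> W w * (- U w * exp (- s * complex_of_real (U w)))"
      proof (intro AE_I2 tendsto_mult tendsto_const)
        fix w
        have "((\<lambda>a. exp (- a * complex_of_real (U w))) has_field_derivative - U w * exp (- s * complex_of_real (U w))) (at s within ?S)"
          by (auto intro!: derivative_eq_intros)
        then show "(\<lambda>n. (exp (- x n * complex_of_real (U w)) - exp (- s * complex_of_real (U w))) / (x n - s))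
          \<longlonglongrightarrow> - U w * exp (- s * complex_of_real (U w))"
          unfolding has_field_derivative_iff tendsto_at_iff_sequentially comp_def using x lim by auto
      qed
      show "AE w in M. norm (W w * ((exp (- x n * complex_of_real (U w)) - exp (- s * complex_of_real (U w))) / (x n - s)))
        \<le> norm (W w) * (1 / d)" for n
      proof (rule AE_I2)
        fix w assume "w \<in> space M"
        then have "norm (exp (- x n * complex_of_real (U w)) - exp (- s * complex_of_real (U w))) \<le> (1 / d) * norm (x n - s)"
          using d x U0 by (intro exp_diff_le) auto
        moreover have "norm (x n - s) > 0" using x by auto
        ultimately have "norm ((exp (- x n * complex_of_real (U w)) - exp (- s * complex_of_real (U w))) / (x n - s)) \<le> 1 / d"
          by (simp add: norm_divide divide_le_eq)
        then show "norm (W w * ((exp (- x n * complex_of_real (U w)) - exp (- s * complex_of_real (U w))) / (x n - s)))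
        \<le> norm (W w) * (1 / d)" unfolding norm_mult by (intro mult_left_mono) auto
      qed
    qed (use W in auto)
    moreover have "(CLINT w|M. W w * ((exp (- x n * complex_of_real (U w)) - exp (- s * complex_of_real (U w))) / (x n - s)))
       = (L (x n) - L s) / (x n - s)" for n
    proof -
      have r: "Re (x n) \<ge> 0" "Re s \<ge> 0" using x d by (auto intro: order_trans[of 0 d])
      have "(L (x n) - L s) / (x n - s) = (CLINT w|M. (W w * exp (- x n * complex_of_real (U w)) - W w * exp (- s * complex_of_real (U w))) / (x n - s))"
        unfolding L_def by (simp only: integral_divide_zero Bochner_Integration.integral_diff[OF r[THEN laplace_integrable]])
      then show ?thesis by (simp only: right_diff_distrib times_divide_eq_right)
    qed
    ultimately show "(\<lambda>n. (L (x n) - L s) / (x n - s)) \<longlonglongrightarrow> (CLINT w|M. W w * (- U w * exp (- s * complex_of_real (U w))))"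
      by (simp only:)
  qed
  moreover have "at s within ?S = at s"
  proof (rule at_within_interior)
    show "s \<in> interior ?S"
      by (rule interiorI[of "{z. Re z > d}"]) (use d in \<open>auto simp: open_halfspace_Re_gt\<close>)
  qed
  ultimately have "(L has_field_derivative (CLINT w|M. W w * (- U w * exp (- s * complex_of_real (U w))))) (at s)"
    by (simp only:)
  then show "L field_differentiable at s within {s. Re s > 0}"
    by (auto simp: field_differentiable_def intro: has_field_derivative_at_within)
qed

text \<open>The function \<open>h\<close> below vanishes on the positive axis, hence on the sector
  \<open>\<bar>arg q\<bar> \<le> pi/4\<close>; on one edge of the sector it relates \<open>L r\<close> and \<open>L (ir)\<close>, on the other one
  \<open>L r\<close> and \<open>L (-ir)\<close>.\<close>

lemma laplace_sector:
  assumes k: "k * k = 1" and eq: "\<And>l. (0::real) < l \<Longrightarrow> L ((1 - \<i>) * l) = k * L ((1 + \<i>) * l)"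
  shows "L (\<i> * complex_of_real r) = L (- \<i> * complex_of_real r)"
proof -
  define h where "h = (\<lambda>q. L ((1 - \<i>) * q) - k * L ((1 + \<i>) * q))"
  define D where "D = {q. Re ((1 - \<i>) * q) > 0} \<inter> {q. Re ((1 + \<i>) * q) > 0}"
  have D': "D = {q. Re q + Im q > 0} \<inter> {q. Re q - Im q > 0}" by (auto simp: D_def)
  have hol: "h holomorphic_on D" unfolding h_def
    by (intro holomorphic_intros holomorphic_on_compose_gen[OF _ laplace_holomorphic, unfolded comp_def])
       (auto simp: D_def)
  have op: "open D" unfolding D' by (intro open_Int open_Collect_less continuous_intros)
  have "convex D"
  proof -
    have "{q. Re q + Im q > 0} = {q. inner (Complex 1 1) q > 0}" "{q. Re q - Im q > 0} = {q. inner (Complex 1 (-1)) q > 0}"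
      by (auto simp: inner_complex_def)
    then show ?thesis unfolding D' using convex_halfspace_gt[of 0] by (metis convex_Int)
  qed
  then have conn: "connected D" by (rule convex_connected)
  have h0: "h q = 0" if "q \<in> D" for q
  \<comment> \<open>Identity theorem: h vanishes on the positive axis, which accumulates at
    1.\<close>
  proof (rule analytic_continuation[OF hol op conn, of "complex_of_real ` {0<..}" 1])
    show "(1::complex) islimpt complex_of_real ` {0<..}"
    proof (rule islimpt_approachable[THEN iffD2], intro allI impI)
      fix e :: real assume "e > 0"
      then show "\<exists>x'\<in>complex_of_real ` {0<..}. x' \<noteq> 1 \<and> dist x' 1 < e"
        by (intro bexI[of _ "complex_of_real (1 + e / 2)"]) (auto simp: dist_norm intro!: image_eqI[of _ _ "1 + e / 2"])
    qed
    show "h u = 0" if "u \<in> complex_of_real ` {0<..}" for u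
    proof -
      from that obtain l :: real where "l > 0" "u = complex_of_real l" by auto
      then show ?thesis using eq[of l] by (simp add: h_def)
    qed
  qed (use that in \<open>auto simp: D_def\<close>)
  \<comment> \<open>The values used below lie on the edges of the sector, where L is only
    continuous; they are approached by moving q to the right.\<close>
  have h1: "h q = 0" if q: "Re q + Im q \<ge> 0" "Re q - Im q \<ge> 0" for q
  proof -
    define d where "d = (\<lambda>n. 1 / real (Suc n))"
    have d: "d n > 0" for n by (simp add: d_def)
    have dl: "d \<longlonglongrightarrow> 0" unfolding d_def by (rule LIMSEQ_Suc[OF lim_1_over_n])
    have "(\<lambda>n. h (q + of_real (d n))) \<longlonglongrightarrow> h q"
    proof -
      have c1: "continuous_on {q. Re ((1 - \<i>) * q) \<ge> 0 \<and> Re ((1 + \<i>) * q) \<ge> 0} h" unfolding h_def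
        by (intro continuous_intros continuous_on_compose2[OF laplace_continuous]) auto
      have c2: "(\<lambda>n. q + of_real (d n)) \<longlonglongrightarrow> q + of_real 0"
        by (intro tendsto_intros dl)
      have c3: "Re ((1 - \<i>) * (q + of_real (d n))) \<ge> 0 \<and> Re ((1 + \<i>) * (q + of_real (d n))) \<ge> 0" for n
        using q d[of n] by (simp add: algebra_simps)
      have "(\<lambda>n. h (q + of_real (d n))) \<longlonglongrightarrow> h (q + of_real 0)"
        by (rule continuous_on_tendsto_compose[OF c1 c2]) (use q c3 in \<open>auto simp: algebra_simps\<close>)
      then show ?thesis by simp
    qed
    moreover have "h (q + of_real (d n)) = 0" for n
      by (rule h0) (use q d[of n] in \<open>auto simp: D'\<close>)
    ultimately show ?thesis by (simp add: LIMSEQ_const_iff)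
  qed
  have *: "L (\<i> * complex_of_real r) = L (- \<i> * complex_of_real r)" if r: "r \<ge> 0" for r
  proof -
    \<comment> \<open>For q = r (1 + i)/2 the arguments (1 - i) q and (1 + i) q are r and ir; for q
      = r (1 - i)/2 they are -ir and r. Eliminating L r leaves the factor k k = 1.\<close>
    have "h (r * (1 + \<i>) / 2) = 0" "h (r * (1 - \<i>) / 2) = 0" by (rule h1; use r in simp)+
    then have "L r = k * L (\<i> * r)" "L (- \<i> * r) = k * L r"
      unfolding h_def by (simp_all add: algebra_simps add_divide_distrib[symmetric] diff_divide_distrib[symmetric])
    then show ?thesis using k by (metis mult.assoc mult_1)
  qed
  show ?thesis using *[of r] *[of "-r"] by (cases "r \<ge> 0") auto
qed

text \<open>By \<open>laplace_sector\<close> the weight W placed at U and the weight -W placed at -U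
  cancel in every characteristic function, so the resulting signed law is zero. Sets of positive
  numbers see only U, as U >= 0. At the point 0 the two copies cancel each other, which is why A
  avoids it.\<close>

lemma laplace_sector_zero:
  assumes M: "finite_measure M" 
    and k: "k * k = 1" and eq: "\<And>l. (0::real) < l \<Longrightarrow> L ((1 - \<i>) * l) = k * L ((1 + \<i>) * l)"
    and A: "A \<in> sets borel" "A \<subseteq> {0<..}"
  shows "(CLINT w|M. W w * indicator A (U w)) = 0"
proof -
  let ?N = "M \<Otimes>\<^sub>M count_space (UNIV :: bool set)"
  define s where "s = (\<lambda>b. if b then 1 else - 1 :: real)"
  have Wb: "integrable M (\<lambda>w. W w * s b)" for b using W by simp
  have "(CLINT x|?N. (case x of (w, b) \<Rightarrow> W w * s b) * indicator A (case x of (w, b) \<Rightarrow> s b * U w)) = 0"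
  proof (rule weighted_char_zero[OF _ _ _ A(1)])
    show "integrable ?N (\<lambda>x. case x of (w, b) \<Rightarrow> W w * s b)"
      by (rule integral_pair_bool[OF M]) (use Wb in auto)
    show "(\<lambda>x. case x of (w, b) \<Rightarrow> s b * U w) \<in> borel_measurable ?N"
      by (rule measurable_pair_measure_countable_bool) auto
    fix v
    have *: "L (- \<i> * complex_of_real v) = L (\<i> * complex_of_real v)" by (rule laplace_sector[OF k eq, symmetric])
    have i: "integrable M (\<lambda>w. W w * s b * iexp (v * (s b * U w)))" for b
      by (rule integrable_mult_cexp[OF Wb]) simp
    have "(CLINT x|?N. (case x of (w, b) \<Rightarrow> W w * s b) * iexp (v * (case x of (w, b) \<Rightarrow> s b * U w))) = 
       (CLINT w|M. W w * s True * iexp (v * (s True * U w))) + (CLINT w|M. W w * s False * iexp (v * (s False * U w)))"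
      by (subst integral_pair_bool[OF M]) (use i in auto)
    also have "\<dots> = L (- \<i> * complex_of_real v) - L (\<i> * complex_of_real v)"
      by (simp add: s_def L_def algebra_simps)
    finally show "(CLINT x|?N. (case x of (w, b) \<Rightarrow> W w * s b) * iexp (v * (case x of (w, b) \<Rightarrow> s b * U w))) = 0"
      using * by simp
  qed
  also have "(CLINT x|?N. (case x of (w, b) \<Rightarrow> W w * s b) * indicator A (case x of (w, b) \<Rightarrow> s b * U w)) = 
      (CLINT w|M. W w * s True * indicator A (s True * U w)) + (CLINT w|M. W w * s False * indicator A (s False * U w))"
    by (subst integral_pair_bool[OF M]) (use integrable_mult_indicator_comp[OF Wb _ A(1)] in auto)
  also have "(CLINT w|M. W w * s False * indicator A (s False * U w)) = (CLINT w|M. 0)"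
    by (rule Bochner_Integration.integral_cong) (use A(2) U0 in \<open>force simp: s_def indicator_def\<close>)+
  finally show ?thesis by (simp add: s_def)
qed

end

section \<open>From the sector to the two edges of E\<close>

lemma F_measurable[measurable]: "(\<lambda>x. F x z) \<in> borel_measurable borel"
  unfolding F_def diamond_def by (intro borel_measurable_continuous_onI continuous_intros)

lemma norm_F_le: "x \<in> quadrant \<Longrightarrow> z \<in> E \<Longrightarrow> norm (F x z) \<le> 1"
  by (auto simp: F_def diamond_def E_def quadrant_def)

text \<open>On E the difference of the coordinates equals their sum u up to the sign that names the
  edge. So F x (l, 0) is exp(-s u) with s = (1 - i) l on the first axis and s = (1 + i) l on the
  second.\<close>

lemma F_axis1: "x \<in> E \<Longrightarrow> F x (l, 0) = exp (- ((1 - \<i> * sgn (fst x - snd x)) * of_real l) * of_real (fst x + snd x))"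
  by (auto simp: E_def quadrant_def open_quadrant_def F_def diamond_def sgn_if algebra_simps
     not_less intro!: arg_cong[of _ _ exp])

lemma F_axis2: "x \<in> E \<Longrightarrow> F x (0, l) = exp (- ((1 + \<i> * sgn (fst x - snd x)) * of_real l) * of_real (fst x + snd x))"
  by (auto simp: E_def quadrant_def open_quadrant_def F_def diamond_def sgn_if algebra_simps
     not_less intro!: arg_cong[of _ _ exp])

text \<open>The sum of F at (l, 0) and (0, l) does not see the edge and yields the sector relation
  with k = -1 for the weight Z. The difference changes sign with the edge and yields it with k = 1
  for the weight Z e. Together the two weights determine Z on each open edge, and z = 0 supplies the
  total mass, hence the origin.\<close>

lemma F_determines:
  fixes Z :: "'a \<Rightarrow> complex"
  assumes M: "finite_measure M" and Z: "integrable M Z" and Y[measurable]: "Y \<in> borel_measurable M"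
    and YE: "\<And>w. w \<in> space M \<Longrightarrow> Y w \<in> E"
    and zero: "\<And>z. z \<in> E \<Longrightarrow> (CLINT w|M. Z w * F (Y w) z) = 0"
    and A: "A \<in> sets borel"
  shows "(CLINT w|M. Z w * indicator A (Y w)) = 0"
proof -
  define U where "U = (\<lambda>w. fst (Y w) + snd (Y w))"
  define e where "e = (\<lambda>w. sgn (fst (Y w) - snd (Y w)))"
  have fs[measurable]: "(\<lambda>w. fst (Y w)) \<in> borel_measurable M" "(\<lambda>w. snd (Y w)) \<in> borel_measurable M"
    by (auto intro!: borel_measurable_continuous_on[OF _ Y] continuous_intros)
  have Um[measurable]: "U \<in> borel_measurable M" unfolding U_def by simp
  have em[measurable]: "e \<in> borel_measurable M" unfolding e_def by simp
  have [measurable]: "Z \<in> borel_measurable M" using Z by auto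
  have U0: "U w \<ge> 0" if "w \<in> space M" for w
    using YE[OF that] by (auto simp: U_def E_def quadrant_def)
  have Ze: "integrable M (\<lambda>w. Z w * e w)"
    by (rule integrable_mult_bounded[OF Z, where C=1]) (auto simp: e_def sgn_if)
  have zE: "(l, 0) \<in> E" "(0, l) \<in> E" if "l \<ge> 0" for l
    using that by (auto simp: E_def quadrant_def open_quadrant_def)
  define f1 where "f1 = (\<lambda>(l::real) w. exp (- ((1 - \<i>) * of_real l) * of_real (U w)))"
  define f2 where "f2 = (\<lambda>(l::real) w. exp (- ((1 + \<i>) * of_real l) * of_real (U w)))"
  have F1: "F (Y w) (l, 0) + F (Y w) (0, l) = f1 l w + f2 l w"
    and F2: "F (Y w) (l, 0) - F (Y w) (0, l) = e w * (f1 l w - f2 l w)" if "w \<in> space M" for w l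
  proof -
    have *: "Y w \<in> E" by (rule YE[OF that])
    \<comment> \<open>The sign e vanishes only at the origin, where U = 0 and both exponentials are
      1, so the two identities survive there.\<close>
    have "e w = 1 \<or> e w = -1 \<or> (e w = 0 \<and> U w = 0)"
      using * by (auto simp: e_def U_def E_def quadrant_def open_quadrant_def sgn_if)
    moreover have "sgn (fst (Y w) - snd (Y w)) = e w" "fst (Y w) + snd (Y w) = U w"
      by (simp_all add: e_def U_def)
    ultimately show "F (Y w) (l, 0) + F (Y w) (0, l) = f1 l w + f2 l w"
      "F (Y w) (l, 0) - F (Y w) (0, l) = e w * (f1 l w - f2 l w)"
      unfolding F_axis1[OF *] F_axis2[OF *] f1_def f2_def by auto
  qed
  have bd: "norm (f1 l w) \<le> 1" "norm (f2 l w) \<le> 1" if "w \<in> space M" "l \<ge> 0" for l w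
    using U0[OF that(1)] that(2) by (auto simp: f1_def f2_def)
  have [measurable]: "f1 l \<in> borel_measurable M" "f2 l \<in> borel_measurable M" for l
    unfolding f1_def f2_def by measurable
  have i1: "integrable M (\<lambda>w. X w * f1 l w)" and i2: "integrable M (\<lambda>w. X w * f2 l w)"
    if "integrable M X" "l \<ge> 0" for X l
    by (rule integrable_mult_bounded[OF that(1), where C=1]; use bd that in simp)+
  have FY: "(\<lambda>w. F (Y w) z) \<in> borel_measurable M" for z
    by measurable
  have nF: "norm (F (Y w) z) \<le> 1" if "w \<in> space M" "z \<in> E" for w z
    using YE[OF that(1)] that(2) by (auto simp: F_def diamond_def E_def quadrant_def)
  have iF: "integrable M (\<lambda>w. Z w * F (Y w) z)" if "z \<in> E" for z
    by (rule integrable_mult_bounded[OF Z FY, where C=1]) (use that nF in auto)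
  have S: "(CLINT w|M. Z w * f1 l w) = (-1) * (CLINT w|M. Z w * f2 l w)" if "l \<ge> 0" for l
  proof -
    have "(CLINT w|M. Z w * f1 l w) + (CLINT w|M. Z w * f2 l w) = (CLINT w|M. Z w * (f1 l w + f2 l w))"
      using i1[OF Z that] i2[OF Z that] by (simp add: distrib_left)
    also have "\<dots> = (CLINT w|M. Z w * F (Y w) (l, 0) + Z w * F (Y w) (0, l))"
      by (rule Bochner_Integration.integral_cong) (auto simp: F1[symmetric] distrib_left)
    also have "\<dots> = 0" using zE[OF that] iF zero by simp
    finally show ?thesis by (simp add: eq_neg_iff_add_eq_0)
  qed
  have D: "(CLINT w|M. Z w * e w * f1 l w) = 1 * (CLINT w|M. Z w * e w * f2 l w)" if "l \<ge> 0" for l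
  proof -
    have "(CLINT w|M. Z w * e w * f1 l w) - (CLINT w|M. Z w * e w * f2 l w) = (CLINT w|M. Z w * e w * (f1 l w - f2 l w))"
      using i1[OF Ze that] i2[OF Ze that] by (simp add: right_diff_distrib)
    also have "\<dots> = (CLINT w|M. Z w * F (Y w) (l, 0) - Z w * F (Y w) (0, l))"
      by (rule Bochner_Integration.integral_cong) (simp_all only: mult.assoc F2[symmetric], simp_all only: right_diff_distrib)
    also have "\<dots> = 0" using zE[OF that] iF zero by simp
    finally show ?thesis by simp
  qed
  have Z0: "(CLINT w|M. Z w * indicator B (U w)) = 0" if "B \<in> sets borel" "B \<subseteq> {0<..}" for B
    by (rule laplace_sector_zero[OF Z Um U0 M, of "-1"]) (use that S in \<open>auto simp: f1_def f2_def\<close>)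
  have E0: "(CLINT w|M. Z w * e w * indicator B (U w)) = 0" if "B \<in> sets borel" "B \<subseteq> {0<..}" for B
    by (rule laplace_sector_zero[OF Ze Um U0 M, of 1]) (use that D in \<open>auto simp: f1_def f2_def\<close>)
  have "(CLINT w|M. Z w) = 0" using zero[OF zE(1)[of 0]] by (simp add: F_def diamond_def)
  define B1 where "B1 = {u. u > 0 \<and> (u, 0) \<in> A}"
  define B2 where "B2 = {u. u > 0 \<and> (0, u) \<in> A}"
  define d where "d = (if (0, 0) \<in> A then 1 else 0 :: complex)"
  have B1: "B1 \<in> sets borel" "B1 \<subseteq> {0<..}"
  proof -
    have "(\<lambda>u::real. (u, 0::real)) \<in> borel_measurable borel" by (intro borel_measurable_continuous_onI continuous_intros)
    from measurable_sets[OF this A] have "{u. (u, 0) \<in> A} \<inter> {0<..} \<in> sets borel"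
      by (intro sets.Int) (auto simp: vimage_def)
    also have "{u. (u, 0) \<in> A} \<inter> {0<..} = B1" by (auto simp: B1_def)
    finally show "B1 \<in> sets borel" .
  qed (auto simp: B1_def)
  have B2: "B2 \<in> sets borel" "B2 \<subseteq> {0<..}"
  proof -
    have "(\<lambda>u::real. (0::real, u)) \<in> borel_measurable borel" by (intro borel_measurable_continuous_onI continuous_intros)
    from measurable_sets[OF this A] have "{u. (0, u) \<in> A} \<inter> {0<..} \<in> sets borel"
      by (intro sets.Int) (auto simp: vimage_def)
    also have "{u. (0, u) \<in> A} \<inter> {0<..} = B2" by (auto simp: B2_def)
    finally show "B2 \<in> sets borel" .
  qed (auto simp: B2_def)
  have pos: "{0<..} \<in> sets (borel :: real measure)" by simp
  note im = integrable_mult_indicator_comp[OF Z Um] integrable_mult_indicator_comp[OF Ze Um]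
  \<comment> \<open>For U > 0, (1 + e)/2 and (1 - e)/2 are the indicators of the two edges; the last
    term is the origin, obtained as the complement of U > 0.\<close>
  have eq: "Z w * indicator A (Y w) = 
      (1 / 2) * (Z w * indicator B1 (U w) + Z w * e w * indicator B1 (U w)) +
      ((1 / 2) * (Z w * indicator B2 (U w) - Z w * e w * indicator B2 (U w)) +
       d * (Z w - Z w * indicator {0<..} (U w)))" if "w \<in> space M" for w
  proof -
    obtain a b where ab: "Y w = (a, b)" by (cases "Y w")
    have "(a = 0 \<and> b > 0) \<or> (b = 0 \<and> a > 0) \<or> (a = 0 \<and> b = 0)"
      using YE[OF that] by (auto simp: ab E_def quadrant_def open_quadrant_def)
    then show ?thesis
      by (elim disjE) (auto simp: U_def e_def ab B1_def B2_def d_def indicator_def)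
  qed
  have "(CLINT w|M. Z w * indicator A (Y w)) = 
     (CLINT w|M. (1 / 2) * (Z w * indicator B1 (U w) + Z w * e w * indicator B1 (U w)) +
      ((1 / 2) * (Z w * indicator B2 (U w) - Z w * e w * indicator B2 (U w)) +
       d * (Z w - Z w * indicator {0<..} (U w))))"
    by (rule Bochner_Integration.integral_cong) (simp_all only: eq)
  also have "\<dots> = 0"
    using im[OF B1(1)] im[OF B2(1)] im[OF pos] Z Z0[OF B1] Z0[OF B2] Z0[OF pos] E0[OF B1] E0[OF B2] \<open>(CLINT w|M. Z w) = 0\<close>
    by (simp del: integral_mult_right_zero integral_mult_left_zero add: Bochner_Integration.integral_add Bochner_Integration.integral_diff integral_mult_right)
  finally show ?thesis .
qed

text \<open>The weight Z at Y1 and -Z at Y2, placed on the doubled space, has vanishing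
  transforms.\<close>

lemma F_determines2:
  fixes Z :: "'a \<Rightarrow> complex"
  assumes M: "finite_measure M" and Z: "integrable M Z"
    and Y: "Y1 \<in> borel_measurable M" "Y2 \<in> borel_measurable M"
    and YE: "\<And>w. w \<in> space M \<Longrightarrow> Y1 w \<in> E" "\<And>w. w \<in> space M \<Longrightarrow> Y2 w \<in> E"
    and eq: "\<And>z. z \<in> E \<Longrightarrow> (CLINT w|M. Z w * F (Y1 w) z) = (CLINT w|M. Z w * F (Y2 w) z)"
    and A: "A \<in> sets borel"
  shows "(CLINT w|M. Z w * indicator A (Y1 w)) = (CLINT w|M. Z w * indicator A (Y2 w))"
proof -
  let ?N = "M \<Otimes>\<^sub>M count_space (UNIV :: bool set)"
  interpret M: finite_measure M by fact
  interpret B: finite_measure "count_space (UNIV :: bool set)" by (rule finite_measure_count_space) simp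
  have N: "finite_measure ?N" by (rule finite_measure_pair_measure) unfold_locales
  define W where "W = (\<lambda>(w, b). if b then Z w else - Z w)"
  define Y where "Y = (\<lambda>(w, b). if b then Y1 w else Y2 w)"
  have iF: "integrable M (\<lambda>w. Z w * F (Y' w) z)" if "z \<in> E" "Y' = Y1 \<or> Y' = Y2" for z Y'
  proof (rule integrable_mult_bounded[OF Z, where C=1])
    have "Y' \<in> borel_measurable M" using Y that by auto
    then show "(\<lambda>w. F (Y' w) z) \<in> borel_measurable M"
      by measurable
    show "norm (F (Y' w) z) \<le> 1" if "w \<in> space M" for w
      using YE[OF that] \<open>z \<in> E\<close> \<open>Y' = Y1 \<or> Y' = Y2\<close> by (auto simp: F_def diamond_def E_def quadrant_def)
  qed
  have "(CLINT x|?N. W x * indicator A (Y x)) = 0"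
  proof (rule F_determines[OF N])
    have "integrable M (\<lambda>w. W (w, b))" for b using Z by (cases b) (auto simp: W_def)
    then show "integrable ?N W" by (rule integral_pair_bool(1)[OF M])
    show "Y \<in> borel_measurable ?N" 
      by (rule measurable_pair_measure_countable_bool) (use Y in \<open>auto simp: Y_def\<close>)
    show "Y x \<in> E" if "x \<in> space ?N" for x
      using that YE by (auto simp: Y_def space_pair_measure split: prod.splits)
    show "(CLINT x|?N. W x * F (Y x) z) = 0" if "z \<in> E" for z
    proof (subst integral_pair_bool[OF M])
      show "integrable M (\<lambda>w. W (w, b) * F (Y (w, b)) z)" for b
        using iF[OF that] by (cases b) (auto simp: W_def Y_def)
    qed (use eq that in \<open>auto simp: W_def Y_def\<close>)
  qed (rule A)
  also have "(CLINT x|?N. W x * indicator A (Y x)) = 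
     (CLINT w|M. Z w * indicator A (Y1 w)) - (CLINT w|M. Z w * indicator A (Y2 w))"
  proof (subst integral_pair_bool[OF M])
    show "integrable M (\<lambda>w. W (w, b) * indicator A (Y (w, b)))" for b
      using integrable_mult_indicator_comp[OF Z Y(1) A] integrable_mult_indicator_comp[OF Z Y(2) A]
      by (cases b) (auto simp: W_def Y_def)
  qed (auto simp: W_def Y_def)
  finally show ?thesis by simp
qed

section \<open>Planar Brownian motion through characteristic functions\<close>

lemma integral_indicator_complex:
  assumes "A \<in> sets M"
  shows "(CLINT w|M. indicator A w) = complex_of_real (measure M A)"
proof -
  have "(CLINT w|M. indicator A w) = (CLINT w|M. complex_of_real (indicator A w))"
    by (rule Bochner_Integration.integral_cong) (auto simp: indicator_def)
  also have "\<dots> = complex_of_real (LINT w|M. indicator A w)" by (rule integral_complex_of_real)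
  finally show ?thesis using assms by simp
qed

lemma sets_sigma_pair_subset:
  fixes X :: "'i \<Rightarrow> 'a \<Rightarrow> real \<times> real"
  assumes A: "A \<in> sigma_sets \<Omega> {X i -` C \<inter> \<Omega> | i C. i \<in> I \<and> C \<in> sets borel}"
  defines "Y \<equiv> \<lambda>(i, b) w. if b then fst (X i w) else snd (X i w)"
  shows "A \<in> sigma_sets \<Omega> {Y j -` B \<inter> \<Omega> | j B. j \<in> I \<times> (UNIV :: bool set) \<and> B \<in> sets (borel :: real measure)}"
proof -
  let ?G = "{Y j -` B \<inter> \<Omega> | j B. j \<in> I \<times> (UNIV :: bool set) \<and> B \<in> sets (borel :: real measure)}"
  define N where "N = sigma \<Omega> ?G"
  have sp: "space N = \<Omega>" unfolding N_def by (rule space_measure_of) auto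
  have sN: "sets N = sigma_sets \<Omega> ?G" unfolding N_def by (rule sets_measure_of) auto
  have Y: "Y j \<in> borel_measurable N" if "j \<in> I \<times> UNIV" for j
  proof (rule measurableI)
    fix B :: "real set" assume "B \<in> sets borel"
    then show "Y j -` B \<inter> space N \<in> sets N" unfolding sp sN using that by (intro sigma_sets.Basic) auto
  qed simp
  have X: "X i \<in> borel_measurable N" if "i \<in> I" for i
  proof -
    have "(\<lambda>w. (Y (i, True) w, Y (i, False) w)) \<in> measurable N (borel \<Otimes>\<^sub>M borel)"
      using Y that by (intro measurable_Pair) auto
    then show ?thesis by (simp add: Y_def borel_prod)
  qed
  have "{X i -` C \<inter> \<Omega> | i C. i \<in> I \<and> C \<in> sets borel} \<subseteq> sets N"
    using measurable_sets[OF X] sp by auto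
  from sets.sigma_sets_subset[OF this] have "A \<in> sets N" using A sp by auto
  then show ?thesis unfolding sN .
qed

text \<open>The planar variables are split into coordinates indexed by I and a boolean. The
  coefficients of both coordinates are then collected in one planar vector, a missing coordinate
  getting coefficient 0.\<close>

lemma weighted_char_zero_sigma2:
  fixes Z :: "'a \<Rightarrow> complex" and X :: "'i \<Rightarrow> 'a \<Rightarrow> real \<times> real"
  assumes Z: "integrable M Z" and X: "\<And>i. i \<in> I \<Longrightarrow> X i \<in> borel_measurable M"
    and zero: "\<And>J u. finite J \<Longrightarrow> J \<subseteq> I \<Longrightarrow> (CLINT w|M. Z w * iexp (\<Sum>j\<in>J. u j \<bullet> X j w)) = 0"
    and A: "A \<in> sigma_sets (space M) {X i -` C \<inter> space M | i C. i \<in> I \<and> C \<in> sets borel}"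
  shows "(CLINT w|M. Z w * indicator A w) = 0"
proof (rule weighted_char_zero_sigma[OF Z _ _ sets_sigma_pair_subset[OF A]])
  let ?Y = "\<lambda>(i, b) w. if b then fst (X i w) else snd (X i w)"
  show "?Y j \<in> borel_measurable M" if "j \<in> I \<times> UNIV" for j
  proof (cases j)
    case (Pair i b)
    have *: "X i \<in> measurable M (borel \<Otimes>\<^sub>M borel)" using X that Pair by (simp add: borel_prod)
    show ?thesis using measurable_compose[OF * measurable_fst] measurable_compose[OF * measurable_snd]
      by (auto simp: Pair)
  qed
  fix J :: "('i \<times> bool) set" and v assume J: "finite J" "J \<subseteq> I \<times> UNIV"
  define u where "u = (\<lambda>i. (if (i, True) \<in> J then v (i, True) else 0 :: real, if (i, False) \<in> J then v (i, False) else 0 :: real))"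
  have "(\<Sum>j\<in>J. v j * ?Y j w) = (\<Sum>i\<in>fst ` J. u i \<bullet> X i w)" for w
  proof -
    have "(\<Sum>j\<in>J. v j * ?Y j w) = (\<Sum>j\<in>fst ` J \<times> UNIV. (if j \<in> J then v j else 0) * ?Y j w)"
      by (rule sum.mono_neutral_cong_left) (use J in \<open>force simp: image_iff\<close>)+
    also have "\<dots> = (\<Sum>i\<in>fst ` J. \<Sum>b\<in>UNIV. (if (i, b) \<in> J then v (i, b) else 0) * ?Y (i, b) w)"
      by (subst sum.cartesian_product) (rule sum.cong, auto)
    also have "\<dots> = (\<Sum>i\<in>fst ` J. u i \<bullet> X i w)"
      by (rule sum.cong) (auto simp: u_def UNIV_bool inner_prod_def)
    finally show ?thesis .
  qed
  then show "(CLINT w|M. Z w * iexp (\<Sum>j\<in>J. v j * ?Y j w)) = 0"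
    using zero[of "fst ` J" u] J by fastforce
qed

section \<open>Exponential integrals of normal laws\<close>

abbreviation normal :: "real \<Rightarrow> real measure" where
  "normal \<sigma> \<equiv> density lborel (normal_density 0 \<sigma>)"

lemma normal_scale:
  assumes "\<sigma> > 0"
  shows "normal \<sigma> = distr (normal 1) borel (\<lambda>x. \<sigma> * x)"
proof -
  interpret prob_space "normal 1" by (rule prob_space_normal_density) simp
  have "distributed (normal 1) lborel (\<lambda>x. x) (normal_density 0 1)"
    unfolding distributed_def by (auto simp: distr_id2 intro!: distr_id2[symmetric])
  from normal_density_affine[OF this, of \<sigma> 0] assms
  have "distributed (normal 1) lborel (\<lambda>x. \<sigma> * x) (normal_density 0 \<sigma>)" by simp
  then have "distr (normal 1) lborel (\<lambda>x. \<sigma> * x) = normal \<sigma>" unfolding distributed_def by simp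
  moreover have "distr (normal 1) lborel (\<lambda>x. \<sigma> * x) = distr (normal 1) borel (\<lambda>x. \<sigma> * x)"
    by (rule distr_cong) auto
  ultimately show ?thesis by simp
qed

text \<open>The known characteristic function covers only the imaginary part q of the exponent. The
  real part p is absorbed by completing the square, that is, by translating the density by
  p.\<close>

lemma normal_exp_std:
  fixes a :: complex
  shows "has_bochner_integral (normal 1) (\<lambda>x. exp (a * x)) (exp (a\<^sup>2 / 2))"
proof -
  define p q where "p = Re a" and "q = Im a"
  have a: "a = p + \<i> * q" by (simp add: p_def q_def complex_eq)
  have char: "(CLINT x|normal 1. iexp (q * x)) = exp (- (q\<^sup>2) / 2)"
    using fun_cong[OF char_std_normal_distribution, of q] unfolding char_def by (simp add: exp_of_real[symmetric])
  have int: "integrable (normal 1) (\<lambda>x. iexp (q * x))"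
  proof -
    interpret prob_space "normal 1" by (rule prob_space_normal_density) simp
    show ?thesis by (rule integrable_const_bound[where B=1]) auto
  qed
  have h: "has_bochner_integral lborel (\<lambda>x. std_normal_density x *\<^sub>R iexp (q * x)) (exp (- (q\<^sup>2) / 2))"
    unfolding has_bochner_integral_iff
  proof
    show "integrable lborel (\<lambda>x. std_normal_density x *\<^sub>R iexp (q * x))"
      using int by (subst (asm) integrable_density) auto
    show "(CLINT x|lborel. std_normal_density x *\<^sub>R iexp (q * x)) = exp (- (q\<^sup>2) / 2)"
      unfolding char[symmetric] by (subst integral_density) auto
  qed
  have "has_bochner_integral lborel (\<lambda>x. std_normal_density (-p + 1 * x) *\<^sub>R iexp (q * (-p + 1 * x))) (exp (- (q\<^sup>2) / 2) /\<^sub>R \<bar>1\<bar>)"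
    using lborel_has_bochner_integral_real_affine_iff[where c=1 and t="-p", THEN iffD1, OF _ h] by simp
  then have "has_bochner_integral lborel (\<lambda>x. std_normal_density (x - p) *\<^sub>R iexp (q * (x - p))) (exp (- (q\<^sup>2) / 2))"
    by simp
  from has_bochner_integral_mult_right[OF this, of "exp (complex_of_real (p\<^sup>2 / 2) + \<i> * (q * p))"]
  have "has_bochner_integral lborel (\<lambda>x. exp (complex_of_real (p\<^sup>2 / 2) + \<i> * (q * p)) * (std_normal_density (x - p) *\<^sub>R iexp (q * (x - p))))
     (exp (complex_of_real (p\<^sup>2 / 2) + \<i> * (q * p)) * exp (- (q\<^sup>2) / 2))" by simp
  also have "(\<lambda>x. exp (complex_of_real (p\<^sup>2 / 2) + \<i> * (q * p)) * (std_normal_density (x - p) *\<^sub>R iexp (q * (x - p)))) = 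
     (\<lambda>x. std_normal_density x *\<^sub>R exp (a * x))"
  proof
    fix x :: real
    have "exp (complex_of_real (p\<^sup>2 / 2) + \<i> * (q * p)) * (std_normal_density (x - p) *\<^sub>R iexp (q * (x - p))) =
      complex_of_real (1 / sqrt (2 * pi)) * (exp (complex_of_real (p\<^sup>2 / 2) + \<i> * (q * p)) * exp (complex_of_real (- (x - p)\<^sup>2 / 2)) * exp (\<i> * (q * (x - p))))"
      unfolding std_normal_density_def by (simp add: scaleR_conv_of_real exp_of_real[symmetric])
    also have "exp (complex_of_real (p\<^sup>2 / 2) + \<i> * (q * p)) * exp (complex_of_real (- (x - p)\<^sup>2 / 2)) * exp (\<i> * (q * (x - p)))
       = exp (complex_of_real (- x\<^sup>2 / 2)) * exp (a * x)"
      unfolding exp_add[symmetric] by (rule arg_cong[of _ _ exp]) (simp add: a field_simps power2_eq_square)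
    also have "complex_of_real (1 / sqrt (2 * pi)) * (exp (complex_of_real (- x\<^sup>2 / 2)) * exp (a * x)) = std_normal_density x *\<^sub>R exp (a * x)"
      unfolding std_normal_density_def by (simp add: scaleR_conv_of_real exp_of_real[symmetric])
    finally show "exp (complex_of_real (p\<^sup>2 / 2) + \<i> * (q * p)) * (std_normal_density (x - p) *\<^sub>R iexp (q * (x - p))) = std_normal_density x *\<^sub>R exp (a * x)" .
  qed
  also have "exp (complex_of_real (p\<^sup>2 / 2) + \<i> * (q * p)) * exp (- (q\<^sup>2) / 2) = exp (a\<^sup>2 / 2)"
    unfolding exp_of_real[symmetric] exp_add[symmetric] by (rule arg_cong[of _ _ exp]) (simp add: a field_simps power2_eq_square)
  finally show ?thesis
    by (intro has_bochner_integral_density) auto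
qed

lemma normal_exp:
  fixes a :: complex
  assumes "\<sigma> > 0"
  shows "has_bochner_integral (normal \<sigma>) (\<lambda>x. exp (a * x)) (exp (\<sigma>\<^sup>2 * a\<^sup>2 / 2))"
proof -
  have "has_bochner_integral (normal 1) (\<lambda>x. exp (a * complex_of_real (\<sigma> * x))) (exp (\<sigma>\<^sup>2 * a\<^sup>2 / 2))"
    using normal_exp_std[of "a * \<sigma>"] by (simp add: power_mult_distrib mult_ac)
  then show ?thesis unfolding normal_scale[OF assms]
    by (subst has_bochner_integral_distr) auto
qed

lemma distr_eq_normal:
  assumes M: "prob_space M" and X: "X \<in> borel_measurable M" and s: "\<sigma> > 0"
    and char: "\<And>v. (CLINT w|M. iexp (v * X w)) = exp (- (\<sigma>\<^sup>2 * v\<^sup>2 / 2))"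
  shows "distr M borel X = normal \<sigma>"
proof (rule Levy_uniqueness)
  interpret prob_space M by fact
  show "real_distribution (distr M borel X)" using X by (rule real_distribution_distr)
  show "real_distribution (normal \<sigma>)"
    using prob_space_normal_density[OF s] by (auto simp: real_distribution_def real_distribution_axioms_def)
  show "Characteristic_Functions.char (distr M borel X) = Characteristic_Functions.char (normal \<sigma>)"
  proof
    fix v
    have "Characteristic_Functions.char (normal \<sigma>) v = exp (\<sigma>\<^sup>2 * (\<i> * v)\<^sup>2 / 2)"
      unfolding char_def using has_bochner_integral_integral_eq[OF normal_exp[OF s, of "\<i> * v"]]
      by (simp add: mult.assoc)
    also have "\<dots> = Characteristic_Functions.char (distr M borel X) v"
      unfolding char_def using X char[of v] by (simp add: integral_distr power_mult_distrib exp_of_real[symmetric])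
    finally show "Characteristic_Functions.char (distr M borel X) v = Characteristic_Functions.char (normal \<sigma>) v" by simp
  qed
qed

text \<open>Brownian motion with an arbitrary initial law; the conditional characteristic function encodes both
  the law of the increments and their independence of the past.\<close>

definition bm :: "'a measure \<Rightarrow> (real \<Rightarrow> 'a \<Rightarrow> real \<times> real) \<Rightarrow> bool" where
  "bm M B \<longleftrightarrow>
     prob_space M \<and> (\<forall>t\<ge>0. B t \<in> borel_measurable M) \<and>
     (\<forall>w\<in>space M. continuous_on {0..} (\<lambda>t. B t w)) \<and>
     (\<forall>s t (u :: real \<times> real) A. 0 \<le> s \<and> s \<le> t \<and> A \<in> sets (nat_filtration M B s) \<longrightarrow>
        (CLINT w|M. indicator A w * iexp (u \<bullet> (B t w - B s w))) =
        measure M A * exp (- (complex_of_real ((t - s) * (u \<bullet> u) / 2))))"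

lemma space_nat_filtration[simp]: "space (nat_filtration M X t) = space M"
  unfolding nat_filtration_def by (rule space_measure_of) blast

lemma sets_nat_filtration: "sets (nat_filtration M X t) =
  sigma_sets (space M) {X s -` A \<inter> space M | s A. s \<in> {0..t} \<and> A \<in> sets borel}"
proof -
  have "{X s -` A \<inter> space M | s A. 0 \<le> s \<and> s \<le> t \<and> A \<in> sets borel} =
    {X s -` A \<inter> space M | s A. s \<in> {0..t} \<and> A \<in> sets borel}"
    by (simp only: atLeastAtMost_iff conj_assoc)
  moreover have "{X s -` A \<inter> space M | s A. s \<in> {0..t} \<and> A \<in> sets borel} \<subseteq> Pow (space M)" by blast
  ultimately show ?thesis unfolding nat_filtration_def by (simp only: sets_measure_of)
qed

lemma nat_filtration_mono: "s \<le> t \<Longrightarrow> sets (nat_filtration M X s) \<subseteq> sets (nat_filtration M X t)"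
  unfolding sets_nat_filtration
  by (rule sigma_sets_mono', intro subsetI, elim CollectE exE conjE, intro CollectI exI conjI, assumption) auto

lemma nat_filtration_subset:
  assumes "\<And>t. t \<ge> 0 \<Longrightarrow> X t \<in> borel_measurable M"
  shows "sets (nat_filtration M X t) \<subseteq> sets M"
  unfolding sets_nat_filtration 
  by (rule sets.sigma_sets_subset, intro subsetI, elim CollectE exE conjE) (simp add: measurable_sets[OF assms])

lemma measurable_nat_filtration:
  assumes "0 \<le> s" "s \<le> t"
  shows "X s \<in> borel_measurable (nat_filtration M X t)"
proof (rule measurableI)
  fix A :: "(real \<times> real) set" assume "A \<in> sets borel"
  then show "X s -` A \<inter> space (nat_filtration M X t) \<in> sets (nat_filtration M X t)"
    unfolding sets_nat_filtration using assms by (auto intro!: sigma_sets.Basic)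
qed simp

text \<open>With c the expected factor, the weight iexp(u . increment) - c has vanishing transforms
  against the past values, so it integrates to 0 over every past event.\<close>

lemma bmI:
  assumes M: "prob_space M" and B: "\<And>t. t \<ge> 0 \<Longrightarrow> B t \<in> borel_measurable M"
    and cont: "\<And>w. w \<in> space M \<Longrightarrow> continuous_on {0..} (\<lambda>t. B t w)"
    and eq: "\<And>s t (u :: real \<times> real) R y. 0 \<le> s \<Longrightarrow> s \<le> t \<Longrightarrow> finite R \<Longrightarrow> R \<subseteq> {0..s} \<Longrightarrow>
      (CLINT w|M. iexp (\<Sum>r\<in>R. y r \<bullet> B r w) * iexp (u \<bullet> (B t w - B s w))) =
      (CLINT w|M. iexp (\<Sum>r\<in>R. y r \<bullet> B r w)) * exp (- (complex_of_real ((t - s) * (u \<bullet> u) / 2)))"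
  shows "bm M B"
  unfolding bm_def
proof (intro conjI allI impI ballI M B cont; (elim conjE)?)
  fix s t :: real and u :: "real \<times> real" and A assume st: "0 \<le> s" "s \<le> t" and A: "A \<in> sets (nat_filtration M B s)"
  interpret prob_space M by fact
  define c where "c = exp (- (complex_of_real ((t - s) * (u \<bullet> u) / 2)))"
  have [measurable]: "B s \<in> borel_measurable M" "B t \<in> borel_measurable M" using B st by auto
  have i: "integrable M (\<lambda>w. iexp (u \<bullet> (B t w - B s w)))"
    by (rule integrable_const_bound[where B=1]) auto
  have AM: "A \<in> sets M" using nat_filtration_subset[of B M s] B A by auto
  have "(CLINT w|M. (iexp (u \<bullet> (B t w - B s w)) - c) * indicator A w) = 0"
  proof (rule weighted_char_zero_sigma2[OF _ _ _ A[unfolded sets_nat_filtration]])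
    show "integrable M (\<lambda>w. iexp (u \<bullet> (B t w - B s w)) - c)" using i by simp
    show "B i \<in> borel_measurable M" if "i \<in> {0..s}" for i using that B by auto
    fix J :: "real set" and y :: "real \<Rightarrow> real \<times> real" assume J: "finite J" "J \<subseteq> {0..s}"
    have [measurable]: "B r \<in> borel_measurable M" if "r \<in> J" for r using B J that by auto
    have m: "(\<lambda>w. \<Sum>j\<in>J. y j \<bullet> B j w) \<in> borel_measurable M" by measurable
    have "(CLINT w|M. (iexp (u \<bullet> (B t w - B s w)) - c) * iexp (\<Sum>j\<in>J. y j \<bullet> B j w)) = 
      (CLINT w|M. iexp (\<Sum>j\<in>J. y j \<bullet> B j w) * iexp (u \<bullet> (B t w - B s w)) - iexp (\<Sum>j\<in>J. y j \<bullet> B j w) * c)"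
      by (rule Bochner_Integration.integral_cong) (auto simp only: algebra_simps)
    also have "\<dots> = (CLINT w|M. iexp (\<Sum>j\<in>J. y j \<bullet> B j w) * iexp (u \<bullet> (B t w - B s w))) - (CLINT w|M. iexp (\<Sum>j\<in>J. y j \<bullet> B j w)) * c"
    proof (subst Bochner_Integration.integral_diff)
      show "integrable M (\<lambda>w. iexp (\<Sum>j\<in>J. y j \<bullet> B j w) * iexp (u \<bullet> (B t w - B s w)))"
        by (rule integrable_const_bound[where B=1]) (auto simp: norm_mult)
      show "integrable M (\<lambda>w. iexp (\<Sum>j\<in>J. y j \<bullet> B j w) * c)"
        by (intro integrable_mult_left integrable_const_bound[where B=1]) (use m in auto)
    qed simp
    also have "\<dots> = 0" using eq[OF st J, of y u] unfolding c_def by simp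
    finally show "(CLINT w|M. (iexp (u \<bullet> (B t w - B s w)) - c) * iexp (\<Sum>j\<in>J. y j \<bullet> B j w)) = 0" .
  qed
  also have "(CLINT w|M. (iexp (u \<bullet> (B t w - B s w)) - c) * indicator A w) = 
     (CLINT w|M. indicator A w * iexp (u \<bullet> (B t w - B s w)) - indicator A w * c)"
    by (rule Bochner_Integration.integral_cong) (auto simp only: algebra_simps)
  also have "\<dots> = (CLINT w|M. indicator A w * iexp (u \<bullet> (B t w - B s w))) - measure M A * c"
  proof (subst Bochner_Integration.integral_diff)
    have iA: "integrable M (\<lambda>w. indicator A w :: complex)"
      using AM by (intro integrable_const_bound[where B=1]) (auto simp: indicator_def)
    show "integrable M (\<lambda>w. indicator A w * iexp (u \<bullet> (B t w - B s w)))"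
      using integrable_mult_cexp[OF iA] by simp
    show "integrable M (\<lambda>w. indicator A w * c)" using iA by simp
    have "(CLINT w|M. indicator A w) = complex_of_real (measure M A)"
      by (rule integral_indicator_complex[OF AM])
    then show "(CLINT w|M. indicator A w * iexp (u \<bullet> (B t w - B s w))) - (CLINT w|M. indicator A w * c) = 
      (CLINT w|M. indicator A w * iexp (u \<bullet> (B t w - B s w))) - measure M A * c" by simp
  qed
  finally show "(CLINT w|M. indicator A w * iexp (u \<bullet> (B t w - B s w))) =
        measure M A * exp (- (complex_of_real ((t - s) * (u \<bullet> u) / 2)))" unfolding c_def by simp
qed

lemma sets_normal_pair: "sets (normal \<sigma> \<Otimes>\<^sub>M normal \<sigma>) = sets (borel :: (real \<times> real) measure)"
proof -
  have "sets (normal \<sigma> \<Otimes>\<^sub>M normal \<sigma>) = sets (borel \<Otimes>\<^sub>M borel)" by (rule sets_pair_measure_cong) simp_all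
  then show ?thesis by (simp only: borel_prod)
qed

lemma (in finite_measure) integral_indicator_diff:
  assumes "A \<in> sets M" "C \<in> sets M"
  shows "(CLINT w|M. indicator A w - complex_of_real p * indicator C w) =
    complex_of_real (measure M A) - p * complex_of_real (measure M C)"
proof -
  have i: "integrable M (\<lambda>w. indicator X w :: complex)" if "X \<in> sets M" for X
    using that by (intro integrable_const_bound[where B=1]) (auto simp: indicator_def)
  show ?thesis
    unfolding integral_indicator_complex[OF assms(1), symmetric] integral_indicator_complex[OF assms(2), symmetric]
      integral_mult_right_zero[symmetric]
    by (rule Bochner_Integration.integral_diff) (use i assms in auto)
qed

lemma bm_prob: "bm M B \<Longrightarrow> prob_space M"
  and bm_measurable: "bm M B \<Longrightarrow> t \<ge> 0 \<Longrightarrow> B t \<in> borel_measurable M"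
  and bm_continuous: "bm M B \<Longrightarrow> w \<in> space M \<Longrightarrow> continuous_on {0..} (\<lambda>t. B t w)"
  and bm_char: "bm M B \<Longrightarrow> 0 \<le> s \<Longrightarrow> s \<le> t \<Longrightarrow> A \<in> sets (nat_filtration M B s) \<Longrightarrow>
    (CLINT w|M. indicator A w * iexp (u \<bullet> (B t w - B s w))) =
    measure M A * exp (- (complex_of_real ((t - s) * (u \<bullet> u) / 2)))"
  unfolding bm_def by blast+

lemma bm_increment_measurable:
  assumes "bm M B" "0 \<le> s" "0 \<le> t"
  shows "(\<lambda>w. B t w - B s w) \<in> borel_measurable M"
  using assms by (intro borel_measurable_diff bm_measurable)

lemma measurable_fst_snd_real:
  fixes X :: "'a \<Rightarrow> real \<times> real"
  assumes "X \<in> borel_measurable M"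
  shows "(\<lambda>w. fst (X w)) \<in> borel_measurable M" "(\<lambda>w. snd (X w)) \<in> borel_measurable M"
  by (auto intro!: borel_measurable_continuous_on[OF _ assms] continuous_intros)

lemma bm_increment_char:
  assumes "bm M B" "0 \<le> s" "s \<le> t"
  shows "(CLINT w|M. iexp (u \<bullet> (B t w - B s w))) = exp (- (complex_of_real ((t - s) * (u \<bullet> u) / 2)))"
proof -
  interpret prob_space M using assms by (simp add: bm_def)
  have "space M \<in> sets (nat_filtration M B s)"
    using sets.top[of "nat_filtration M B s"] by simp
  then have "(CLINT w|M. indicator (space M) w * iexp (u \<bullet> (B t w - B s w))) = exp (- (complex_of_real ((t - s) * (u \<bullet> u) / 2)))"
    using bm_char[OF assms, of "space M" u] by (simp only: prob_space of_real_1 mult_1)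
  moreover have "(CLINT w|M. indicator (space M) w * iexp (u \<bullet> (B t w - B s w))) = (CLINT w|M. iexp (u \<bullet> (B t w - B s w)))"
    by (rule Bochner_Integration.integral_cong) auto
  ultimately show ?thesis by simp
qed

text \<open>The condition in \<open>bm\<close> yields the same factor for A and for the whole space.
  Hence the weight 1_A - P(A) has vanishing transforms against the increment.\<close>

lemma bm_increment_indep:
  assumes bm: "bm M B" and st: "0 \<le> s" "s \<le> t" and A: "A \<in> sets (nat_filtration M B s)" and C: "C \<in> sets borel"
  shows "measure M (A \<inter> {w\<in>space M. B t w - B s w \<in> C}) = measure M A * measure M {w\<in>space M. B t w - B s w \<in> C}"
proof -
  interpret prob_space M using bm by (simp add: bm_def)
  let ?D = "\<lambda>w. B t w - B s w"
  have D: "?D \<in> borel_measurable M" using bm_increment_measurable[OF bm] st by auto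
  have AM: "A \<in> sets M" using nat_filtration_subset[of B M s] bm A by (auto simp: bm_def)
  have CM: "{w\<in>space M. ?D w \<in> C} \<in> sets M" using measurable_sets_Collect[OF D, of "\<lambda>x. x \<in> C"] C by simp
  have iA: "integrable M (\<lambda>w. indicator A w :: complex)"
    using AM by (intro integrable_const_bound[where B=1]) (auto simp: indicator_def)
  have i1: "integrable M (\<lambda>w. indicator A w * iexp (u \<bullet> ?D w))" for u
    using integrable_mult_cexp[OF iA, of "\<lambda>w. u \<bullet> ?D w"] D by auto
  have i2: "integrable M (\<lambda>w. measure M A * iexp (u \<bullet> ?D w))" for u
    by (intro integrable_mult_right integrable_const_bound[where B=1]) (use D in auto)
  have eq: "(CLINT w|M. (indicator A w - complex_of_real (measure M A)) * iexp (u \<bullet> ?D w)) = 0" for u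
  proof -
    have "(CLINT w|M. indicator A w * iexp (u \<bullet> ?D w)) = measure M A * exp (- (complex_of_real ((t - s) * (u \<bullet> u) / 2)))"
      by (rule bm_char[OF bm st A])
    also have "\<dots> = (CLINT w|M. measure M A * iexp (u \<bullet> ?D w))"
      unfolding bm_increment_char[OF bm st, symmetric] by (rule integral_mult_right_zero[symmetric])
    finally show ?thesis
      using Bochner_Integration.integral_diff[OF i1[of u] i2[of u]] by (simp add: left_diff_distrib)
  qed
  have "(CLINT w|M. (indicator A w - complex_of_real (measure M A)) * indicator {w\<in>space M. ?D w \<in> C} w) = 0"
  \<comment> \<open>The increment is a single variable, so the unit type serves as index
    set.\<close>
  proof (rule weighted_char_zero_sigma2[where I="{()}" and X="\<lambda>_. ?D"])
    show "integrable M (\<lambda>w. indicator A w - complex_of_real (measure M A))" using iA by simp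
    fix J :: "unit set" and u :: "unit \<Rightarrow> real \<times> real" assume "J \<subseteq> {()}"
    then have "(\<Sum>j\<in>J. u j \<bullet> ?D w) = (if J = {} then 0 else u ()) \<bullet> ?D w" for w
      by (cases "J = {}") (auto simp: subset_singleton_iff)
    then show "(CLINT w|M. (indicator A w - complex_of_real (measure M A)) * iexp (\<Sum>j\<in>J. u j \<bullet> ?D w)) = 0"
      using eq by simp
  next
    show "{w\<in>space M. ?D w \<in> C} \<in> sigma_sets (space M) {?D -` C \<inter> space M | i C. i \<in> {()} \<and> C \<in> sets borel}"
      by (rule sigma_sets.Basic) (use C in auto)
  qed (use D in auto)
  moreover have "(CLINT w|M. (indicator A w - complex_of_real (measure M A)) * indicator {w\<in>space M. ?D w \<in> C} w) = 
     (CLINT w|M. indicator (A \<inter> {w\<in>space M. ?D w \<in> C}) w - complex_of_real (measure M A) * indicator {w\<in>space M. ?D w \<in> C} w)"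
    by (rule Bochner_Integration.integral_cong) (auto simp: indicator_def)
  moreover have "\<dots> = complex_of_real (measure M (A \<inter> {w\<in>space M. ?D w \<in> C})) - measure M A * complex_of_real (measure M {w\<in>space M. ?D w \<in> C})"
    by (rule integral_indicator_diff) (use AM CM in auto)
  ultimately have "complex_of_real (measure M (A \<inter> {w\<in>space M. ?D w \<in> C})) = measure M A * complex_of_real (measure M {w\<in>space M. ?D w \<in> C})"
    by simp
  then show ?thesis by (simp only: of_real_mult[symmetric] of_real_eq_iff)
qed

text \<open>The characteristic function of the increment is a product, which gives normal marginals.
  Independence of the coordinates follows by replacing exponentials with indicators twice: for X
  with Y in the weight, then for Y with X in the weight.\<close>

lemma bm_increment_law:
  assumes bm: "bm M B" and st: "0 \<le> s" "s < t"
  shows "distr M borel (\<lambda>w. B t w - B s w) = normal (sqrt (t - s)) \<Otimes>\<^sub>M normal (sqrt (t - s))"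
proof -
  interpret prob_space M using bm by (simp add: bm_def)
  define X where "X = (\<lambda>w. fst (B t w - B s w))"
  define Y where "Y = (\<lambda>w. snd (B t w - B s w))"
  let ?D = "\<lambda>w. B t w - B s w"
  have D: "?D \<in> borel_measurable M" using bm_increment_measurable[OF bm] st by auto
  have [measurable]: "X \<in> borel_measurable M" "Y \<in> borel_measurable M"
    using measurable_fst_snd_real[OF D] by (auto simp: X_def Y_def)
  have cXY: "(CLINT w|M. iexp (v * X w) * iexp (m * Y w)) = exp (- (complex_of_real ((t - s) * v\<^sup>2 / 2))) * exp (- (complex_of_real ((t - s) * m\<^sup>2 / 2)))" for v m
  proof -
    have "iexp (v * X w) * iexp (m * Y w) = iexp ((v, m) \<bullet> ?D w)" for w
      unfolding exp_add[symmetric] by (simp add: X_def Y_def inner_prod_def distrib_left)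
    then have "(CLINT w|M. iexp (v * X w) * iexp (m * Y w)) = exp (- (complex_of_real ((t - s) * ((v, m) \<bullet> (v, m)) / 2)))"
      using bm_increment_char[OF bm, of s t "(v, m)"] st by simp
    moreover have "(t - s) * ((v, m) \<bullet> (v, m)) / 2 = (t - s) * v\<^sup>2 / 2 + (t - s) * m\<^sup>2 / 2"
      by (simp add: inner_prod_def power2_eq_square field_simps)
    ultimately show ?thesis by (simp only: of_real_add minus_add_distrib exp_add)
  qed
  have dX: "distr M borel X = normal (sqrt (t - s))"
    by (rule distr_eq_normal) (use st cXY[of _ 0] in \<open>auto simp: prob_space_axioms exp_of_real[symmetric]\<close>)
  have dY: "distr M borel Y = normal (sqrt (t - s))"
    by (rule distr_eq_normal) (use st cXY[of 0] in \<open>auto simp: prob_space_axioms exp_of_real[symmetric]\<close>)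
  have i: "integrable M (\<lambda>w. iexp (m * Y w))" for m by (rule integrable_const_bound[where B=1]) auto
  have iX: "integrable M (\<lambda>w. iexp (m * X w))" for m by (rule integrable_const_bound[where B=1]) auto
  have prod: "prob ({w\<in>space M. X w \<in> A} \<inter> {w\<in>space M. Y w \<in> C}) = prob {w\<in>space M. X w \<in> A} * prob {w\<in>space M. Y w \<in> C}"
    if A: "A \<in> sets borel" and C: "C \<in> sets borel" for A C
  proof -
    have AM: "{w\<in>space M. X w \<in> A} \<in> sets M" using A by measurable
    have CM: "{w\<in>space M. Y w \<in> C} \<in> sets M" using C by measurable
    have eqA: "indicator A (X w) = (indicator {w\<in>space M. X w \<in> A} w :: complex)" if "w \<in> space M" for w
      using that by (auto simp: indicator_def)
    have iA: "integrable M (\<lambda>w. indicator A (X w) :: complex)"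
      using A by (intro integrable_const_bound[where B=1]) (auto simp: indicator_def)
    have pA: "(CLINT w|M. indicator A (X w)) = complex_of_real (prob {w\<in>space M. X w \<in> A})"
      unfolding integral_indicator_complex[OF AM, symmetric] by (rule Bochner_Integration.integral_cong) (auto simp: eqA)
    define c where "c = (\<lambda>m. exp (- (complex_of_real ((t - s) * m\<^sup>2 / 2))))"
    have z1: "(CLINT w|M. (iexp (m * Y w) - c m) * indicator A (X w)) = 0" for m
    proof (rule weighted_char_zero[OF _ _ _ A])
      show "integrable M (\<lambda>w. iexp (m * Y w) - c m)" using i by simp
      fix v
      have "(CLINT w|M. (iexp (m * Y w) - c m) * iexp (v * X w)) = (CLINT w|M. iexp (v * X w) * iexp (m * Y w) - c m * iexp (v * X w))"
        by (rule Bochner_Integration.integral_cong) (auto simp only: algebra_simps)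
      also have "\<dots> = (CLINT w|M. iexp (v * X w) * iexp (m * Y w)) - c m * (CLINT w|M. iexp (v * X w))"
        using integrable_mult_cexp[OF iX[of v], of "\<lambda>w. m * Y w"] integrable_mult_right[OF iX[of v], of "c m"]
        by (subst Bochner_Integration.integral_diff) (simp_all add: mult.commute)
      also have "\<dots> = 0" using cXY[of v m] cXY[of v 0] by (simp add: c_def)
      finally show "(CLINT w|M. (iexp (m * Y w) - c m) * iexp (v * X w)) = 0" .
    qed simp
    have "(CLINT w|M. (indicator A (X w) - complex_of_real (prob {w\<in>space M. X w \<in> A})) * indicator C (Y w)) = 0"
    proof (rule weighted_char_zero[OF _ _ _ C])
      show "integrable M (\<lambda>w. indicator A (X w) - complex_of_real (prob {w\<in>space M. X w \<in> A}))" using iA by simp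
      fix m
      have cw: "(CLINT w|M. iexp (m * Y w)) = c m" using cXY[of 0 m] by (simp add: c_def)
      have iAY: "integrable M (\<lambda>w. indicator A (X w) * iexp (m * Y w))" by (rule integrable_mult_cexp[OF iA]) simp
      have "0 = (CLINT w|M. indicator A (X w) * iexp (m * Y w) - indicator A (X w) * c m)"
        unfolding z1[of m, symmetric] by (rule Bochner_Integration.integral_cong) (auto simp only: algebra_simps)
      also have "\<dots> = (CLINT w|M. indicator A (X w) * iexp (m * Y w)) - prob {w\<in>space M. X w \<in> A} * (CLINT w|M. iexp (m * Y w))"
        unfolding cw using iAY iA pA by (subst Bochner_Integration.integral_diff) simp_all
      also have "\<dots> = (CLINT w|M. (indicator A (X w) - complex_of_real (prob {w\<in>space M. X w \<in> A})) * iexp (m * Y w))"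
        using iAY integrable_mult_right[OF i[of m], of "complex_of_real (prob {w\<in>space M. X w \<in> A})"]
        unfolding left_diff_distrib by (subst Bochner_Integration.integral_diff) simp_all
      finally show "(CLINT w|M. (indicator A (X w) - complex_of_real (prob {w\<in>space M. X w \<in> A})) * iexp (m * Y w)) = 0" by simp
    qed simp
    also have "(CLINT w|M. (indicator A (X w) - complex_of_real (prob {w\<in>space M. X w \<in> A})) * indicator C (Y w)) = 
      (CLINT w|M. indicator ({w\<in>space M. X w \<in> A} \<inter> {w\<in>space M. Y w \<in> C}) w - complex_of_real (prob {w\<in>space M. X w \<in> A}) * indicator {w\<in>space M. Y w \<in> C} w)"
      by (rule Bochner_Integration.integral_cong) (auto simp: indicator_def)
    also have "\<dots> = complex_of_real (prob ({w\<in>space M. X w \<in> A} \<inter> {w\<in>space M. Y w \<in> C})) - prob {w\<in>space M. X w \<in> A} * complex_of_real (prob {w\<in>space M. Y w \<in> C})"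
      by (rule integral_indicator_diff) (use AM CM in auto)
    finally have "complex_of_real (prob ({w\<in>space M. X w \<in> A} \<inter> {w\<in>space M. Y w \<in> C})) = prob {w\<in>space M. X w \<in> A} * complex_of_real (prob {w\<in>space M. Y w \<in> C})"
      by simp
    then show ?thesis by (simp only: of_real_mult[symmetric] of_real_eq_iff)
  qed
  have "normal (sqrt (t - s)) \<Otimes>\<^sub>M normal (sqrt (t - s)) = distr M borel ?D"
  proof (rule pair_measure_eqI)
    show "sigma_finite_measure (normal (sqrt (t - s)))" "sigma_finite_measure (normal (sqrt (t - s)))"
      using prob_space_normal_density[of "sqrt (t - s)" 0] st by (auto intro: prob_space_imp_sigma_finite)
    show "sets (normal (sqrt (t - s)) \<Otimes>\<^sub>M normal (sqrt (t - s))) = sets (distr M borel ?D)"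
      by (simp only: sets_normal_pair sets_distr)
    fix A C assume "A \<in> sets (normal (sqrt (t - s)))" "C \<in> sets (normal (sqrt (t - s)))"
    then have A: "A \<in> sets borel" and C: "C \<in> sets borel" by auto
    have AC: "A \<times> C \<in> sets borel" using pair_measureI[OF A C] by (simp only: borel_prod)
    have *: "?D -` (A \<times> C) \<inter> space M = {w\<in>space M. X w \<in> A} \<inter> {w\<in>space M. Y w \<in> C}"
      by (auto simp: X_def Y_def mem_Times_iff simp del: fst_diff snd_diff)
    have "emeasure (normal (sqrt (t - s))) A = ennreal (prob {w\<in>space M. X w \<in> A})"
      unfolding dX[symmetric] using A by (subst emeasure_distr) (auto simp: emeasure_eq_measure intro!: arg_cong[of _ _ prob])
    moreover have "emeasure (normal (sqrt (t - s))) C = ennreal (prob {w\<in>space M. Y w \<in> C})"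
      unfolding dY[symmetric] using C by (subst emeasure_distr) (auto simp: emeasure_eq_measure intro!: arg_cong[of _ _ prob])
    moreover have "emeasure (distr M borel ?D) (A \<times> C) = ennreal (prob ({w\<in>space M. X w \<in> A} \<inter> {w\<in>space M. Y w \<in> C}))"
      using D AC by (simp add: emeasure_distr emeasure_eq_measure *)
    ultimately show "emeasure (normal (sqrt (t - s))) A * emeasure (normal (sqrt (t - s))) C = emeasure (distr M borel ?D) (A \<times> C)"
      unfolding prod[OF A C] by (simp add: ennreal_mult)
  qed
  then show ?thesis by simp
qed

text \<open>The exponents may have real parts, so characteristic functions alone do not suffice. The
  law of the increment provides its exponential moments, and independence of the past lets V factor
  out. Exponential martingales rest on this.\<close>

lemma bm_increment_exp:
  assumes bm: "bm M B" and st: "0 \<le> s" "s \<le> t"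
    and V: "V \<in> borel_measurable (nat_filtration M B s)" and iV: "integrable M V"
  shows "has_bochner_integral M (\<lambda>w. V w * exp (a * complex_of_real (fst (B t w - B s w)) + b * complex_of_real (snd (B t w - B s w))))
     ((CLINT w|M. V w) * exp ((t - s) * (a\<^sup>2 + b\<^sup>2) / 2))"
proof (cases "s = t")
  case True
  then show ?thesis using iV by (simp add: has_bochner_integral_iff)
next
  case False
  with st have st': "s < t" by simp
  interpret prob_space M using bm by (simp add: bm_def)
  let ?D = "\<lambda>w. B t w - B s w"
  let ?N = "normal (sqrt (t - s))"
  have D: "?D \<in> borel_measurable M" using bm_increment_measurable[OF bm] st by auto
  note fs[measurable] = measurable_fst_snd_real[OF D]
  interpret N: prob_space ?N by (rule prob_space_normal_density) (use st' in simp)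
  interpret NN: pair_prob_space ?N ?N ..
  have law: "distr M borel ?D = ?N \<Otimes>\<^sub>M ?N" by (rule bm_increment_law[OF bm st(1) st'])
  have dX: "distr M borel (\<lambda>w. fst (?D w)) = ?N"
  proof -
    have "distr M borel (\<lambda>w. fst (?D w)) = distr (distr M borel ?D) borel fst"
      by (subst distr_distr) (use D in \<open>auto simp: comp_def intro!: borel_measurable_continuous_onI continuous_intros\<close>)
    also have "\<dots> = distr (?N \<Otimes>\<^sub>M ?N) ?N fst" unfolding law by (rule distr_cong) auto
    also have "\<dots> = ?N" by (rule N.distr_pair_fst)
    finally show ?thesis .
  qed
  have dY: "distr M borel (\<lambda>w. snd (?D w)) = ?N"
  proof -
    have "distr M borel (\<lambda>w. snd (?D w)) = distr (distr M borel ?D) borel snd"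
      by (subst distr_distr) (use D in \<open>auto simp: comp_def intro!: borel_measurable_continuous_onI continuous_intros\<close>)
    also have "\<dots> = distr (?N \<Otimes>\<^sub>M ?N) ?N snd" unfolding law by (rule distr_cong) auto
    also have "\<dots> = ?N"
    proof (rule measure_eqI)
      fix A assume "A \<in> sets (distr (?N \<Otimes>\<^sub>M ?N) ?N snd)"
      then have A: "A \<in> sets ?N" by simp
      have *: "snd -` A \<inter> space (?N \<Otimes>\<^sub>M ?N) = space ?N \<times> A" by (auto simp: space_pair_measure)
      show "emeasure (distr (?N \<Otimes>\<^sub>M ?N) ?N snd) A = emeasure ?N A"
        unfolding emeasure_distr[OF measurable_snd A] * N.emeasure_pair_measure_Times[OF sets.top A] N.emeasure_space_1 mult_1 ..
    qed simp
    finally show ?thesis .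
  qed
  have indXY: "indep_var borel (\<lambda>w. fst (?D w)) borel (\<lambda>w. snd (?D w))"
    unfolding indep_var_distribution_eq dX dY using law fs by (simp add: borel_prod del: fst_diff snd_diff)
  have exp1: "has_bochner_integral M (\<lambda>w. exp (c * complex_of_real (f (?D w)))) (exp ((t - s) * c\<^sup>2 / 2))"
    if "f = fst \<or> f = snd" for c :: complex and f
  proof -
    have "distr M borel (\<lambda>w. f (?D w)) = ?N" using that dX dY by auto
    moreover have "has_bochner_integral ?N (\<lambda>x. exp (c * x)) (exp ((t - s) * c\<^sup>2 / 2))"
      using normal_exp[of "sqrt (t - s)" c] st' by (simp flip: of_real_power)
    ultimately have "has_bochner_integral (distr M borel (\<lambda>w. f (?D w))) (\<lambda>x. exp (c * x)) (exp ((t - s) * c\<^sup>2 / 2))"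
      by simp
    moreover have "(\<lambda>w. f (?D w)) \<in> borel_measurable M" using that fs by auto
    ultimately show ?thesis by (simp add: has_bochner_integral_iff integrable_distr_eq integral_distr)
  qed
  have "indep_var borel ((\<lambda>x. exp (a * complex_of_real x)) \<circ> (\<lambda>w. fst (?D w))) borel ((\<lambda>x. exp (b * complex_of_real x)) \<circ> (\<lambda>w. snd (?D w)))"
    by (rule indep_var_compose[OF indXY]) auto
  then have ind: "indep_var borel (\<lambda>w. exp (a * complex_of_real (fst (?D w)))) borel (\<lambda>w. exp (b * complex_of_real (snd (?D w))))"
    by (simp add: comp_def)
  have e: "has_bochner_integral M (\<lambda>w. exp (a * complex_of_real (fst (?D w)) + b * complex_of_real (snd (?D w)))) (exp ((t - s) * (a\<^sup>2 + b\<^sup>2) / 2))"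
    using exp1[of fst a] exp1[of snd b] indep_var_lebesgue_integral[OF ind] indep_var_integrable[OF ind]
    by (simp add: has_bochner_integral_iff exp_add[symmetric] add_divide_distrib distrib_left del: fst_diff snd_diff)
  have VM: "V \<in> borel_measurable M" using iV by auto
  define g where "g = (\<lambda>x :: real \<times> real. exp (a * complex_of_real (fst x) + b * complex_of_real (snd x)))"
  have g: "g \<in> borel_measurable borel"
    unfolding g_def by (intro borel_measurable_continuous_onI continuous_intros)
  have gD: "(\<lambda>w. g (?D w)) \<in> borel_measurable M" by (rule measurable_compose[OF D g])
  have "indep_var borel V borel (\<lambda>w. g (?D w))"
  proof (subst indep_var_eq, intro conjI indep_setI)
    show "random_variable borel V" "random_variable borel (\<lambda>w. g (?D w))" by (fact VM gD)+
    \<comment> \<open>Preimages of Borel sets under one map already form a sigma-algebra, so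
      elements of the generated one have this explicit form.\<close>
    have *: "sigma_sets (space M) {X -` A \<inter> space M |A. A \<in> sets borel} = {X -` A \<inter> space M |A. A \<in> sets borel}" for X :: "'a \<Rightarrow> complex"
      using sets.sigma_sets_eq[of "vimage_algebra (space M) X borel"] 
      by (simp add: sets_vimage_algebra2)
    show "sigma_sets (space M) {V -` A \<inter> space M |A. A \<in> sets borel} \<subseteq> events"
      "sigma_sets (space M) {(\<lambda>w. g (?D w)) -` A \<inter> space M |A. A \<in> sets borel} \<subseteq> events"
      unfolding * using measurable_sets[OF VM] measurable_sets[OF gD] by auto
    fix x y assume "x \<in> sigma_sets (space M) {V -` A \<inter> space M |A. A \<in> sets borel}" "y \<in> sigma_sets (space M) {(\<lambda>w. g (?D w)) -` A \<inter> space M |A. A \<in> sets borel}"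
    then obtain A C where AC: "A \<in> sets borel" "C \<in> sets borel" "x = V -` A \<inter> space M" "y = (\<lambda>w. g (?D w)) -` C \<inter> space M"
      unfolding * by blast
    have y: "y = {w\<in>space M. ?D w \<in> g -` C}" unfolding AC(4) by auto
    have "x \<in> sets (nat_filtration M B s)" using measurable_sets[OF V AC(1)] AC(3) by simp
    moreover have "g -` C \<in> sets borel" using measurable_sets[OF g AC(2)] by simp
    ultimately show "prob (x \<inter> y) = prob x * prob y"
      unfolding y by (rule bm_increment_indep[OF bm st])
  qed
  then have ind2: "indep_var borel V borel (\<lambda>w. exp (a * complex_of_real (fst (?D w)) + b * complex_of_real (snd (?D w))))"
    by (simp only: g_def)
  show ?thesis
    using e iV indep_var_lebesgue_integral[OF ind2] indep_var_integrable[OF ind2]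
    by (simp add: has_bochner_integral_iff del: fst_diff snd_diff)
qed

section \<open>Agreement with the definition by independent increments\<close>

lemma normal_pair_char:
  assumes "\<sigma> > 0"
  shows "(CLINT y|normal \<sigma> \<Otimes>\<^sub>M normal \<sigma>. iexp (u \<bullet> y)) = exp (- complex_of_real (\<sigma>\<^sup>2 * (u \<bullet> u) / 2))"
proof -
  let ?N = "normal \<sigma>"
  interpret N: prob_space ?N by (rule prob_space_normal_density) (use assms in simp)
  interpret NN: pair_prob_space ?N ?N ..
  have c: "(CLINT x|?N. iexp (v * x)) = exp (- complex_of_real (\<sigma>\<^sup>2 * v\<^sup>2 / 2))" for v
    using has_bochner_integral_integral_eq[OF normal_exp[OF assms, of "\<i> * v"]]
    by (simp add: power_mult_distrib mult.assoc)
  have m: "(\<lambda>y. iexp (u \<bullet> y)) \<in> borel_measurable (?N \<Otimes>\<^sub>M ?N)"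
  proof -
    have "(\<lambda>y. iexp (u \<bullet> y)) \<in> borel_measurable borel" by (intro borel_measurable_continuous_onI continuous_intros)
    then show ?thesis by (simp only: measurable_cong_sets[OF sets_normal_pair refl])
  qed
  have "(CLINT y|?N \<Otimes>\<^sub>M ?N. iexp (u \<bullet> y)) = (CLINT x|?N. CLINT y|?N. iexp (u \<bullet> (x, y)))"
    by (rule NN.integral_fst'[symmetric], rule NN.integrable_const_bound[where B=1]) (use m in auto)
  also have "\<dots> = (CLINT x|?N. iexp (fst u * x) * (CLINT y|?N. iexp (snd u * y)))"
    by (simp add: inner_prod_def distrib_left exp_add)
  also have "\<dots> = exp (- complex_of_real (\<sigma>\<^sup>2 * (fst u)\<^sup>2 / 2)) * exp (- complex_of_real (\<sigma>\<^sup>2 * (snd u)\<^sup>2 / 2))"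
    unfolding c by (simp only: integral_mult_left_zero c)
  also have "\<dots> = exp (- complex_of_real (\<sigma>\<^sup>2 * (u \<bullet> u) / 2))"
    unfolding exp_add[symmetric] by (rule arg_cong[of _ _ exp]) (simp add: inner_prod_def power2_eq_square field_simps)
  finally show ?thesis .
qed

text \<open>All times are arranged in one partition of [0, s], followed by t. In terms of the
  increments over this partition the exponent is a sum of independent terms, and the last factor
  splits off.\<close>

lemma indep_increments_char:
  assumes M: "prob_space M"
    and law: "\<And>s t. 0 \<le> s \<Longrightarrow> s < t \<Longrightarrow> distr M borel (\<lambda>w. B t w - B s w) = normal (sqrt (t - s)) \<Otimes>\<^sub>M normal (sqrt (t - s))"
    and ind: "\<And>(n::nat) (t :: nat \<Rightarrow> real). 0 \<le> t 0 \<Longrightarrow> (\<forall>i<n. t i \<le> t (Suc i)) \<Longrightarrow> 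
       prob_space.indep_vars M (\<lambda>_. borel) (\<lambda>i w. B (t (Suc i)) w - B (t i) w) {..<n}"
    and B0: "\<And>w. w \<in> space M \<Longrightarrow> B 0 w = x"
    and B: "\<And>t. t \<ge> 0 \<Longrightarrow> B t \<in> borel_measurable M"
    and st: "0 \<le> s" "s \<le> t" and R: "finite R" "R \<subseteq> {0..s}"
  shows "(CLINT w|M. iexp (\<Sum>r\<in>R. a r \<bullet> B r w) * iexp (u \<bullet> (B t w - B s w))) =
      (CLINT w|M. iexp (\<Sum>r\<in>R. a r \<bullet> B r w)) * exp (- (complex_of_real ((t - s) * (u \<bullet> u) / 2)))"
proof (cases "s = t")
  case True then show ?thesis by simp
next
  case False
  with st have st': "s < t" by simp
  interpret prob_space M by fact
  define xs where "xs = sorted_list_of_set (insert 0 (insert s R))"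
  define n where "n = length xs - 1"
  \<comment> \<open>The list provides 0 = T 0 < ... < T n = s, and the default value beyond its end
    makes T (n + 1) = t.\<close>
  define T where "T = (\<lambda>i. if i < length xs then xs ! i else t)"
  have set: "set xs = insert 0 (insert s R)" unfolding xs_def by (rule set_sorted_list_of_set) (use R in simp)
  have sd: "sorted_wrt (<) xs" unfolding xs_def by (rule strict_sorted_list_of_set)
  have len: "length xs = Suc n" using set unfolding n_def by (cases xs) auto
  have mono: "T i < T j" if "i < j" "j \<le> n" for i j
    using sorted_wrt_nth_less[OF sd that(1)] that len by (auto simp: T_def)
  have mono': "T i \<le> T j \<longleftrightarrow> i \<le> j" if "i \<le> n" "j \<le> n" for i j
    using mono[of i j] mono[of j i] that by (metis linorder_not_le order_le_less order_less_irrefl)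
  have inset: "T i \<in> insert 0 (insert s R)" if "i \<le> n" for i
    using that len set nth_mem[of i xs] by (auto simp: T_def)
  have ex: "\<exists>i\<le>n. T i = r" if "r \<in> insert 0 (insert s R)" for r
    using that len unfolding set[symmetric] in_set_conv_nth by (auto simp: T_def less_Suc_eq_le)
  have bd: "0 \<le> T i" "T i \<le> s" if "i \<le> n" for i using inset[OF that] R st by auto
  have T0: "T 0 = 0"
  proof -
    obtain i where "i \<le> n" "T i = 0" using ex[of 0] by auto
    then show ?thesis using mono'[of 0 i] bd[of 0] by simp
  qed
  have Tn: "T n = s"
  proof -
    obtain i where "i \<le> n" "T i = s" using ex[of s] by auto
    then show ?thesis using mono'[of i n] bd[of n] by simp
  qed
  have TS: "T (Suc n) = t" using len by (simp add: T_def)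
  define D where "D = (\<lambda>i w. B (T (Suc i)) w - B (T i) w)"
  have indD: "indep_vars (\<lambda>_. borel) D {..<Suc n}"
    unfolding D_def
  proof (rule ind)
    show "\<forall>i<Suc n. T i \<le> T (Suc i)"
      using mono st' Tn TS by (metis Suc_leI lessI less_antisym order.strict_implies_order)
  qed (use T0 in simp)
  \<comment> \<open>Summation by parts: the increment from T j to T (j + 1) is contained in B r
    exactly when T (j + 1) <= r, so its coefficient collects those a r.\<close>
  define p where "p = (\<lambda>j. if j = n then u else (\<Sum>r\<in>{r\<in>R. T (Suc j) \<le> r}. a r))"
  have sumR: "(\<Sum>r\<in>R. a r \<bullet> B r w) = (\<Sum>r\<in>R. a r) \<bullet> x + (\<Sum>j<n. p j \<bullet> D j w)" if w: "w \<in> space M" for w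
  proof -
    have "a r \<bullet> B r w = a r \<bullet> x + (\<Sum>j<n. if T (Suc j) \<le> r then a r \<bullet> D j w else 0)" if r: "r \<in> R" for r
    proof -
      obtain k where k: "k \<le> n" "T k = r" using ex[of r] r by auto
      have "(\<Sum>j<k. D j w) = B (T k) w - B (T 0) w" unfolding D_def by (rule sum_lessThan_telescope)
      then have "B r w = x + (\<Sum>j<k. D j w)" using k T0 B0[OF w] by simp
      also have "(\<Sum>j<k. D j w) = (\<Sum>j<n. if T (Suc j) \<le> r then D j w else 0)"
        unfolding sum.If_cases[OF finite_lessThan] 
        using k mono'[of "Suc _" k] by (auto intro!: sum.cong simp: Suc_le_eq)
      finally have "a r \<bullet> B r w = a r \<bullet> x + a r \<bullet> (\<Sum>j<n. if T (Suc j) \<le> r then D j w else 0)"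
        by (simp add: inner_right_distrib)
      also have "a r \<bullet> (\<Sum>j<n. if T (Suc j) \<le> r then D j w else 0) = (\<Sum>j<n. if T (Suc j) \<le> r then a r \<bullet> D j w else 0)"
        unfolding inner_sum_right by (rule sum.cong) auto
      finally show ?thesis .
    qed
    then have "(\<Sum>r\<in>R. a r \<bullet> B r w) = (\<Sum>r\<in>R. a r \<bullet> x + (\<Sum>j<n. if T (Suc j) \<le> r then a r \<bullet> D j w else 0))"
      by (rule sum.cong[OF refl])
    also have "\<dots> = (\<Sum>r\<in>R. a r) \<bullet> x + (\<Sum>j<n. \<Sum>r\<in>R. if T (Suc j) \<le> r then a r \<bullet> D j w else 0)"
      by (simp add: sum.distrib inner_sum_left) (rule sum.swap)
    also have "(\<Sum>j<n. \<Sum>r\<in>R. if T (Suc j) \<le> r then a r \<bullet> D j w else 0) = (\<Sum>j<n. p j \<bullet> D j w)"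
    proof (rule sum.cong[OF refl])
      fix j assume "j \<in> {..<n}"
      then show "(\<Sum>r\<in>R. if T (Suc j) \<le> r then a r \<bullet> D j w else 0) = p j \<bullet> D j w"
        using R(1) by (auto simp: p_def inner_sum_left sum.inter_filter intro!: sum.cong)
    qed
    finally show ?thesis .
  qed
  define f where "f = (\<lambda>j w. iexp (p j \<bullet> D j w))"
  have "indep_vars (\<lambda>_. borel) (\<lambda>j. (\<lambda>y. iexp (p j \<bullet> y)) \<circ> D j) {..<Suc n}"
    by (rule indep_vars_compose[OF indD]) (auto intro!: borel_measurable_continuous_onI continuous_intros)
  then have indf: "indep_vars (\<lambda>_. borel) f {..<Suc n}" by (simp add: f_def comp_def)
  have fi: "integrable M (f j)" if "j \<in> {..<Suc n}" for j
    by (rule integrable_const_bound[where B=1]) (use indf that in \<open>auto simp: f_def indep_vars_def\<close>)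
  have prodE: "(CLINT w|M. (\<Prod>j<Suc n. f j w)) = (\<Prod>j<Suc n. CLINT w|M. f j w)"
    by (rule indep_vars_lebesgue_integral[OF _ indf fi]) auto
  have prodE': "(CLINT w|M. (\<Prod>j<n. f j w)) = (\<Prod>j<n. CLINT w|M. f j w)"
    by (rule indep_vars_lebesgue_integral[OF _ indep_vars_subset[OF indf] fi]) auto
  have last: "(CLINT w|M. f n w) = exp (- (complex_of_real ((t - s) * (u \<bullet> u) / 2)))"
  proof -
    have m: "(\<lambda>w. B t w - B s w) \<in> borel_measurable M" using B st by auto
    have "(CLINT w|M. f n w) = (CLINT y|distr M borel (\<lambda>w. B t w - B s w). iexp (u \<bullet> y))"
      by (subst integral_distr[OF m]) (auto simp: f_def D_def p_def Tn TS intro!: borel_measurable_continuous_onI continuous_intros)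
    also have "\<dots> = exp (- (complex_of_real ((t - s) * (u \<bullet> u) / 2)))"
      unfolding law[OF st(1) st'] using normal_pair_char[of "sqrt (t - s)" u] st' by simp
    finally show ?thesis .
  qed
  have e1: "iexp (\<Sum>r\<in>R. a r \<bullet> B r w) = iexp ((\<Sum>r\<in>R. a r) \<bullet> x) * (\<Prod>j<n. f j w)" if "w \<in> space M" for w
    unfolding sumR[OF that] f_def by (simp add: exp_add distrib_left exp_sum sum_distrib_left)
  have "(CLINT w|M. iexp (\<Sum>r\<in>R. a r \<bullet> B r w) * iexp (u \<bullet> (B t w - B s w))) =
     (CLINT w|M. iexp ((\<Sum>r\<in>R. a r) \<bullet> x) * (\<Prod>j<Suc n. f j w))"
  proof (rule Bochner_Integration.integral_cong[OF refl])
    fix w assume "w \<in> space M"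
    have "f n w = iexp (u \<bullet> (B t w - B s w))" by (simp add: f_def D_def p_def Tn TS)
    then show "iexp (\<Sum>r\<in>R. a r \<bullet> B r w) * iexp (u \<bullet> (B t w - B s w)) = iexp ((\<Sum>r\<in>R. a r) \<bullet> x) * (\<Prod>j<Suc n. f j w)"
      unfolding e1[OF \<open>w \<in> space M\<close>] prod.lessThan_Suc by (simp only: mult.assoc)
  qed
  also have "\<dots> = iexp ((\<Sum>r\<in>R. a r) \<bullet> x) * (CLINT w|M. (\<Prod>j<n. f j w)) * (CLINT w|M. f n w)"
    unfolding integral_mult_right_zero prodE prodE' by (simp only: prod.lessThan_Suc mult.assoc)
  also have "iexp ((\<Sum>r\<in>R. a r) \<bullet> x) * (CLINT w|M. (\<Prod>j<n. f j w)) = (CLINT w|M. iexp (\<Sum>r\<in>R. a r \<bullet> B r w))"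
    unfolding integral_mult_right_zero[symmetric] by (rule Bochner_Integration.integral_cong) (simp_all only: e1)
  finally show ?thesis unfolding last .
qed

lemma planar_BM_bm:
  assumes "planar_BM M B x"
  shows "bm M B"
proof (rule bmI)
  fix s t :: real and u R a assume "0 \<le> s" "s \<le> t" "finite R" "R \<subseteq> {0..s}"
  then show "(CLINT w|M. iexp (\<Sum>r\<in>R. a r \<bullet> B r w) * iexp (u \<bullet> (B t w - B s w))) =
      (CLINT w|M. iexp (\<Sum>r\<in>R. a r \<bullet> B r w)) * exp (- (complex_of_real ((t - s) * (u \<bullet> u) / 2)))"
    by (intro indep_increments_char[where x=x]) (use assms in \<open>simp_all add: planar_BM_def\<close>)
qed (use assms in \<open>simp_all add: planar_BM_def\<close>)

text \<open>Joint independence of several increments follows from the independence of each one from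
  its past, adding one increment at a time.\<close>

lemma bm_planar_BM:
  assumes bm: "bm M B" and B0: "\<And>w. w \<in> space M \<Longrightarrow> B 0 w = x"
  shows "planar_BM M B x"
  unfolding planar_BM_def
proof (intro conjI allI impI ballI)
  show M: "prob_space M" by (rule bm_prob[OF bm])
  interpret prob_space M by fact
  show "B t \<in> borel_measurable M" if "0 \<le> t" for t by (rule bm_measurable[OF bm that])
  show "B 0 w = x" "continuous_on {0..} (\<lambda>t. B t w)" if "w \<in> space M" for w
    using B0[OF that] bm_continuous[OF bm that] by auto
  show "distr M borel (\<lambda>w. B t w - B s w) = normal (sqrt (t - s)) \<Otimes>\<^sub>M normal (sqrt (t - s))" if "0 \<le> s \<and> s < t" for s t
    using bm_increment_law[OF bm] that by auto
  fix n :: nat and t :: "nat \<Rightarrow> real" assume t: "0 \<le> t 0 \<and> (\<forall>i<n. t i \<le> t (Suc i))"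
  define D where "D = (\<lambda>i w. B (t (Suc i)) w - B (t i) w)"
  have t0: "0 \<le> t i" if "i \<le> n" for i
    using that by (induction i) (use t in \<open>auto intro: order_trans\<close>)
  have tle: "t i \<le> t j" if "i \<le> j" "j \<le> n" for i j
    using that by (induction rule: dec_induct) (use t in \<open>auto intro: order_trans\<close>)
  have rv: "D i \<in> borel_measurable M" if "i < n" for i
    unfolding D_def using t0[of i] t0[of "Suc i"] that by (intro bm_increment_measurable[OF bm]) auto
  have "indep_vars (\<lambda>_. borel) D {..<n}"
  proof (cases "n = 0")
    case True then show ?thesis by (simp add: indep_vars_def indep_sets_def)
  next
    case False
    show ?thesis
    proof (subst indep_vars_finite[where E="\<lambda>_. sets borel"])
      show "\<forall>A\<in>{..<n} \<rightarrow> sets borel. prob (\<Inter>j\<in>{..<n}. D j -` A j \<inter> space M) = (\<Prod>j<n. prob (D j -` A j \<inter> space M))"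
      proof
        fix A :: "nat \<Rightarrow> (real \<times> real) set" assume A: "A \<in> {..<n} \<rightarrow> sets borel"
        \<comment> \<open>The induction also records that the event belongs to the past of t m,
          since independence of the next increment is available only for such events.\<close>
        have "{w\<in>space M. \<forall>j<m. D j w \<in> A j} \<in> sets (nat_filtration M B (t m)) \<and>
           prob {w\<in>space M. \<forall>j<m. D j w \<in> A j} = (\<Prod>j<m. prob (D j -` A j \<inter> space M))" if "m \<le> n" for m
          using that
        proof (induction m)
          case 0
          show ?case using sets.top[of "nat_filtration M B (t 0)"] by (simp add: prob_space)
        next
          case (Suc m)
          let ?S = "{w\<in>space M. \<forall>j<m. D j w \<in> A j}"
          have eq: "{w\<in>space M. \<forall>j<Suc m. D j w \<in> A j} = ?S \<inter> {w\<in>space M. B (t (Suc m)) w - B (t m) w \<in> A m}"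
            by (auto simp: less_Suc_eq D_def)
          have Am: "A m \<in> sets borel" using A Suc.prems by auto
          have m0: "0 \<le> t m" "t m \<le> t (Suc m)" "0 \<le> t (Suc m)" using Suc.prems t0 tle by auto
          have a1: "?S \<in> sets (nat_filtration M B (t (Suc m)))" 
            using Suc.IH Suc.prems nat_filtration_mono[OF m0(2), of M B] by (meson Suc_leD subsetD)
          have a2: "{w\<in>space M. B (t (Suc m)) w - B (t m) w \<in> A m} \<in> sets (nat_filtration M B (t (Suc m)))"
          proof -
            have "(\<lambda>w. B (t (Suc m)) w - B (t m) w) \<in> borel_measurable (nat_filtration M B (t (Suc m)))"
              using m0 by (intro borel_measurable_diff measurable_nat_filtration) auto
            from measurable_sets[OF this Am] show ?thesis by (simp add: vimage_def Int_def conj_commute)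
          qed
          have a3: "prob (?S \<inter> {w\<in>space M. B (t (Suc m)) w - B (t m) w \<in> A m}) = prob ?S * prob (D m -` A m \<inter> space M)"
          proof -
            have "prob (?S \<inter> {w\<in>space M. B (t (Suc m)) w - B (t m) w \<in> A m}) = prob ?S * prob {w\<in>space M. B (t (Suc m)) w - B (t m) w \<in> A m}"
              by (rule bm_increment_indep[OF bm m0(1,2) _ Am]) (use Suc.IH Suc.prems Suc_leD in blast)
            then show ?thesis by (simp add: D_def vimage_def Int_def conj_commute)
          qed
          have a4: "prob ?S = (\<Prod>j<m. prob (D j -` A j \<inter> space M))"
            using Suc.IH[OF Suc_leD[OF Suc.prems]] by (rule conjunct2)
          show ?case unfolding eq prod.lessThan_Suc a4[symmetric] a3 by (intro conjI sets.Int a1 a2 refl)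
        qed
        from this[of n, OF order_refl] have "prob {w\<in>space M. \<forall>j<n. D j w \<in> A j} = (\<Prod>j<n. prob (D j -` A j \<inter> space M))" 
          by (rule conjunct2)
        moreover have "{w\<in>space M. \<forall>j<n. D j w \<in> A j} = (\<Inter>j\<in>{..<n}. D j -` A j \<inter> space M)" using False by auto
        ultimately show "prob (\<Inter>j\<in>{..<n}. D j -` A j \<inter> space M) = (\<Prod>j<n. prob (D j -` A j \<inter> space M))" by (simp only:)
      qed
      show "sets borel = sigma_sets (space borel) (sets borel)" by (simp only: sets.sigma_sets_eq)
      show "Int_stable (sets borel)" by (rule sets.Int_stable)
    qed (use False rv in auto)
  qed
  then show "prob_space.indep_vars M (\<lambda>_. borel) (\<lambda>i w. B (t (Suc i)) w - B (t i) w) {..<n}" by (simp add: D_def)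
qed

section \<open>The construction of Brownian motion\<close>

definition gauss2 :: "(real \<times> real) measure" where
  "gauss2 = normal 1 \<Otimes>\<^sub>M normal 1"

lemma sets_gauss2[measurable_cong]: "sets gauss2 = sets borel"
  unfolding gauss2_def by (rule sets_normal_pair)

lemma prob_space_gauss2: "prob_space gauss2"
proof -
  interpret N: prob_space "normal 1" by (rule prob_space_normal_density) simp
  interpret NN: pair_prob_space "normal 1" "normal 1" ..
  show ?thesis unfolding gauss2_def by (rule NN.P.prob_space_axioms)
qed

lemma gauss2_char: "(CLINT y|gauss2. iexp (u \<bullet> y)) = exp (- complex_of_real (u \<bullet> u / 2))"
  unfolding gauss2_def using normal_pair_char[of 1 u] by simp

text \<open>The power 16 is chosen for the growth of the coefficients. It yields |x_e| = O((e +
  1)^(1/8)); on a bounded time interval level n uses indices e = O(4^n), so its coefficients are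
  O(2^(n/4)), which the factor 2^(-n/2) of the Schauder functions outweighs.\<close>

lemma gauss2_moment: "integrable gauss2 (\<lambda>x. norm x ^ 16)"
proof -
  interpret N: prob_space "normal 1" by (rule prob_space_normal_density) simp
  interpret NN: pair_prob_space "normal 1" "normal 1" ..
  have i: "integrable (normal 1) (\<lambda>x. \<bar>x\<bar> ^ 16)"
    using integrable_std_normal_moment_abs[of 16] by (subst integrable_density) auto
  have [measurable]: "(\<lambda>x. norm x ^ 16) \<in> borel_measurable (normal 1 \<Otimes>\<^sub>M normal 1 :: (real \<times> real) measure)"
    unfolding measurable_cong_sets[OF sets_normal_pair refl] by measurable
  have fst: "integrable (normal 1 \<Otimes>\<^sub>M normal 1) (\<lambda>x. \<bar>fst x :: real\<bar> ^ 16)"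
  proof (rule NN.Fubini_integrable)
    show "(\<lambda>x. \<bar>fst x :: real\<bar> ^ 16) \<in> borel_measurable (normal 1 \<Otimes>\<^sub>M normal 1)"
      unfolding measurable_cong_sets[OF sets_normal_pair refl]
      by (intro borel_measurable_continuous_onI continuous_intros)
  qed (use i in \<open>simp_all add: N.prob_space\<close>)
  have snd: "integrable (normal 1 \<Otimes>\<^sub>M normal 1) (\<lambda>x. \<bar>snd x :: real\<bar> ^ 16)"
  proof (rule NN.Fubini_integrable)
    show "(\<lambda>x. \<bar>snd x :: real\<bar> ^ 16) \<in> borel_measurable (normal 1 \<Otimes>\<^sub>M normal 1)"
      unfolding measurable_cong_sets[OF sets_normal_pair refl]
      by (intro borel_measurable_continuous_onI continuous_intros)
  qed (use i in \<open>simp_all add: N.prob_space\<close>)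
  show ?thesis unfolding gauss2_def
  proof (rule Bochner_Integration.integrable_bound)
    show "integrable (normal 1 \<Otimes>\<^sub>M normal 1) (\<lambda>x. 2 ^ 16 * (\<bar>fst x :: real\<bar> ^ 16 + \<bar>snd x :: real\<bar> ^ 16))"
      using fst snd by simp
    show "AE x in (normal 1 \<Otimes>\<^sub>M normal 1). norm (norm x ^ 16) \<le> norm (2 ^ 16 * (\<bar>fst x :: real\<bar> ^ 16 + \<bar>snd x :: real\<bar> ^ 16))"
    proof (rule AE_I2)
      fix x :: "real \<times> real"
      define m where "m = max \<bar>fst x\<bar> \<bar>snd x\<bar>"
      have "norm x \<le> \<bar>fst x\<bar> + \<bar>snd x\<bar>" using norm_Pair_le[of "fst x" "snd x"] by simp
      also have "\<dots> \<le> 2 * m" by (simp add: m_def)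
      finally have "norm x ^ 16 \<le> (2 * m) ^ 16" by (rule power_mono) simp
      also have "\<dots> = 2 ^ 16 * m ^ 16" by (rule power_mult_distrib)
      also have "m ^ 16 \<le> \<bar>fst x\<bar> ^ 16 + \<bar>snd x\<bar> ^ 16" by (auto simp: m_def max_def)
      finally show "norm (norm x ^ 16) \<le> norm (2 ^ 16 * (\<bar>fst x\<bar> ^ 16 + \<bar>snd x\<bar> ^ 16))" by simp
    qed
  qed simp
qed

text \<open>Indexing by reals, rather than by naturals, makes the sample points elements of
  \<open>path\<close>, the type required in \<open>Q\<close> and in the existence
  statements.\<close>

definition coord_measure :: "(real \<times> real) measure \<Rightarrow> (real \<Rightarrow> real \<times> real) measure" where
  "coord_measure \<mu> = PiM UNIV (\<lambda>i. if i = - 1 then \<mu> else gauss2)"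

context
  fixes \<mu> :: "(real \<times> real) measure"
  assumes \<mu>: "prob_space \<mu>" "sets \<mu> = sets borel"
begin

lemma coord_measure_factor_prob: "prob_space (if (i::real) = - 1 then \<mu> else gauss2)"
  using \<mu> prob_space_gauss2 by simp

lemma prob_space_coord_measure: "prob_space (coord_measure \<mu>)"
  unfolding coord_measure_def by (intro prob_space_PiM coord_measure_factor_prob)

lemma coord_measurable[measurable]: "(\<lambda>w. w i) \<in> borel_measurable (coord_measure \<mu>)"
proof -
  have "(\<lambda>w. w i) \<in> measurable (coord_measure \<mu>) (if i = - 1 then \<mu> else gauss2)"
    unfolding coord_measure_def by (rule measurable_component_singleton) simp
  moreover have "sets (if i = - 1 then \<mu> else gauss2) = sets borel" using \<mu> sets_gauss2 by simp
  ultimately show ?thesis using measurable_cong_sets[OF refl] by blast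
qed

lemma coord_distr: "distr (coord_measure \<mu>) borel (\<lambda>w. w i) = (if i = - 1 then \<mu> else gauss2)"
proof -
  interpret PP: product_prob_space "\<lambda>i. if i = - 1 then \<mu> else gauss2" "UNIV :: real set"
    by (intro product_prob_spaceI coord_measure_factor_prob)
  have "distr (coord_measure \<mu>) borel (\<lambda>w. w i) = distr (coord_measure \<mu>) (if i = - 1 then \<mu> else gauss2) (\<lambda>w. w i)"
    by (rule distr_cong[OF refl _ refl]) (simp add: \<mu> sets_gauss2)
  also have "\<dots> = (if i = - 1 then \<mu> else gauss2)"
    unfolding coord_measure_def by (rule PP.PiM_component) simp
  finally show ?thesis .
qed

lemma coord_indep: "prob_space.indep_vars (coord_measure \<mu>) (\<lambda>_. borel) (\<lambda>i w. w i) UNIV"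
proof -
  interpret P: prob_space "coord_measure \<mu>" by (rule prob_space_coord_measure)
  have "distr (coord_measure \<mu>) (PiM UNIV (\<lambda>_. borel)) (\<lambda>x. \<lambda>i\<in>UNIV. x i) = coord_measure \<mu>"
  proof -
    have "distr (coord_measure \<mu>) (PiM UNIV (\<lambda>_. borel)) (\<lambda>x. \<lambda>i\<in>UNIV. x i) = distr (coord_measure \<mu>) (coord_measure \<mu>) (\<lambda>x. x)"
    proof (rule distr_cong[OF refl])
      show "sets (PiM UNIV (\<lambda>_. borel)) = sets (coord_measure \<mu>)"
        unfolding coord_measure_def by (rule sets_PiM_cong[OF refl]) (simp add: \<mu> sets_gauss2)
    qed (auto simp: restrict_def)
    then show ?thesis by (simp add: distr_id)
  qed
  also have "coord_measure \<mu> = PiM UNIV (\<lambda>i. distr (coord_measure \<mu>) borel (\<lambda>w. w i))"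
    unfolding coord_distr by (simp add: coord_measure_def)
  finally show ?thesis
    by (subst P.indep_vars_iff_distr_eq_PiM') simp_all
qed

text \<open>By independence the Gaussian factor depends on the coefficients only through the sum of
  their squares. Hence that sum is all that must be followed when a linear combination is
  rewritten.\<close>

lemma coord_char:
  assumes g: "g \<in> borel_measurable borel" "\<And>x. norm (g x :: complex) \<le> 1"
    and I: "finite I" "- 1 \<notin> I"
  shows "(CLINT w|coord_measure \<mu>. g (w (- 1)) * iexp (\<Sum>i\<in>I. a i \<bullet> w i)) =
    (CLINT w|coord_measure \<mu>. g (w (- 1))) * exp (- complex_of_real ((\<Sum>i\<in>I. a i \<bullet> a i) / 2))"
proof -
  interpret P: prob_space "coord_measure \<mu>" by (rule prob_space_coord_measure)
  define f where "f = (\<lambda>i x. if i = - 1 then g x else iexp (a i \<bullet> x))"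
  have fm[measurable]: "f i \<in> borel_measurable borel" for i
    unfolding f_def using g(1) by (cases "i = -1") (auto intro!: borel_measurable_continuous_onI continuous_intros)
  have ind: "P.indep_vars (\<lambda>_. borel) (\<lambda>i w. f i (w i)) (insert (-1) I)"
    by (rule P.indep_vars_compose2[OF P.indep_vars_subset[OF coord_indep]]) auto
  have fb: "norm (f i x) \<le> 1" for i x using g(2) by (simp add: f_def)
  have int: "integrable (coord_measure \<mu>) (\<lambda>w. f i (w i))" for i
    by (rule P.integrable_const_bound[where B=1]) (use fb in auto)
  have prod: "(\<Prod>i\<in>insert (-1) I. f i (w i)) = g (w (-1)) * iexp (\<Sum>i\<in>I. a i \<bullet> w i)" for w
  proof -
    have "(\<Prod>i\<in>I. f i (w i)) = (\<Prod>i\<in>I. iexp (a i \<bullet> w i))"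
      by (rule prod.cong) (use I in \<open>auto simp: f_def\<close>)
    also have "\<dots> = iexp (\<Sum>i\<in>I. a i \<bullet> w i)"
      using I by (simp add: exp_sum sum_distrib_left)
    finally show ?thesis using I by (simp add: f_def)
  qed
  have "(CLINT w|coord_measure \<mu>. g (w (- 1)) * iexp (\<Sum>i\<in>I. a i \<bullet> w i)) = 
     (\<Prod>i\<in>insert (-1) I. CLINT w|coord_measure \<mu>. f i (w i))"
    unfolding prod[symmetric] by (rule P.indep_vars_lebesgue_integral[OF _ ind int]) (use I in auto)
  also have "\<dots> = (CLINT w|coord_measure \<mu>. g (w (- 1))) * (\<Prod>i\<in>I. exp (- complex_of_real (a i \<bullet> a i / 2)))"
  proof -
    have "(CLINT w|coord_measure \<mu>. f i (w i)) = exp (- complex_of_real (a i \<bullet> a i / 2))" if "i \<in> I" for i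
    proof -
      have i: "i \<noteq> -1" using that I by auto
      have "(CLINT w|coord_measure \<mu>. f i (w i)) = (CLINT x|distr (coord_measure \<mu>) borel (\<lambda>w. w i). f i x)"
        by (rule integral_distr[symmetric]) auto
      also have "\<dots> = (CLINT x|gauss2. iexp (a i \<bullet> x))" unfolding coord_distr using i by (simp add: f_def)
      finally show ?thesis unfolding gauss2_char .
    qed
    then show ?thesis using I by (simp add: f_def)
  qed
  also have "(\<Prod>i\<in>I. exp (- complex_of_real (a i \<bullet> a i / 2))) = exp (- complex_of_real ((\<Sum>i\<in>I. a i \<bullet> a i) / 2))"
  proof -
    have "- complex_of_real ((\<Sum>i\<in>I. a i \<bullet> a i) / 2) = (\<Sum>i\<in>I. - complex_of_real (a i \<bullet> a i / 2))"
      by (simp add: sum_negf sum_divide_distrib)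
    then show ?thesis by (simp only: exp_sum[OF I(1)])
  qed
  finally show ?thesis .
qed

text \<open>The expectations of |w e|^16 / (e + 1)^2 form a convergent series, so the random series
  converges almost surely and bounds each of its terms.\<close>

lemma coord_growth: "AE w in coord_measure \<mu>. \<exists>C. \<forall>e::nat. norm (w (real e)) ^ 16 \<le> C * (real e + 1)\<^sup>2"
proof -
  interpret P: prob_space "coord_measure \<mu>" by (rule prob_space_coord_measure)
  define K where "K = (LINT x|gauss2. norm x ^ 16)"
  have m: "(\<integral>\<^sup>+w. ennreal (norm (w (real e)) ^ 16 / (real e + 1)\<^sup>2) \<partial>coord_measure \<mu>) = ennreal (K * (1 / (real e + 1)\<^sup>2))" for e :: nat
  proof -
    have "(\<integral>\<^sup>+w. ennreal (norm (w (real e)) ^ 16 / (real e + 1)\<^sup>2) \<partial>coord_measure \<mu>) =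
      (\<integral>\<^sup>+x. ennreal (norm x ^ 16 / (real e + 1)\<^sup>2) \<partial>distr (coord_measure \<mu>) borel (\<lambda>w. w (real e)))"
      by (rule nn_integral_distr[symmetric]) auto
    also have "\<dots> = (\<integral>\<^sup>+x. ennreal (norm x ^ 16 / (real e + 1)\<^sup>2) \<partial>gauss2)"
      unfolding coord_distr by simp
    also have "\<dots> = ennreal (LINT x|gauss2. norm x ^ 16 / (real e + 1)\<^sup>2)"
      by (rule nn_integral_eq_integral) (use gauss2_moment in auto)
    finally show ?thesis by (simp add: K_def)
  qed
  have "summable (\<lambda>e. inverse ((real (Suc e))\<^sup>2))"
    by (subst summable_Suc_iff) (rule inverse_power_summable, simp)
  then have "summable (\<lambda>e. K * (1 / (real e + 1)\<^sup>2))"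
    by (intro summable_mult) (simp add: inverse_eq_divide add.commute)
  then have "(\<Sum>e. ennreal (K * (1 / (real e + 1)\<^sup>2))) < \<infinity>"
    by (simp add: K_def suminf_ennreal2 integral_nonneg_AE less_top[symmetric])
  then have "(\<integral>\<^sup>+w. (\<Sum>e. ennreal (norm (w (real e)) ^ 16 / (real e + 1)\<^sup>2)) \<partial>coord_measure \<mu>) < \<infinity>"
    by (subst nn_integral_suminf) (auto simp: m)
  then have "AE w in coord_measure \<mu>. (\<Sum>e. ennreal (norm (w (real e)) ^ 16 / (real e + 1)\<^sup>2)) \<noteq> \<infinity>"
    by (intro nn_integral_noteq_infinite) auto
  then show ?thesis
  proof eventually_elim
    case (elim w)
    define C where "C = enn2real (\<Sum>e. ennreal (norm (w (real e)) ^ 16 / (real e + 1)\<^sup>2))"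
    have C: "(\<Sum>e. ennreal (norm (w (real e)) ^ 16 / (real e + 1)\<^sup>2)) = ennreal C" "C \<ge> 0"
      using elim by (auto simp: C_def less_top)
    have "norm (w (real e)) ^ 16 \<le> C * (real e + 1)\<^sup>2" for e
    proof -
      have "(\<Sum>e\<in>{e}. ennreal (norm (w (real e)) ^ 16 / (real e + 1)\<^sup>2)) \<le> ennreal C"
        unfolding C(1)[symmetric] by (rule sum_le_suminf) (auto intro: summableI)
      then have "ennreal (norm (w (real e)) ^ 16 / (real e + 1)\<^sup>2) \<le> ennreal C" by simp
      then have "norm (w (real e)) ^ 16 / (real e + 1)\<^sup>2 \<le> C" by (simp only: ennreal_le_iff[OF C(2)])
      then show ?thesis by (simp add: divide_le_eq)
    qed
    then show ?case by blast
  qed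
qed

end

text \<open>The path is built from the values at the integers, interpolated linearly by \<open>ramp\<close>, and the
  Schauder functions obtained by scaling \<open>hat\<close>. The Gaussian coefficients are indexed by natural numbers
  through \<open>prod_encode\<close>; index \<open>-1\<close> carries the initial value.\<close>

definition ramp :: "real \<Rightarrow> real" where "ramp y = max 0 (min 1 y)"
definition hat :: "real \<Rightarrow> real" where "hat y = max 0 (1 / 2 - \<bar>y - 1 / 2\<bar>)"

text \<open>For f vanishing on the nonpositive axis this is the sum over all k, since the terms with
  k >= t are 0. The cut-off makes it a finite sum for each t.\<close>

definition shifts :: "(real \<Rightarrow> real) \<Rightarrow> (nat \<Rightarrow> real \<times> real) \<Rightarrow> real \<Rightarrow> real \<times> real" where
  "shifts f a t = (\<Sum>k<Suc (nat \<lfloor>t\<rfloor>). f (t - real k) *\<^sub>R a k)"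

lemma ramp_nonpos: "z \<le> 0 \<Longrightarrow> ramp z = 0" and hat_nonpos: "z \<le> 0 \<Longrightarrow> hat z = 0"
  by (auto simp: ramp_def hat_def)

lemma shifts_eq:
  assumes f: "\<And>z. z \<le> 0 \<Longrightarrow> f z = 0" and K: "t \<le> real K"
  shows "shifts f a t = (\<Sum>k<K. f (t - real k) *\<^sub>R a k)"
proof -
  let ?g = "\<lambda>k. f (t - real k) *\<^sub>R a k"
  have "shifts f a t = sum ?g {..<max K (Suc (nat \<lfloor>t\<rfloor>))}"
    unfolding shifts_def
  proof (rule sum.mono_neutral_left)
    show "\<forall>i\<in>{..<max K (Suc (nat \<lfloor>t\<rfloor>))} - {..<Suc (nat \<lfloor>t\<rfloor>)}. ?g i = 0"
    proof
      fix i assume "i \<in> {..<max K (Suc (nat \<lfloor>t\<rfloor>))} - {..<Suc (nat \<lfloor>t\<rfloor>)}"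
      then have "t - real i \<le> 0" by auto linarith
      then show "?g i = 0" using f by simp
    qed
  qed auto
  also have "\<dots> = sum ?g {..<K}"
  proof (rule sum.mono_neutral_right)
    show "\<forall>i\<in>{..<max K (Suc (nat \<lfloor>t\<rfloor>))} - {..<K}. ?g i = 0"
    proof
      fix i assume "i \<in> {..<max K (Suc (nat \<lfloor>t\<rfloor>))} - {..<K}"
      then have "t - real i \<le> 0" using K by auto
      then show "?g i = 0" using f by simp
    qed
  qed auto
  finally show ?thesis .
qed

lemma continuous_on_halfline:
  fixes f :: "real \<Rightarrow> 'b::topological_space"
  assumes "\<And>T. T > 0 \<Longrightarrow> continuous_on {0..T} f"
  shows "continuous_on {0..} f"
  unfolding continuous_on_eq_continuous_within
proof
  fix t :: real assume t: "t \<in> {0..}"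
  have "continuous (at t within {0..t+1}) f"
    using assms[of "t + 1"] t unfolding continuous_on_eq_continuous_within by auto
  moreover have "at t within {0..t+1} = at t within {0..}"
    by (rule at_within_nhd[of _ "{..<t+1}"]) auto
  ultimately show "continuous (at t within {0..}) f" by simp
qed

lemma shifts_continuous:
  assumes f: "\<And>z. z \<le> 0 \<Longrightarrow> f z = 0" and c: "continuous_on UNIV f"
  shows "continuous_on {0..} (shifts f a)"
proof (rule continuous_on_halfline)
  fix T :: real assume "T > 0"
  obtain K :: nat where K: "T \<le> real K" using real_arch_simple by blast
  have "continuous_on {0..T} (\<lambda>t. \<Sum>k<K. f (t - real k) *\<^sub>R a k)"
    by (intro continuous_intros continuous_on_compose2[OF c]) auto
  then show "continuous_on {0..T} (shifts f a)"
    by (rule continuous_on_eq) (use K in \<open>auto intro!: shifts_eq[symmetric] f\<close>)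
qed

lemma shifts_mid:
  assumes f: "\<And>z. z \<le> 0 \<Longrightarrow> f z = 0"
    and mid: "\<And>k. f ((t + s) / 2 - real k) = (f (t - real k) + f (s - real k)) / 2"
  shows "shifts f a ((t + s) / 2) = (1 / 2) *\<^sub>R (shifts f a t + shifts f a s)"
proof -
  obtain K :: nat where K: "\<bar>t\<bar> + \<bar>s\<bar> \<le> real K" using real_arch_simple by blast
  have *: "shifts f a r = (\<Sum>k<K. f (r - real k) *\<^sub>R a k)" if "r = t \<or> r = s \<or> r = (t + s) / 2" for r
    by (rule shifts_eq[OF f]) (use K that in auto)
  show ?thesis
    by (simp add: * mid sum.distrib[symmetric] scaleR_sum_right scaleR_add_left[symmetric])
qed

text \<open>Neighbouring grid points i/d and (i + 1)/d never have 0 or 1 strictly between them, so a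
  function with kinks at these places only is affine from one to the other.\<close>

lemma affine_disj:
  fixes i :: int
  assumes "d > (0::nat)"
  defines "p \<equiv> real_of_int i / real_of_int (int d)" and "q \<equiv> (real_of_int i + 1) / real_of_int (int d)"
  shows "q \<le> 0 \<or> p \<ge> 1 \<or> (p \<ge> 0 \<and> q \<le> 1)" and "p \<le> q"
proof -
  have "i \<le> -1 \<or> i \<ge> int d \<or> (0 \<le> i \<and> i + 1 \<le> int d)" by linarith
  then have "real_of_int i + 1 \<le> 0 \<or> real_of_int i \<ge> real d \<or> (0 \<le> real_of_int i \<and> real_of_int i + 1 \<le> real d)"
    by linarith
  then show "q \<le> 0 \<or> p \<ge> 1 \<or> (p \<ge> 0 \<and> q \<le> 1)" "p \<le> q"
    using assms(1) by (auto simp: p_def q_def field_simps)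
qed

lemma ramp_mid:
  assumes d: "d > (0::nat)"
  shows "ramp ((real j / d + real (Suc j) / d) / 2 - real k) = (ramp (real j / d - real k) + ramp (real (Suc j) / d - real k)) / 2"
proof -
  define i where "i = int j - int k * int d"
  define p q where "p = real_of_int i / real_of_int (int d)" and "q = (real_of_int i + 1) / real_of_int (int d)"
  have p: "real j / d - real k = p" and q: "real (Suc j) / d - real k = q"
    using d by (auto simp: p_def q_def i_def field_simps)
  have m: "(real j / d + real (Suc j) / d) / 2 - real k = (p + q) / 2" using p q by (simp add: field_simps)
  have "q \<le> 0 \<or> p \<ge> 1 \<or> (p \<ge> 0 \<and> q \<le> 1)" "p \<le> q"
    using affine_disj[OF d, of i] by (auto simp: p_def q_def)
  then show ?thesis unfolding m p q ramp_def by (auto simp: max_def min_def)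
qed

text \<open>\<open>hat\<close> has a third kink at 1/2, and the even denominator makes it a grid
  point. After doubling the arguments the kinks are 0, 1 and 2; they are covered by
  \<open>affine_disj\<close> for i and for i - d.\<close>

lemma hat_mid:
  assumes d: "d > (0::nat)"
  shows "hat ((real j / (2 * real d) + real (Suc j) / (2 * real d)) / 2 - real k) = (hat (real j / (2 * real d) - real k) + hat (real (Suc j) / (2 * real d) - real k)) / 2"
proof -
  define i where "i = int j - int k * (2 * int d)"
  define p q where "p = real_of_int i / real_of_int (int d)" and "q = (real_of_int i + 1) / real_of_int (int d)"
  have p: "real j / (2 * real d) - real k = p / 2" and q: "real (Suc j) / (2 * real d) - real k = q / 2"
    using d by (auto simp: p_def q_def i_def field_simps)
  have m: "(real j / (2 * real d) + real (Suc j) / (2 * real d)) / 2 - real k = (p + q) / 4"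
  proof -
    have "a - r = p / 2 \<Longrightarrow> b - r = q / 2 \<Longrightarrow> (a + b) / 2 - r = (p + q) / 4" for a b r :: real
      by (simp add: field_simps)
    then show ?thesis using p q .
  qed
  have a: "q \<le> 0 \<or> p \<ge> 1 \<or> (p \<ge> 0 \<and> q \<le> 1)" "p \<le> q"
    using affine_disj[OF d, of i] by (auto simp: p_def q_def)
  have p1: "p - 1 = real_of_int (i - int d) / real_of_int (int d)" and q1: "q - 1 = (real_of_int (i - int d) + 1) / real_of_int (int d)"
    using d by (auto simp: p_def q_def field_simps)
  have "q - 1 \<le> 0 \<or> p - 1 \<ge> 1 \<or> (p - 1 \<ge> 0 \<and> q - 1 \<le> 1)"
    using affine_disj[OF d, of "i - int d"] unfolding p1 q1 by auto
  with a show ?thesis unfolding m p q hat_def by (auto simp: max_def abs_if) (simp_all add: field_simps)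
qed

lemma shifts_hat_nat: "shifts hat a (real j) = 0"
proof -
  have "shifts hat a (real j) = (\<Sum>k<j. hat (real j - real k) *\<^sub>R a k)"
    by (rule shifts_eq) (auto simp: hat_nonpos)
  also have "\<dots> = 0"
  proof (rule sum.neutral, rule ballI)
    fix k assume "k \<in> {..<j}"
    then have "real k + 1 \<le> real j" by (simp add: Suc_le_eq[symmetric])
    then show "hat (real j - real k) *\<^sub>R a k = 0" by (simp add: hat_def)
  qed
  finally show ?thesis .
qed

lemma shifts_hat_single:
  assumes "t \<ge> 0"
  shows "shifts hat a t = hat (t - real (nat \<lfloor>t\<rfloor>)) *\<^sub>R a (nat \<lfloor>t\<rfloor>)"
proof -
  have "(\<Sum>k<nat \<lfloor>t\<rfloor>. hat (t - real k) *\<^sub>R a k) = 0"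
  proof (rule sum.neutral, rule ballI)
    fix k assume "k \<in> {..<nat \<lfloor>t\<rfloor>}"
    then have "int k + 1 \<le> \<lfloor>t\<rfloor>" by auto
    then have "real k + 1 \<le> t" by linarith
    then show "hat (t - real k) *\<^sub>R a k = 0" by (simp add: hat_def)
  qed
  then show ?thesis by (simp add: shifts_def)
qed

lemma shifts_hat_half: "shifts hat a (real j + 1 / 2) = (1 / 2) *\<^sub>R a j"
proof -
  have "nat \<lfloor>real j + 1 / 2\<rfloor> = j" by linarith
  then show ?thesis by (subst shifts_hat_single) (auto simp: hat_def)
qed

lemma shifts_hat_norm: "t \<ge> 0 \<Longrightarrow> norm (shifts hat a t) \<le> norm (a (nat \<lfloor>t\<rfloor>))"
proof -
  assume "t \<ge> 0"
  have "\<bar>hat y\<bar> * norm v \<le> 1 * norm v" for y and v :: "real \<times> real"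
    by (rule mult_right_mono) (auto simp: hat_def)
  then show ?thesis using \<open>t \<ge> 0\<close> by (simp add: shifts_hat_single)
qed

lemma shifts_ramp_nat: "shifts ramp a (real j) = (\<Sum>k<j. a k)"
proof -
  have "shifts ramp a (real j) = (\<Sum>k<j. ramp (real j - real k) *\<^sub>R a k)"
    by (rule shifts_eq) (auto simp: ramp_nonpos)
  also have "\<dots> = (\<Sum>k<j. a k)"
  proof (rule sum.cong[OF refl])
    fix k assume "k \<in> {..<j}"
    then have "real k + 1 \<le> real j" by (simp add: Suc_le_eq[symmetric])
    then show "ramp (real j - real k) *\<^sub>R a k = a k" by (simp add: ramp_def)
  qed
  finally show ?thesis .
qed

text \<open>The scaled hats are primitives of the Haar functions of unit norm supported on intervals
  of length 2^(-n), with peak 2^(-n/2) / 2. The index \<open>Suc n\<close> leaves level 0 to the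
  increments over integers.\<close>

definition levy_term :: "(nat \<Rightarrow> real \<times> real) \<Rightarrow> nat \<Rightarrow> real \<Rightarrow> real \<times> real" where
  "levy_term x n t = shifts hat (\<lambda>k. (2 powr (- (real n / 2))) *\<^sub>R x (prod_encode (Suc n, k))) (2 ^ n * t)"

definition levy_partial :: "(nat \<Rightarrow> real \<times> real) \<Rightarrow> nat \<Rightarrow> real \<Rightarrow> real \<times> real" where
  "levy_partial x N t = shifts ramp (\<lambda>k. x (prod_encode (0, k))) t + (\<Sum>n<N. levy_term x n t)"

definition levy :: "(nat \<Rightarrow> real \<times> real) \<Rightarrow> real \<Rightarrow> real \<times> real" where
  "levy x t = shifts ramp (\<lambda>k. x (prod_encode (0, k))) t + (\<Sum>n. levy_term x n t)"

text \<open>\<open>hat\<close> vanishes at integers. As a consequence the infinite series is a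
  finite sum at every dyadic time, and laws at such times are computed without limits.\<close>

lemma levy_term_dyadic:
  assumes "N \<le> n"
  shows "levy_term x n (real j / 2 ^ N) = 0"
proof -
  have "(2::real) ^ n * (real j / 2 ^ N) = real (2 ^ (n - N) * j)"
  proof -
    have "(2::real) ^ n = 2 ^ (n - N) * 2 ^ N" using assms by (simp add: power_add[symmetric])
    then show ?thesis by simp
  qed
  then show ?thesis unfolding levy_term_def by (simp only: shifts_hat_nat)
qed

lemma levy_dyadic: "levy x (real j / 2 ^ N) = levy_partial x N (real j / 2 ^ N)"
proof -
  have "(\<Sum>n. levy_term x n (real j / 2 ^ N)) = (\<Sum>n<N. levy_term x n (real j / 2 ^ N))"
    by (rule suminf_finite) (auto intro: levy_term_dyadic)
  then show ?thesis by (simp add: levy_def levy_partial_def)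
qed

lemma levy_partial_mid:
  "levy_partial x N ((real j / 2 ^ N + real (Suc j) / 2 ^ N) / 2) =
    (1 / 2) *\<^sub>R (levy_partial x N (real j / 2 ^ N) + levy_partial x N (real (Suc j) / 2 ^ N))"
proof -
  have 1: "shifts ramp a ((real j / 2 ^ N + real (Suc j) / 2 ^ N) / 2) = 
     (1 / 2) *\<^sub>R (shifts ramp a (real j / 2 ^ N) + shifts ramp a (real (Suc j) / 2 ^ N))" for a
    using ramp_mid[of "2 ^ N"] by (intro shifts_mid ramp_nonpos) auto
  have 2: "levy_term x n ((real j / 2 ^ N + real (Suc j) / 2 ^ N) / 2) = 
     (1 / 2) *\<^sub>R (levy_term x n (real j / 2 ^ N) + levy_term x n (real (Suc j) / 2 ^ N))" if "n < N" for n
  proof -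
    have "(2::real) ^ N = 2 ^ n * (2 * 2 ^ (N - Suc n))"
      using that by (metis Suc_leI power_Suc power_add le_add_diff_inverse add_Suc_shift add_Suc)
    then have e: "2 ^ n * (real i / 2 ^ N) = real i / (2 * real (2 ^ (N - Suc n)))" for i by simp
    have e2: "2 ^ n * ((real j / 2 ^ N + real (Suc j) / 2 ^ N) / 2) = (2 ^ n * (real j / 2 ^ N) + 2 ^ n * (real (Suc j) / 2 ^ N)) / 2"
      by (simp add: distrib_left)
    show ?thesis unfolding levy_term_def e2 e
      by (rule shifts_mid, erule hat_nonpos, rule hat_mid, simp)
  qed
  have "(\<Sum>n<N. levy_term x n ((real j / 2 ^ N + real (Suc j) / 2 ^ N) / 2)) = 
      (\<Sum>n<N. (1 / 2) *\<^sub>R (levy_term x n (real j / 2 ^ N) + levy_term x n (real (Suc j) / 2 ^ N)))"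
    by (rule sum.cong) (simp_all only: 2 lessThan_iff)
  then show ?thesis unfolding levy_partial_def 1
    by (simp only: scaleR_sum_right[symmetric] sum.distrib scaleR_right_distrib add_ac)
qed

text \<open>Midpoint refinement as for a Brownian bridge: the path of level N is linear between the
  two grid points, and the new Gaussian variable displaces its midpoint by \<xi>, with opposite
  effects on the two halves.\<close>

lemma levy_partial_halves:
  fixes x N j
  defines "D \<equiv> levy_partial x N (real (Suc j) / 2 ^ N) - levy_partial x N (real j / 2 ^ N)"
    and "\<xi> \<equiv> (2 powr (- (real N / 2)) / 2) *\<^sub>R x (prod_encode (Suc N, j))"
  shows "levy_partial x (Suc N) (real (Suc (2 * j)) / 2 ^ Suc N) - levy_partial x (Suc N) (real (2 * j) / 2 ^ Suc N) = (1 / 2) *\<^sub>R D + \<xi>"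
    and "levy_partial x (Suc N) (real (Suc (Suc (2 * j))) / 2 ^ Suc N) - levy_partial x (Suc N) (real (Suc (2 * j)) / 2 ^ Suc N) = (1 / 2) *\<^sub>R D - \<xi>"
proof -
  have e: "real (2 * j) / 2 ^ Suc N = real j / 2 ^ N" "real (Suc (Suc (2 * j))) / 2 ^ Suc N = real (Suc j) / 2 ^ N"
    "real (Suc (2 * j)) / 2 ^ Suc N = (real j / 2 ^ N + real (Suc j) / 2 ^ N) / 2"
    by (auto simp: field_simps)
  have h: "2 ^ N * ((real j / 2 ^ N + real (Suc j) / 2 ^ N) / 2) = real j + 1 / 2" by (simp add: field_simps)
  have l: "levy_term x N ((real j / 2 ^ N + real (Suc j) / 2 ^ N) / 2) = \<xi>"
    unfolding levy_term_def h shifts_hat_half \<xi>_def by simp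
  have S: "levy_partial x (Suc N) t = levy_partial x N t + levy_term x N t" for t by (simp add: levy_partial_def)
  show "levy_partial x (Suc N) (real (Suc (2 * j)) / 2 ^ Suc N) - levy_partial x (Suc N) (real (2 * j) / 2 ^ Suc N) = (1 / 2) *\<^sub>R D + \<xi>"
    unfolding e S l levy_partial_mid levy_term_dyadic[OF order_refl] D_def
    by (simp add: prod_eq_iff algebra_simps)
  show "levy_partial x (Suc N) (real (Suc (Suc (2 * j))) / 2 ^ Suc N) - levy_partial x (Suc N) (real (Suc (2 * j)) / 2 ^ Suc N) = (1 / 2) *\<^sub>R D - \<xi>"
    unfolding e S l levy_partial_mid levy_term_dyadic[OF order_refl] D_def
    by (simp add: prod_eq_iff algebra_simps)
qed

lemma sum_lessThan_double: "(\<Sum>j<2 * K. g j) = (\<Sum>k<K. g (2 * k) + g (Suc (2 * k)) :: 'a::comm_monoid_add)" for K :: nat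
  by (induction K) (auto simp: algebra_simps)

text \<open>In the induction, coefficients p and q on the two halves of an interval become (p + q)/2
  on the whole interval and c (p - q) on the new Gaussian variable. By the parallelogram identity
  and c c = 1/(4 2^N) the squares add up to (|p|^2 + |q|^2) / 2^(N + 1), the value for independent
  increments. Restricting the levels in I ensures that the new variables are fresh.\<close>

lemma levy_partial_linear:
  "\<exists>I a. finite I \<and> I \<subseteq> {e. fst (prod_decode e) \<le> N} \<and>
    (\<forall>x. (\<Sum>j<K. u j \<bullet> (levy_partial x N (real (Suc j) / 2 ^ N) - levy_partial x N (real j / 2 ^ N))) = (\<Sum>i\<in>I. a i \<bullet> x i)) \<and>
    (\<Sum>i\<in>I. a i \<bullet> a i) = (\<Sum>j<K. u j \<bullet> u j) / 2 ^ N"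
proof (induction N arbitrary: K u)
  case 0
  let ?e = "\<lambda>k. prod_encode (0, k)"
  have inj: "inj_on ?e {..<K}" by (auto simp: inj_on_def prod_encode_eq)
  show ?case
  proof (intro exI[of _ "?e ` {..<K}"] exI[of _ "\<lambda>i. u (snd (prod_decode i))"] conjI allI)
    fix x
    show "(\<Sum>j<K. u j \<bullet> (levy_partial x 0 (real (Suc j) / 2 ^ 0) - levy_partial x 0 (real j / 2 ^ 0))) = 
        (\<Sum>i\<in>?e ` {..<K}. u (snd (prod_decode i)) \<bullet> x i)"
      unfolding sum.reindex[OF inj] levy_partial_def power_0 div_by_1 shifts_ramp_nat by simp
  qed (auto simp: sum.reindex[OF inj])
next
  case (Suc N)
  \<comment> \<open>Padding with zeros embeds the K intervals of level N + 1 into the 2K halves of K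
    intervals of level N.\<close>
  define u' where "u' = (\<lambda>j. if j < K then u j else 0)"
  define v where "v = (\<lambda>k. (1 / 2) *\<^sub>R (u' (2 * k) + u' (Suc (2 * k))))"
  define c where "c = 2 powr (- (real N / 2)) / 2"
  define b where "b = (\<lambda>k. c *\<^sub>R (u' (2 * k) - u' (Suc (2 * k))))"
  have c2: "c * c = 1 / (4 * 2 ^ N)"
    unfolding c_def by (simp add: powr_add[symmetric] powr_minus powr_realpow inverse_eq_divide)
  obtain I a where IH: "finite I" "I \<subseteq> {e. fst (prod_decode e) \<le> N}"
    "\<And>x. (\<Sum>j<K. v j \<bullet> (levy_partial x N (real (Suc j) / 2 ^ N) - levy_partial x N (real j / 2 ^ N))) = (\<Sum>i\<in>I. a i \<bullet> x i)"
    "(\<Sum>i\<in>I. a i \<bullet> a i) = (\<Sum>j<K. v j \<bullet> v j) / 2 ^ N"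
    using Suc.IH[where K=K and u=v] by blast
  let ?e = "\<lambda>k. prod_encode (Suc N, k)"
  have inj: "inj_on ?e {..<K}" by (auto simp: inj_on_def prod_encode_eq)
  have disj: "I \<inter> ?e ` {..<K} = {}" using IH(2) by auto
  define a' where "a' = (\<lambda>i. if i \<in> I then a i else b (snd (prod_decode i)))"
  have a'I: "a' i = a i" if "i \<in> I" for i using that by (simp add: a'_def)
  have a'e: "a' (?e k) = b k" if "k < K" for k
    using disj that by (auto simp: a'_def)
  have split: "sum h (I \<union> ?e ` {..<K}) = sum h I + (\<Sum>k<K. h (?e k))" for h :: "nat \<Rightarrow> real"
    using IH(1) disj by (simp add: sum.union_disjoint sum.reindex[OF inj] comp_def)
  show ?case
  proof (intro exI[of _ "I \<union> ?e ` {..<K}"] exI[of _ a'] conjI allI)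
    show "finite (I \<union> ?e ` {..<K})" using IH(1) by simp
    show "I \<union> ?e ` {..<K} \<subseteq> {e. fst (prod_decode e) \<le> Suc N}" using IH(2) by auto
    have pad: "(\<Sum>j<K. h j (u j)) = (\<Sum>j<2 * K. h j (u' j))" if "\<And>j. h j 0 = 0" for h :: "nat \<Rightarrow> real \<times> real \<Rightarrow> real"
      by (rule sum.mono_neutral_cong_left) (auto simp: u'_def that)
    fix x
    let ?D = "\<lambda>j. levy_partial x (Suc N) (real (Suc j) / 2 ^ Suc N) - levy_partial x (Suc N) (real j / 2 ^ Suc N)"
    let ?L = "\<lambda>j. levy_partial x N (real (Suc j) / 2 ^ N) - levy_partial x N (real j / 2 ^ N)"
    have "(\<Sum>j<K. u j \<bullet> ?D j) = (\<Sum>j<2 * K. u' j \<bullet> ?D j)" by (rule pad) simp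
    also have "\<dots> = (\<Sum>k<K. u' (2 * k) \<bullet> ?D (2 * k) + u' (Suc (2 * k)) \<bullet> ?D (Suc (2 * k)))"
      by (rule sum_lessThan_double)
    also have "\<dots> = (\<Sum>k<K. v k \<bullet> ?L k + b k \<bullet> x (?e k))"
    proof (rule sum.cong[OF refl])
      fix k
      have gen: "p \<bullet> ((1 / 2) *\<^sub>R d + c *\<^sub>R y) + q \<bullet> ((1 / 2) *\<^sub>R d - c *\<^sub>R y) = ((1 / 2) *\<^sub>R (p + q)) \<bullet> d + (c *\<^sub>R (p - q)) \<bullet> y"
        for p q d y :: "real \<times> real"
        by (simp add: inner_diff_left inner_diff_right inner_add_left inner_add_right algebra_simps)
      have "?D (2 * k) = (1 / 2) *\<^sub>R ?L k + c *\<^sub>R x (?e k)" "?D (Suc (2 * k)) = (1 / 2) *\<^sub>R ?L k - c *\<^sub>R x (?e k)"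
        unfolding c_def by (rule levy_partial_halves)+
      then show "u' (2 * k) \<bullet> ?D (2 * k) + u' (Suc (2 * k)) \<bullet> ?D (Suc (2 * k)) = v k \<bullet> ?L k + b k \<bullet> x (?e k)"
        unfolding v_def b_def by (simp only: gen)
    qed
    also have "\<dots> = (\<Sum>i\<in>I \<union> ?e ` {..<K}. a' i \<bullet> x i)"
      unfolding split sum.distrib IH(3) by (simp add: a'I a'e)
    finally show "(\<Sum>j<K. u j \<bullet> ?D j) = (\<Sum>i\<in>I \<union> ?e ` {..<K}. a' i \<bullet> x i)" .
    have "(\<Sum>i\<in>I \<union> ?e ` {..<K}. a' i \<bullet> a' i) = (\<Sum>j<K. v j \<bullet> v j) / 2 ^ N + (\<Sum>k<K. b k \<bullet> b k)"
      unfolding split IH(4)[symmetric] by (simp add: a'I a'e)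
    also have "\<dots> = (\<Sum>k<K. (v k \<bullet> v k) / 2 ^ N + (c * c) * ((u' (2 * k) - u' (Suc (2 * k))) \<bullet> (u' (2 * k) - u' (Suc (2 * k)))))"
      by (simp add: b_def sum.distrib sum_divide_distrib mult.assoc)
    also have "\<dots> = (\<Sum>k<K. (u' (2 * k) \<bullet> u' (2 * k) + u' (Suc (2 * k)) \<bullet> u' (Suc (2 * k))) / 2 ^ Suc N)"
    proof (rule sum.cong[OF refl])
      fix k
      have par: "(p + q) \<bullet> (p + q) + (p - q) \<bullet> (p - q) = 2 * (p \<bullet> p + q \<bullet> q)" for p q :: "real \<times> real"
        by (simp add: inner_diff_left inner_diff_right inner_add_left inner_add_right)
      show "(v k \<bullet> v k) / 2 ^ N + (c * c) * ((u' (2 * k) - u' (Suc (2 * k))) \<bullet> (u' (2 * k) - u' (Suc (2 * k)))) = 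
        (u' (2 * k) \<bullet> u' (2 * k) + u' (Suc (2 * k)) \<bullet> u' (Suc (2 * k))) / 2 ^ Suc N"
      proof -
        have gen: "A + B = 2 * C \<Longrightarrow> A / 4 / 2 ^ N + 1 / (4 * 2 ^ N) * B = C / 2 ^ Suc N" for A B C :: real
          by (simp add: field_simps)
        have vv: "v k \<bullet> v k = ((u' (2 * k) + u' (Suc (2 * k))) \<bullet> (u' (2 * k) + u' (Suc (2 * k)))) / 4"
          by (simp add: v_def scaleR_add_right[symmetric] del: scaleR_add_right)
        show ?thesis unfolding c2 vv by (rule gen[OF par])
      qed
    qed
    also have "\<dots> = (\<Sum>j<2 * K. u' j \<bullet> u' j) / 2 ^ Suc N"
      unfolding sum_lessThan_double sum_divide_distrib ..
    also have "(\<Sum>j<2 * K. u' j \<bullet> u' j) = (\<Sum>j<K. u j \<bullet> u j)" by (rule pad[symmetric]) simp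
    finally show "(\<Sum>i\<in>I \<union> ?e ` {..<K}. a' i \<bullet> a' i) = (\<Sum>j<K. u j \<bullet> u j) / 2 ^ Suc N" .
  qed
qed

lemma prod_encode_le: "prod_encode (m, k) + 1 \<le> (m + k + 1)\<^sup>2"
proof -
  have "triangle (m + k) \<le> (m + k) * (m + k + 1)" unfolding triangle_def by simp
  then show ?thesis by (simp add: prod_encode_def power2_eq_square algebra_simps)
qed

text \<open>Up to time T the indices of level n are at most of order 4^n, so the growth hypothesis
  bounds the coefficients by a multiple of 2^(n/4), while the Schauder functions carry
  2^(-n/2).\<close>

lemma levy_term_bound:
  assumes C: "\<And>e::nat. norm (x e) ^ 16 \<le> C * (real e + 1)\<^sup>2" and T: "T > 0"
  shows "\<exists>D. \<forall>n t. 0 \<le> t \<and> t \<le> T \<longrightarrow> norm (levy_term x n t) \<le> D * (2 powr (- 1 / 4)) ^ n"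
proof (intro exI allI impI, elim conjE)
  fix n :: nat and t :: real assume t: "0 \<le> t" "t \<le> T"
  \<comment> \<open>D >= 1 gives D <= D^16, so that the 16th root can be taken with the same
    constant.\<close>
  define D where "D = max 1 (C * (T + 2) ^ 4)"
  have "0 \<le> norm (x 0) ^ 16" by simp
  also have "\<dots> \<le> C" using C[of 0] by simp
  finally have C0: "C \<ge> 0" .
  define k where "k = nat \<lfloor>2 ^ n * t\<rfloor>"
  have k: "real k \<le> 2 ^ n * T"
  proof -
    have "real k \<le> 2 ^ n * t" using t by (simp add: k_def)
    also have "\<dots> \<le> 2 ^ n * T" using t by (intro mult_left_mono) auto
    finally show ?thesis .
  qed
  have n2: "real n + 2 \<le> 2 ^ n * 2" 
    by (induction n) auto
  let ?e = "prod_encode (Suc n, k)"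
  have "real ?e + 1 \<le> (real (Suc n + k + 1))\<^sup>2"
    using prod_encode_le[of "Suc n" k] by (metis of_nat_1 of_nat_add of_nat_le_iff of_nat_power)
  also have "\<dots> \<le> (2 ^ n * (T + 2))\<^sup>2"
    by (rule power_mono) (use k n2 in \<open>auto simp: algebra_simps\<close>)
  finally have e: "real ?e + 1 \<le> (2 ^ n * (T + 2))\<^sup>2" .
  have "norm (x ?e) ^ 16 \<le> C * (real ?e + 1)\<^sup>2" by (rule C)
  also have "\<dots> \<le> C * ((2 ^ n * (T + 2))\<^sup>2)\<^sup>2"
    by (intro mult_left_mono power_mono e C0) auto
  also have "\<dots> = C * (T + 2) ^ 4 * (2 ^ n) ^ 4" by (simp add: power_mult_distrib)
  also have "\<dots> \<le> D * (2 ^ n) ^ 4" by (intro mult_right_mono) (auto simp: D_def)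
  also have "\<dots> \<le> D ^ 16 * (2 ^ n) ^ 4"
    by (intro mult_right_mono self_le_power) (auto simp: D_def)
  also have "((2::real) ^ n) ^ 4 = (2 powr (real n / 4)) ^ 16"
    by (simp add: powr_realpow[symmetric] powr_powr mult.commute)
  also have "D ^ 16 * (2 powr (real n / 4)) ^ 16 = (D * 2 powr (real n / 4)) ^ 16" by (simp add: power_mult_distrib)
  \<comment> \<open>The rule for taking roots is stated for an exponent \<open>Suc n\<close>, hence
    the 15.\<close>
  finally have nx: "norm (x ?e) \<le> D * 2 powr (real n / 4)"
    by (rule power_le_imp_le_base[of _ 15, unfolded Suc_numeral, simplified]) (auto simp: D_def)
  have "norm (levy_term x n t) \<le> norm ((2 powr (- (real n / 2))) *\<^sub>R x ?e)"
    unfolding levy_term_def k_def using t by (intro order_trans[OF shifts_hat_norm]) auto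
  also have "\<dots> = 2 powr (- (real n / 2)) * norm (x ?e)" by simp
  also have "\<dots> \<le> 2 powr (- (real n / 2)) * (D * 2 powr (real n / 4))" by (intro mult_left_mono nx) auto
  also have "\<dots> = D * 2 powr (- (real n / 2) + real n / 4)" by (simp only: powr_add mult_ac)
  also have "- (real n / 2) + real n / 4 = real n * (- 1 / 4)" by simp
  also have "2 powr (real n * (- 1 / 4)) = (2 powr (- 1 / 4)) ^ n"
    by (simp add: powr_realpow[symmetric] powr_powr mult.commute)
  finally show "norm (levy_term x n t) \<le> max 1 (C * (T + 2) ^ 4) * (2 powr (- 1 / 4)) ^ n" unfolding D_def .
qed

lemma levy_continuous:
  assumes C: "\<And>e::nat. norm (x e) ^ 16 \<le> C * (real e + 1)\<^sup>2"
  shows "continuous_on {0..} (levy x)"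
  unfolding levy_def
proof (intro continuous_on_add shifts_continuous ramp_nonpos)
  show "continuous_on UNIV ramp" unfolding ramp_def by (intro continuous_intros)
  show "continuous_on {0..} (\<lambda>t. \<Sum>n. levy_term x n t)"
  proof (rule continuous_on_halfline)
    fix T :: real assume T: "T > 0"
    obtain D where D: "\<And>n t. 0 \<le> t \<Longrightarrow> t \<le> T \<Longrightarrow> norm (levy_term x n t) \<le> D * (2 powr (- 1 / 4)) ^ n"
      using levy_term_bound[OF C T] by blast
    have "uniform_limit {0..T} (\<lambda>N t. \<Sum>n<N. levy_term x n t) (\<lambda>t. \<Sum>n. levy_term x n t) sequentially"
    proof (rule Weierstrass_m_test)
      have "(2::real) powr (- 1 / 4) < 2 powr 0" by (rule powr_less_mono) auto
      then show "summable (\<lambda>n. D * (2 powr (- 1 / 4)) ^ n)" by (intro summable_mult summable_geometric) auto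
    qed (use D in auto)
    moreover have "continuous_on {0..T} (\<lambda>t. \<Sum>n<N. levy_term x n t)" for N
    proof (rule continuous_on_sum)
      fix n
      have "continuous_on UNIV hat" unfolding hat_def by (intro continuous_intros)
      then show "continuous_on {0..T} (\<lambda>t. levy_term x n t)" unfolding levy_term_def
        by (intro continuous_on_compose2[OF shifts_continuous[OF hat_nonpos]] continuous_intros) auto
    qed
    ultimately show "continuous_on {0..T} (\<lambda>t. \<Sum>n. levy_term x n t)"
      by (intro uniform_limit_theorem[OF always_eventually]) auto
  qed
qed

lemma levy_0: "levy x 0 = 0"
  using levy_dyadic[of x 0 0] shifts_ramp_nat[of _ 0] by (simp add: levy_partial_def)

section \<open>The Brownian path on the coordinate space and its law\<close>

context
  fixes \<mu> :: "(real \<times> real) measure"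
  assumes \<mu>: "prob_space \<mu>" "sets \<mu> = sets borel"
begin

text \<open>A natural bound C makes this a countable union of countable intersections, hence an
  event. Off it the series may diverge; there \<open>BM\<close> stays at its initial value, so that
  every path is continuous.\<close>

definition growth_set :: "path set" where
  "growth_set = {w. \<exists>C::nat. \<forall>e::nat. norm (w (real e)) ^ 16 \<le> real C * (real e + 1)\<^sup>2}"

definition BM :: "real \<Rightarrow> path \<Rightarrow> real \<times> real" where
  "BM t w = w (- 1) + (if w \<in> growth_set then levy (\<lambda>e. w (real e)) t else 0)"

lemma space_coord_measure: "space (coord_measure \<mu>) = UNIV"
proof -
  have "space (if i = - 1 then \<mu> else gauss2) = UNIV" for i :: real
    using sets_eq_imp_space_eq[OF \<mu>(2)] sets_eq_imp_space_eq[OF sets_gauss2] by simp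
  then show ?thesis unfolding coord_measure_def by (auto simp: space_PiM)
qed

lemma growth_set_measurable: "growth_set \<in> sets (coord_measure \<mu>)"
proof -
  note [measurable] = coord_measurable[OF \<mu>]
  have "{w\<in>space (coord_measure \<mu>). \<exists>C::nat. \<forall>e::nat. norm (w (real e)) ^ 16 \<le> real C * (real e + 1)\<^sup>2} \<in> sets (coord_measure \<mu>)"
    by measurable
  then show ?thesis by (simp add: growth_set_def space_coord_measure)
qed

lemma AE_growth_set: "AE w in coord_measure \<mu>. w \<in> growth_set"
  using coord_growth[OF \<mu>]
proof eventually_elim
  case (elim w)
  then obtain C where C: "\<And>e::nat. norm (w (real e)) ^ 16 \<le> C * (real e + 1)\<^sup>2" by blast
  obtain n :: nat where n: "C \<le> real n" using real_arch_simple by blast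
  have "norm (w (real e)) ^ 16 \<le> real n * (real e + 1)\<^sup>2" for e
    by (rule order_trans[OF C]) (intro mult_right_mono n, simp)
  then show ?case unfolding growth_set_def by blast
qed

lemma shifts_measurable:
  assumes "\<And>k. (\<lambda>w. a w k) \<in> borel_measurable M"
  shows "(\<lambda>w. shifts f (a w) t) \<in> borel_measurable M"
  unfolding shifts_def using assms by measurable

lemma BM_measurable: "BM t \<in> borel_measurable (coord_measure \<mu>)"
proof -
  note [measurable] = coord_measurable[OF \<mu>] growth_set_measurable
  have [measurable]: "(\<lambda>w. shifts ramp (\<lambda>k. w (real (prod_encode (0, k)))) t) \<in> borel_measurable (coord_measure \<mu>)"
    by (rule shifts_measurable) measurable
  have [measurable]: "(\<lambda>w. levy_term (\<lambda>e. w (real e)) n t) \<in> borel_measurable (coord_measure \<mu>)" for n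
    unfolding levy_term_def by (rule shifts_measurable) measurable
  have [measurable]: "(\<lambda>w. levy (\<lambda>e. w (real e)) t) \<in> borel_measurable (coord_measure \<mu>)"
  proof -
    have fst: "(\<lambda>w. \<Sum>n. levy_term (\<lambda>e. w (real e)) n t) \<in> borel_measurable (coord_measure \<mu>)"
      unfolding suminf_eq_lim by (rule borel_measurable_lim_metric) measurable
    then show ?thesis unfolding levy_def by measurable
  qed
  show ?thesis unfolding BM_def[abs_def] by measurable
qed

lemma BM_continuous: "continuous_on {0..} (\<lambda>t. BM t w)"
proof (cases "w \<in> growth_set")
  case True
  then obtain C :: nat where "\<And>e::nat. norm (w (real e)) ^ 16 \<le> real C * (real e + 1)\<^sup>2"
    unfolding growth_set_def by blast
  from levy_continuous[OF this] True show ?thesis by (auto simp: BM_def intro!: continuous_intros)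
qed (simp add: BM_def)

lemma BM_0: "BM 0 w = w (- 1)"
  by (simp add: BM_def levy_0)

definition dyd :: "nat \<Rightarrow> real \<Rightarrow> nat" where "dyd N t = nat \<lfloor>2 ^ N * t\<rfloor>"

lemma dyd_mono: "s \<le> t \<Longrightarrow> dyd N s \<le> dyd N t"
  unfolding dyd_def by (intro nat_mono floor_mono mult_left_mono) auto

lemma dyd_tendsto:
  assumes "t \<ge> 0"
  shows "(\<lambda>N. real (dyd N t) / 2 ^ N) \<longlonglongrightarrow> t"
proof (rule tendsto_sandwich[where f="\<lambda>N. t - (1 / 2) ^ N" and h="\<lambda>_. t"])
  have "real (dyd N t) \<le> 2 ^ N * t" "2 ^ N * t - 1 \<le> real (dyd N t)" for N
    using assms by (auto simp: dyd_def)
  note bd = this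
  have "t - (1 / 2) ^ N = (2 ^ N * t - 1) / 2 ^ N" for N by (simp add: power_one_over diff_divide_distrib)
  then have "t - (1 / 2) ^ N \<le> real (dyd N t) / 2 ^ N" for N
    using divide_right_mono[OF bd(2), of "2 ^ N" N] by simp
  then show "\<forall>\<^sub>F N in sequentially. t - (1 / 2) ^ N \<le> real (dyd N t) / 2 ^ N"
    by (intro always_eventually allI)
  show "\<forall>\<^sub>F N in sequentially. real (dyd N t) / 2 ^ N \<le> t"
    using bd(1) by (intro always_eventually allI) (simp add: divide_le_eq mult.commute)
  have "(\<lambda>N. t - (1 / 2 :: real) ^ N) \<longlonglongrightarrow> t - 0"
    by (intro tendsto_diff tendsto_const LIMSEQ_power_zero) simp
  then show "(\<lambda>N. t - (1 / 2) ^ N) \<longlonglongrightarrow> t" by simp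
qed simp

text \<open>Characteristic functional at dyadic times: an increment after time \<open>b / 2 ^ N\<close> contributes
  an independent Gaussian factor.\<close>

lemma BM_dyadic_char:
  "(CLINT w|coord_measure \<mu>. iexp (v \<bullet> w (- 1) + (\<Sum>j<K. p j \<bullet> (BM (real (Suc j) / 2 ^ N) w - BM (real j / 2 ^ N) w)))) =
    (CLINT w|coord_measure \<mu>. iexp (v \<bullet> w (- 1))) * exp (- complex_of_real ((\<Sum>j<K. p j \<bullet> p j) / 2 ^ N / 2))"
proof -
  obtain I a where Ia: "finite I" 
    "\<And>x. (\<Sum>j<K. p j \<bullet> (levy_partial x N (real (Suc j) / 2 ^ N) - levy_partial x N (real j / 2 ^ N))) = (\<Sum>i\<in>I. a i \<bullet> x i)"
    "(\<Sum>i\<in>I. a i \<bullet> a i) = (\<Sum>j<K. p j \<bullet> p j) / 2 ^ N"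
    using levy_partial_linear[where N=N and K=K and u=p] by blast
  \<comment> \<open>The Gaussian variables sit at real indices, so the coefficients are transported
    from the naturals.\<close>
  define a' where "a' = (\<lambda>r::real. a (nat \<lfloor>r\<rfloor>))"
  have inj: "inj_on real I" by (auto simp: inj_on_def)
  have g: "(\<lambda>x. iexp (v \<bullet> x)) \<in> borel_measurable borel" by (intro borel_measurable_continuous_onI continuous_intros)
  have "(CLINT w|coord_measure \<mu>. iexp (v \<bullet> w (- 1) + (\<Sum>j<K. p j \<bullet> (BM (real (Suc j) / 2 ^ N) w - BM (real j / 2 ^ N) w)))) =
     (CLINT w|coord_measure \<mu>. iexp (v \<bullet> w (- 1)) * iexp (\<Sum>i\<in>real ` I. a' i \<bullet> w i))"
  proof (rule integral_cong_AE)
    note [measurable] = coord_measurable[OF \<mu>] BM_measurable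
    show "(\<lambda>w. iexp (v \<bullet> w (- 1) + (\<Sum>j<K. p j \<bullet> (BM (real (Suc j) / 2 ^ N) w - BM (real j / 2 ^ N) w)))) \<in> borel_measurable (coord_measure \<mu>)"
      by measurable
    show "(\<lambda>w. iexp (v \<bullet> w (- 1)) * iexp (\<Sum>i\<in>real ` I. a' i \<bullet> w i)) \<in> borel_measurable (coord_measure \<mu>)"
      by measurable
    show "AE w in coord_measure \<mu>. iexp (v \<bullet> w (- 1) + (\<Sum>j<K. p j \<bullet> (BM (real (Suc j) / 2 ^ N) w - BM (real j / 2 ^ N) w))) =
      iexp (v \<bullet> w (- 1)) * iexp (\<Sum>i\<in>real ` I. a' i \<bullet> w i)"
      using AE_growth_set
    proof eventually_elim
      case (elim w)
      let ?x = "\<lambda>e::nat. w (real e)"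
      have "(\<Sum>j<K. p j \<bullet> (BM (real (Suc j) / 2 ^ N) w - BM (real j / 2 ^ N) w)) =
         (\<Sum>j<K. p j \<bullet> (levy_partial ?x N (real (Suc j) / 2 ^ N) - levy_partial ?x N (real j / 2 ^ N)))"
        by (rule sum.cong[OF refl]) (simp only: BM_def elim if_True levy_dyadic add_diff_cancel_left)
      also have "\<dots> = (\<Sum>i\<in>real ` I. a' i \<bullet> w i)"
        unfolding Ia(2) sum.reindex[OF inj] by (simp add: a'_def)
      finally show ?case by (simp only: of_real_add distrib_left exp_add)
    qed
  qed
  also have "\<dots> = (CLINT w|coord_measure \<mu>. iexp (v \<bullet> w (- 1))) * exp (- complex_of_real ((\<Sum>i\<in>real ` I. a' i \<bullet> a' i) / 2))"
    by (rule coord_char[OF \<mu> g]) (use Ia(1) in auto)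
  also have "(\<Sum>i\<in>real ` I. a' i \<bullet> a' i) = (\<Sum>j<K. p j \<bullet> p j) / 2 ^ N"
    unfolding Ia(3)[symmetric] sum.reindex[OF inj] by (simp add: a'_def)
  finally show ?thesis .
qed

text \<open>Summation by parts: for j < b the j-th dyadic increment carries the coefficients of all
  later times, for b <= j < b' it carries u. The exponent in \<open>BM_dyadic_char\<close> is a sum
  over j, so the part beyond b splits off as a factor.\<close>

lemma BM_dyadic_increment:
  fixes N :: nat
  assumes R: "finite R" "\<And>r. r \<in> R \<Longrightarrow> d r \<le> b" and bb: "b \<le> b'"
  defines "B \<equiv> \<lambda>k. BM (real k / 2 ^ N)"
  shows "(CLINT w|coord_measure \<mu>. iexp (\<Sum>r\<in>R. c r \<bullet> B (d r) w) * iexp (u \<bullet> (B b' w - B b w))) =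
    (CLINT w|coord_measure \<mu>. iexp (\<Sum>r\<in>R. c r \<bullet> B (d r) w)) * exp (- complex_of_real ((real b' / 2 ^ N - real b / 2 ^ N) * (u \<bullet> u) / 2))"
proof -
  define D where "D = (\<lambda>j w. BM (real (Suc j) / 2 ^ N) w - BM (real j / 2 ^ N) w)"
  define p where "p = (\<lambda>j. \<Sum>r\<in>{r\<in>R. j < d r}. c r)"
  define q where "q = (\<lambda>j. if j < b then p j else u)"
  let ?v = "\<Sum>r\<in>R. c r"
  have tel: "B k w = w (- 1) + (\<Sum>j<k. D j w)" for k w
    using sum_lessThan_telescope[of "\<lambda>j. BM (real j / 2 ^ N) w" k] by (simp add: D_def B_def BM_0)
  have e1: "(\<Sum>r\<in>R. c r \<bullet> B (d r) w) = ?v \<bullet> w (- 1) + (\<Sum>j<b. p j \<bullet> D j w)" for w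
  proof -
    have "c r \<bullet> (\<Sum>j<d r. D j w) = (\<Sum>j<b. if j < d r then c r \<bullet> D j w else 0)" if "r \<in> R" for r
      unfolding inner_sum_right by (rule sum.mono_neutral_cong_left) (use R(2)[OF that] in auto)
    then have "(\<Sum>r\<in>R. c r \<bullet> B (d r) w) = (\<Sum>r\<in>R. c r \<bullet> w (- 1) + (\<Sum>j<b. if j < d r then c r \<bullet> D j w else 0))"
      by (intro sum.cong refl) (simp add: tel inner_add_right)
    also have "\<dots> = ?v \<bullet> w (- 1) + (\<Sum>j<b. \<Sum>r\<in>R. if j < d r then c r \<bullet> D j w else 0)"
      unfolding sum.distrib inner_sum_left by (subst sum.swap) simp
    also have "(\<Sum>j<b. \<Sum>r\<in>R. if j < d r then c r \<bullet> D j w else 0) = (\<Sum>j<b. p j \<bullet> D j w)"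
      by (rule sum.cong[OF refl]) (auto simp: p_def inner_sum_left sum.inter_filter R(1) intro!: sum.cong)
    finally show ?thesis .
  qed
  have e2: "u \<bullet> (B b' w - B b w) = (\<Sum>j\<in>{b..<b'}. u \<bullet> D j w)" for w
  proof -
    have "(\<Sum>j<b'. D j w) = (\<Sum>j<b. D j w) + (\<Sum>j\<in>{b..<b'}. D j w)"
      using sum.atLeastLessThan_concat[of 0 b b' "\<lambda>j. D j w"] bb by (simp add: atLeast0LessThan)
    then show ?thesis unfolding tel by (simp add: inner_sum_right)
  qed
  have split: "(\<Sum>j<b'. h j (q j)) = (\<Sum>j<b. h j (p j)) + (\<Sum>j\<in>{b..<b'}. h j u)" for h :: "nat \<Rightarrow> real \<times> real \<Rightarrow> real"
  proof -
    have "(\<Sum>j<b'. h j (q j)) = (\<Sum>j<b. h j (q j)) + (\<Sum>j\<in>{b..<b'}. h j (q j))"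
      using sum.atLeastLessThan_concat[of 0 b b' "\<lambda>j. h j (q j)"] bb by (simp add: atLeast0LessThan)
    then show ?thesis by (simp add: q_def)
  qed
  have "(CLINT w|coord_measure \<mu>. iexp (\<Sum>r\<in>R. c r \<bullet> B (d r) w) * iexp (u \<bullet> (B b' w - B b w))) =
     (CLINT w|coord_measure \<mu>. iexp (?v \<bullet> w (- 1) + (\<Sum>j<b'. q j \<bullet> D j w)))"
    unfolding e1 e2 split[where h="\<lambda>j y. y \<bullet> D j _"] by (simp only: exp_add[symmetric] distrib_left[symmetric] of_real_add[symmetric] add.assoc)
  also have "\<dots> = (CLINT w|coord_measure \<mu>. iexp (?v \<bullet> w (- 1))) * exp (- complex_of_real ((\<Sum>j<b'. q j \<bullet> q j) / 2 ^ N / 2))"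
    unfolding D_def by (rule BM_dyadic_char)
  also have "(\<Sum>j<b'. q j \<bullet> q j) / 2 ^ N / 2 = (\<Sum>j<b. p j \<bullet> p j) / 2 ^ N / 2 + (real b' / 2 ^ N - real b / 2 ^ N) * (u \<bullet> u) / 2"
    unfolding split[where h="\<lambda>j y. y \<bullet> y"] using bb by (simp add: field_simps of_nat_diff)
  also have "exp (- complex_of_real ((\<Sum>j<b. p j \<bullet> p j) / 2 ^ N / 2 + (real b' / 2 ^ N - real b / 2 ^ N) * (u \<bullet> u) / 2)) = 
     exp (- complex_of_real ((\<Sum>j<b. p j \<bullet> p j) / 2 ^ N / 2)) * exp (- complex_of_real ((real b' / 2 ^ N - real b / 2 ^ N) * (u \<bullet> u) / 2))"
    by (simp only: of_real_add minus_add_distrib exp_add)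
  also have "(CLINT w|coord_measure \<mu>. iexp (?v \<bullet> w (- 1))) * (exp (- complex_of_real ((\<Sum>j<b. p j \<bullet> p j) / 2 ^ N / 2)) * exp (- complex_of_real ((real b' / 2 ^ N - real b / 2 ^ N) * (u \<bullet> u) / 2))) =
     (CLINT w|coord_measure \<mu>. iexp (?v \<bullet> w (- 1) + (\<Sum>j<b. p j \<bullet> D j w))) * exp (- complex_of_real ((real b' / 2 ^ N - real b / 2 ^ N) * (u \<bullet> u) / 2))"
    unfolding D_def BM_dyadic_char by (simp only: mult.assoc)
  finally show ?thesis unfolding e1 .
qed

text \<open>Rounding times down to the grid keeps their order, so the dyadic identity holds for the
  rounded times; continuity of the paths and dominated convergence give the limit.\<close>

lemma bm_BM: "bm (coord_measure \<mu>) BM"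
proof (rule bmI)
  show "prob_space (coord_measure \<mu>)" by (rule prob_space_coord_measure[OF \<mu>])
  then interpret P: prob_space "coord_measure \<mu>" .
  show "BM t \<in> borel_measurable (coord_measure \<mu>)" for t by (rule BM_measurable)
  show "continuous_on {0..} (\<lambda>t. BM t w)" for w by (rule BM_continuous)
  note [measurable] = BM_measurable
  fix s t :: real and u :: "real \<times> real" and R and c :: "real \<Rightarrow> real \<times> real"
  assume st: "0 \<le> s" "s \<le> t" and R: "finite R" "R \<subseteq> {0..s}"
  let ?d = "\<lambda>N r. real (dyd N r) / 2 ^ N"
  have BMlim: "(\<lambda>N. BM (?d N r) w) \<longlonglongrightarrow> BM r w" if "r \<ge> 0" for r w
    by (rule continuous_on_tendsto_compose[OF BM_continuous dyd_tendsto[OF that]]) (use that in auto)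
  have l1: "(\<lambda>N. CLINT w|coord_measure \<mu>. iexp (\<Sum>r\<in>R. c r \<bullet> BM (?d N r) w) * iexp (u \<bullet> (BM (?d N t) w - BM (?d N s) w)))
    \<longlonglongrightarrow> (CLINT w|coord_measure \<mu>. iexp (\<Sum>r\<in>R. c r \<bullet> BM r w) * iexp (u \<bullet> (BM t w - BM s w)))"
  proof (rule integral_dominated_convergence[where w="\<lambda>_. 1"])
    show "AE w in coord_measure \<mu>. (\<lambda>N. iexp (\<Sum>r\<in>R. c r \<bullet> BM (?d N r) w) * iexp (u \<bullet> (BM (?d N t) w - BM (?d N s) w)))
       \<longlonglongrightarrow> iexp (\<Sum>r\<in>R. c r \<bullet> BM r w) * iexp (u \<bullet> (BM t w - BM s w))"
      by (intro AE_I2 tendsto_intros BMlim) (use st R in auto)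
  qed (auto simp: norm_mult)
  have l2: "(\<lambda>N. CLINT w|coord_measure \<mu>. iexp (\<Sum>r\<in>R. c r \<bullet> BM (?d N r) w))
    \<longlonglongrightarrow> (CLINT w|coord_measure \<mu>. iexp (\<Sum>r\<in>R. c r \<bullet> BM r w))"
  proof (rule integral_dominated_convergence[where w="\<lambda>_. 1"])
    show "AE w in coord_measure \<mu>. (\<lambda>N. iexp (\<Sum>r\<in>R. c r \<bullet> BM (?d N r) w)) \<longlonglongrightarrow> iexp (\<Sum>r\<in>R. c r \<bullet> BM r w)"
      by (intro AE_I2 tendsto_intros BMlim) (use st R in auto)
  qed auto
  have l3: "(\<lambda>N. exp (- complex_of_real ((?d N t - ?d N s) * (u \<bullet> u) / 2))) \<longlonglongrightarrow> exp (- complex_of_real ((t - s) * (u \<bullet> u) / 2))"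
    by (intro tendsto_intros dyd_tendsto) (use st in auto)
  have "(CLINT w|coord_measure \<mu>. iexp (\<Sum>r\<in>R. c r \<bullet> BM (?d N r) w) * iexp (u \<bullet> (BM (?d N t) w - BM (?d N s) w))) = 
    (CLINT w|coord_measure \<mu>. iexp (\<Sum>r\<in>R. c r \<bullet> BM (?d N r) w)) * exp (- complex_of_real ((?d N t - ?d N s) * (u \<bullet> u) / 2))" for N
    by (rule BM_dyadic_increment[OF R(1)]) (use R st in \<open>auto intro!: dyd_mono\<close>)
  with l1 have "(\<lambda>N. (CLINT w|coord_measure \<mu>. iexp (\<Sum>r\<in>R. c r \<bullet> BM (?d N r) w)) * exp (- complex_of_real ((?d N t - ?d N s) * (u \<bullet> u) / 2)))
     \<longlonglongrightarrow> (CLINT w|coord_measure \<mu>. iexp (\<Sum>r\<in>R. c r \<bullet> BM r w) * iexp (u \<bullet> (BM t w - BM s w)))"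
    by (simp only:)
  from LIMSEQ_unique[OF this tendsto_mult[OF l2 l3]]
  show "(CLINT w|coord_measure \<mu>. iexp (\<Sum>r\<in>R. c r \<bullet> BM r w) * iexp (u \<bullet> (BM t w - BM s w))) =
      (CLINT w|coord_measure \<mu>. iexp (\<Sum>r\<in>R. c r \<bullet> BM r w)) * exp (- (complex_of_real ((t - s) * (u \<bullet> u) / 2)))" .
qed

end

lemma bm_exists:
  assumes "prob_space \<mu>" "sets \<mu> = sets borel"
  shows "\<exists>(M :: path measure) B. bm M B \<and> distr M borel (B 0) = \<mu>"
proof (intro exI conjI)
  show "bm (coord_measure \<mu>) BM" by (rule bm_BM[OF assms])
  have "BM 0 = (\<lambda>w. w (- 1))" using BM_0[OF assms] by auto
  then show "distr (coord_measure \<mu>) borel (BM 0) = \<mu>" using coord_distr[OF assms, of "-1"] by simp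
qed

section \<open>Hitting times and optional stopping\<close>

text \<open>Only values before time r are consulted, so for an adapted process the event lies in the
  past of r. Compactness reduces it to rational times: on a closed interval a continuous function
  attains a value <= 0 iff it takes values below every 1/(k + 1).\<close>

lemma hit_measurable:
  fixes f :: "real \<Rightarrow> 'a \<Rightarrow> real"
  assumes f: "\<And>u. 0 < u \<Longrightarrow> u < r \<Longrightarrow> f u \<in> borel_measurable N"
    and cont: "\<And>w. w \<in> space N \<Longrightarrow> continuous_on {0..} (\<lambda>u. f u w)"
  shows "{w\<in>space N. \<exists>u. 0 < u \<and> u < r \<and> f u w \<le> 0} \<in> sets N"
proof -
  \<comment> \<open>The margin 1/(m + 1) at both ends turns the open interval into a compact one;
    the strict bound 1/(k + 1) is an open condition, which rational times detect.\<close>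
  define P where "P = (\<lambda>(m::nat) (k::nat) (x::rat) w. 1 / real (Suc m) \<le> of_rat x \<and> of_rat x \<le> r - 1 / real (Suc m) \<and> f (of_rat x) w < 1 / real (Suc k))"
  have "{w\<in>space N. P m k x w} \<in> sets N" for m k x
  proof (cases "1 / real (Suc m) \<le> of_rat x \<and> of_rat x \<le> r - 1 / real (Suc m)")
    case True
    have "1 / real (Suc m) > 0" by simp
    with True have "f (of_rat x) \<in> borel_measurable N" by (intro f) linarith+
    then have "{w\<in>space N. f (of_rat x) w < 1 / real (Suc k)} \<in> sets N" by measurable
    then show ?thesis using True by (simp add: P_def)
  next
    case False
    then have "{w\<in>space N. P m k x w} = {}" by (auto simp: P_def)
    then show ?thesis by (simp only: sets.empty_sets)
  qed
  then have "{w\<in>space N. \<exists>m. \<forall>k. \<exists>x. P m k x w} \<in> sets N"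
    by (intro sets.sets_Collect_countable_Ex sets.sets_Collect_countable_All)
  also have "{w\<in>space N. \<exists>m. \<forall>k. \<exists>x. P m k x w} = {w\<in>space N. \<exists>u. 0 < u \<and> u < r \<and> f u w \<le> 0}"
  proof (rule Collect_cong, rule conj_cong[OF refl])
    fix w assume w: "w \<in> space N"
    show "(\<exists>m. \<forall>k. \<exists>x. P m k x w) \<longleftrightarrow> (\<exists>u. 0 < u \<and> u < r \<and> f u w \<le> 0)"
    proof
      assume "\<exists>m. \<forall>k. \<exists>x. P m k x w"
      then obtain m where m: "\<And>k. \<exists>x. P m k x w" by blast
      define d where "d = 1 / real (Suc m)"
      have d: "d > 0" by (simp add: d_def)
      have m': "\<exists>x. d \<le> x \<and> x \<le> r - d \<and> f x w < 1 / real (Suc k)" for k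
        using m[of k] unfolding P_def d_def by blast
      then have "\<exists>x. d \<le> x \<and> x \<le> r - d" by blast
      then have ne: "{d..r - d} \<noteq> {}" by auto
      have "continuous_on {d..r - d} (\<lambda>u. f u w)"
        by (rule continuous_on_subset[OF cont[OF w]]) (use d in auto)
      from continuous_attains_inf[OF compact_Icc ne this]
      obtain u where u: "u \<in> {d..r - d}" "\<And>y. y \<in> {d..r - d} \<Longrightarrow> f u w \<le> f y w" by blast
      have "f u w < 1 / real (Suc k)" for k
      proof -
        obtain x where "x \<in> {d..r - d}" "f x w < 1 / real (Suc k)" using m'[of k] by auto
        then show ?thesis using u(2)[of x] by linarith
      qed
      then have "f u w \<le> 0"
        by (metis nat_approx_posE not_less less_asym)
      then show "\<exists>u. 0 < u \<and> u < r \<and> f u w \<le> 0" using u(1) d by (intro exI[of _ u]) auto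
    next
      assume "\<exists>u. 0 < u \<and> u < r \<and> f u w \<le> 0"
      then obtain u where u: "0 < u" "u < r" "f u w \<le> 0" by blast
      obtain m where m: "1 / real (Suc m) < min u (r - u)" using nat_approx_posE[of "min u (r - u)"] u by auto
      define d where "d = 1 / real (Suc m)"
      have "\<exists>x. P m k x w" for k
      proof -
        have ct: "continuous_on {0<..} (\<lambda>u. f u w)" by (rule continuous_on_subset[OF cont[OF w]]) auto
        then have "open ({0<..} \<inter> (\<lambda>u. f u w) -` {..<1 / real (Suc k)})"
          by (rule continuous_open_preimage) auto
        then have "open ({0<..} \<inter> (\<lambda>u. f u w) -` {..<1 / real (Suc k)} \<inter> {d<..<r - d})"
          by (rule open_Int[OF _ open_greaterThanLessThan])
        moreover have "u \<in> {0<..} \<inter> (\<lambda>u. f u w) -` {..<1 / real (Suc k)} \<inter> {d<..<r - d}"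
          using u m by (auto simp: d_def intro: le_less_trans)
        ultimately obtain e where e: "e > 0" "\<And>y. dist y u < e \<Longrightarrow> y \<in> {0<..} \<inter> (\<lambda>u. f u w) -` {..<1 / real (Suc k)} \<inter> {d<..<r - d}"
          unfolding open_dist by blast
        obtain x where x: "u < of_rat x" "of_rat x < u + e" using of_rat_dense[of u "u + e"] e(1) by auto
        then have "of_rat x \<in> {0<..} \<inter> (\<lambda>u. f u w) -` {..<1 / real (Suc k)} \<inter> {d<..<r - d}" by (intro e(2)) (simp add: dist_real_def)
        then show ?thesis unfolding P_def d_def[symmetric] by (intro exI[of _ x]) auto
      qed
      then show "\<exists>m. \<forall>k. \<exists>x. P m k x w" by blast
    qed
  qed
  finally show ?thesis .
qed

lemma nonneg_before_hit:
  fixes f :: "real \<Rightarrow> real"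
  assumes cont: "continuous_on {0..} f" and u: "0 < u" and before: "\<And>h. 0 < h \<Longrightarrow> f h \<le> 0 \<Longrightarrow> u \<le> h"
  shows "f u \<ge> 0"
proof (rule ccontr)
  assume "\<not> f u \<ge> 0"
  \<comment> \<open>Dividing by n + 2 keeps these times strictly between 0 and u.\<close>
  have "(\<lambda>n. u - u / real (Suc (Suc n))) \<longlonglongrightarrow> u - 0"
    by (intro tendsto_diff tendsto_const LIMSEQ_Suc[OF LIMSEQ_Suc[OF lim_const_over_n]])
  then have "(\<lambda>n. f (u - u / real (Suc (Suc n)))) \<longlonglongrightarrow> f u"
    by (intro continuous_on_tendsto_compose[OF cont]) (use u in \<open>auto simp: field_simps\<close>)
  then have "\<forall>\<^sub>F n in sequentially. f (u - u / real (Suc (Suc n))) < 0"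
    by (rule order_tendstoD) (use \<open>\<not> f u \<ge> 0\<close> in auto)
  then obtain n where n: "f (u - u / real (Suc (Suc n))) < 0"
    using eventually_happens by fastforce
  have "u - u / real (Suc (Suc n)) > 0" using u by (simp add: field_simps add_pos_nonneg)
  from before[OF this] n u show False by (simp add: field_simps)
qed

lemma Inf_limit_seq:
  fixes H :: "real set"
  assumes "H \<noteq> {}" "H \<subseteq> {0..}"
  obtains h where "\<And>n. h n \<in> H" "h \<longlonglongrightarrow> Inf H"
proof -
  have bdd: "bdd_below H" using assms by (intro bdd_belowI[of _ 0]) auto
  have "\<exists>h\<in>H. h < Inf H + 1 / real (Suc n)" for n
    using cInf_less_iff[OF assms(1) bdd, of "Inf H + 1 / real (Suc n)"] by simp
  then obtain h where h: "\<And>n. h n \<in> H" "\<And>n. h n < Inf H + 1 / real (Suc n)" by metis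
  have "h \<longlonglongrightarrow> Inf H"
  proof (rule tendsto_sandwich[where f="\<lambda>_. Inf H" and h="\<lambda>n. Inf H + 1 / real (Suc n)"])
    have "(\<lambda>n. Inf H + 1 / real (Suc n)) \<longlonglongrightarrow> Inf H + 0"
      by (intro tendsto_add tendsto_const LIMSEQ_Suc[OF lim_const_over_n])
    then show "(\<lambda>n. Inf H + 1 / real (Suc n)) \<longlonglongrightarrow> Inf H" by simp
    show "\<forall>\<^sub>F n in sequentially. Inf H \<le> h n"
      by (intro always_eventually allI cInf_lower h(1) bdd)
    show "\<forall>\<^sub>F n in sequentially. h n \<le> Inf H + 1 / real (Suc n)"
      by (intro always_eventually allI less_imp_le h(2))
  qed simp
  with h(1) that show ?thesis by blast
qed

lemma nonpos_at_hit:
  fixes f :: "real \<Rightarrow> real"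
  assumes cont: "continuous_on {0..} f" and H: "H \<noteq> {}" "H \<subseteq> {0..}" and le: "\<And>h. h \<in> H \<Longrightarrow> f h \<le> 0"
  shows "f (Inf H) \<le> 0"
proof -
  obtain h where h: "\<And>n. h n \<in> H" "h \<longlonglongrightarrow> Inf H" using Inf_limit_seq[OF H] by blast
  have "Inf H \<ge> 0" by (rule cInf_greatest) (use H in auto)
  then have "(\<lambda>n. f (h n)) \<longlonglongrightarrow> f (Inf H)"
    by (intro continuous_on_tendsto_compose[OF cont h(2)]) (use h(1) H in \<open>auto intro!: always_eventually\<close>)
  then show ?thesis by (rule LIMSEQ_le_const2) (use le h(1) in auto)
qed

text \<open>Progressive measurability: time is replaced by a slightly later dyadic point, which
  takes countably many values, and right continuity gives the limit. The cap at r keeps the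
  approximation inside the observed time interval.\<close>

lemma right_continuous_measurable:
  fixes X :: "real \<Rightarrow> 'a \<Rightarrow> 'b::{metric_space, second_countable_topology}"
  assumes r: "r \<ge> 0" and X: "\<And>u. 0 \<le> u \<Longrightarrow> u \<le> r \<Longrightarrow> X u \<in> borel_measurable N"
    and rc: "\<And>w u. w \<in> space N \<Longrightarrow> u \<ge> 0 \<Longrightarrow> continuous (at_right u) (\<lambda>u. X u w)"
  shows "(\<lambda>(u, w). X (min (max u 0) r) w) \<in> borel_measurable (borel \<Otimes>\<^sub>M N)"
proof -
  define d where "d = (\<lambda>(n::nat) (u::real). min (real (Suc (nat \<lfloor>2 ^ n * max u 0\<rfloor>)) / 2 ^ n) r)"
  show ?thesis
  proof (rule borel_measurable_LIMSEQ_metric[where f="\<lambda>n (u, w). X (d n u) w"])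
  show "(\<lambda>(u, w). X (d n u) w) \<in> borel_measurable (borel \<Otimes>\<^sub>M N)" for n
  proof -
    have "(\<lambda>x. (\<lambda>i x. X (min (real (Suc i) / 2 ^ n) r) (snd x)) ((\<lambda>x. nat \<lfloor>2 ^ n * max (fst x :: real) 0\<rfloor>) x) x) \<in> borel_measurable (borel \<Otimes>\<^sub>M N)"
    proof (rule measurable_compose_countable[where f="\<lambda>i x. X (min (real (Suc i) / 2 ^ n) r) (snd x)" and g="\<lambda>x. nat \<lfloor>2 ^ n * max (fst x :: real) 0\<rfloor>"])
      show "(\<lambda>x. X (min (real (Suc i) / 2 ^ n) r) (snd x)) \<in> borel_measurable (borel \<Otimes>\<^sub>M N)" for i :: nat
        by (rule measurable_compose[OF measurable_snd X]) (use r in auto)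
      show "(\<lambda>x. nat \<lfloor>2 ^ n * max (fst x :: real) 0\<rfloor>) \<in> measurable (borel \<Otimes>\<^sub>M N) (count_space UNIV)"
      proof (rule measurable_compose[OF measurable_fst])
        have "(\<lambda>u::real. \<lfloor>2 ^ n * max u 0\<rfloor>) \<in> measurable borel (count_space UNIV)"
          by (rule measurable_compose[OF _ measurable_real_floor]) measurable
        then show "(\<lambda>u::real. nat \<lfloor>2 ^ n * max u 0\<rfloor>) \<in> measurable borel (count_space UNIV)"
          by (rule measurable_compose) simp
      qed
    qed
    then show ?thesis by (simp add: d_def case_prod_beta')
  qed
  fix x :: "real \<times> 'a" assume "x \<in> space (borel \<Otimes>\<^sub>M N)"
  then obtain u w where x: "x = (u, w)" "w \<in> space N" by (auto simp: space_pair_measure)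
  define v where "v = max u 0"
  have v: "v \<ge> 0" by (simp add: v_def)
  have up: "real (Suc (nat \<lfloor>2 ^ n * v\<rfloor>)) / 2 ^ n > v" for n :: nat
  proof -
    have "2 ^ n * v < real (Suc (nat \<lfloor>2 ^ n * v\<rfloor>))" using v by (simp add: of_nat_nat) linarith
    then show ?thesis by (simp add: field_simps)
  qed
  have lo: "real (Suc (nat \<lfloor>2 ^ n * v\<rfloor>)) / 2 ^ n \<le> v + (1 / 2) ^ n" for n :: nat
  proof -
    have "real (Suc (nat \<lfloor>2 ^ n * v\<rfloor>)) \<le> 2 ^ n * v + 1" using v by (simp add: of_nat_nat)
    then show ?thesis by (simp add: field_simps power_one_over)
  qed
  show "(\<lambda>n. case x of (u, w) \<Rightarrow> X (d n u) w) \<longlonglongrightarrow> (case x of (u, w) \<Rightarrow> X (min (max u 0) r) w)"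
  proof (cases "v < r")
    case False
    then have "d n u = r" for n using up[of n] unfolding d_def v_def[symmetric] by linarith
    moreover have "min (max u 0) r = r" using False unfolding v_def not_less by (rule min.absorb2)
    ultimately show ?thesis by (simp add: x)
  next
    case True
    have lim: "(\<lambda>n. d n u) \<longlonglongrightarrow> v"
    proof (rule tendsto_sandwich[where f="\<lambda>_. v" and h="\<lambda>n. v + (1 / 2) ^ n"])
      have "(\<lambda>n. v + (1 / 2 :: real) ^ n) \<longlonglongrightarrow> v + 0"
        by (intro tendsto_add tendsto_const LIMSEQ_power_zero) simp
      then show "(\<lambda>n. v + (1 / 2) ^ n) \<longlonglongrightarrow> v" by simp
      show "\<forall>\<^sub>F n in sequentially. v \<le> d n u" "\<forall>\<^sub>F n in sequentially. d n u \<le> v + (1 / 2) ^ n"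
        using up lo True unfolding d_def v_def[symmetric] by (auto intro!: always_eventually intro: less_imp_le min.coboundedI1)
    qed simp
    have gt: "d n u > v" for n using up[of n] True unfolding d_def v_def[symmetric] by simp
    have "(\<lambda>n. X (d n u) w) \<longlonglongrightarrow> X v w"
    proof (rule filterlim_compose[of "\<lambda>u. X u w"])
      show "((\<lambda>u. X u w) \<longlongrightarrow> X v w) (at_right v)"
        using rc[OF x(2) v] by (simp add: continuous_within)
      show "filterlim (\<lambda>n. d n u) (at_right v) sequentially"
      proof -
        have ne: "d n u \<noteq> v" for n using gt[of n] by simp
        show ?thesis unfolding filterlim_at using lim gt ne by (auto intro!: always_eventually)
      qed
    qed
    moreover have "min (max u 0) r = v" using True by (simp add: v_def)
    ultimately show ?thesis by (simp add: x)
  qed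
  qed
qed

text \<open>The infimum is below q exactly when some element is, whether or not it is attained.
  Capping it at r means that only levels q <= r are tested.\<close>

lemma hitting_time_measurable:
  fixes H :: "'a \<Rightarrow> real set"
  assumes meas: "\<And>q. 0 < q \<Longrightarrow> q \<le> r \<Longrightarrow> {w\<in>space N. \<exists>h\<in>H w. h < q} \<in> sets N"
    and H: "\<And>w. w \<in> space N \<Longrightarrow> H w \<noteq> {}" "\<And>w. w \<in> space N \<Longrightarrow> H w \<subseteq> {0..}"
  shows "(\<lambda>w. min (Inf (H w)) r) \<in> borel_measurable N"
  unfolding borel_measurable_iff_less
proof
  fix q :: real
  show "{w\<in>space N. min (Inf (H w)) r < q} \<in> sets N"
  proof (cases "q \<le> r")
    case False
    then have "{w\<in>space N. min (Inf (H w)) r < q} = space N" by auto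
    then show ?thesis by simp
  next
    case True
    have "Inf (H w) < q \<longleftrightarrow> (\<exists>h\<in>H w. h < q)" if "w \<in> space N" for w
      by (rule cInf_less_iff) (use H[OF that] in \<open>auto intro: bdd_belowI[of _ 0]\<close>)
    then have eq: "{w\<in>space N. min (Inf (H w)) r < q} = {w\<in>space N. \<exists>h\<in>H w. h < q}"
      using True by (auto simp: min_less_iff_disj)
    show ?thesis
    proof (cases "0 < q")
      case True then show ?thesis unfolding eq using meas \<open>q \<le> r\<close> by blast
    next
      case False
      then have "{w\<in>space N. \<exists>h\<in>H w. h < q} = {}" using H(2) by fastforce
      then show ?thesis unfolding eq by (simp only: sets.empty_sets)
    qed
  qed
qed

text \<open>A bound on second moments gives uniform integrability. Fatou's lemma bounds the second
  moment of g, and d <= min d R + d^2 / R separates a bounded part, handled by dominated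
  convergence, from a remainder of order 1/R.\<close>

lemma L2_bounded_tendsto:
  fixes f :: "nat \<Rightarrow> 'a \<Rightarrow> complex"
  assumes M: "finite_measure M" and m: "\<And>n. f n \<in> borel_measurable M" "g \<in> borel_measurable M"
    and lim: "\<And>x. x \<in> space M \<Longrightarrow> (\<lambda>n. f n x) \<longlonglongrightarrow> g x"
    and i2: "\<And>n. integrable M (\<lambda>x. (norm (f n x))\<^sup>2)" and bd: "\<And>n. (LINT x|M. (norm (f n x))\<^sup>2) \<le> C"
  shows "integrable M g" "(\<lambda>n. integral\<^sup>L M (f n)) \<longlonglongrightarrow> integral\<^sup>L M g"
proof -
  interpret finite_measure M by fact
  note [measurable] = m
  have C0: "C \<ge> 0" using order_trans[OF _ bd[of 0]] by (simp add: integral_nonneg_AE)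
  have L1: "integrable M h" if "h \<in> borel_measurable M" "integrable M (\<lambda>x. (norm (h x))\<^sup>2)" for h :: "'a \<Rightarrow> complex"
  proof (rule Bochner_Integration.integrable_bound[where f="\<lambda>x. 1 + (norm (h x))\<^sup>2"])
    show "AE x in M. norm (h x) \<le> norm (1 + (norm (h x))\<^sup>2)"
    proof (rule AE_I2)
      fix x
      have "0 \<le> (norm (h x) - 1)\<^sup>2" by simp
      then have "2 * norm (h x) \<le> 1 + (norm (h x))\<^sup>2" by (simp add: power2_eq_square algebra_simps)
      then show "norm (h x) \<le> norm (1 + (norm (h x))\<^sup>2)" using norm_ge_zero[of "h x"] by (simp del: norm_ge_zero)
    qed
  qed (use that in auto)
  have nn: "(\<integral>\<^sup>+x. ennreal ((norm (f n x))\<^sup>2) \<partial>M) \<le> ennreal C" for n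
    using bd[of n] nn_integral_eq_integral[OF i2[of n]] by (simp add: ennreal_leI)
  have "(\<integral>\<^sup>+x. ennreal ((norm (g x))\<^sup>2) \<partial>M) = (\<integral>\<^sup>+x. liminf (\<lambda>n. ennreal ((norm (f n x))\<^sup>2)) \<partial>M)"
  proof (rule nn_integral_cong)
    fix x assume "x \<in> space M"
    have "(\<lambda>n. ennreal ((norm (f n x))\<^sup>2)) \<longlonglongrightarrow> ennreal ((norm (g x))\<^sup>2)"
      by (intro tendsto_ennrealI tendsto_intros lim \<open>x \<in> space M\<close>)
    then show "ennreal ((norm (g x))\<^sup>2) = liminf (\<lambda>n. ennreal ((norm (f n x))\<^sup>2))"
      by (rule lim_imp_Liminf[OF trivial_limit_sequentially, symmetric])
  qed
  also have "\<dots> \<le> liminf (\<lambda>n. \<integral>\<^sup>+x. ennreal ((norm (f n x))\<^sup>2) \<partial>M)"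
    by (rule nn_integral_liminf) measurable
  also have "\<dots> \<le> ennreal C"
    by (rule Liminf_le) (use nn in auto)
  finally have ng: "(\<integral>\<^sup>+x. ennreal ((norm (g x))\<^sup>2) \<partial>M) \<le> ennreal C" .
  have g2: "integrable M (\<lambda>x. (norm (g x))\<^sup>2)"
    by (rule integrableI_nonneg) (use ng in \<open>auto intro: le_less_trans\<close>)
  have g2C: "(LINT x|M. (norm (g x))\<^sup>2) \<le> C"
    using ng C0 nn_integral_eq_integral[OF g2] by (simp add: ennreal_le_iff)
  show g1: "integrable M g" by (rule L1[OF m(2) g2])
  have f1: "integrable M (f n)" for n by (rule L1[OF m(1) i2])
  define d where "d = (\<lambda>n x. norm (f n x - g x))"
  have d2: "(d n x)\<^sup>2 \<le> 2 * (norm (f n x))\<^sup>2 + 2 * (norm (g x))\<^sup>2" for n x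
  proof -
    have "(d n x)\<^sup>2 \<le> (norm (f n x) + norm (g x))\<^sup>2"
      unfolding d_def by (rule power_mono[OF norm_triangle_ineq4]) simp
    also have "\<dots> \<le> 2 * (norm (f n x))\<^sup>2 + 2 * (norm (g x))\<^sup>2"
      using zero_le_power2[of "norm (f n x) - norm (g x)"] by (simp add: power2_eq_square algebra_simps)
    finally show ?thesis .
  qed
  have id2: "integrable M (\<lambda>x. (d n x)\<^sup>2)" for n
    by (rule Bochner_Integration.integrable_bound[where f="\<lambda>x. 2 * (norm (f n x))\<^sup>2 + 2 * (norm (g x))\<^sup>2"])
      (use i2 g2 d2 in \<open>auto simp: d_def\<close>)
  have id2C: "(LINT x|M. (d n x)\<^sup>2) \<le> 4 * C" for n
  proof -
    have "(LINT x|M. (d n x)\<^sup>2) \<le> (LINT x|M. 2 * (norm (f n x))\<^sup>2 + 2 * (norm (g x))\<^sup>2)"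
      by (rule integral_mono) (use id2 i2 g2 d2 in auto)
    also have "\<dots> \<le> 4 * C" using i2 g2 bd[of n] g2C by simp
    finally show ?thesis .
  qed
  have ind: "integrable M (d n)" for n unfolding d_def using f1 g1 by simp
  have "(\<lambda>n. LINT x|M. d n x) \<longlonglongrightarrow> 0"
  proof (rule LIMSEQ_I)
    fix e :: real assume e: "e > 0"
    \<comment> \<open>Chosen so that the remainder 4 C / R is at most e/2; the summand 1 keeps R
      positive when C = 0.\<close>
    define R where "R = (8 * C + 1) / e"
    have R: "R > 0" using e C0 by (simp add: R_def)
    have "(\<lambda>n. LINT x|M. min (d n x) R) \<longlonglongrightarrow> (LINT x|M. 0)"
    proof (rule integral_dominated_convergence[where w="\<lambda>_. R"])
      show "AE x in M. (\<lambda>n. min (d n x) R) \<longlonglongrightarrow> 0"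
      proof (rule AE_I2)
        fix x assume "x \<in> space M"
        have "(\<lambda>n. d n x) \<longlonglongrightarrow> 0" unfolding d_def using lim[OF \<open>x \<in> space M\<close>] by (simp add: tendsto_norm_zero LIM_zero)
        then have "(\<lambda>n. min (d n x) R) \<longlonglongrightarrow> min 0 R" by (intro tendsto_min tendsto_const)
        then show "(\<lambda>n. min (d n x) R) \<longlonglongrightarrow> 0" using R by simp
      qed
      show "AE x in M. norm (min (d n x) R) \<le> R" for n using R by (auto simp: d_def)
    qed (auto simp: d_def)
    then have "\<forall>\<^sub>F n in sequentially. (LINT x|M. min (d n x) R) < e / 2"
      by (intro order_tendstoD) (use e in auto)
    then obtain n0 where n0: "\<And>n. n \<ge> n0 \<Longrightarrow> (LINT x|M. min (d n x) R) < e / 2"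
      unfolding eventually_sequentially by blast
    show "\<exists>no. \<forall>n\<ge>no. norm ((LINT x|M. d n x) - 0) < e"
    proof (intro exI[of _ n0] allI impI)
      fix n assume n: "n \<ge> n0"
      have imin: "integrable M (\<lambda>x. min (d n x) R)"
        by (rule Bochner_Integration.integrable_bound[OF ind[of n]]) (use R in \<open>auto simp: d_def\<close>)
      have "(LINT x|M. d n x) \<le> (LINT x|M. min (d n x) R + (d n x)\<^sup>2 / R)"
      proof (rule integral_mono)
        fix x
        have "d n x \<ge> 0" by (simp add: d_def)
        moreover have "d n x \<le> (d n x)\<^sup>2 / R" if "d n x > R"
          using that R by (simp add: field_simps power2_eq_square)
        ultimately show "d n x \<le> min (d n x) R + (d n x)\<^sup>2 / R" using R by (cases "d n x > R") auto
      qed (use ind imin id2 in auto)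
      also have "\<dots> = (LINT x|M. min (d n x) R) + (LINT x|M. (d n x)\<^sup>2) / R" using imin id2 by simp
      also have "\<dots> < e / 2 + 4 * C / R"
        by (intro add_less_le_mono n0[OF n] divide_right_mono id2C) (use R in simp)
      also have "4 * C / R \<le> e / 2" unfolding R_def using e C0 by (simp add: field_simps)
      finally have "(LINT x|M. d n x) < e" by simp
      moreover have "(LINT x|M. d n x) \<ge> 0" by (rule integral_nonneg_AE) (simp add: d_def)
      ultimately show "norm ((LINT x|M. d n x) - 0) < e" by simp
    qed
  qed
  then have "(\<lambda>n. integral\<^sup>L M (f n) - integral\<^sup>L M g) \<longlonglongrightarrow> 0"
  proof (rule Lim_null_comparison[rotated])
    show "\<forall>\<^sub>F n in sequentially. norm (integral\<^sup>L M (f n) - integral\<^sup>L M g) \<le> (LINT x|M. d n x)"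
      unfolding d_def
    proof (intro always_eventually allI)
      fix n
      have "integral\<^sup>L M (f n) - integral\<^sup>L M g = (CLINT x|M. f n x - g x)" using f1 g1 by simp
      then show "norm (integral\<^sup>L M (f n) - integral\<^sup>L M g) \<le> (LINT x|M. norm (f n x - g x))"
        by (simp only: integral_norm_bound)
    qed
  qed
  then show "(\<lambda>n. integral\<^sup>L M (f n)) \<longlonglongrightarrow> integral\<^sup>L M g" by (simp add: LIM_zero_iff)
qed

text \<open>The exponential formula for increments with purely imaginary exponents: the past events
  in \<open>bm\<close> are replaced by integrable past weights.\<close>

lemma bmI':
  assumes bm: "bm M B" and st: "0 \<le> s" "s \<le> t" and Z: "Z \<in> borel_measurable (nat_filtration M B s)" "integrable M Z"
  shows "(CLINT w|M. Z w * iexp (u \<bullet> (B t w - B s w))) = (CLINT w|M. Z w) * exp (- (complex_of_real ((t - s) * (u \<bullet> u) / 2)))"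
proof -
  have "iexp (u \<bullet> (B t w - B s w)) = exp (\<i> * fst u * complex_of_real (fst (B t w - B s w)) + \<i> * snd u * complex_of_real (snd (B t w - B s w)))" for w
    by (simp add: inner_prod_def algebra_simps)
  moreover have "(complex_of_real t - complex_of_real s) * ((\<i> * fst u)\<^sup>2 + (\<i> * snd u)\<^sup>2) / 2 = - (complex_of_real ((t - s) * (u \<bullet> u) / 2))"
    by (simp add: inner_prod_def power_mult_distrib power2_eq_square algebra_simps add_divide_distrib diff_divide_distrib)
  ultimately show ?thesis
    using has_bochner_integral_integral_eq[OF bm_increment_exp[OF bm st Z, of "\<i> * fst u" "\<i> * snd u"]] by (simp only:)
qed

text \<open>A change on a null event alters the natural filtration, but \<open>bmI\<close> tests
  only expectations that involve finitely many times, and these stay the same. The lemma turns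
  almost sure properties of the paths into sure ones.\<close>

lemma bm_modify:
  assumes bm: "bm M B" and G: "G \<in> sets M" "AE w in M. w \<in> G"
    and b: "\<And>w. w \<in> space M \<Longrightarrow> continuous_on {0..} (\<lambda>t. b t w)" "\<And>t. t \<ge> 0 \<Longrightarrow> b t \<in> borel_measurable M"
  shows "bm M (\<lambda>t w. if w \<in> G then B t w else b t w)" (is "bm M ?B")
proof (rule bmI)
  interpret prob_space M by (rule bm_prob[OF bm])
  note Bm = bm_measurable[OF bm]
  show mB: "?B t \<in> borel_measurable M" if "t \<ge> 0" for t
    using Bm[OF that] b(2)[OF that] G(1) by measurable
  show "continuous_on {0..} (\<lambda>t. ?B t w)" if "w \<in> space M" for w
    using bm_continuous[OF bm that] b(1)[OF that] by (cases "w \<in> G") auto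
  fix s t :: real and u :: "real \<times> real" and R and v :: "real \<Rightarrow> real \<times> real"
  assume st: "0 \<le> s" "s \<le> t" and R: "finite R" "R \<subseteq> {0..s}"
  have m1: "(\<lambda>w. iexp (\<Sum>r\<in>R. v r \<bullet> C r w)) \<in> borel_measurable M" if "\<And>t. t \<ge> 0 \<Longrightarrow> C t \<in> borel_measurable M" for C
  proof -
    have [measurable]: "C r \<in> borel_measurable M" if "r \<in> R" for r using R that \<open>\<And>t. t \<ge> 0 \<Longrightarrow> C t \<in> borel_measurable M\<close> by auto
    show ?thesis by measurable
  qed
  have m2: "(\<lambda>w. iexp (u \<bullet> (C t w - C s w))) \<in> borel_measurable M" if "\<And>t. t \<ge> 0 \<Longrightarrow> C t \<in> borel_measurable M" for C
  proof -
    have [measurable]: "C s \<in> borel_measurable M" "C t \<in> borel_measurable M" using st that by auto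
    show ?thesis by measurable
  qed
  have ZG: "(\<lambda>w. iexp (\<Sum>r\<in>R. v r \<bullet> B r w)) \<in> borel_measurable (nat_filtration M B s)"
  proof -
    have [measurable]: "B r \<in> borel_measurable (nat_filtration M B s)" if "r \<in> R" for r
      using R that by (intro measurable_nat_filtration) auto
    show ?thesis by measurable
  qed
  have iZ: "integrable M (\<lambda>w. iexp (\<Sum>r\<in>R. v r \<bullet> B r w))"
    by (rule integrable_const_bound[where B=1]) (use m1[OF Bm] in auto)
  have "(CLINT w|M. iexp (\<Sum>r\<in>R. v r \<bullet> ?B r w) * iexp (u \<bullet> (?B t w - ?B s w))) =
    (CLINT w|M. iexp (\<Sum>r\<in>R. v r \<bullet> B r w) * iexp (u \<bullet> (B t w - B s w)))"
    by (rule integral_cong_AE) (use G(2) m1[OF mB] m2[OF mB] m1[OF Bm] m2[OF Bm] in \<open>auto intro!: borel_measurable_times\<close>)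
  also have "\<dots> = (CLINT w|M. iexp (\<Sum>r\<in>R. v r \<bullet> B r w)) * exp (- (complex_of_real ((t - s) * (u \<bullet> u) / 2)))"
    by (rule bmI'[OF bm st ZG iZ])
  also have "(CLINT w|M. iexp (\<Sum>r\<in>R. v r \<bullet> B r w)) = (CLINT w|M. iexp (\<Sum>r\<in>R. v r \<bullet> ?B r w))"
    by (rule integral_cong_AE) (use G(2) m1[OF mB] m1[OF Bm] in auto)
  finally show "(CLINT w|M. iexp (\<Sum>r\<in>R. v r \<bullet> ?B r w) * iexp (u \<bullet> (?B t w - ?B s w))) =
    (CLINT w|M. iexp (\<Sum>r\<in>R. v r \<bullet> ?B r w)) * exp (- (complex_of_real ((t - s) * (u \<bullet> u) / 2)))" .
qed (rule bm_prob[OF bm])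

section \<open>Complex exponential martingales and optional stopping\<close>

definition expmart :: "complex \<Rightarrow> complex \<Rightarrow> real \<Rightarrow> real \<times> real \<Rightarrow> complex" where
  "expmart a b u x = exp (a * complex_of_real (fst x) + b * complex_of_real (snd x) - u * (a\<^sup>2 + b\<^sup>2) / 2)"

lemma expmart_measurable: "expmart a b u \<in> borel_measurable borel"
  unfolding expmart_def[abs_def] by (intro borel_measurable_continuous_onI continuous_intros)

lemma expmart_increment:
  "expmart a b t y = expmart a b s x * exp (a * complex_of_real (fst (y - x)) + b * complex_of_real (snd (y - x))) * exp (- ((t - s) * (a\<^sup>2 + b\<^sup>2) / 2))"
  unfolding expmart_def exp_add[symmetric] by (rule arg_cong[of _ _ exp]) (simp add: algebra_simps diff_divide_distrib add_divide_distrib)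

lemma expmart_norm: "norm (expmart a b u x) = exp (Re a * fst x + Re b * snd x - u * Re (a\<^sup>2 + b\<^sup>2) / 2)"
  by (simp add: expmart_def)

lemma expmart_step:
  assumes bm: "bm M B" and st: "0 \<le> s" "s \<le> t" and A: "A \<in> sets (nat_filtration M B s)"
    and i: "integrable M (\<lambda>w. expmart a b s (B s w))"
  shows "has_bochner_integral M (\<lambda>w. indicator A w * expmart a b t (B t w)) (CLINT w|M. indicator A w * expmart a b s (B s w))"
proof -
  let ?N = "nat_filtration M B s"
  have AM: "A \<in> sets M" using nat_filtration_subset[of B M s] A bm_measurable[OF bm] by blast
  define V where "V = (\<lambda>w. indicator A w * expmart a b s (B s w))"
  have m: "V \<in> borel_measurable ?N"
    unfolding V_def using A measurable_compose[OF measurable_nat_filtration[OF st(1) order_refl, of B M] expmart_measurable]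
    by (intro borel_measurable_times) auto
  have iV: "integrable M V"
    unfolding V_def using integrable_mult_bounded[OF i, of "indicator A" 1] AM by (auto simp: indicator_def mult.commute)
  from has_bochner_integral_mult_left[OF bm_increment_exp[OF bm st m iV, of a b], of "exp (- ((t - s) * (a\<^sup>2 + b\<^sup>2) / 2))"]
  have "has_bochner_integral M (\<lambda>w. V w * exp (a * complex_of_real (fst (B t w - B s w)) + b * complex_of_real (snd (B t w - B s w))) * exp (- ((t - s) * (a\<^sup>2 + b\<^sup>2) / 2)))
     ((CLINT w|M. V w) * exp ((t - s) * (a\<^sup>2 + b\<^sup>2) / 2) * exp (- ((t - s) * (a\<^sup>2 + b\<^sup>2) / 2)))"
    by (simp only: of_real_diff)
  also have "(\<lambda>w. V w * exp (a * complex_of_real (fst (B t w - B s w)) + b * complex_of_real (snd (B t w - B s w))) * exp (- ((t - s) * (a\<^sup>2 + b\<^sup>2) / 2)))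
     = (\<lambda>w. indicator A w * expmart a b t (B t w))"
  proof
    fix w
    show "V w * exp (a * complex_of_real (fst (B t w - B s w)) + b * complex_of_real (snd (B t w - B s w))) * exp (- ((t - s) * (a\<^sup>2 + b\<^sup>2) / 2))
       = indicator A w * expmart a b t (B t w)"
      unfolding V_def expmart_increment[of a b t "B t w" s "B s w"] by (simp only: mult.assoc of_real_diff)
  qed
  also have "(CLINT w|M. V w) * exp ((t - s) * (a\<^sup>2 + b\<^sup>2) / 2) * exp (- ((t - s) * (a\<^sup>2 + b\<^sup>2) / 2)) = (CLINT w|M. V w)"
    by (simp only: mult.assoc exp_add[symmetric]) simp
  finally show ?thesis unfolding V_def .
qed

lemma expmart_integrable:
  assumes bm: "bm M B" and t: "0 \<le> t" and C: "\<And>w. w \<in> space M \<Longrightarrow> norm (expmart a b 0 (B 0 w)) \<le> C"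
  shows "integrable M (\<lambda>w. expmart a b t (B t w))"
proof -
  interpret prob_space M by (rule bm_prob[OF bm])
  have m: "B 0 \<in> borel_measurable M" by (rule bm_measurable[OF bm]) simp
  have "integrable M (\<lambda>w. expmart a b 0 (B 0 w))"
    by (rule integrable_const_bound[where B=C]) (use C measurable_compose[OF m expmart_measurable] in auto)
  from expmart_step[OF bm order_refl t _ this, of "space M"] sets.top[of "nat_filtration M B 0"]
  have "integrable M (\<lambda>w. indicator (space M) w * expmart a b t (B t w))" by (auto simp: has_bochner_integral_iff)
  then show ?thesis by (rule Bochner_Integration.integrable_cong[THEN iffD1, rotated -1]) auto
qed

text \<open>Optional stopping on the grid \<open>K i / 2^n\<close>; the second moments are controlled by the exponential
  martingale with doubled real exponents.\<close>

lemma optional_stopping_bounded: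
  fixes H :: "'a \<Rightarrow> real set"
  assumes bm: "bm M B" and C: "\<And>w. w \<in> space M \<Longrightarrow> norm (expmart a b 0 (B 0 w)) \<le> C"
    and K: "0 < K" and A: "A \<subseteq> space M"
    and H: "\<And>w. H w \<subseteq> {0..}"
    and meas: "\<And>q. 0 < q \<Longrightarrow> q \<le> K \<Longrightarrow> {w\<in>A. \<exists>h\<in>H w. h < q} \<in> sets (nat_filtration M B q)"
  defines "D \<equiv> {w\<in>A. \<exists>h\<in>H w. h < K}"
  shows "has_bochner_integral M (\<lambda>w. indicator D w * expmart a b (Inf (H w)) (B (Inf (H w)) w)) (CLINT w|M. indicator D w * expmart a b K (B K w))"
proof -
  interpret prob_space M by (rule bm_prob[OF bm])
  note Bm = bm_measurable[OF bm]
  define N where "N = (\<lambda>u w. expmart a b u (B u w))"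
  define D' where "D' = (\<lambda>q. {w\<in>A. \<exists>h\<in>H w. h < q})"
  define g where "g = (\<lambda>(n::nat) (i::nat). K * real i / 2 ^ n)"
  have g0: "g n i \<ge> 0" and gS: "g n i < g n (Suc i)" for n i using K by (auto simp: g_def divide_strict_right_mono)
  have gK: "g n i \<le> K" if "i \<le> 2 ^ n" for n i
  proof -
    have "real i \<le> 2 ^ n" using that by (metis of_nat_le_iff of_nat_numeral of_nat_power)
    then show ?thesis using K by (simp add: g_def divide_le_eq)
  qed
  have g2: "g n (2 ^ n) = K" for n by (simp add: g_def)
  \<comment> \<open>The event that the infimum is located in the i-th cell. It is known only at the
    right end of the cell, so the grid approximation stops there.\<close>
  define P where "P = (\<lambda>n i. D' (g n (Suc i)) - D' (g n i))"
  have D'0: "D' 0 = {}" using H by (fastforce simp: D'_def)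
  have D'm: "D' (g n i) \<in> sets (nat_filtration M B (g n i))" if "i \<le> 2 ^ n" for n i
  proof (cases "i = 0")
    case True then show ?thesis using D'0 by (simp add: g_def)
  next
    case False
    then have "g n i > 0" using K by (simp add: g_def)
    then show ?thesis unfolding D'_def using meas gK[OF that] by blast
  qed
  have Pm: "P n i \<in> sets (nat_filtration M B (g n (Suc i)))" if "i < 2 ^ n" for n i
    unfolding P_def using D'm[of "Suc i" n] D'm[of i n] that nat_filtration_mono[OF less_imp_le[OF gS[of n i]], of M B] by (intro sets.Diff) auto
  have PM: "P n i \<in> sets M" if "i < 2 ^ n" for n i
    using Pm[OF that] nat_filtration_subset[of B M] Bm by blast
  have disj: "i = j" if "w \<in> P n i" "w \<in> P n j" for n i j w
  proof -
    have "\<not> Suc i \<le> j" if "w \<in> P n i" "w \<in> P n j" for i j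
    proof
      assume "Suc i \<le> j"
      then have "g n (Suc i) \<le> g n j" using K by (auto simp: g_def intro!: divide_right_mono mult_left_mono)
      then show False using that by (force simp: P_def D'_def)
    qed
    from this[of i j] this[of j i] that show ?thesis by linarith
  qed
  have cover: "\<exists>i<2 ^ n. w \<in> P n i" if "w \<in> D" for n w
  proof -
    have "w \<in> D' (g n (2 ^ n))" using that by (simp add: g2 D_def D'_def)
    moreover have "w \<notin> D' (g n 0)" using D'0 by (simp add: g_def)
    ultimately obtain i where "i < 2 ^ n" "w \<notin> D' (g n i)" "w \<in> D' (g n (Suc i))"
      using ex_least_nat_less[of "\<lambda>i. w \<in> D' (g n i)" "2 ^ n"] by (metis order.refl)
    then show ?thesis by (auto simp: P_def)
  qed
  have PD: "w \<in> D" if w: "w \<in> P n i" and "i < 2 ^ n" for w n i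
  proof -
    obtain h where "w \<in> A" "h \<in> H w" "h < g n (Suc i)" using w unfolding P_def D'_def by blast
    moreover have "g n (Suc i) \<le> K" using gK[of "Suc i" n] that(2) by simp
    ultimately show ?thesis by (force simp: D_def)
  qed
  have sumP: "(\<Sum>i<2 ^ n. indicator (P n i) w * c i) = (if w \<in> D then c (THE i. w \<in> P n i) else 0)" for n w and c :: "nat \<Rightarrow> complex"
  proof (cases "w \<in> D")
    case True
    from cover[OF this] obtain i where i: "i < 2 ^ n" "w \<in> P n i" by blast
    have the: "(THE i. w \<in> P n i) = i" using i disj by blast
    have "(\<Sum>i<2 ^ n. indicator (P n i) w * c i) = (\<Sum>j\<in>{i}. indicator (P n j) w * c j)"
      by (rule sum.mono_neutral_right) (use i disj in \<open>auto simp: indicator_def\<close>)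
    then show ?thesis using i True the by simp
  next
    case False
    then show ?thesis using PD by (auto simp: indicator_def intro!: sum.neutral)
  qed
  have iN: "integrable M (N u)" if "u \<ge> 0" for u unfolding N_def by (rule expmart_integrable[OF bm that C])
  have step: "has_bochner_integral M (\<lambda>w. indicator (P n i) w * N K w) (CLINT w|M. indicator (P n i) w * N (g n (Suc i)) w)"
    if "i < 2 ^ n" for n i
    unfolding N_def by (rule expmart_step[OF bm g0 gK Pm[OF that]]) (use that iN[OF g0] in \<open>auto simp: N_def\<close>)
  define f where "f = (\<lambda>n w. \<Sum>i<2 ^ n. indicator (P n i) w * N (g n (Suc i)) w)"
  have iP: "integrable M (\<lambda>w. indicator (P n i) w * N u w)" if "i < 2 ^ n" "u \<ge> 0" for n i u
    using integrable_mult_bounded[OF iN[OF that(2)], of "indicator (P n i)" 1] PM[OF that(1)] by (auto simp: indicator_def mult.commute)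
  have fi: "integrable M (f n)" for n unfolding f_def by (intro Bochner_Integration.integrable_sum iP g0) auto
  have fE: "integral\<^sup>L M (f n) = (CLINT w|M. indicator D w * N K w)" for n
  proof -
    have "integral\<^sup>L M (f n) = (\<Sum>i<2 ^ n. CLINT w|M. indicator (P n i) w * N (g n (Suc i)) w)"
      unfolding f_def by (rule Bochner_Integration.integral_sum) (auto intro!: iP g0)
    also have "\<dots> = (\<Sum>i<2 ^ n. CLINT w|M. indicator (P n i) w * N K w)"
      by (rule sum.cong) (use has_bochner_integral_integral_eq[OF step] in auto)
    also have "\<dots> = (CLINT w|M. (\<Sum>i<2 ^ n. indicator (P n i) w * N K w))"
      by (rule Bochner_Integration.integral_sum[symmetric]) (use K in \<open>auto intro!: iP\<close>)
    also have "\<dots> = (CLINT w|M. indicator D w * N K w)"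
      unfolding sumP by (rule Bochner_Integration.integral_cong) auto
    finally show ?thesis .
  qed
  \<comment> \<open>The square of |N| equals this real martingale up to the factor exp(u c), which
    is bounded for u <= K. As L is nonnegative, summing over the cells bounds the second moments
    uniformly in n.\<close>
  define L where "L = (\<lambda>u w. expmart (of_real (2 * Re a)) (of_real (2 * Re b)) u (B u w))"
  define c where "c = (Re a)\<^sup>2 + (Im a)\<^sup>2 + ((Re b)\<^sup>2 + (Im b)\<^sup>2)"
  have c0: "c \<ge> 0" by (simp add: c_def)
  have normN: "(norm (N u w))\<^sup>2 = Re (L u w) * exp (u * c)" for u w
  proof -
    define y where "y = B u w"
    have "L u w = complex_of_real (exp (2 * Re a * fst y + 2 * Re b * snd y - u * (4 * (Re a)\<^sup>2 + 4 * (Re b)\<^sup>2) / 2))"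
      unfolding L_def expmart_def y_def[symmetric] by (simp add: exp_of_real[symmetric] power_mult_distrib)
    then have "Re (L u w) = exp (2 * Re a * fst y + 2 * Re b * snd y - u * (4 * (Re a)\<^sup>2 + 4 * (Re b)\<^sup>2) / 2)" by simp
    moreover have "(norm (N u w))\<^sup>2 = exp (2 * (Re a * fst y + Re b * snd y - u * Re (a\<^sup>2 + b\<^sup>2) / 2))"
      unfolding N_def expmart_norm y_def[symmetric] by (simp only: exp_double)
    moreover have "2 * (Re a * fst y + Re b * snd y - u * Re (a\<^sup>2 + b\<^sup>2) / 2) = (2 * Re a * fst y + 2 * Re b * snd y - u * (4 * (Re a)\<^sup>2 + 4 * (Re b)\<^sup>2) / 2) + u * c"
      by (simp add: c_def power2_eq_square field_simps)
    ultimately show ?thesis by (simp only: exp_add)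
  qed
  have C': "norm (expmart (of_real (2 * Re a)) (of_real (2 * Re b)) 0 (B 0 w)) \<le> C\<^sup>2" if "w \<in> space M" for w
  proof -
    have "norm (expmart (of_real (2 * Re a)) (of_real (2 * Re b)) 0 (B 0 w)) = (norm (expmart a b 0 (B 0 w)))\<^sup>2"
      unfolding expmart_norm exp_double[symmetric] by (rule arg_cong[of _ _ exp]) (simp add: algebra_simps)
    also have "\<dots> \<le> C\<^sup>2" by (rule power_mono[OF C[OF that]]) simp
    finally show ?thesis .
  qed
  have iL: "integrable M (L u)" if "u \<ge> 0" for u unfolding L_def by (rule expmart_integrable[OF bm that C'])
  have L0: "Re (L u w) \<ge> 0" for u w
    using normN[of u w] zero_le_power2[of "norm (N u w)"] by (metis exp_gt_zero zero_le_mult_iff not_less)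
  have stepL: "has_bochner_integral M (\<lambda>w. indicator (P n i) w * L K w) (CLINT w|M. indicator (P n i) w * L (g n (Suc i)) w)"
    if "i < 2 ^ n" for n i
    unfolding L_def by (rule expmart_step[OF bm g0 gK Pm[OF that]]) (use that iL[OF g0] in \<open>auto simp: L_def\<close>)
  have iPL: "integrable M (\<lambda>w. indicator (P n i) w * L u w)" if "i < 2 ^ n" "u \<ge> 0" for n i u
    using integrable_mult_bounded[OF iL[OF that(2)], of "indicator (P n i)" 1] PM[OF that(1)] by (auto simp: indicator_def mult.commute)
  define l where "l = (\<lambda>n w. \<Sum>i<2 ^ n. indicator (P n i) w * L (g n (Suc i)) w)"
  have li: "integrable M (l n)" for n unfolding l_def by (intro Bochner_Integration.integrable_sum iPL g0) auto
  have lE: "Re (integral\<^sup>L M (l n)) \<le> Re (integral\<^sup>L M (L K))" for n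
  proof -
    have "integral\<^sup>L M (l n) = (\<Sum>i<2 ^ n. CLINT w|M. indicator (P n i) w * L (g n (Suc i)) w)"
      unfolding l_def by (rule Bochner_Integration.integral_sum) (auto intro!: iPL g0)
    also have "\<dots> = (\<Sum>i<2 ^ n. CLINT w|M. indicator (P n i) w * L K w)"
      by (rule sum.cong) (use has_bochner_integral_integral_eq[OF stepL] in auto)
    also have "\<dots> = (CLINT w|M. (\<Sum>i<2 ^ n. indicator (P n i) w * L K w))"
      by (rule Bochner_Integration.integral_sum[symmetric]) (use K in \<open>auto intro!: iPL\<close>)
    finally have eq: "integral\<^sup>L M (l n) = (CLINT w|M. (\<Sum>i<2 ^ n. indicator (P n i) w * L K w))" .
    have isum: "integrable M (\<lambda>w. \<Sum>i<2 ^ n. indicator (P n i) w * L K w)"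
      by (rule Bochner_Integration.integrable_sum, rule iPL) (use K in auto)
    have "Re (integral\<^sup>L M (l n)) = (LINT w|M. Re (\<Sum>i<2 ^ n. indicator (P n i) w * L K w))"
      by (simp only: eq integral_Re[OF isum])
    also have "\<dots> \<le> (LINT w|M. Re (L K w))"
    proof (rule integral_mono)
      show "integrable M (\<lambda>w. Re (\<Sum>i<2 ^ n. indicator (P n i) w * L K w))"
        by (rule integrable_Re[OF isum])
      show "Re (\<Sum>i<2 ^ n. indicator (P n i) w * L K w) \<le> Re (L K w)" for w
        unfolding sumP using L0[of K w] by auto
    qed (use iL K in auto)
    finally show ?thesis using iL[of K] K by (simp add: integral_Re)
  qed
  have f2: "(norm (f n w))\<^sup>2 \<le> Re (l n w) * exp (K * c)" for n w
  proof (cases "w \<in> D")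
    case True
    then obtain i where i: "i < 2 ^ n" "w \<in> P n i" using cover by blast
    have the: "(THE i. w \<in> P n i) = i" using i disj by blast
    have "(norm (f n w))\<^sup>2 = Re (L (g n (Suc i)) w) * exp (g n (Suc i) * c)"
      unfolding f_def sumP the using True normN by simp
    also have "\<dots> \<le> Re (L (g n (Suc i)) w) * exp (K * c)"
      using gK[of "Suc i" n] i(1) c0 by (intro mult_left_mono L0) (auto intro!: mult_right_mono)
    finally show ?thesis unfolding l_def sumP the using True by simp
  next
    case False then show ?thesis unfolding f_def l_def sumP by simp
  qed
  have if2: "integrable M (\<lambda>w. (norm (f n w))\<^sup>2)" for n
    by (rule Bochner_Integration.integrable_bound[where f="\<lambda>w. Re (l n w) * exp (K * c)"])
      (use f2 li fi[THEN borel_measurable_integrable] in \<open>auto intro!: borel_measurable_power borel_measurable_norm AE_I2 order_trans[OF f2]\<close>)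
  have bd: "(LINT w|M. (norm (f n w))\<^sup>2) \<le> Re (integral\<^sup>L M (L K)) * exp (K * c)" for n
  proof -
    have "(LINT w|M. (norm (f n w))\<^sup>2) \<le> (LINT w|M. Re (l n w) * exp (K * c))"
      by (rule integral_mono) (use if2 li f2 in auto)
    also have "\<dots> = Re (integral\<^sup>L M (l n)) * exp (K * c)" using li by (simp add: integral_Re)
    also have "\<dots> \<le> Re (integral\<^sup>L M (L K)) * exp (K * c)" by (intro mult_right_mono lE) simp
    finally show ?thesis .
  qed
  define F where "F = (\<lambda>w. indicator D w * expmart a b (Inf (H w)) (B (Inf (H w)) w))"
  have lim: "(\<lambda>n. f n w) \<longlonglongrightarrow> F w" if w: "w \<in> space M" for w
  proof (cases "w \<in> D")
    case False then show ?thesis unfolding f_def sumP F_def by simp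
  next
    case True
    define S where "S = Inf (H w)"
    have ne: "H w \<noteq> {}" using True by (auto simp: D_def)
    have bdd: "bdd_below (H w)" using H[of w] by (intro bdd_belowI[of _ 0]) auto
    have S0: "S \<ge> 0" unfolding S_def by (rule cInf_greatest[OF ne]) (use H in auto)
    \<comment> \<open>The right end of the cell that contains the infimum; it exceeds the infimum by
      at most one mesh width.\<close>
    define u where "u = (\<lambda>n. g n (Suc (THE i. w \<in> P n i)))"
    have u: "S \<le> u n \<and> u n \<le> S + K * (1 / 2) ^ n" for n
    proof -
      obtain i where i: "i < 2 ^ n" "w \<in> P n i" using cover[OF True] by blast
      have the: "(THE i. w \<in> P n i) = i" using i disj by blast
      obtain h where h: "h \<in> H w" "h < g n (Suc i)" using i(2) unfolding P_def D'_def by blast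
      have "S \<le> g n (Suc i)" using cInf_lower[OF h(1) bdd] h(2) by (simp add: S_def)
      moreover have "g n i \<le> S" unfolding S_def
        by (rule cInf_greatest[OF ne]) (use i(2) True in \<open>force simp: P_def D'_def D_def\<close>)
      moreover have "g n (Suc i) = g n i + K * (1 / 2) ^ n" by (simp add: g_def power_one_over field_simps)
      ultimately show ?thesis unfolding u_def the by simp
    qed
    have "u \<longlonglongrightarrow> S"
    proof (rule tendsto_sandwich[where f="\<lambda>_. S" and h="\<lambda>n. S + K * (1 / 2) ^ n"])
      have "(\<lambda>n. S + K * (1 / 2 :: real) ^ n) \<longlonglongrightarrow> S + K * 0"
        by (intro tendsto_add tendsto_mult tendsto_const LIMSEQ_power_zero) simp
      then show "(\<lambda>n. S + K * (1 / 2) ^ n) \<longlonglongrightarrow> S" by simp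
    qed (use u in \<open>auto intro!: always_eventually\<close>)
    moreover have "(\<lambda>n. B (u n) w) \<longlonglongrightarrow> B S w"
      by (rule continuous_on_tendsto_compose[OF bm_continuous[OF bm w] \<open>u \<longlonglongrightarrow> S\<close>])
        (use S0 u in \<open>auto intro!: always_eventually intro: order_trans\<close>)
    ultimately have "(\<lambda>n. expmart a b (u n) (B (u n) w)) \<longlonglongrightarrow> expmart a b S (B S w)"
      unfolding expmart_def by (intro tendsto_intros) auto
    then show ?thesis unfolding f_def sumP F_def N_def using True by (simp add: u_def S_def)
  qed
  have Fm: "F \<in> borel_measurable M"
    by (rule borel_measurable_LIMSEQ_metric[OF _ lim]) (use fi in auto)
  note conv = L2_bounded_tendsto[OF finite_measure_axioms borel_measurable_integrable[OF fi] Fm lim if2 bd]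
  have "integral\<^sup>L M F = (CLINT w|M. indicator D w * N K w)"
    using LIMSEQ_unique[OF conv(2)] fE by (simp add: tendsto_const)
  with conv(1) show ?thesis unfolding has_bochner_integral_iff F_def N_def by simp
qed

lemma mem_sets_of_nat_filtration:
  "bm M B \<Longrightarrow> A \<in> sets (nat_filtration M B q) \<Longrightarrow> A \<in> sets M"
  using nat_filtration_subset[of B M q] bm_measurable[of M B] by blast

text \<open>Before the hit the first coordinate B1 stays above -\<alpha>. For l > 0 the martingale
  exp(-l B1 - u l^2/2) is then at most exp(l \<alpha>) at the hit, and at most exp(l \<alpha> - K
  l^2/2) at time K if there was no hit. Letting K grow gives E exp(-l B1(0)) <= exp(l \<alpha>)
  P(hit), and l to 0 gives P(hit) >= 1.\<close>

lemma hit_AE: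
  fixes H :: "'a \<Rightarrow> real set"
  assumes bm: "bm M B" and H: "\<And>w. H w \<subseteq> {0..}"
    and meas: "\<And>q. 0 < q \<Longrightarrow> {w\<in>space M. \<exists>h\<in>H w. h < q} \<in> sets (nat_filtration M B q)"
    and lower: "\<And>w u. w \<in> space M \<Longrightarrow> u \<ge> 0 \<Longrightarrow> (\<And>h. h \<in> H w \<Longrightarrow> u \<le> h) \<Longrightarrow> fst (B u w) \<ge> - \<alpha>"
    and lower0: "\<And>w. w \<in> space M \<Longrightarrow> fst (B 0 w) \<ge> - \<alpha>"
  shows "AE w in M. H w \<noteq> {}"
proof -
  interpret prob_space M by (rule bm_prob[OF bm])
  define D where "D = (\<lambda>K. {w\<in>space M. \<exists>h\<in>H w. h < real (Suc K)})"
  have DM: "D K \<in> sets M" for K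
    unfolding D_def by (rule mem_sets_of_nat_filtration[OF bm meas]) simp
  have U: "{w\<in>space M. H w \<noteq> {}} = (\<Union>K. D K)"
  proof -
    have "\<exists>K. \<exists>h\<in>H w. h < real (Suc K)" if Hw: "H w \<noteq> {}" for w
    proof -
      obtain h where "h \<in> H w" using Hw by blast
      moreover obtain K :: nat where "h < real K" using reals_Archimedean2 by blast
      ultimately show ?thesis by (intro exI[of _ K] bexI[of _ h]) auto
    qed
    then show ?thesis unfolding D_def by auto
  qed
  then have UM: "{w\<in>space M. H w \<noteq> {}} \<in> sets M" using DM by auto
  define p where "p = prob {w\<in>space M. H w \<noteq> {}}"
  define B0 where "B0 = (\<lambda>w. fst (B 0 w))"
  have B0m: "B0 \<in> borel_measurable M"
    unfolding B0_def by (rule measurable_fst_snd_real[OF bm_measurable[OF bm]]) simp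
  have ineq: "(LINT w|M. exp (- l * B0 w)) \<le> exp (l * \<alpha>) * p" if l: "l > 0" for l :: real
  proof -
    define N where "N = (\<lambda>u w. exp (- l * fst (B u w) - u * l\<^sup>2 / 2))"
    have e: "expmart (complex_of_real (- l)) 0 u (B u w) = complex_of_real (N u w)" for u w
      by (simp add: expmart_def N_def exp_of_real[symmetric])
    have bd0: "norm (expmart (complex_of_real (- l)) 0 0 (B 0 w)) \<le> exp (l * \<alpha>)" if "w \<in> space M" for w
      unfolding e using lower0[OF that] l by (simp add: N_def mult_left_mono[of "- fst (B 0 w)" \<alpha> l, simplified])
    have iN: "integrable M (N u)" if "u \<ge> 0" for u
      using expmart_integrable[OF bm that bd0, THEN integrable_Re] unfolding e by simp
    have EN: "integral\<^sup>L M (N u) = integral\<^sup>L M (N 0)" if "u \<ge> 0" for u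
    proof -
      have "complex_of_real (LINT w|M. indicator (space M) w * N u w) = complex_of_real (LINT w|M. indicator (space M) w * N 0 w)"
        using has_bochner_integral_integral_eq[OF expmart_step[OF bm order_refl that _ expmart_integrable[OF bm order_refl bd0], of "space M"]]
          sets.top[of "nat_filtration M B 0"]
        unfolding e integral_complex_of_real[symmetric] by (simp add: of_real_indicator)
      then have "(LINT w|M. indicator (space M) w * N u w) = (LINT w|M. indicator (space M) w * N 0 w)" by (simp only: of_real_eq_iff)
      moreover have "(LINT w|M. indicator (space M) w * N u w) = integral\<^sup>L M (N u)" for u
        by (rule Bochner_Integration.integral_cong) auto
      ultimately show ?thesis by simp
    qed
    have K: "integral\<^sup>L M (N 0) \<le> exp (l * \<alpha>) * p + exp (l * \<alpha>) * exp (- (real (Suc K) * l\<^sup>2 / 2))" for K :: nat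
    proof -
      let ?K = "real (Suc K)"
      have os: "has_bochner_integral M (\<lambda>w. indicator (D K) w * complex_of_real (N (Inf (H w)) w)) (CLINT w|M. indicator (D K) w * complex_of_real (N ?K w))"
        using optional_stopping_bounded[OF bm bd0 _ order_refl H meas, of ?K] unfolding e D_def by simp
      have os_int: "integrable M (\<lambda>w. indicator (D K) w * N (Inf (H w)) w)"
      proof -
        have "complex_integrable M (\<lambda>w. complex_of_real (indicator (D K) w * N (Inf (H w)) w))"
          using os[unfolded has_bochner_integral_iff, THEN conjunct1] by (simp only: of_real_mult of_real_indicator)
        then show ?thesis by (simp only: complex_of_real_integrable_eq)
      qed
      have os_eq: "(LINT w|M. indicator (D K) w * N (Inf (H w)) w) = (LINT w|M. indicator (D K) w * N ?K w)"
      proof -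
        have "complex_of_real (LINT w|M. indicator (D K) w * N (Inf (H w)) w) = complex_of_real (LINT w|M. indicator (D K) w * N ?K w)"
          using has_bochner_integral_integral_eq[OF os] by (simp only: integral_complex_of_real[symmetric] of_real_mult of_real_indicator)
        then show ?thesis by (simp only: of_real_eq_iff)
      qed
      have iK: "integrable M (\<lambda>w. indicator (D K) w * N ?K w)"
        using integrable_mult_bounded[OF iN[of ?K], of "indicator (D K)" 1] DM by (auto simp: indicator_def mult.commute)
      have "integral\<^sup>L M (N 0) = (LINT w|M. N ?K w)" using EN[of ?K] by simp
      also have "\<dots> \<le> (LINT w|M. indicator (D K) w * N ?K w + exp (l * \<alpha>) * exp (- (?K * l\<^sup>2 / 2)))"
      proof (rule integral_mono)
        fix w assume w: "w \<in> space M"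
        show "N ?K w \<le> indicator (D K) w * N ?K w + exp (l * \<alpha>) * exp (- (?K * l\<^sup>2 / 2))"
        proof (cases "w \<in> D K")
          case False
          then have "fst (B ?K w) \<ge> - \<alpha>" by (intro lower w) (use w in \<open>force simp: D_def not_less\<close>)+
          then have "- (l * fst (B ?K w)) \<le> l * \<alpha>" using l mult_left_mono[of "- fst (B ?K w)" \<alpha> l] by simp
          then show ?thesis using False by (simp add: N_def exp_add[symmetric])
        qed simp
      qed (use iN iK in auto)
      also have "\<dots> = (LINT w|M. indicator (D K) w * N (Inf (H w)) w) + exp (l * \<alpha>) * exp (- (?K * l\<^sup>2 / 2))"
        unfolding os_eq using iK by (simp add: prob_space)
      also have "(LINT w|M. indicator (D K) w * N (Inf (H w)) w) \<le> (LINT w|M. indicator (D K) w * exp (l * \<alpha>))"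
      proof (rule integral_mono)
        show "integrable M (\<lambda>w. indicator (D K) w * exp (l * \<alpha>))" using DM by (simp add: emeasure_eq_measure)
        fix w assume w: "w \<in> space M"
        show "indicator (D K) w * N (Inf (H w)) w \<le> indicator (D K) w * exp (l * \<alpha>)"
        proof (cases "w \<in> D K")
          case True
          then have ne: "H w \<noteq> {}" by (auto simp: D_def)
          have S0: "Inf (H w) \<ge> 0" by (rule cInf_greatest[OF ne]) (use H in auto)
          have "fst (B (Inf (H w)) w) \<ge> - \<alpha>"
            by (rule lower[OF w S0]) (rule cInf_lower, use H[of w] in \<open>auto intro: bdd_belowI[of _ 0]\<close>)
          then have "- (l * fst (B (Inf (H w)) w)) \<le> l * \<alpha>" using l mult_left_mono[of "- fst (B (Inf (H w)) w)" \<alpha> l] by simp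
          moreover have "Inf (H w) * l\<^sup>2 / 2 \<ge> 0" using S0 by simp
          ultimately show ?thesis using True by (simp add: N_def)
        qed simp
      qed (rule os_int)
      also have "(LINT w|M. indicator (D K) w * exp (l * \<alpha>)) = exp (l * \<alpha>) * prob (D K)"
        using DM by simp
      also have "prob (D K) \<le> p" unfolding p_def by (rule finite_measure_mono) (use UM in \<open>auto simp: D_def\<close>)
      finally show ?thesis by simp
    qed
    have "integral\<^sup>L M (N 0) \<le> exp (l * \<alpha>) * p + exp (l * \<alpha>) * 0"
    proof (rule LIMSEQ_le_const)
      have "(\<lambda>K. exp (- (l\<^sup>2 / 2)) ^ Suc K) \<longlonglongrightarrow> 0"
        by (rule LIMSEQ_Suc[OF LIMSEQ_power_zero]) (use l in simp)
      also have "(\<lambda>K. exp (- (l\<^sup>2 / 2)) ^ Suc K) = (\<lambda>K. exp (- (real (Suc K) * l\<^sup>2 / 2)))"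
        by (simp only: exp_of_nat_mult[symmetric]) simp
      finally have "(\<lambda>K. exp (- (real (Suc K) * l\<^sup>2 / 2))) \<longlonglongrightarrow> 0" .
      then show "(\<lambda>K. exp (l * \<alpha>) * p + exp (l * \<alpha>) * exp (- (real (Suc K) * l\<^sup>2 / 2))) \<longlonglongrightarrow> exp (l * \<alpha>) * p + exp (l * \<alpha>) * 0"
        by (intro tendsto_intros)
    qed (use K in auto)
    then show ?thesis by (simp add: N_def B0_def)
  qed
  have "(\<lambda>n. LINT w|M. exp (- (1 / real (Suc n)) * B0 w)) \<longlonglongrightarrow> (LINT w|M. exp (- 0 * B0 w))"
  proof (rule integral_dominated_convergence[where w="\<lambda>_. exp \<bar>\<alpha>\<bar>"])
    show "AE w in M. (\<lambda>n. exp (- (1 / real (Suc n)) * B0 w)) \<longlonglongrightarrow> exp (- 0 * B0 w)"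
      by (intro AE_I2 tendsto_intros LIMSEQ_Suc[OF lim_1_over_n])
    show "AE w in M. norm (exp (- (1 / real (Suc n)) * B0 w)) \<le> exp \<bar>\<alpha>\<bar>" for n
    proof (rule AE_I2)
      fix w assume "w \<in> space M"
      then have "- B0 w \<le> \<bar>\<alpha>\<bar>" using lower0 by (force simp: B0_def)
      then have "(1 / real (Suc n)) * (- B0 w) \<le> (1 / real (Suc n)) * \<bar>\<alpha>\<bar>" by (rule mult_left_mono) simp
      also have "\<dots> \<le> 1 * \<bar>\<alpha>\<bar>" by (rule mult_right_mono) auto
      finally show "norm (exp (- (1 / real (Suc n)) * B0 w)) \<le> exp \<bar>\<alpha>\<bar>" by simp
    qed
  qed (use B0m in auto)
  then have l1: "(\<lambda>n. LINT w|M. exp (- (1 / real (Suc n)) * B0 w)) \<longlonglongrightarrow> 1" by (simp add: prob_space)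
  have l2: "(\<lambda>n. exp ((1 / real (Suc n)) * \<alpha>) * p) \<longlonglongrightarrow> exp (0 * \<alpha>) * p"
    by (intro tendsto_intros LIMSEQ_Suc[OF lim_1_over_n])
  have "1 \<le> exp (0 * \<alpha>) * p"
    by (rule LIMSEQ_le[OF l1 l2]) (intro exI[of _ 0] allI impI ineq, simp)
  then have "prob {w\<in>space M. H w \<noteq> {}} = 1" using prob_le_1[of "{w\<in>space M. H w \<noteq> {}}"] unfolding p_def by simp
  then have "AE w in M. w \<in> {w\<in>space M. H w \<noteq> {}}" using UM by (rule AE_in_set_eq_1[THEN iffD2, rotated])
  then show ?thesis by eventually_elim simp
qed

text \<open>With a^2 + b^2 = 0 there is no compensator. Both stopped values are compared with the
  value at a fixed time K, and the two comparisons differ on the event that H' but not H was hit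
  before K. There the value at K is bounded by C, and the event disappears as K grows. The larger
  set H' gives the earlier time. Sample points with empty H w are sent to 0, since the infimum of
  the empty set carries no information.\<close>

lemma optional_stopping:
  fixes H :: "'a \<Rightarrow> real set"
  assumes bm: "bm M B" and ab: "a\<^sup>2 + b\<^sup>2 = 0"
    and C: "\<And>w. w \<in> space M \<Longrightarrow> norm (expmart a b 0 (B 0 w)) \<le> C"
    and A: "A \<in> sets M"
    and H: "\<And>w. H w \<subseteq> H' w" "\<And>w. H' w \<subseteq> {0..}" and ne: "AE w in M. H w \<noteq> {}"
    and meas: "\<And>q. 0 < q \<Longrightarrow> {w\<in>A. \<exists>h\<in>H w. h < q} \<in> sets (nat_filtration M B q)"
    and meas': "\<And>q. 0 < q \<Longrightarrow> {w\<in>A. \<exists>h\<in>H' w. h < q} \<in> sets (nat_filtration M B q)"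
    and bound: "\<And>w u. w \<in> space M \<Longrightarrow> u \<ge> 0 \<Longrightarrow> (\<And>h. h \<in> H w \<Longrightarrow> u \<le> h) \<Longrightarrow> norm (expmart a b 0 (B u w)) \<le> C"
  shows "(CLINT w|M. if H w = {} then 0 else indicator A w * expmart a b 0 (B (Inf (H w)) w)) =
    (CLINT w|M. if H w = {} then 0 else indicator A w * expmart a b 0 (B (Inf (H' w)) w))"
proof -
  interpret prob_space M by (rule bm_prob[OF bm])
  have u0: "expmart a b u = expmart a b 0" for u unfolding expmart_def using ab by (intro ext) simp
  have AS: "A \<subseteq> space M" using sets.sets_into_space[OF A] .
  define D where "D = (\<lambda>J K. {w\<in>A. \<exists>h\<in>J w. h < real (Suc K)} :: 'a set)"
  define Y where "Y = (\<lambda>J w. expmart a b 0 (B (Inf (J w :: real set)) w))"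
  have DM: "D H K \<in> sets M" "D H' K \<in> sets M" for K
    unfolding D_def using mem_sets_of_nat_filtration[OF bm meas] mem_sets_of_nat_filtration[OF bm meas'] by auto
  have H0: "H w \<subseteq> {0..}" for w using H by blast
  have os: "has_bochner_integral M (\<lambda>w. indicator (D H K) w * Y H w) (CLINT w|M. indicator (D H K) w * expmart a b 0 (B (real (Suc K)) w))" for K
    using optional_stopping_bounded[OF bm C _ AS H0 meas, of "real (Suc K)"] unfolding u0[of "real (Suc K)"] u0[of "Inf _"] D_def Y_def by simp
  have os': "has_bochner_integral M (\<lambda>w. indicator (D H' K) w * Y H' w) (CLINT w|M. indicator (D H' K) w * expmart a b 0 (B (real (Suc K)) w))" for K
    using optional_stopping_bounded[OF bm C _ AS H(2) meas', of "real (Suc K)"] unfolding u0[of "real (Suc K)"] u0[of "Inf _"] D_def Y_def by simp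
  have Hfin: "\<exists>K0. \<forall>K\<ge>K0. \<exists>h\<in>J. h < real (Suc K)" if J: "J \<noteq> {}" for J :: "real set"
  proof -
    obtain h where "h \<in> J" using J by blast
    moreover obtain K0 :: nat where "h < real K0" using reals_Archimedean2 by blast
    ultimately show ?thesis by (intro exI[of _ K0] allI impI bexI[of _ h]) auto
  qed
  have limD: "(\<lambda>K. indicator (D J K) w * y) \<longlonglongrightarrow> indicator A w * (y::complex)" if J: "J w \<noteq> {}" for J w y
  proof (rule tendsto_eventually)
    obtain K0 where "\<forall>K\<ge>K0. \<exists>h\<in>J w. h < real (Suc K)" using Hfin[OF J] by blast
    then show "\<forall>\<^sub>F K in sequentially. indicator (D J K) w * y = indicator A w * y"
      unfolding eventually_sequentially by (intro exI[of _ K0]) (auto simp: D_def indicator_def)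
  qed
  have before: "norm (Y H w) \<le> C" if "w \<in> space M" "H w \<noteq> {}" for w
    unfolding Y_def by (rule bound[OF that(1)])
      (use that H0[of w] in \<open>auto intro!: cInf_greatest cInf_lower intro: bdd_belowI[of _ 0]\<close>)
  have before': "norm (Y H' w) \<le> C" if "w \<in> space M" "H w \<noteq> {}" for w
  proof -
    have ne': "H' w \<noteq> {}" using that H(1) by blast
    show ?thesis unfolding Y_def
      by (rule bound[OF that(1)])
        (use ne' H(1)[of w] H(2)[of w] in \<open>auto intro!: cInf_greatest cInf_lower intro: bdd_belowI[of _ 0]\<close>)
  qed
  have mH: "(\<lambda>w. indicator (D H K) w * Y H w) \<in> borel_measurable M" "(\<lambda>w. indicator (D H' K) w * Y H' w) \<in> borel_measurable M" for K
    using os[of K] os'[of K] by (auto simp: has_bochner_integral_iff)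
  have measY: "(\<lambda>w. if H w = {} then 0 else indicator A w * Y J w) \<in> borel_measurable M" if "J = H \<or> J = H'" for J
  proof (rule borel_measurable_LIMSEQ_metric)
    have "D H K \<in> sets M" for K by (rule DM)
    show "(\<lambda>w. indicator (D H K) w * (indicator (D J K) w * Y J w)) \<in> borel_measurable M" for K
    proof -
      have ind: "(\<lambda>w. indicator (D H K) w :: complex) \<in> borel_measurable M" using DM by simp
      show ?thesis using that by (elim disjE) (simp_all only: borel_measurable_times[OF ind mH(1)] borel_measurable_times[OF ind mH(2)])
    qed
    fix w assume "w \<in> space M"
    show "(\<lambda>K. indicator (D H K) w * (indicator (D J K) w * Y J w)) \<longlonglongrightarrow> (if H w = {} then 0 else indicator A w * Y J w)"
    proof (cases "H w = {}")
      case True then show ?thesis by (simp add: D_def)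
    next
      case False
      then have "J w \<noteq> {}" using that H(1) by blast
      have "(\<lambda>K. indicator (D H K) w * (1::complex) * (indicator (D J K) w * Y J w)) \<longlonglongrightarrow> indicator A w * 1 * (indicator A w * Y J w)"
        by (intro tendsto_mult limD False \<open>J w \<noteq> {}\<close>)
      then show ?thesis using False by (cases "w \<in> A") (auto simp: indicator_def)
    qed
  qed
  have l1: "(\<lambda>K. CLINT w|M. indicator (D H K) w * Y H w) \<longlonglongrightarrow> (CLINT w|M. if H w = {} then 0 else indicator A w * Y H w)"
  proof (rule integral_dominated_convergence[where w="\<lambda>_. norm C"])
    show "AE w in M. (\<lambda>K. indicator (D H K) w * Y H w) \<longlonglongrightarrow> (if H w = {} then 0 else indicator A w * Y H w)"
      using ne by eventually_elim (simp add: limD)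
    show "AE w in M. norm (indicator (D H K) w * Y H w) \<le> norm C" for K
      by (rule AE_I2) (use before in \<open>auto simp: indicator_def D_def intro: order_trans[OF _ abs_ge_self]\<close>)
  qed (use mH measY in auto)
  have l2: "(\<lambda>K. CLINT w|M. indicator (D H' K) w * Y H' w) \<longlonglongrightarrow> (CLINT w|M. if H w = {} then 0 else indicator A w * Y H' w)"
  proof (rule integral_dominated_convergence[where w="\<lambda>_. norm C"])
    show "AE w in M. (\<lambda>K. indicator (D H' K) w * Y H' w) \<longlonglongrightarrow> (if H w = {} then 0 else indicator A w * Y H' w)"
      using ne
    proof eventually_elim
      case (elim w)
      then have "H' w \<noteq> {}" using H(1) by blast
      from limD[of H' w, OF this] elim show ?case by simp
    qed
    show "AE w in M. norm (indicator (D H' K) w * Y H' w) \<le> norm C" for K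
      using ne AE_space
      by eventually_elim (use before' in \<open>auto simp: indicator_def D_def intro: order_trans[OF _ abs_ge_self]\<close>)
  qed (use mH measY in auto)
  have "(\<lambda>K. (CLINT w|M. indicator (D H' K) w * expmart a b 0 (B (real (Suc K)) w)) - (CLINT w|M. indicator (D H K) w * expmart a b 0 (B (real (Suc K)) w))) \<longlonglongrightarrow> 0"
  proof -
    have iE: "integrable M (\<lambda>w. expmart a b 0 (B (real (Suc K)) w))" for K
      using expmart_integrable[OF bm _ C, of "real (Suc K)"] unfolding u0[of "real (Suc K)"] by simp
    have iDE: "integrable M (\<lambda>w. indicator X w * expmart a b 0 (B (real (Suc K)) w))" if "X \<in> sets M" for X K
      using integrable_mult_bounded[OF iE[of K], of "indicator X" 1] that by (auto simp: indicator_def mult.commute)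
    have "(\<lambda>K. CLINT w|M. indicator (D H' K) w * expmart a b 0 (B (real (Suc K)) w) - indicator (D H K) w * expmart a b 0 (B (real (Suc K)) w)) \<longlonglongrightarrow> (CLINT w|M. 0)"
    proof (rule integral_dominated_convergence[where w="\<lambda>_. norm C"])
      have sub: "D H K \<subseteq> D H' K" for K using H(1) by (force simp: D_def)
      show "AE w in M. norm (indicator (D H' K) w * expmart a b 0 (B (real (Suc K)) w) - indicator (D H K) w * expmart a b 0 (B (real (Suc K)) w)) \<le> norm C" for K
      proof (rule AE_I2)
        fix w assume w: "w \<in> space M"
        show "norm (indicator (D H' K) w * expmart a b 0 (B (real (Suc K)) w) - indicator (D H K) w * expmart a b 0 (B (real (Suc K)) w)) \<le> norm C"
        \<comment> \<open>On this event K does not exceed any element of H w, so the bound up to the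
          hit of H applies at time K.\<close>
        proof (cases "w \<in> D H' K \<and> w \<notin> D H K")
          case True
          then have "norm (expmart a b 0 (B (real (Suc K)) w)) \<le> C"
            by (intro bound w) (force simp: D_def not_less)+
          then show ?thesis using True by simp
        next
          case False
          then show ?thesis using sub[of K] by (auto simp: indicator_def)
        qed
      qed
      show "AE w in M. (\<lambda>K. indicator (D H' K) w * expmart a b 0 (B (real (Suc K)) w) - indicator (D H K) w * expmart a b 0 (B (real (Suc K)) w)) \<longlonglongrightarrow> 0"
        using ne
      proof eventually_elim
        case (elim w)
        obtain K0 where K0: "\<forall>K\<ge>K0. \<exists>h\<in>H w. h < real (Suc K)" using Hfin[OF elim] by blast
        then have K0': "\<forall>K\<ge>K0. \<exists>h\<in>H' w. h < real (Suc K)" using H(1) by blast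
        show ?case
        proof (rule tendsto_eventually, unfold eventually_sequentially, intro exI[of _ K0] allI impI)
          fix K assume "K \<ge> K0"
          then have "w \<in> D H' K \<longleftrightarrow> w \<in> A" "w \<in> D H K \<longleftrightarrow> w \<in> A" using K0 K0' unfolding D_def by blast+
          then show "indicator (D H' K) w * expmart a b 0 (B (real (Suc K)) w) - indicator (D H K) w * expmart a b 0 (B (real (Suc K)) w) = 0"
            by (simp add: indicator_def)
        qed
      qed
    qed (use iDE DM in auto)
    then show ?thesis using iDE[OF DM(1)] iDE[OF DM(2)] by simp
  qed
  moreover have "(\<lambda>K. (CLINT w|M. indicator (D H' K) w * expmart a b 0 (B (real (Suc K)) w)) - (CLINT w|M. indicator (D H K) w * expmart a b 0 (B (real (Suc K)) w)))
    \<longlonglongrightarrow> (CLINT w|M. if H w = {} then 0 else indicator A w * Y H' w) - (CLINT w|M. if H w = {} then 0 else indicator A w * Y H w)"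
    using tendsto_diff[OF l2 l1] unfolding has_bochner_integral_integral_eq[OF os] has_bochner_integral_integral_eq[OF os'] .
  ultimately have "(CLINT w|M. if H w = {} then 0 else indicator A w * Y H' w) - (CLINT w|M. if H w = {} then 0 else indicator A w * Y H w) = 0"
    by (rule LIMSEQ_unique[rotated])
  then show ?thesis unfolding Y_def by simp
qed

section \<open>The exit law from the quadrant and the transition kernel\<close>

text \<open>One continuous function whose sign describes the open quadrant, the closed quadrant and
  E, so that leaving the quadrant is a level crossing of a real path.\<close>

definition mc :: "real \<times> real \<Rightarrow> real" where "mc x = min (fst x) (snd x)"

lemma mc_open_quadrant: "x \<in> open_quadrant \<longleftrightarrow> 0 < mc x"
  and mc_quadrant: "x \<in> quadrant \<longleftrightarrow> 0 \<le> mc x"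
  and mc_E: "x \<in> E \<longleftrightarrow> mc x = 0"
  by (cases x; auto simp: mc_def open_quadrant_def quadrant_def E_def min_def)+

lemma continuous_on_mc: "continuous_on S f \<Longrightarrow> continuous_on S (\<lambda>u. mc (f u))"
  unfolding mc_def by (intro continuous_intros)

lemma mc_measurable[measurable]: "mc \<in> borel_measurable borel"
  by (intro borel_measurable_continuous_onI continuous_on_mc continuous_on_id)

lemma E_borel[measurable]: "E \<in> sets borel"
proof -
  have "E = mc -` {0} \<inter> space borel" by (auto simp: mc_E)
  then show ?thesis using measurable_sets[OF mc_measurable, of "{0}"] by simp
qed

lemma zero_in_E: "0 \<in> E" by (simp add: mc_E mc_def)

lemma E_subset_quadrant: "x \<in> E \<Longrightarrow> x \<in> quadrant" by (simp add: mc_E mc_quadrant)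

definition exit_set :: "(real \<Rightarrow> real \<times> real) \<Rightarrow> real set" where
  "exit_set b = {u. 0 < u \<and> mc (b u) \<le> 0}"

lemma exit_set_nonneg: "exit_set b \<subseteq> {0..}" by (auto simp: exit_set_def)

lemma exit_time_eq: "exit_time b = (if exit_set b = {} then 0 else Inf (exit_set b))"
proof -
  have "exit_set b = {t. 0 < t \<and> b t \<notin> open_quadrant}" by (auto simp: exit_set_def mc_open_quadrant not_less)
  then show ?thesis unfolding exit_time_def by auto
qed

lemma exit_set_measurable:
  assumes "\<And>u. 0 < u \<Longrightarrow> u < q \<Longrightarrow> B u \<in> borel_measurable N" and "\<And>w. w \<in> space N \<Longrightarrow> continuous_on {0..} (\<lambda>u. B u w)"
  shows "{w\<in>space N. \<exists>h\<in>exit_set (\<lambda>u. B u w). h < q} \<in> sets N"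
proof -
  have "{w\<in>space N. \<exists>u. 0 < u \<and> u < q \<and> mc (B u w) \<le> 0} \<in> sets N"
    by (rule hit_measurable) (use assms in \<open>auto intro: continuous_on_mc measurable_compose[OF _ mc_measurable]\<close>)
  moreover have "{w\<in>space N. \<exists>u. 0 < u \<and> u < q \<and> mc (B u w) \<le> 0} = {w\<in>space N. \<exists>h\<in>exit_set (\<lambda>u. B u w). h < q}"
    by (auto simp: exit_set_def)
  ultimately show ?thesis by simp
qed

lemma exit_set_nonempty_measurable:
  assumes "\<And>u. 0 < u \<Longrightarrow> B u \<in> borel_measurable N" and "\<And>w. w \<in> space N \<Longrightarrow> continuous_on {0..} (\<lambda>u. B u w)"
  shows "{w\<in>space N. exit_set (\<lambda>u. B u w) \<noteq> {}} \<in> sets N"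
proof -
  have "{w\<in>space N. \<exists>n::nat. \<exists>h\<in>exit_set (\<lambda>u. B u w). h < real n} \<in> sets N"
    by (intro sets.sets_Collect_countable_Ex exit_set_measurable) (use assms in auto)
  moreover have "{w\<in>space N. \<exists>n::nat. \<exists>h\<in>exit_set (\<lambda>u. B u w). h < real n} = {w\<in>space N. exit_set (\<lambda>u. B u w) \<noteq> {}}"
    using reals_Archimedean2 by blast
  ultimately show ?thesis by simp
qed

lemma continuous_imp_right:
  fixes f :: "real \<Rightarrow> 'b::topological_space"
  assumes "continuous_on {0..} f" "u \<ge> 0"
  shows "continuous (at_right u) f"
proof -
  have "continuous (at u within {0..}) f" using assms by (simp add: continuous_on_eq_continuous_within)
  then show ?thesis by (rule continuous_within_subset) (use assms(2) in auto)
qed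

lemma stopped_measurable:
  fixes B :: "real \<Rightarrow> 'a \<Rightarrow> real \<times> real"
  assumes B: "\<And>u. 0 \<le> u \<Longrightarrow> B u \<in> borel_measurable N" and cont: "\<And>w. w \<in> space N \<Longrightarrow> continuous_on {0..} (\<lambda>u. B u w)"
    and S: "S \<in> borel_measurable N" "\<And>w. w \<in> space N \<Longrightarrow> S w \<ge> 0"
  shows "(\<lambda>w. B (S w) w) \<in> borel_measurable N"
proof (rule borel_measurable_LIMSEQ_metric)
  fix n :: nat
  have "(\<lambda>(u, w). B (min (max u 0) (real n)) w) \<in> borel_measurable (borel \<Otimes>\<^sub>M N)"
    by (rule right_continuous_measurable) (use B cont continuous_imp_right in auto)
  from measurable_compose[OF measurable_Pair[OF S(1) measurable_ident] this]
  show "(\<lambda>w. B (min (max (S w) 0) (real n)) w) \<in> borel_measurable N" by simp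
next
  fix w assume "w \<in> space N"
  then have S0: "S w \<ge> 0" by (rule S(2))
  obtain n0 :: nat where n0: "S w \<le> real n0" using real_arch_simple by blast
  show "(\<lambda>n. B (min (max (S w) 0) (real n)) w) \<longlonglongrightarrow> B (S w) w"
  proof (rule tendsto_eventually, unfold eventually_sequentially, intro exI[of _ n0] allI impI)
    fix n assume "n \<ge> n0"
    then have "min (max (S w) 0) (real n) = S w" using n0 S0 by (auto simp: max_def min_def)
    then show "B (min (max (S w) 0) (real n)) w = B (S w) w" by simp
  qed
qed

lemma exit_time_measurable:
  assumes B: "\<And>u. 0 \<le> u \<Longrightarrow> B u \<in> borel_measurable N" and cont: "\<And>w. w \<in> space N \<Longrightarrow> continuous_on {0..} (\<lambda>u. B u w)"
  shows "(\<lambda>w. exit_time (\<lambda>u. B u w)) \<in> borel_measurable N"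
proof (rule borel_measurable_LIMSEQ_metric)
  \<comment> \<open>The set {0} reproduces the convention of \<open>exit_time\<close> for paths that
    never leave.\<close>
  define H where "H = (\<lambda>w. if exit_set (\<lambda>u. B u w) = {} then {0} else exit_set (\<lambda>u. B u w))"
  have e: "exit_time (\<lambda>u. B u w) = Inf (H w)" for w by (simp add: exit_time_eq H_def)
  fix n :: nat
  show "(\<lambda>w. min (Inf (H w)) (real n)) \<in> borel_measurable N"
  proof (rule hitting_time_measurable)
    fix q :: real assume q: "0 < q"
    have "{w\<in>space N. \<exists>h\<in>H w. h < q} = {w\<in>space N. \<exists>h\<in>exit_set (\<lambda>u. B u w). h < q} \<union> (space N - {w\<in>space N. exit_set (\<lambda>u. B u w) \<noteq> {}})"
      using q by (auto simp: H_def)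
    also have "\<dots> \<in> sets N"
      by (intro sets.Un sets.Diff sets.top exit_set_measurable exit_set_nonempty_measurable) (use B cont in auto)
    finally show "{w\<in>space N. \<exists>h\<in>H w. h < q} \<in> sets N" .
  qed (use exit_set_nonneg in \<open>auto simp: H_def\<close>)
  fix w
  obtain n0 :: nat where n0: "Inf (H w) \<le> real n0" using real_arch_simple by blast
  show "(\<lambda>n. min (Inf (H w)) (real n)) \<longlonglongrightarrow> exit_time (\<lambda>u. B u w)"
    unfolding e by (rule tendsto_eventually, unfold eventually_sequentially, intro exI[of _ n0]) (use n0 in auto)
qed

lemma exit_time_nonneg: "exit_time b \<ge> 0"
  using exit_set_nonneg[of b] by (auto simp: exit_time_eq intro: cInf_greatest)

lemma exit_point_measurable:
  assumes B: "\<And>u. 0 \<le> u \<Longrightarrow> B u \<in> borel_measurable N" and cont: "\<And>w. w \<in> space N \<Longrightarrow> continuous_on {0..} (\<lambda>u. B u w)"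
  shows "(\<lambda>w. B (exit_time (\<lambda>u. B u w)) w) \<in> borel_measurable N"
  by (rule stopped_measurable[OF B cont exit_time_measurable[OF B cont] exit_time_nonneg])

lemma quadrant_before_exit:
  assumes cont: "continuous_on {0..} b" and 0: "b 0 \<in> quadrant" and u: "u \<ge> 0" "\<And>h. h \<in> exit_set b \<Longrightarrow> u \<le> h"
  shows "b u \<in> quadrant"
proof (cases "u = 0")
  case False
  then show ?thesis unfolding mc_quadrant
    by (intro nonneg_before_hit[OF continuous_on_mc[OF cont]]) (use u in \<open>auto simp: exit_set_def\<close>)
qed (use 0 in simp)

lemma exit_point_in_E:
  assumes cont: "continuous_on {0..} b" and 0: "b 0 \<in> quadrant" and ne: "exit_set b \<noteq> {}"
  shows "b (exit_time b) \<in> E"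
proof -
  have T: "exit_time b = Inf (exit_set b)" using ne by (simp add: exit_time_eq)
  have "mc (b (exit_time b)) \<le> 0"
    unfolding T by (rule nonpos_at_hit[OF continuous_on_mc[OF cont] ne exit_set_nonneg]) (simp add: exit_set_def)
  moreover have "b (exit_time b) \<in> quadrant"
    by (rule quadrant_before_exit[OF cont 0 exit_time_nonneg])
      (unfold T, rule cInf_lower, use exit_set_nonneg[of b] in \<open>auto intro: bdd_belowI[of _ 0]\<close>)
  ultimately show ?thesis by (simp add: mc_quadrant mc_E)
qed

text \<open>\<open>F(\<cdot>, z)\<close> is the exponential of a complex linear form whose coefficients satisfy \<open>a\<^sup>2 + b\<^sup>2 = 0\<close>
  for \<open>z \<in> E\<close>. It is therefore harmonic, and the exponential martingale has no compensator.\<close>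

definition F_a :: "real \<times> real \<Rightarrow> complex" where
  "F_a z = Complex (- (fst z + snd z)) (fst z - snd z)"

lemma F_expmart: "F x z = expmart (F_a z) (cnj (F_a z)) 0 x"
  unfolding F_def expmart_def by (rule arg_cong[of _ _ exp]) (simp add: F_a_def diamond_def complex_eq_iff algebra_simps)

text \<open>With a = \<open>F_a z\<close> the sum equals 2 Re(a^2) = 8 z1 z2, which vanishes on the
  two axes.\<close>

lemma F_a_isotropic: "z \<in> E \<Longrightarrow> (F_a z)\<^sup>2 + (cnj (F_a z))\<^sup>2 = 0"
  by (cases z) (auto simp: F_a_def E_def quadrant_def open_quadrant_def complex_eq_iff power2_eq_square algebra_simps not_less)

text \<open>Before the exit the path stays in the quadrant, where |F| <= 1, so bounded optional
  stopping applies; the nonnegative first coordinate makes the exit almost sure by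
  \<open>hit_AE\<close>. Starting points on E are included without a study of the boundary
  behaviour.\<close>

lemma exit_law:
  assumes bm: "bm M B" and x: "x \<in> quadrant" and B0: "\<And>w. w \<in> space M \<Longrightarrow> B 0 w = x"
  defines "Y \<equiv> \<lambda>w. B (exit_time (\<lambda>t. B t w)) w"
  shows "Y \<in> borel_measurable M" "AE w in M. Y w \<in> E" "\<And>z. z \<in> E \<Longrightarrow> (CLINT w|M. F (Y w) z) = F x z"
proof -
  interpret prob_space M by (rule bm_prob[OF bm])
  note cont = bm_continuous[OF bm]
  show Ym: "Y \<in> borel_measurable M" unfolding Y_def by (rule exit_point_measurable[OF bm_measurable[OF bm] cont])
  define H where "H = (\<lambda>w. exit_set (\<lambda>t. B t w))"
  have meas: "{w\<in>space M. \<exists>h\<in>H w. h < q} \<in> sets (nat_filtration M B q)" if "0 < q" for q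
    using exit_set_measurable[of q B "nat_filtration M B q"] measurable_nat_filtration[of _ q B M] cont unfolding H_def by auto
  have quad: "B u w \<in> quadrant" if "w \<in> space M" "u \<ge> 0" "\<And>h. h \<in> H w \<Longrightarrow> u \<le> h" for w u
    by (rule quadrant_before_exit[OF cont[OF that(1)]]) (use that B0 x in \<open>auto simp: H_def\<close>)
  have ne: "AE w in M. H w \<noteq> {}"
  proof (rule hit_AE[OF bm _ meas, where \<alpha>=0])
    show "H w \<subseteq> {0..}" for w unfolding H_def by (rule exit_set_nonneg)
    show "fst (B u w) \<ge> - 0" if "w \<in> space M" "u \<ge> 0" "\<And>h. h \<in> H w \<Longrightarrow> u \<le> h" for w u
      using quad[OF that] by (auto simp: quadrant_def)
    show "fst (B 0 w) \<ge> - 0" if "w \<in> space M" for w using B0[OF that] x by (auto simp: quadrant_def)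
  qed
  show "AE w in M. Y w \<in> E"
    using ne AE_space unfolding Y_def
    by eventually_elim (rule exit_point_in_E[OF cont], use B0 x in \<open>auto simp: H_def\<close>)
  fix z assume z: "z \<in> E"
  \<comment> \<open>Comparison with the constant time 0, realised as the infimum of {0..}.\<close>
  have "(CLINT w|M. if H w = {} then 0 else indicator (space M) w * expmart (F_a z) (cnj (F_a z)) 0 (B (Inf (H w)) w)) =
    (CLINT w|M. if H w = {} then 0 else indicator (space M) w * expmart (F_a z) (cnj (F_a z)) 0 (B (Inf {0..}) w))"
  proof (rule optional_stopping[OF bm F_a_isotropic[OF z], where C=1])
    show "norm (expmart (F_a z) (cnj (F_a z)) 0 (B 0 w)) \<le> 1" if "w \<in> space M" for w
      unfolding F_expmart[symmetric] using B0[OF that] x z by (simp add: norm_F_le)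
    show "norm (expmart (F_a z) (cnj (F_a z)) 0 (B u w)) \<le> 1" if "w \<in> space M" "u \<ge> 0" "\<And>h. h \<in> H w \<Longrightarrow> u \<le> h" for w u
      unfolding F_expmart[symmetric] using quad[OF that] z by (simp add: norm_F_le)
    show "{w\<in>space M. \<exists>h\<in>{0..}. h < q} \<in> sets (nat_filtration M B q)" if "0 < q" for q :: real
    proof -
      have "{w\<in>space M. \<exists>h\<in>{0..}. h < q} = space (nat_filtration M B q)" using that by auto
      then show ?thesis by (simp only: sets.top)
    qed
  qed (use ne meas exit_set_nonneg in \<open>auto simp: H_def\<close>)
  moreover have "(CLINT w|M. if H w = {} then 0 else indicator (space M) w * expmart (F_a z) (cnj (F_a z)) 0 (B (Inf (H w)) w)) = (CLINT w|M. F (Y w) z)"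
  proof (rule integral_cong_AE)
    show FY: "(\<lambda>w. F (Y w) z) \<in> borel_measurable M" using Ym by measurable
    have "{w\<in>space M. H w \<noteq> {}} \<in> sets M"
      unfolding H_def by (rule exit_set_nonempty_measurable) (use bm_measurable[OF bm] cont in auto)
    then have "(\<lambda>w. if H w \<noteq> {} then F (Y w) z else 0) \<in> borel_measurable M" using FY by (intro measurable_If) (auto simp: pred_def)
    then show "(\<lambda>w. if H w = {} then 0 else indicator (space M) w * expmart (F_a z) (cnj (F_a z)) 0 (B (Inf (H w)) w)) \<in> borel_measurable M"
      by (rule measurable_cong[THEN iffD1, rotated]) (auto simp: Y_def H_def exit_time_eq F_expmart)
    show "AE w in M. (if H w = {} then 0 else indicator (space M) w * expmart (F_a z) (cnj (F_a z)) 0 (B (Inf (H w)) w)) = F (Y w) z"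
      using ne AE_space by eventually_elim (auto simp: Y_def H_def exit_time_eq F_expmart)
  qed
  moreover have "(CLINT w|M. if H w = {} then 0 else indicator (space M) w * expmart (F_a z) (cnj (F_a z)) 0 (B (Inf {0..}) w)) = (CLINT w|M. F x z)"
  proof (rule integral_cong_AE)
    have "{w\<in>space M. H w \<noteq> {}} \<in> sets M"
      unfolding H_def by (rule exit_set_nonempty_measurable) (use bm_measurable[OF bm] cont in auto)
    then have "(\<lambda>w. if H w \<noteq> {} then F x z else 0) \<in> borel_measurable M" by (intro measurable_If) (auto simp: pred_def)
    then show "(\<lambda>w. if H w = {} then 0 else indicator (space M) w * expmart (F_a z) (cnj (F_a z)) 0 (B (Inf {0..}) w)) \<in> borel_measurable M"
      by (rule measurable_cong[THEN iffD1, rotated]) (auto simp: B0 F_expmart)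
    show "AE w in M. (if H w = {} then 0 else indicator (space M) w * expmart (F_a z) (cnj (F_a z)) 0 (B (Inf {0..}) w)) = F x z"
      using ne AE_space by eventually_elim (auto simp: B0 F_expmart)
  qed simp
  ultimately show "(CLINT w|M. F (Y w) z) = F x z" by (simp add: prob_space)
qed

text \<open>The two laws become the laws of the two coordinates on the product space, so that the
  uniqueness lemma for variables on a common space applies with weight 1.\<close>

lemma F_determines_prob:
  assumes p1: "prob_space \<nu>1" "sets \<nu>1 = sets borel" "AE y in \<nu>1. y \<in> E"
    and p2: "prob_space \<nu>2" "sets \<nu>2 = sets borel" "AE y in \<nu>2. y \<in> E"
    and eq: "\<And>z. z \<in> E \<Longrightarrow> (CLINT y|\<nu>1. F y z) = (CLINT y|\<nu>2. F y z)"
  shows "\<nu>1 = \<nu>2"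
proof -
  interpret N1: prob_space \<nu>1 by fact
  interpret N2: prob_space \<nu>2 by fact
  interpret P: pair_prob_space \<nu>1 \<nu>2 ..
  note [measurable_cong] = p1(2) p2(2)
  \<comment> \<open>Sends the null set outside E to the origin, as \<open>F_determines2\<close>
    demands values in E at every sample point.\<close>
  define r where "r = (\<lambda>y. if y \<in> E then y else 0)"
  have rm[measurable]: "r \<in> borel_measurable borel" unfolding r_def by measurable
  have rE: "r y \<in> E" for y by (simp add: r_def zero_in_E)
  have rF: "(CLINT y|\<nu>. g (r y)) = (CLINT y|\<nu>. g y)" if "AE y in \<nu>. y \<in> E" "g \<in> borel_measurable borel" "sets \<nu> = sets borel" for g :: "_ \<Rightarrow> complex" and \<nu>
  proof (rule integral_cong_AE)
    show "(\<lambda>y. g (r y)) \<in> borel_measurable \<nu>" "g \<in> borel_measurable \<nu>"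
      using measurable_compose[OF rm that(2)] that(2) by (simp_all add: measurable_cong_sets[OF that(3) refl])
    show "AE y in \<nu>. g (r y) = g y" using that(1) by eventually_elim (simp add: r_def)
  qed
  have f1: "(CLINT p|\<nu>1 \<Otimes>\<^sub>M \<nu>2. g (r (fst p))) = (CLINT y|\<nu>1. g y)"
    and f2: "(CLINT p|\<nu>1 \<Otimes>\<^sub>M \<nu>2. g (r (snd p))) = (CLINT y|\<nu>2. g y)"
    if g[measurable]: "g \<in> borel_measurable borel" and b: "\<And>y. y \<in> E \<Longrightarrow> norm (g y) \<le> 1" for g :: "_ \<Rightarrow> complex"
  proof -
    have i1: "integrable (\<nu>1 \<Otimes>\<^sub>M \<nu>2) (\<lambda>p. g (r (fst p)))" and i2: "integrable (\<nu>1 \<Otimes>\<^sub>M \<nu>2) (\<lambda>p. g (r (snd p)))"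
      by (rule P.integrable_const_bound[where B=1]; use b rE in auto)+
    have "(CLINT p|\<nu>1 \<Otimes>\<^sub>M \<nu>2. g (r (fst p))) = (CLINT x|\<nu>1. CLINT y|\<nu>2. g (r x))"
      using P.integral_fst'[OF i1] by simp
    then show "(CLINT p|\<nu>1 \<Otimes>\<^sub>M \<nu>2. g (r (fst p))) = (CLINT y|\<nu>1. g y)"
      using rF[OF p1(3) g p1(2)] by (simp add: N2.prob_space)
    have "(CLINT p|\<nu>1 \<Otimes>\<^sub>M \<nu>2. g (r (snd p))) = (CLINT x|\<nu>1. CLINT y|\<nu>2. g (r y))"
      using P.integral_fst'[OF i2] by simp
    then show "(CLINT p|\<nu>1 \<Otimes>\<^sub>M \<nu>2. g (r (snd p))) = (CLINT y|\<nu>2. g y)"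
      using rF[OF p2(3) g p2(2)] by (simp add: N1.prob_space)
  qed
  have main: "(CLINT p|\<nu>1 \<Otimes>\<^sub>M \<nu>2. 1 * indicator A (r (fst p))) = (CLINT p|\<nu>1 \<Otimes>\<^sub>M \<nu>2. 1 * indicator A (r (snd p)))" if A: "A \<in> sets borel" for A
  proof (rule F_determines2[OF _ _ _ _ _ _ _ A])
    show "(CLINT p|\<nu>1 \<Otimes>\<^sub>M \<nu>2. 1 * F (r (fst p)) z) = (CLINT p|\<nu>1 \<Otimes>\<^sub>M \<nu>2. 1 * F (r (snd p)) z)" if "z \<in> E" for z
      using f1[of "\<lambda>y. F y z"] f2[of "\<lambda>y. F y z"] eq[OF that] that by (simp add: norm_F_le E_subset_quadrant)
    show "finite_measure (\<nu>1 \<Otimes>\<^sub>M \<nu>2)" by unfold_locales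
  qed (use rE in \<open>auto\<close>)
  show ?thesis
  proof (rule measure_eqI)
    fix A assume "A \<in> sets \<nu>1"
    then have A[measurable]: "A \<in> sets borel" using p1(2) by simp
    have "(CLINT y|\<nu>1. indicator A y) = (CLINT y|\<nu>2. indicator A y)"
      using main[OF A] f1[of "indicator A"] f2[of "indicator A"] by (simp add: indicator_def)
    then have "measure \<nu>1 A = measure \<nu>2 A"
      using integral_indicator_complex[of A \<nu>1] integral_indicator_complex[of A \<nu>2] A p1(2) p2(2) by simp
    then show "emeasure \<nu>1 A = emeasure \<nu>2 A" by (simp add: N1.emeasure_eq_measure N2.emeasure_eq_measure)
  qed (use p1 p2 in simp)
qed

section \<open>All exit laws on one probability space\<close>

lemma bm_shift:
  assumes bm: "bm M B"
  shows "bm M (\<lambda>t w. x + B t w)"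
proof (rule bmI)
  interpret prob_space M by (rule bm_prob[OF bm])
  show "(\<lambda>w. x + B t w) \<in> borel_measurable M" if "t \<ge> 0" for t
    using bm_measurable[OF bm that] by measurable
  show "continuous_on {0..} (\<lambda>t. x + B t w)" if "w \<in> space M" for w
    by (intro continuous_intros bm_continuous[OF bm that])
  fix s t :: real and u :: "real \<times> real" and R and v :: "real \<Rightarrow> real \<times> real"
  assume st: "0 \<le> s" "s \<le> t" and R: "finite R" "R \<subseteq> {0..s}"
  define c where "c = iexp (\<Sum>r\<in>R. v r \<bullet> x)"
  have e: "iexp (\<Sum>r\<in>R. v r \<bullet> (x + B r w)) = c * iexp (\<Sum>r\<in>R. v r \<bullet> B r w)" for w
    unfolding c_def exp_add[symmetric] by (simp add: inner_add_right sum.distrib distrib_left)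
  have [measurable]: "B r \<in> borel_measurable (nat_filtration M B s)" "B r \<in> borel_measurable M" if "r \<in> R" for r
    using R that bm_measurable[OF bm] by (auto intro!: measurable_nat_filtration)
  have ZG: "(\<lambda>w. iexp (\<Sum>r\<in>R. v r \<bullet> B r w)) \<in> borel_measurable (nat_filtration M B s)" by measurable
  have "(\<lambda>w. iexp (\<Sum>r\<in>R. v r \<bullet> B r w)) \<in> borel_measurable M" by measurable
  then have iZ: "integrable M (\<lambda>w. iexp (\<Sum>r\<in>R. v r \<bullet> B r w))"
    by (intro integrable_const_bound[where B=1]) auto
  show "(CLINT w|M. iexp (\<Sum>r\<in>R. v r \<bullet> (x + B r w)) * iexp (u \<bullet> ((x + B t w) - (x + B s w)))) =
    (CLINT w|M. iexp (\<Sum>r\<in>R. v r \<bullet> (x + B r w))) * exp (- (complex_of_real ((t - s) * (u \<bullet> u) / 2)))"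
    unfolding e add_diff_cancel_left mult.assoc integral_mult_right_zero bmI'[OF bm st ZG iZ] ..
qed (rule bm_prob[OF bm])

text \<open>The constructed process starts at 0 only almost surely; on the exceptional null event it
  is replaced by the zero path.\<close>

lemma std_bm_exists: "\<exists>(M :: path measure) B. bm M B \<and> (\<forall>w\<in>space M. B 0 w = 0)"
proof -
  have "prob_space (return borel (0 :: real \<times> real))" by (rule prob_space_return) simp
  from bm_exists[OF this] obtain M :: "path measure" and B where bm: "bm M B" and d: "distr M borel (B 0) = return borel 0" by auto
  have m: "B 0 \<in> borel_measurable M" by (rule bm_measurable[OF bm]) simp
  define G where "G = {w\<in>space M. B 0 w = 0}"
  have G: "G \<in> sets M" using measurable_sets[OF m, of "{0}"] by (simp add: G_def vimage_def Int_def conj_commute)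
  have "AE x in return borel (0 :: real \<times> real). x = 0" by (subst AE_return) auto
  then have "AE x in distr M borel (B 0). x = 0" unfolding d .
  then have "AE w in M. B 0 w = 0" by (subst (asm) AE_distr_iff) (use m in auto)
  then have AE: "AE w in M. w \<in> G" using AE_space by eventually_elim (simp add: G_def)
  have "bm M (\<lambda>t w. if w \<in> G then B t w else 0)" by (rule bm_modify[OF bm G AE]) auto
  then show ?thesis by (intro exI[of _ M] exI[of _ "\<lambda>t w. if w \<in> G then B t w else 0"]) (simp add: G_def)
qed

text \<open>The translates by x of this fixed Brownian motion realise all exit laws on one space.
  This makes the kernel measurable in x and turns mixtures of kernels into laws on a product
  space.\<close>

definition std_bm :: "path measure \<times> (real \<Rightarrow> path \<Rightarrow> real \<times> real)" where
  "std_bm = (SOME p. bm (fst p) (snd p) \<and> (\<forall>w\<in>space (fst p). snd p 0 w = 0))"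

abbreviation "\<Omega>W \<equiv> fst std_bm"
abbreviation "W \<equiv> snd std_bm"

lemma std_bm: "bm \<Omega>W W" "w \<in> space \<Omega>W \<Longrightarrow> W 0 w = 0"
proof -
  have "\<exists>p :: path measure \<times> (real \<Rightarrow> path \<Rightarrow> real \<times> real). bm (fst p) (snd p) \<and> (\<forall>w\<in>space (fst p). snd p 0 w = 0)"
    using std_bm_exists by auto
  from someI_ex[OF this] show "bm \<Omega>W W" "w \<in> space \<Omega>W \<Longrightarrow> W 0 w = 0" unfolding std_bm_def by blast+
qed

definition exit_point :: "real \<times> real \<Rightarrow> path \<Rightarrow> real \<times> real" where
  "exit_point x w = x + W (exit_time (\<lambda>t. x + W t w)) w"

lemma prob_space_\<Omega>W: "prob_space \<Omega>W" by (rule bm_prob[OF std_bm(1)])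

lemma exit_point_pair_measurable[measurable]: "(\<lambda>(x, w). exit_point x w) \<in> borel_measurable (borel \<Otimes>\<^sub>M \<Omega>W)"
proof -
  have "(\<lambda>p. (\<lambda>t p. fst p + W t (snd p)) (exit_time (\<lambda>t. fst p + W t (snd p))) p) \<in> borel_measurable (borel \<Otimes>\<^sub>M \<Omega>W)"
  proof (rule exit_point_measurable)
    fix u :: real assume "0 \<le> u"
    have "(\<lambda>p. W u (snd p)) \<in> borel_measurable (borel \<Otimes>\<^sub>M \<Omega>W)"
      by (rule measurable_compose[OF measurable_snd bm_measurable[OF std_bm(1) \<open>0 \<le> u\<close>]])
    then show "(\<lambda>p. fst p + W u (snd p)) \<in> borel_measurable (borel \<Otimes>\<^sub>M \<Omega>W)" by measurable
  next
    fix p :: "(real \<times> real) \<times> path" assume "p \<in> space (borel \<Otimes>\<^sub>M \<Omega>W)"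
    then show "continuous_on {0..} (\<lambda>u. fst p + W u (snd p))"
      by (intro continuous_intros bm_continuous[OF std_bm(1)]) (auto simp: space_pair_measure)
  qed
  then show ?thesis by (simp add: exit_point_def case_prod_beta')
qed

lemma exit_point_law:
  assumes "x \<in> quadrant"
  shows "exit_point x \<in> borel_measurable \<Omega>W" "AE w in \<Omega>W. exit_point x w \<in> E"
    "\<And>z. z \<in> E \<Longrightarrow> (CLINT w|\<Omega>W. F (exit_point x w) z) = F x z"
  using exit_law[OF bm_shift[OF std_bm(1)] assms, of x] std_bm(2) unfolding exit_point_def by auto

lemma Q_eq:
  assumes x: "x \<in> quadrant"
  shows "Q x = distr \<Omega>W borel (exit_point x)"
  unfolding Q_def
proof (rule the_equality)
  have "planar_BM \<Omega>W (\<lambda>t w. x + W t w) x"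
    by (rule bm_planar_BM[OF bm_shift[OF std_bm(1)]]) (simp add: std_bm(2))
  then show "\<exists>(M :: path measure) B. planar_BM M B x \<and> distr \<Omega>W borel (exit_point x) = distr M borel (\<lambda>w. B (exit_time (\<lambda>t. B t w)) w)"
    unfolding exit_point_def[abs_def] by blast
  fix \<nu> assume "\<exists>(M :: path measure) B. planar_BM M B x \<and> \<nu> = distr M borel (\<lambda>w. B (exit_time (\<lambda>t. B t w)) w)"
  then obtain M :: "path measure" and B where B: "planar_BM M B x" and \<nu>: "\<nu> = distr M borel (\<lambda>w. B (exit_time (\<lambda>t. B t w)) w)" by blast
  have bm: "bm M B" by (rule planar_BM_bm[OF B])
  have B0: "\<And>w. w \<in> space M \<Longrightarrow> B 0 w = x" using B by (simp add: planar_BM_def)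
  have l: "(\<lambda>w. B (exit_time (\<lambda>t. B t w)) w) \<in> borel_measurable M" "AE w in M. B (exit_time (\<lambda>t. B t w)) w \<in> E"
    "\<And>z. z \<in> E \<Longrightarrow> (CLINT w|M. F (B (exit_time (\<lambda>t. B t w)) w) z) = F x z"
    by (rule exit_law[OF bm x B0]; assumption)+
  note l' = exit_point_law[OF x]
  show "\<nu> = distr \<Omega>W borel (exit_point x)" unfolding \<nu>
  proof (rule F_determines_prob)
    show "prob_space (distr M borel (\<lambda>w. B (exit_time (\<lambda>t. B t w)) w))"
      by (rule prob_space.prob_space_distr[OF bm_prob[OF bm] l(1)])
    show "prob_space (distr \<Omega>W borel (exit_point x))"
      by (rule prob_space.prob_space_distr[OF prob_space_\<Omega>W l'(1)])
    show "AE y in distr M borel (\<lambda>w. B (exit_time (\<lambda>t. B t w)) w). y \<in> E"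
      using l(2) by (subst AE_distr_iff[OF l(1)]) auto
    show "AE y in distr \<Omega>W borel (exit_point x). y \<in> E"
      using l'(2) by (subst AE_distr_iff[OF l'(1)]) auto
    show "(CLINT y|distr M borel (\<lambda>w. B (exit_time (\<lambda>t. B t w)) w). F y z) = (CLINT y|distr \<Omega>W borel (exit_point x). F y z)" if "z \<in> E" for z
      by (simp add: integral_distr[OF l(1)] integral_distr[OF l'(1)] l(3)[OF that] l'(3)[OF that])
  qed auto
qed

lemma Q_prob: "x \<in> quadrant \<Longrightarrow> prob_space (Q x)"
  unfolding Q_eq by (rule prob_space.prob_space_distr[OF prob_space_\<Omega>W exit_point_law(1)])

lemma sets_Q: "x \<in> quadrant \<Longrightarrow> sets (Q x) = sets borel" by (simp add: Q_eq)

section \<open>Mixtures of kernels and their transforms\<close>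

definition mean :: "real \<Rightarrow> real \<times> real \<Rightarrow> real \<Rightarrow> real \<times> real \<Rightarrow> real \<times> real" where
  "mean c \<theta> r x = exp (- c * r) *\<^sub>R x + (1 - exp (- c * r)) *\<^sub>R \<theta>"

lemma kernel_eq: "kernel c \<theta> r x = Q (mean c \<theta> r x)"
  by (simp add: kernel_def mean_def)

lemma mean_quadrant:
  assumes "c \<ge> 0" "r \<ge> 0" "\<theta> \<in> quadrant" "x \<in> quadrant"
  shows "mean c \<theta> r x \<in> quadrant"
proof -
  have "exp (- c * r) \<le> 1" using assms by simp
  then show ?thesis using assms by (auto simp: mean_def quadrant_def)
qed

lemma mean_measurable[measurable]: "mean c \<theta> r \<in> borel_measurable borel"
  unfolding mean_def by (intro borel_measurable_continuous_onI continuous_intros)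

text \<open>A weighted form of \<open>F_determines_prob\<close>: the two weighted laws live on different spaces and are
  compared on the product space, where \<open>F_determines2\<close> applies.\<close>

lemma kernel_from_transform:
  assumes M: "prob_space M" and B: "B \<in> sets M" and Y: "Y \<in> borel_measurable M" "\<And>w. w \<in> space M \<Longrightarrow> Y w \<in> E"
    and V: "V \<in> borel_measurable M" "\<And>w. w \<in> space M \<Longrightarrow> V w \<in> quadrant"
    and eq: "\<And>z. z \<in> E \<Longrightarrow> (CLINT w|M. indicator B w * F (Y w) z) = (CLINT w|M. indicator B w * F (V w) z)"
  shows "distr (density M (indicator B)) borel Y = distr (density (M \<Otimes>\<^sub>M \<Omega>W) (\<lambda>p. indicator B (fst p))) borel (\<lambda>p. exit_point (V (fst p)) (snd p))"
proof -
  interpret M: prob_space M by fact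
  interpret O: prob_space \<Omega>W by (rule prob_space_\<Omega>W)
  interpret P: pair_prob_space M \<Omega>W ..
  note [measurable] = B Y(1) V(1)
  \<comment> \<open>The exit point lies in E only almost surely; as before, the exceptional values
    are sent to the origin.\<close>
  define r where "r = (\<lambda>y. if y \<in> E then y else 0)"
  have rm[measurable]: "r \<in> borel_measurable borel" unfolding r_def by measurable
  have rE: "r y \<in> E" for y by (simp add: r_def zero_in_E)
  define X where "X = (\<lambda>p. exit_point (V (fst p)) (snd p))"
  have Xm[measurable]: "X \<in> borel_measurable (M \<Otimes>\<^sub>M \<Omega>W)"
    using measurable_compose[OF measurable_Pair[OF measurable_compose[OF measurable_fst V(1)] measurable_snd] exit_point_pair_measurable]
    by (simp add: X_def)
  have XE: "AE p in M \<Otimes>\<^sub>M \<Omega>W. X p \<in> E"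
  proof (rule P.AE_pair_measure)
    show "{p \<in> space (M \<Otimes>\<^sub>M \<Omega>W). X p \<in> E} \<in> sets (M \<Otimes>\<^sub>M \<Omega>W)" by measurable
    show "AE x in M. AE y in \<Omega>W. X (x, y) \<in> E"
      using AE_space by eventually_elim (simp add: X_def exit_point_law(2) V(2))
  qed
  have Z: "integrable (M \<Otimes>\<^sub>M \<Omega>W) (\<lambda>p. indicator B (fst p) :: complex)"
    by (rule P.integrable_const_bound[where B=1]) (auto simp: indicator_def)
  have main: "(CLINT p|M \<Otimes>\<^sub>M \<Omega>W. indicator B (fst p) * indicator A (Y (fst p))) = (CLINT p|M \<Otimes>\<^sub>M \<Omega>W. indicator B (fst p) * indicator A (r (X p)))"
    if A: "A \<in> sets borel" for A
  proof (rule F_determines2[OF _ Z _ _ _ _ _ A])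
    show "finite_measure (M \<Otimes>\<^sub>M \<Omega>W)" by unfold_locales
    show "Y (fst p) \<in> E" if "p \<in> space (M \<Otimes>\<^sub>M \<Omega>W)" for p using that Y(2) by (auto simp: space_pair_measure)
    fix z assume z: "z \<in> E"
    have FY: "integrable (M \<Otimes>\<^sub>M \<Omega>W) (\<lambda>p. indicator B (fst p) * F (Y (fst p)) z)"
      by (rule integrable_mult_bounded[OF Z, where C=1]) (use Y(2) z in \<open>auto simp: space_pair_measure norm_F_le E_subset_quadrant\<close>)
    have FX: "integrable (M \<Otimes>\<^sub>M \<Omega>W) (\<lambda>p. indicator B (fst p) * F (r (X p)) z)"
      by (rule integrable_mult_bounded[OF Z, where C=1]) (use rE z in \<open>auto simp: norm_F_le E_subset_quadrant\<close>)
    have "(CLINT p|M \<Otimes>\<^sub>M \<Omega>W. indicator B (fst p) * F (Y (fst p)) z) = (CLINT x|M. CLINT y|\<Omega>W. indicator B x * F (Y x) z)"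
      using P.integral_fst'[OF FY] by simp
    also have "\<dots> = (CLINT x|M. indicator B x * F (V x) z)" using eq[OF z] by (simp add: O.prob_space)
    also have "\<dots> = (CLINT x|M. CLINT y|\<Omega>W. indicator B x * F (r (X (x, y))) z)"
    proof (rule Bochner_Integration.integral_cong[OF refl])
      fix x assume x: "x \<in> space M"
      note l = exit_point_law[OF V(2)[OF x]]
      note [measurable] = l(1)
      have "(CLINT y|\<Omega>W. F (r (X (x, y))) z) = (CLINT y|\<Omega>W. F (exit_point (V x) y) z)"
        unfolding X_def fst_conv snd_conv
      proof (rule integral_cong_AE)
        show "AE y in \<Omega>W. F (r (exit_point (V x) y)) z = F (exit_point (V x) y) z"
          using l(2) by eventually_elim (simp add: r_def)
      qed measurable
      then show "indicator B x * F (V x) z = (CLINT y|\<Omega>W. indicator B x * F (r (X (x, y))) z)"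
        by (simp add: l(3)[OF z])
    qed
    also have "\<dots> = (CLINT p|M \<Otimes>\<^sub>M \<Omega>W. indicator B (fst p) * F (r (X p)) z)"
      using P.integral_fst'[OF FX] by simp
    finally show "(CLINT p|M \<Otimes>\<^sub>M \<Omega>W. indicator B (fst p) * F (Y (fst p)) z) = (CLINT p|M \<Otimes>\<^sub>M \<Omega>W. indicator B (fst p) * F (r (X p)) z)" .
  qed (use rE in auto)
  show ?thesis
  proof (rule measure_eqI)
    fix A assume "A \<in> sets (distr (density M (indicator B)) borel Y)"
    then have A[measurable]: "A \<in> sets borel" by simp
    have S1: "{p \<in> space (M \<Otimes>\<^sub>M \<Omega>W). fst p \<in> B \<and> Y (fst p) \<in> A} \<in> sets (M \<Otimes>\<^sub>M \<Omega>W)" by measurable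
    have S2: "{p \<in> space (M \<Otimes>\<^sub>M \<Omega>W). fst p \<in> B \<and> X p \<in> A} \<in> sets (M \<Otimes>\<^sub>M \<Omega>W)" by measurable
    have "complex_of_real (P.prob {p \<in> space (M \<Otimes>\<^sub>M \<Omega>W). fst p \<in> B \<and> Y (fst p) \<in> A}) = (CLINT p|M \<Otimes>\<^sub>M \<Omega>W. indicator B (fst p) * indicator A (Y (fst p)))"
      unfolding integral_indicator_complex[OF S1, symmetric] by (rule Bochner_Integration.integral_cong) (auto simp: indicator_def)
    also have "\<dots> = (CLINT p|M \<Otimes>\<^sub>M \<Omega>W. indicator {p \<in> space (M \<Otimes>\<^sub>M \<Omega>W). fst p \<in> B \<and> X p \<in> A} p)"
      unfolding main[OF A]
    proof (rule integral_cong_AE)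
      show "AE p in M \<Otimes>\<^sub>M \<Omega>W. indicator B (fst p) * indicator A (r (X p)) = (indicator {p \<in> space (M \<Otimes>\<^sub>M \<Omega>W). fst p \<in> B \<and> X p \<in> A} p :: complex)"
        using XE AE_space by eventually_elim (auto simp: indicator_def r_def)
    qed (use S2 in measurable)
    also have "\<dots> = complex_of_real (P.prob {p \<in> space (M \<Otimes>\<^sub>M \<Omega>W). fst p \<in> B \<and> X p \<in> A})"
      by (rule integral_indicator_complex[OF S2])
    finally have e: "P.prob {p \<in> space (M \<Otimes>\<^sub>M \<Omega>W). fst p \<in> B \<and> Y (fst p) \<in> A} = P.prob {p \<in> space (M \<Otimes>\<^sub>M \<Omega>W). fst p \<in> B \<and> X p \<in> A}"
      by (simp only: of_real_eq_iff)
    have YA: "Y -` A \<inter> space M \<in> sets M" by measurable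
    have "emeasure (distr (density M (indicator B)) borel Y) A = emeasure M (B \<inter> (Y -` A \<inter> space M))"
      using YA by (simp add: emeasure_distr emeasure_density indicator_inter_arith[symmetric])
    also have "\<dots> = emeasure M (B \<inter> (Y -` A \<inter> space M)) * emeasure \<Omega>W (space \<Omega>W)" by (simp add: O.emeasure_space_1)
    also have "\<dots> = emeasure (M \<Otimes>\<^sub>M \<Omega>W) ((B \<inter> (Y -` A \<inter> space M)) \<times> space \<Omega>W)"
      by (rule O.emeasure_pair_measure_Times[symmetric]) auto
    also have "(B \<inter> (Y -` A \<inter> space M)) \<times> space \<Omega>W = {p \<in> space (M \<Otimes>\<^sub>M \<Omega>W). fst p \<in> B \<and> Y (fst p) \<in> A}"
      by (auto simp: space_pair_measure)
    also have "emeasure (M \<Otimes>\<^sub>M \<Omega>W) \<dots> = emeasure (M \<Otimes>\<^sub>M \<Omega>W) {p \<in> space (M \<Otimes>\<^sub>M \<Omega>W). fst p \<in> B \<and> X p \<in> A}"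
      by (simp only: P.emeasure_eq_measure e)
    also have "\<dots> = (\<integral>\<^sup>+p. indicator {p \<in> space (M \<Otimes>\<^sub>M \<Omega>W). fst p \<in> B \<and> X p \<in> A} p \<partial>(M \<Otimes>\<^sub>M \<Omega>W))"
      by (rule nn_integral_indicator[symmetric, OF S2])
    also have "\<dots> = (\<integral>\<^sup>+p. indicator B (fst p) * indicator (X -` A \<inter> space (M \<Otimes>\<^sub>M \<Omega>W)) p \<partial>(M \<Otimes>\<^sub>M \<Omega>W))"
      by (rule nn_integral_cong) (auto simp: indicator_def)
    also have "\<dots> = emeasure (distr (density (M \<Otimes>\<^sub>M \<Omega>W) (\<lambda>p. indicator B (fst p))) borel X) A"
      by (subst emeasure_distr) (simp_all add: emeasure_density)
    finally show "emeasure (distr (density M (indicator B)) borel Y) A = emeasure (distr (density (M \<Otimes>\<^sub>M \<Omega>W) (\<lambda>p. indicator B (fst p))) borel (\<lambda>p. exit_point (V (fst p)) (snd p))) A"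
      unfolding X_def .
  qed simp
qed

lemma kernel_measurable:
  assumes f: "f \<in> borel_measurable (borel :: (real \<times> real) measure)" and V: "V \<in> borel_measurable M" "\<And>w. w \<in> space M \<Longrightarrow> V w \<in> quadrant"
  shows "(\<lambda>w. \<integral>\<^sup>+y. f y \<partial>Q (V w)) \<in> borel_measurable M"
proof -
  interpret O: prob_space \<Omega>W by (rule prob_space_\<Omega>W)
  have "(\<lambda>x. \<integral>\<^sup>+w'. f (exit_point x w') \<partial>\<Omega>W) \<in> borel_measurable borel"
    by (rule O.borel_measurable_nn_integral) (use measurable_compose[OF exit_point_pair_measurable f] in \<open>simp add: case_prod_beta'\<close>)
  from measurable_compose[OF V(1) this] have "(\<lambda>w. \<integral>\<^sup>+w'. f (exit_point (V w) w') \<partial>\<Omega>W) \<in> borel_measurable M" .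
  moreover have "(\<integral>\<^sup>+w'. f (exit_point (V w) w') \<partial>\<Omega>W) = (\<integral>\<^sup>+y. f y \<partial>Q (V w))" if "w \<in> space M" for w
    using V(2)[OF that] f by (simp add: Q_eq nn_integral_distr[OF exit_point_law(1)])
  ultimately show ?thesis by (simp cong: measurable_cong)
qed

text \<open>Once the two weighted laws agree, every nonnegative test function may be integrated
  against them, and Fubini's theorem turns the Brownian factor into the kernel.\<close>

lemma kernel_nn_integral:
  assumes M: "prob_space M" and B: "B \<in> sets M" and Y: "Y \<in> borel_measurable M" "\<And>w. w \<in> space M \<Longrightarrow> Y w \<in> E"
    and V: "V \<in> borel_measurable M" "\<And>w. w \<in> space M \<Longrightarrow> V w \<in> quadrant"
    and eq: "\<And>z. z \<in> E \<Longrightarrow> (CLINT w|M. indicator B w * F (Y w) z) = (CLINT w|M. indicator B w * F (V w) z)"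
    and f[measurable]: "f \<in> borel_measurable borel"
  shows "(\<integral>\<^sup>+w. indicator B w * f (Y w) \<partial>M) = (\<integral>\<^sup>+w. indicator B w * (\<integral>\<^sup>+y. f y \<partial>Q (V w)) \<partial>M)"
proof -
  interpret M: prob_space M by fact
  interpret O: prob_space \<Omega>W by (rule prob_space_\<Omega>W)
  interpret P: pair_prob_space M \<Omega>W ..
  note [measurable] = B Y(1) V(1)
  have Xm[measurable]: "(\<lambda>p. exit_point (V (fst p)) (snd p)) \<in> borel_measurable (M \<Otimes>\<^sub>M \<Omega>W)"
    using measurable_compose[OF measurable_Pair[OF measurable_compose[OF measurable_fst V(1)] measurable_snd] exit_point_pair_measurable]
    by simp
  have k: "distr (density M (indicator B)) borel Y = distr (density (M \<Otimes>\<^sub>M \<Omega>W) (\<lambda>p. indicator B (fst p))) borel (\<lambda>p. exit_point (V (fst p)) (snd p))"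
    by (rule kernel_from_transform[OF M B Y V eq])
  have "(\<integral>\<^sup>+w. indicator B w * f (Y w) \<partial>M) = (\<integral>\<^sup>+y. f y \<partial>distr (density M (indicator B)) borel Y)"
    by (simp add: nn_integral_distr nn_integral_density)
  also have "\<dots> = (\<integral>\<^sup>+p. indicator B (fst p) * f (exit_point (V (fst p)) (snd p)) \<partial>(M \<Otimes>\<^sub>M \<Omega>W))"
    unfolding k by (simp add: nn_integral_distr nn_integral_density)
  also have "\<dots> = (\<integral>\<^sup>+w. \<integral>\<^sup>+w'. indicator B w * f (exit_point (V w) w') \<partial>\<Omega>W \<partial>M)"
    by (subst O.nn_integral_fst[symmetric]) simp_all
  also have "\<dots> = (\<integral>\<^sup>+w. indicator B w * (\<integral>\<^sup>+y. f y \<partial>Q (V w)) \<partial>M)"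
  proof (rule nn_integral_cong)
    fix w assume w: "w \<in> space M"
    note l = exit_point_law(1)[OF V(2)[OF w]]
    note [measurable] = l
    show "(\<integral>\<^sup>+w'. indicator B w * f (exit_point (V w) w') \<partial>\<Omega>W) = indicator B w * (\<integral>\<^sup>+y. f y \<partial>Q (V w))"
      by (simp add: Q_eq[OF V(2)[OF w]] nn_integral_distr[OF l] nn_integral_cmult)
  qed
  finally show ?thesis .
qed

section \<open>A transport equation for the transforms\<close>

lemma diamond_add: "(x + y) \<diamondop> z = x \<diamondop> z + y \<diamondop> z"
  and diamond_diff: "(x - y) \<diamondop> z = x \<diamondop> z - y \<diamondop> z"
  and diamond_scale: "(r *\<^sub>R x) \<diamondop> z = of_real r * (x \<diamondop> z)"
  and diamond_diff_right: "x \<diamondop> (y - z) = x \<diamondop> y - x \<diamondop> z"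
  and diamond_scale_right: "x \<diamondop> (r *\<^sub>R z) = of_real r * (x \<diamondop> z)"
  by (simp_all add: diamond_def complex_eq_iff algebra_simps)

lemma scale_in_E: "z \<in> E \<Longrightarrow> l \<ge> 0 \<Longrightarrow> l *\<^sub>R z \<in> E"
  by (cases z; cases "l = 0") (auto simp: E_def quadrant_def open_quadrant_def not_less mult_le_0_iff)

text \<open>The two readings of this function drive the uniqueness proof. By \<open>kf_F\<close> it
  is F at a weighted mean, the form required by the Markov identities; by \<open>kf_F_split\<close>
  it is F(_, l z) up to a constant, the form supplied by the martingale problem.\<close>

definition kf :: "real \<times> real \<Rightarrow> real \<times> real \<Rightarrow> real \<Rightarrow> real \<times> real \<Rightarrow> complex" where
  "kf \<theta> z l x = exp (\<theta> \<diamondop> z + of_real l * ((x - \<theta>) \<diamondop> z))"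

lemma kf_F: "kf \<theta> z l x = F (l *\<^sub>R x + (1 - l) *\<^sub>R \<theta>) z"
  unfolding kf_def F_def by (simp add: diamond_add diamond_diff diamond_scale algebra_simps)

lemma kf_F_split: "kf \<theta> z l x = F x (l *\<^sub>R z) * F \<theta> ((1 - l) *\<^sub>R z)"
  unfolding kf_def F_def exp_add[symmetric] by (simp add: diamond_diff diamond_diff_right diamond_scale_right algebra_simps)

lemma kf_measurable[measurable]: "kf \<theta> z l \<in> borel_measurable borel" "(\<lambda>x. (x - \<theta>) \<diamondop> z) \<in> borel_measurable borel"
  unfolding kf_def diamond_def by (auto intro!: borel_measurable_continuous_onI continuous_intros)

text \<open>Bounds, uniform in x, for the first and second derivative of \<open>kf\<close> in l on
  [l, 1]. The terms 1/l and 4/l^2 bound p exp(-l p) and p^2 exp(-l p) over p >= 0.\<close>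

definition C1 :: "real \<times> real \<Rightarrow> real \<times> real \<Rightarrow> real \<Rightarrow> real" where
  "C1 \<theta> z l = 2 * (1 / l + (fst \<theta> + snd \<theta>) * (fst z + snd z))"
definition C2 :: "real \<times> real \<Rightarrow> real \<times> real \<Rightarrow> real \<Rightarrow> real" where
  "C2 \<theta> z l = 8 * (4 / l\<^sup>2 + ((fst \<theta> + snd \<theta>) * (fst z + snd z))\<^sup>2)"

text \<open>With p and q the products of coordinate sums for x and for \<theta>, the factor (x -
  \<theta>) \<diamondop> z is at most 2 (p + q), while |kf| <= exp(-l0 p). Exponential decay beats
  the polynomial factor as long as l stays away from 0.\<close>

lemma kf_bounds:
  assumes x: "x \<in> quadrant" and \<theta>: "\<theta> \<in> quadrant" and z: "z \<in> E" and l: "0 < l0" "l0 \<le> l" "l \<le> 1"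
  shows "norm (((x - \<theta>) \<diamondop> z) * kf \<theta> z l x) \<le> C1 \<theta> z l0"
    and "norm (((x - \<theta>) \<diamondop> z)\<^sup>2 * kf \<theta> z l x) \<le> C2 \<theta> z l0"
    and "norm (kf \<theta> z l x) \<le> 1"
proof -
  define p where "p = (fst x + snd x) * (fst z + snd z)"
  define q where "q = (fst \<theta> + snd \<theta>) * (fst z + snd z)"
  have zq: "fst z \<ge> 0" "snd z \<ge> 0" using z by (auto simp: E_def quadrant_def)
  have xq: "fst x \<ge> 0" "snd x \<ge> 0" using x by (auto simp: quadrant_def)
  have tq: "fst \<theta> \<ge> 0" "snd \<theta> \<ge> 0" using \<theta> by (auto simp: quadrant_def)
  have p0: "p \<ge> 0" and q0: "q \<ge> 0" using zq xq tq by (auto simp: p_def q_def)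
  have w: "norm ((x - \<theta>) \<diamondop> z) \<le> 2 * (p + q)"
  proof -
    have b: "norm (y \<diamondop> z) \<le> 2 * ((fst y + snd y) * (fst z + snd z))" if "fst y \<ge> 0" "snd y \<ge> 0" for y
    proof -
      have "norm (y \<diamondop> z) \<le> norm (- complex_of_real ((fst y + snd y) * (fst z + snd z))) + norm (\<i> * complex_of_real ((fst y - snd y) * (fst z - snd z)))"
        unfolding diamond_def by (rule norm_triangle_ineq)
      also have "\<dots> = \<bar>(fst y + snd y) * (fst z + snd z)\<bar> + \<bar>fst y - snd y\<bar> * \<bar>fst z - snd z\<bar>"
        by (simp add: norm_mult abs_mult del: of_real_mult of_real_diff of_real_add)
      also have "\<bar>fst y - snd y\<bar> * \<bar>fst z - snd z\<bar> \<le> (fst y + snd y) * (fst z + snd z)"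
        by (rule mult_mono) (use that zq in auto)
      finally show ?thesis using that zq by simp
    qed
    have "norm ((x - \<theta>) \<diamondop> z) \<le> norm (x \<diamondop> z) + norm (\<theta> \<diamondop> z)"
      unfolding diamond_diff by (rule norm_triangle_ineq4)
    also have "\<dots> \<le> 2 * p + 2 * q" using b[OF xq] b[OF tq] by (simp add: p_def q_def)
    finally show ?thesis by simp
  qed
  have k: "norm (kf \<theta> z l x) \<le> exp (- (l0 * p))"
  proof -
    have "Re (\<theta> \<diamondop> z + of_real l * ((x - \<theta>) \<diamondop> z)) = - (l * p) - (1 - l) * q"
      by (simp add: diamond_def p_def q_def algebra_simps)
    also have "\<dots> \<le> - (l0 * p)"
      using mult_right_mono[OF l(2) p0] mult_nonneg_nonneg[of "1 - l" q] l q0 by linarith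
    finally show ?thesis by (simp add: kf_def)
  qed
  then show "norm (kf \<theta> z l x) \<le> 1" using l p0 by (simp add: order_trans[OF k])
  have e1: "p * exp (- (l0 * p)) \<le> 1 / l0"
  proof -
    have "l0 * p \<le> exp (l0 * p)" using exp_ge_add_one_self[of "l0 * p"] by linarith
    then show ?thesis using l by (simp add: exp_minus field_simps)
  qed
  have e2: "p\<^sup>2 * exp (- (l0 * p)) \<le> 4 / l0\<^sup>2"
  proof -
    have "l0 * p / 2 \<le> exp (l0 * p / 2)" using exp_ge_add_one_self[of "l0 * p / 2"] by linarith
    then have "(l0 * p / 2)\<^sup>2 \<le> (exp (l0 * p / 2))\<^sup>2" using l p0 by (intro power_mono) auto
    also have "\<dots> = exp (l0 * p)" by (simp add: exp_double[symmetric])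
    finally have "(l0 * p)\<^sup>2 \<le> 4 * exp (l0 * p)" by (simp add: power_divide)
    then show ?thesis using l by (simp add: exp_minus field_simps power_mult_distrib)
  qed
  have eq1: "exp (- (l0 * p)) \<le> 1" using l p0 by simp
  have "norm (((x - \<theta>) \<diamondop> z) * kf \<theta> z l x) \<le> 2 * (p + q) * exp (- (l0 * p))"
    unfolding norm_mult by (rule mult_mono[OF w k]) (use p0 q0 in auto)
  also have "\<dots> = 2 * (p * exp (- (l0 * p)) + q * exp (- (l0 * p)))" by (simp add: algebra_simps)
  also have "\<dots> \<le> 2 * (1 / l0 + q * 1)"
    by (intro mult_left_mono add_mono e1 eq1 q0) auto
  finally show "norm (((x - \<theta>) \<diamondop> z) * kf \<theta> z l x) \<le> C1 \<theta> z l0" by (simp add: C1_def q_def)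
  have pq: "(2 * (p + q))\<^sup>2 \<le> 8 * (p\<^sup>2 + q\<^sup>2)"
    using zero_le_power2[of "p - q"] by (simp add: power2_eq_square algebra_simps)
  have "norm (((x - \<theta>) \<diamondop> z)\<^sup>2 * kf \<theta> z l x) \<le> (2 * (p + q))\<^sup>2 * exp (- (l0 * p))"
    unfolding norm_mult norm_power by (rule mult_mono[OF power_mono[OF w] k]) auto
  also have "\<dots> \<le> 8 * (p\<^sup>2 + q\<^sup>2) * exp (- (l0 * p))" by (rule mult_right_mono[OF pq]) simp
  also have "\<dots> = 8 * (p\<^sup>2 * exp (- (l0 * p)) + q\<^sup>2 * exp (- (l0 * p)))" by (simp add: algebra_simps)
  also have "\<dots> \<le> 8 * (4 / l0\<^sup>2 + q\<^sup>2 * 1)"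
    by (intro mult_left_mono add_mono e2 eq1) auto
  finally show "norm (((x - \<theta>) \<diamondop> z)\<^sup>2 * kf \<theta> z l x) \<le> C2 \<theta> z l0" by (simp add: C2_def q_def)
qed

text \<open>\<open>kf\<close> is entire in l, so the complex Taylor estimate applies on the segment
  [l0, 1], with the second derivative controlled by \<open>C2\<close>.\<close>

lemma kf_taylor:
  assumes x: "x \<in> quadrant" and \<theta>: "\<theta> \<in> quadrant" and z: "z \<in> E"
    and l: "0 < l0" "l0 \<le> l" "l \<le> 1" "l0 \<le> m" "m \<le> 1"
  shows "norm (kf \<theta> z m x - kf \<theta> z l x - of_real (m - l) * (((x - \<theta>) \<diamondop> z) * kf \<theta> z l x)) \<le> C2 \<theta> z l0 * (m - l)\<^sup>2"
proof -
  define w where "w = (x - \<theta>) \<diamondop> z"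
  define f where "f = (\<lambda>(i::nat) (s::complex). w ^ i * exp (\<theta> \<diamondop> z + s * w))"
  let ?S = "complex_of_real ` {l0..1}"
  have "norm (f 0 (of_real m) - (\<Sum>i\<le>1. f i (of_real l) * (of_real m - of_real l) ^ i / fact i)) \<le> C2 \<theta> z l0 * norm (complex_of_real m - of_real l) ^ Suc 1 / fact 1"
  proof (rule complex_Taylor)
    show "convex ?S" by (rule convex_linear_image) (auto intro!: bounded_linear.linear bounded_linear_of_real)
    show "(f i has_field_derivative f (Suc i) s) (at s within ?S)" for i s
      unfolding f_def by (auto intro!: derivative_eq_intros)
    fix s assume "s \<in> ?S"
    then obtain r where r: "s = of_real r" "l0 \<le> r" "r \<le> 1" by auto
    have "f (Suc 1) s = w\<^sup>2 * kf \<theta> z r x" by (simp add: f_def kf_def w_def r(1) power2_eq_square)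
    then show "norm (f (Suc 1) s) \<le> C2 \<theta> z l0"
      using kf_bounds(2)[OF x \<theta> z l(1) r(2,3)] by (simp add: w_def)
  qed (use l in auto)
  also have "f 0 (of_real m) - (\<Sum>i\<le>1. f i (of_real l) * (of_real m - of_real l) ^ i / fact i) = kf \<theta> z m x - kf \<theta> z l x - of_real (m - l) * (w * kf \<theta> z l x)"
    by (simp add: f_def kf_def w_def algebra_simps)
  also have "C2 \<theta> z l0 * norm (complex_of_real m - of_real l) ^ Suc 1 / fact 1 = C2 \<theta> z l0 * (m - l)\<^sup>2"
    by (simp flip: of_real_diff add: power2_eq_square)
  finally show ?thesis by (simp add: w_def)
qed

text \<open>Discrete form of the statement that \<open>t \<mapsto> f t (exp (-c (T - t)))\<close> is constant if
  \<open>\<partial>\<^sub>t f = - c l \<partial>\<^sub>l f\<close>: since \<open>g = \<partial>\<^sub>l f\<close> is merely measurable in \<open>t\<close> at first, its modulus of continuity is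
  obtained from difference quotients of \<open>f\<close>.\<close>

lemma transport_constant:
  fixes f g :: "real \<Rightarrow> real \<Rightarrow> complex"
  assumes c: "c \<ge> 0" and sT: "s \<le> T"
    and l0: "0 < l0" "2 * l0 \<le> exp (- c * (T - s))"
    and f: "\<And>u v l. s \<le> u \<Longrightarrow> u \<le> v \<Longrightarrow> v \<le> T \<Longrightarrow> l0 \<le> l \<Longrightarrow> l \<le> 1 \<Longrightarrow>
      f v l - f u l = - of_real (c * l) * (CLINT r:{u..v}|lborel. g r l)"
    and gm: "\<And>l. l0 \<le> l \<Longrightarrow> l \<le> 1 \<Longrightarrow> set_integrable lborel {s..T} (\<lambda>r. g r l)"
    and gC: "\<And>u l. s \<le> u \<Longrightarrow> u \<le> T \<Longrightarrow> l0 \<le> l \<Longrightarrow> l \<le> 1 \<Longrightarrow> norm (g u l) \<le> K1"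
    and fC: "\<And>u l m. s \<le> u \<Longrightarrow> u \<le> T \<Longrightarrow> l0 \<le> l \<Longrightarrow> l \<le> 1 \<Longrightarrow> l0 \<le> m \<Longrightarrow> m \<le> 1 \<Longrightarrow>
      norm (f u m - f u l - of_real (m - l) * g u l) \<le> K2 * (m - l)\<^sup>2"
  shows "f T 1 = f s (exp (- c * (T - s)))"
proof (cases "s = T")
  case False
  with sT have sT': "s < T" by simp
  have e1: "exp (- c * (T - s)) \<le> 1" using c sT by simp
  have l1: "l0 \<le> 1" using l0 e1 by linarith
  have K1: "K1 \<ge> 0" using order_trans[OF norm_ge_zero gC[of s 1]] sT l1 by simp
  have K2: "K2 \<ge> 0"
  proof -
    have "0 \<le> K2 * (l0 - 1)\<^sup>2" using order_trans[OF norm_ge_zero fC[of s 1 l0]] sT l1 by simp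
    moreover have "l0 < 1" using l0 e1 by linarith
    then have "(l0 - 1)\<^sup>2 > 0" by simp
    ultimately show ?thesis by (simp add: zero_le_mult_iff)
  qed
  have setint: "set_integrable lborel {u..v} (\<lambda>r. g r l)" if "s \<le> u" "v \<le> T" "l0 \<le> l" "l \<le> 1" for u v l
    by (rule set_integrable_subset[OF gm]) (use that in auto)
  have lint: "norm (CLINT r:{u..v}|lborel. h r) \<le> C * (v - u)" if "u \<le> v" "set_integrable lborel {u..v} h" "\<And>r. u \<le> r \<Longrightarrow> r \<le> v \<Longrightarrow> norm (h r) \<le> C" for u v h C
  proof -
    have "norm (CLINT r:{u..v}|lborel. h r) \<le> (LINT r:{u..v}|lborel. norm (h r))"
      by (rule set_integral_norm_bound[OF that(2)])
    also have "\<dots> \<le> (LINT r:{u..v}|lborel. C)"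
    proof (rule set_integral_mono)
      show "set_integrable lborel {u..v} (\<lambda>r. norm (h r))" by (rule set_integrable_norm[OF that(2)])
      show "set_integrable lborel {u..v} (\<lambda>r. C)" using that(1) by (auto simp: set_integrable_def intro!: integrable_real_indicator)
    qed (use that in auto)
    also have "\<dots> = C * (v - u)" using that(1) by (simp add: set_lebesgue_integral_def)
    finally show ?thesis .
  qed
  have fu: "norm (f v l - f u l) \<le> c * K1 * (v - u)" if "s \<le> u" "u \<le> v" "v \<le> T" "l0 \<le> l" "l \<le> 1" for u v l
  proof -
    have "norm (f v l - f u l) = c * l * norm (CLINT r:{u..v}|lborel. g r l)"
      unfolding f[OF that] using c l0 that by (simp add: norm_mult)
    also have "\<dots> \<le> c * 1 * (K1 * (v - u))"
      by (intro mult_mono lint setint gC) (use that c K1 l0 in auto)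
    finally show ?thesis by simp
  qed
  \<comment> \<open>g is compared at two times through difference quotients of f with step e: their
    error is of order e, and f itself moves by O(v - u). Starting from l >= 2 l0 leaves room for l -
    e >= l0.\<close>
  have gh: "norm (g v l - g u l) \<le> 2 * (c * K1 * (v - u)) / e + 2 * K2 * e"
    if "s \<le> u" "u \<le> v" "v \<le> T" "2 * l0 \<le> l" "l \<le> 1" and e: "0 < e" "e \<le> l0" for u v l e
  proof -
    define m where "m = l - e"
    have m: "l0 \<le> m" "m \<le> 1" "l0 \<le> l" using that l0 by (auto simp: m_def)
    let ?a = "\<lambda>u. f u m - f u l - of_real (m - l) * g u l"
    have "complex_of_real e * (g v l - g u l) = (?a v - ?a u) - (f v m - f u m) + (f v l - f u l)"
      by (simp add: m_def algebra_simps)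
    then have "e * norm (g v l - g u l) = norm ((?a v - ?a u) - (f v m - f u m) + (f v l - f u l))"
      using e by (metis norm_mult norm_of_real abs_of_pos)
    also have "\<dots> \<le> norm (?a v) + norm (?a u) + norm (f v m - f u m) + norm (f v l - f u l)"
      by (intro order_trans[OF norm_triangle_ineq] add_mono order_trans[OF norm_triangle_ineq4] order_refl)
    also have "\<dots> \<le> K2 * (m - l)\<^sup>2 + K2 * (m - l)\<^sup>2 + c * K1 * (v - u) + c * K1 * (v - u)"
      by (intro add_mono fC fu) (use that m in auto)
    finally have "e * norm (g v l - g u l) \<le> 2 * K2 * e\<^sup>2 + 2 * (c * K1 * (v - u))" by (simp add: m_def algebra_simps)
    then have "norm (g v l - g u l) \<le> (2 * K2 * e\<^sup>2 + 2 * (c * K1 * (v - u))) / e" using e by (simp add: field_simps)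
    also have "\<dots> = 2 * (c * K1 * (v - u)) / e + 2 * K2 * e" using e by (simp add: field_simps power2_eq_square)
    finally show ?thesis .
  qed
  \<comment> \<open>The characteristic that passes through l = 1 at time T; by the choice of l0 it
    stays above 2 l0.\<close>
  define L where "L = (\<lambda>t. exp (- c * (T - t)))"
  define w where "w = (\<lambda>t. f t (L t))"
  have lam: "2 * l0 \<le> L t" "L t \<le> 1" if "s \<le> t" "t \<le> T" for t
  proof -
    have "c * (T - t) \<le> c * (T - s)" by (rule mult_left_mono) (use that c in auto)
    then have "exp (- c * (T - s)) \<le> L t" by (simp add: L_def)
    then show "2 * l0 \<le> L t" using l0(2) by linarith
    show "L t \<le> 1" using that c by (simp add: L_def)
  qed
  have step: "norm (w (t + h) - w t) \<le> h * (2 * c\<^sup>2 * K1 * h / e + 2 * c * K2 * e + c\<^sup>2 * h * K1 + K2 * c\<^sup>2 * h)"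
    if t: "s \<le> t" "t + h \<le> T" and h: "h > 0" and e: "0 < e" "e \<le> l0" for t h e
  proof -
    define l m where "l = L (t + h)" and "m = L t"
    have lm: "2 * l0 \<le> l" "l \<le> 1" "2 * l0 \<le> m" "m \<le> 1" using lam[of t] lam[of "t + h"] t h by (auto simp: l_def m_def)
    have m_eq: "m = l * exp (- (c * h))" by (simp add: l_def m_def L_def exp_add[symmetric] algebra_simps)
    have ch: "c * h \<ge> 0" using c h by simp
    have E1: "1 - c * h \<le> exp (- (c * h))" using exp_ge_add_one_self[of "- (c * h)"] by simp
    \<comment> \<open>exp(-y) <= 1 - y + y^2 for y >= 0: from exp(-y) <= 1/(1 + y) if y <= 1, and
      from y <= y^2 otherwise.\<close>
    have E2: "exp (- (c * h)) \<le> 1 - c * h + (c * h)\<^sup>2"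
    proof (cases "c * h \<le> 1")
      case True
      have "exp (- (c * h)) = 1 / exp (c * h)" by (simp add: exp_minus inverse_eq_divide)
      also have "\<dots> \<le> 1 / (1 + c * h)" using ch exp_ge_add_one_self[of "c * h"] by (intro divide_left_mono) auto
      also have "\<dots> \<le> 1 - c * h + (c * h)\<^sup>2"
      proof -
        have "(1 - c * h + (c * h)\<^sup>2) * (1 + c * h) = 1 + (c * h) ^ 3" by (simp add: algebra_simps power2_eq_square power3_eq_cube)
        also have "\<dots> \<ge> 1" using ch by simp
        finally show ?thesis using ch by (simp add: divide_le_eq)
      qed
      finally show ?thesis .
    next
      case False
      then have "c * h \<le> (c * h)\<^sup>2" using mult_left_mono[of 1 "c * h" "c * h"] ch by (simp add: power2_eq_square)
      moreover have "exp (- (c * h)) \<le> 1" using ch by simp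
      ultimately show ?thesis by linarith
    qed
    have d1: "\<bar>l - m\<bar> \<le> c * h"
    proof -
      have "l - m = l * (1 - exp (- (c * h)))" by (simp add: m_eq algebra_simps)
      also have "\<bar>\<dots>\<bar> \<le> 1 * (c * h)" unfolding abs_mult
        by (rule mult_mono) (use lm l0 E1 ch in auto)
      finally show ?thesis by simp
    qed
    \<comment> \<open>Along the characteristic the increment l - m agrees with c l h up to second
      order; this is the cancellation that makes w constant.\<close>
    have d2: "\<bar>c * l * h - (l - m)\<bar> \<le> (c * h)\<^sup>2"
    proof -
      have "c * l * h - (l - m) = l * (exp (- (c * h)) - (1 - c * h))" by (simp add: m_eq algebra_simps)
      also have "\<bar>\<dots>\<bar> \<le> 1 * (c * h)\<^sup>2" unfolding abs_mult
        by (rule mult_mono) (use lm l0 E1 E2 in auto)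
      finally show ?thesis by simp
    qed
    have gi: "set_integrable lborel {t..t + h} (\<lambda>r. g r l)" by (rule setint) (use t h lm l0 in auto)
    have ci: "set_integrable lborel {t..t + h} (\<lambda>r. g t l)"
      using h by (auto simp: set_integrable_def intro!: integrable_scaleR_left integrable_real_indicator)
    have I: "(CLINT r:{t..t + h}|lborel. g r l) = (CLINT r:{t..t + h}|lborel. g r l - g t l) + h * g t l"
      using set_integral_diff(2)[OF gi ci] h by (simp add: set_lebesgue_integral_def scaleR_conv_of_real)
    define a where "a = f t m - f t l - of_real (m - l) * g t l"
    have "w (t + h) - w t = (f (t + h) l - f t l) - (a + of_real (m - l) * g t l)"
      by (simp add: w_def a_def l_def m_def)
    also have "f (t + h) l - f t l = - of_real (c * l) * (CLINT r:{t..t + h}|lborel. g r l)"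
      by (rule f) (use t h lm l0 in auto)
    also have "- of_real (c * l) * (CLINT r:{t..t + h}|lborel. g r l) - (a + of_real (m - l) * g t l) =
      - (complex_of_real (c * l) * (CLINT r:{t..t + h}|lborel. g r l - g t l) + of_real (c * l * h - (l - m)) * g t l + a)"
      unfolding I by (simp add: algebra_simps)
    finally have "norm (w (t + h) - w t) = norm (complex_of_real (c * l) * (CLINT r:{t..t + h}|lborel. g r l - g t l) + of_real (c * l * h - (l - m)) * g t l + a)"
      by (simp only: norm_minus_cancel)
    also have "\<dots> \<le> norm (complex_of_real (c * l) * (CLINT r:{t..t + h}|lborel. g r l - g t l)) + norm (of_real (c * l * h - (l - m)) * g t l) + norm a"
      by (intro order_trans[OF norm_triangle_ineq] add_mono order_refl norm_triangle_ineq)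
    also have "\<dots> \<le> c * ((2 * (c * K1 * h) / e + 2 * K2 * e) * h) + (c * h)\<^sup>2 * K1 + K2 * (c * h)\<^sup>2"
    proof (intro add_mono)
      have "norm (CLINT r:{t..t + h}|lborel. g r l - g t l) \<le> (2 * (c * K1 * h) / e + 2 * K2 * e) * (t + h - t)"
      proof (rule lint)
        show "set_integrable lborel {t..t + h} (\<lambda>r. g r l - g t l)" by (rule set_integral_diff(1)[OF gi ci])
        fix r assume r: "t \<le> r" "r \<le> t + h"
        have "norm (g r l - g t l) \<le> 2 * (c * K1 * (r - t)) / e + 2 * K2 * e"
          by (rule gh) (use r t h lm e in auto)
        also have "\<dots> \<le> 2 * (c * K1 * h) / e + 2 * K2 * e"
          by (intro add_mono divide_right_mono mult_left_mono) (use r c K1 K2 e in auto)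
        finally show "norm (g r l - g t l) \<le> 2 * (c * K1 * h) / e + 2 * K2 * e" .
      qed (use h in simp)
      moreover have "norm (complex_of_real (c * l)) \<le> c" using c lm l0 by (simp add: mult_left_le norm_mult)
      ultimately show "norm (complex_of_real (c * l) * (CLINT r:{t..t + h}|lborel. g r l - g t l)) \<le> c * ((2 * (c * K1 * h) / e + 2 * K2 * e) * h)"
        unfolding norm_mult[of "complex_of_real (c * l)"] by (intro mult_mono) (use c in auto)
      show "norm (of_real (c * l * h - (l - m)) * g t l) \<le> (c * h)\<^sup>2 * K1"
        unfolding norm_mult norm_of_real by (intro mult_mono d2 gC) (use t h lm l0 in auto)
      have "norm a \<le> K2 * (m - l)\<^sup>2" unfolding a_def by (rule fC) (use t h lm l0 in auto)
      also have "(m - l)\<^sup>2 \<le> (c * h)\<^sup>2" using power_mono[OF d1, of 2] by (simp add: power2_commute)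
      finally show "norm a \<le> K2 * (c * h)\<^sup>2" using K2 by (simp add: mult_left_mono)
    qed
    also have "\<dots> = h * (2 * c\<^sup>2 * K1 * h / e + 2 * c * K2 * e + c\<^sup>2 * h * K1 + K2 * c\<^sup>2 * h)"
      using e by (simp add: field_simps power2_eq_square)
    finally show ?thesis .
  qed
  \<comment> \<open>Cutting [s, T] into n + 1 pieces and letting n grow removes every error term
    with a factor h. The term with e remains and vanishes only afterwards, as e tends to 0.\<close>
  have bnd: "norm (w T - w s) \<le> (T - s) * (2 * c * K2 * e)" if e: "0 < e" "e \<le> l0" for e
  proof -
    define h where "h = (\<lambda>n. (T - s) / real (Suc n))"
    have hpos: "h n > 0" for n using sT' by (simp add: h_def)
    let ?b = "\<lambda>h. 2 * c\<^sup>2 * K1 * h / e + 2 * c * K2 * e + c\<^sup>2 * h * K1 + K2 * c\<^sup>2 * h"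
    have "norm (w T - w s) \<le> (T - s) * ?b (h n)" for n
    proof -
      have part: "s + real (Suc i) * h n \<le> T" if "i < Suc n" for i
      proof -
        have "real (Suc i) * h n \<le> real (Suc n) * h n" using that hpos[of n] by (intro mult_right_mono) auto
        then show ?thesis by (simp add: h_def del: of_nat_Suc)
      qed
      have ws: "w T - w s = (\<Sum>i<Suc n. w (s + real (Suc i) * h n) - w (s + real i * h n))"
        using sum_lessThan_telescope[of "\<lambda>i. w (s + real i * h n)" "Suc n"]
        by (simp add: h_def del: of_nat_Suc sum.lessThan_Suc)
      have "norm (w T - w s) \<le> (\<Sum>i<Suc n. h n * ?b (h n))"
        unfolding ws
      proof (rule sum_norm_le)
        fix i assume "i \<in> {..<Suc n}"
        have si: "s + real (Suc i) * h n = s + real i * h n + h n" by (simp add: distrib_right)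
        show "norm (w (s + real (Suc i) * h n) - w (s + real i * h n)) \<le> h n * ?b (h n)"
          unfolding si
        proof (rule step)
          show "s \<le> s + real i * h n" using hpos[of n] by simp
          show "s + real i * h n + h n \<le> T" using part[of i] \<open>i \<in> {..<Suc n}\<close> si by simp
        qed (use hpos[of n] e in simp_all)
      qed
      also have "\<dots> = (T - s) * ?b (h n)"
      proof -
        have "real (Suc n) * h n = T - s" by (simp add: h_def del: of_nat_Suc)
        then show ?thesis unfolding sum_constant card_lessThan mult.assoc[symmetric, of "real (Suc n)"] by (simp only:)
      qed
      finally show ?thesis .
    qed
    moreover have "(\<lambda>n. (T - s) * ?b (h n)) \<longlonglongrightarrow> (T - s) * ?b 0"
    proof -
      have "h \<longlonglongrightarrow> 0" unfolding h_def by (rule LIMSEQ_Suc[OF lim_const_over_n])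
      then show ?thesis by (intro tendsto_intros) (use e in auto)
    qed
    ultimately have "norm (w T - w s) \<le> (T - s) * ?b 0" by (intro LIMSEQ_le_const) auto
    then show ?thesis by simp
  qed
  have "norm (w T - w s) \<le> (T - s) * (2 * c * K2 * 0)"
  proof (rule LIMSEQ_le_const)
    have "(\<lambda>n. l0 / real (Suc n)) \<longlonglongrightarrow> 0" by (rule LIMSEQ_Suc[OF lim_const_over_n])
    then show "(\<lambda>n. (T - s) * (2 * c * K2 * (l0 / real (Suc n)))) \<longlonglongrightarrow> (T - s) * (2 * c * K2 * 0)"
      by (intro tendsto_intros)
    show "\<exists>N. \<forall>n\<ge>N. norm (w T - w s) \<le> (T - s) * (2 * c * K2 * (l0 / real (Suc n)))"
      by (intro exI[of _ 0] allI impI bnd) (use l0 in \<open>auto simp: field_simps\<close>)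
  qed
  then have "w T = w s" by simp
  then show ?thesis by (simp add: w_def L_def)
qed simp

section \<open>The Markov property in terms of transforms\<close>

text \<open>The common ground of the process and of the martingale problem: it asks for no path
  regularity and mentions neither kernels nor conditional expectations, yet by separation it carries
  the full transition kernel.\<close>

definition tmarkov :: "real \<Rightarrow> real \<times> real \<Rightarrow> 'a measure \<Rightarrow> (real \<Rightarrow> 'a \<Rightarrow> real \<times> real) \<Rightarrow> bool" where
  "tmarkov c \<theta> M X \<longleftrightarrow> prob_space M \<and> (\<forall>t\<ge>0. X t \<in> borel_measurable M) \<and>
     (\<forall>t\<ge>0. \<forall>w\<in>space M. X t w \<in> E) \<and>
     (\<forall>s t. 0 \<le> s \<and> s \<le> t \<longrightarrow> (\<forall>A\<in>sets (nat_filtration M X s). \<forall>z\<in>E.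
       (CLINT w|M. indicator A w * F (X t w) z) = (CLINT w|M. indicator A w * F (mean c \<theta> (t - s) (X s w)) z)))"

lemma tmarkovD:
  assumes "tmarkov c \<theta> M X" "0 \<le> s" "s \<le> t" "A \<in> sets (nat_filtration M X s)" "z \<in> E"
  shows "(CLINT w|M. indicator A w * F (X t w) z) = (CLINT w|M. indicator A w * F (mean c \<theta> (t - s) (X s w)) z)"
  using assms by (simp add: tmarkov_def)

lemma mean_E: "c \<ge> 0 \<Longrightarrow> r \<ge> 0 \<Longrightarrow> \<theta> \<in> quadrant \<Longrightarrow> x \<in> E \<Longrightarrow> mean c \<theta> r x \<in> quadrant"
  by (simp add: mean_quadrant E_subset_quadrant)

lemma nat_filtration_sub:
  assumes "\<And>t. t \<ge> 0 \<Longrightarrow> X t \<in> borel_measurable M"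
  shows "subalgebra M (nat_filtration M X s)"
  using nat_filtration_subset[of X M s] assms by (auto simp: subalgebra_def)

lemma tmarkov_kernel:
  assumes T: "tmarkov c \<theta> M X" and c: "c \<ge> 0" and \<theta>: "\<theta> \<in> quadrant" and st: "0 \<le> s" "s \<le> t"
    and A: "A \<in> sets (nat_filtration M X s)" and f: "f \<in> borel_measurable borel"
  shows "(\<integral>\<^sup>+w. indicator A w * f (X t w) \<partial>M) = (\<integral>\<^sup>+w. indicator A w * (\<integral>\<^sup>+y. f y \<partial>kernel c \<theta> (t - s) (X s w)) \<partial>M)"
  unfolding kernel_eq
proof (rule kernel_nn_integral)
  have Xm: "X r \<in> borel_measurable M" if "r \<ge> 0" for r using T that by (simp add: tmarkov_def)
  show "prob_space M" using T by (simp add: tmarkov_def)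
  show "A \<in> sets M" using nat_filtration_sub[of X M s] Xm A by (auto simp: subalgebra_def)
  show "X t \<in> borel_measurable M" "(\<lambda>w. mean c \<theta> (t - s) (X s w)) \<in> borel_measurable M"
    using Xm[of t] measurable_compose[OF Xm[of s] mean_measurable] st by auto
  show "X t w \<in> E" "mean c \<theta> (t - s) (X s w) \<in> quadrant" if "w \<in> space M" for w
    using T that st c \<theta> by (auto simp: tmarkov_def intro!: mean_E)
  show "(CLINT w|M. indicator A w * F (X t w) z) = (CLINT w|M. indicator A w * F (mean c \<theta> (t - s) (X s w)) z)" if "z \<in> E" for z
    using T that st A by (simp add: tmarkov_def)
qed (rule f)

lemma kernel_integral_measurable:
  assumes T: "tmarkov c \<theta> M X" and c: "c \<ge> 0" and \<theta>: "\<theta> \<in> quadrant" and st: "0 \<le> s" "r \<ge> 0"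
    and f: "f \<in> borel_measurable borel"
  shows "(\<lambda>w. \<integral>\<^sup>+y. f y \<partial>kernel c \<theta> r (X s w)) \<in> borel_measurable (nat_filtration M X s)"
  unfolding kernel_eq
proof (rule kernel_measurable[OF f])
  have "X s \<in> borel_measurable (nat_filtration M X s)"
    using st by (rule_tac measurable_nat_filtration) auto
  then show "(\<lambda>w. mean c \<theta> r (X s w)) \<in> borel_measurable (nat_filtration M X s)" by simp
  fix w assume "w \<in> space (nat_filtration M X s)"
  then show "mean c \<theta> r (X s w) \<in> quadrant"
    using T st c \<theta> by (auto simp: tmarkov_def intro!: mean_E)
qed

text \<open>For x outside E the mean may leave the quadrant, where nothing is known about
  \<open>Q\<close>; hence the truncation.\<close>

lemma kernel_integral_E_measurable:
  assumes c: "c \<ge> 0" and \<theta>: "\<theta> \<in> quadrant" and r: "r \<ge> 0" and f: "f \<in> borel_measurable borel"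
  shows "(\<lambda>x. if x \<in> E then \<integral>\<^sup>+y. f y \<partial>kernel c \<theta> r x else 0) \<in> borel_measurable borel"
proof -
  define q where "q = (\<lambda>x. if x \<in> E then x else 0)"
  have [measurable]: "q \<in> borel_measurable borel" unfolding q_def by measurable
  have "(\<lambda>x. \<integral>\<^sup>+y. f y \<partial>Q (mean c \<theta> r (q x))) \<in> borel_measurable borel"
    by (rule kernel_measurable[OF f]) (auto simp: q_def intro!: mean_E c \<theta> r zero_in_E)
  then have "(\<lambda>x. if x \<in> E then \<integral>\<^sup>+y. f y \<partial>Q (mean c \<theta> r (q x)) else 0) \<in> borel_measurable borel" by measurable
  then show ?thesis by (simp add: q_def kernel_eq cong: if_cong)
qed

text \<open>With an indicator as test function, \<open>tmarkov_kernel\<close> is the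
  characterisation of the conditional probability by its integrals over past events.\<close>

lemma tmarkov_imp_MCB:
  assumes T: "tmarkov c \<theta> M X" and c: "c \<ge> 0" and \<theta>: "\<theta> \<in> quadrant"
    and cl: "\<And>w. w \<in> space M \<Longrightarrow> cadlag (\<lambda>t. X t w)"
  shows "infinite_rate_MCB c \<theta> M X"
  unfolding infinite_rate_MCB_def
proof (intro conjI allI impI ballI)
  show "prob_space M" using T by (simp add: tmarkov_def)
  interpret prob_space M by fact
  fix s t :: real and C :: "(real \<times> real) set" assume st: "0 \<le> s \<and> s \<le> t" and C[measurable]: "C \<in> sets borel"
  have Xm: "X r \<in> borel_measurable M" if "r \<ge> 0" for r using T that by (simp add: tmarkov_def)
  have [measurable]: "X t \<in> borel_measurable M" using st by (intro Xm) auto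
  have sub: "subalgebra M (nat_filtration M X s)" by (rule nat_filtration_sub[OF Xm])
  interpret finite_measure_subalgebra M "nat_filtration M X s" by unfold_locales (rule sub)
  have V: "mean c \<theta> (t - s) (X s w) \<in> quadrant" if "w \<in> space M" for w
    using T st c \<theta> that by (auto simp: tmarkov_def intro!: mean_E)
  let ?k = "\<lambda>w. kernel c \<theta> (t - s) (X s w)"
  have emk: "emeasure (?k w) C = ennreal (measure (?k w) C)" if "w \<in> space M" for w
    using Q_prob[OF V[OF that]] unfolding kernel_eq by (intro finite_measure.emeasure_eq_measure prob_space.finite_measure)
  have ei: "(\<integral>\<^sup>+y. indicator C y \<partial>?k w) = ennreal (measure (?k w) C)" if "w \<in> space M" for w
    using emk[OF that] sets_Q[OF V[OF that]] C by (simp add: kernel_eq)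
  have "(\<lambda>w. enn2real (\<integral>\<^sup>+y. indicator C y \<partial>?k w)) \<in> borel_measurable (nat_filtration M X s)"
    using kernel_integral_measurable[OF T c \<theta>, of s "t - s" "indicator C"] st by simp
  then have g: "(\<lambda>w. measure (?k w) C) \<in> borel_measurable (nat_filtration M X s)"
    by (rule measurable_cong[THEN iffD1, rotated]) (simp add: ei)
  have gM: "(\<lambda>w. measure (?k w) C) \<in> borel_measurable M" by (rule measurable_from_subalg[OF sub g])
  have gi: "integrable M (\<lambda>w. measure (?k w) C)"
    by (rule integrable_const_bound[where B = 1, OF _ gM])
      (use Q_prob[OF V] in \<open>auto intro!: AE_I2 prob_space.prob_le_1 simp: kernel_eq\<close>)
  show "AE w in M. real_cond_exp M (nat_filtration M X s) (\<lambda>w'. indicator C (X t w')) w = measure (?k w) C"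
  proof (rule real_cond_exp_charact[OF _ _ gi g])
    show "integrable M (\<lambda>w'. indicator C (X t w') :: real)"
      by (rule integrable_const_bound[where B = 1]) (auto simp: indicator_def)
    fix A assume A: "A \<in> sets (nat_filtration M X s)"
    then have [measurable]: "A \<in> sets M" using sub by (auto simp: subalgebra_def)
    have "ennreal (set_lebesgue_integral M A (\<lambda>w'. indicator C (X t w'))) = (\<integral>\<^sup>+w. ennreal (indicator A w * indicator C (X t w)) \<partial>M)"
      unfolding set_lebesgue_integral_def by (subst nn_integral_eq_integral) (auto intro!: integrable_const_bound[where B = 1] simp: indicator_def)
    also have "\<dots> = (\<integral>\<^sup>+w. indicator A w * indicator C (X t w) \<partial>M)"
      by (intro nn_integral_cong) (auto simp: indicator_def)
    also have "\<dots> = (\<integral>\<^sup>+w. indicator A w * (\<integral>\<^sup>+y. indicator C y \<partial>?k w) \<partial>M)"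
      by (rule tmarkov_kernel[OF T c \<theta> _ _ A]) (use st in auto)
    also have "\<dots> = (\<integral>\<^sup>+w. ennreal (indicator A w * measure (?k w) C) \<partial>M)"
      by (intro nn_integral_cong) (subst ei, assumption, auto simp: indicator_def)
    also have "\<dots> = ennreal (set_lebesgue_integral M A (\<lambda>w. measure (?k w) C))"
      unfolding set_lebesgue_integral_def using gi
      by (subst nn_integral_eq_integral) (auto intro: integrable_mult_indicator[where 'b = real, simplified])
    finally show "set_lebesgue_integral M A (\<lambda>w'. indicator C (X t w')) = set_lebesgue_integral M A (\<lambda>w. measure (?k w) C)"
      by (subst (asm) ennreal_inj) (auto simp: set_lebesgue_integral_def intro!: Bochner_Integration.integral_nonneg)
  qed
qed (use T cl in \<open>auto simp: tmarkov_def\<close>)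

text \<open>Conditional probabilities integrated over A say that the law of X t on A is a mixture of
  exit laws. Integrating F against both sides gives the transforms; the mixture is written on the
  product with the Brownian space, so that its integral is computed by Fubini's theorem and
  \<open>exit_point_law\<close>.\<close>

lemma MCB_imp_tmarkov:
  assumes P: "infinite_rate_MCB c \<theta> M X" and c: "c \<ge> 0" and \<theta>: "\<theta> \<in> quadrant"
  shows "tmarkov c \<theta> M X"
  unfolding tmarkov_def
proof (intro conjI allI impI ballI)
  show "prob_space M" using P by (simp add: infinite_rate_MCB_def)
  interpret prob_space M by fact
  interpret O: prob_space \<Omega>W by (rule prob_space_\<Omega>W)
  interpret P: pair_prob_space M \<Omega>W ..
  have Xm: "X r \<in> borel_measurable M" if "r \<ge> 0" for r using P that by (simp add: infinite_rate_MCB_def)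
  fix s t :: real and A z assume st: "0 \<le> s \<and> s \<le> t" and A: "A \<in> sets (nat_filtration M X s)" and z: "z \<in> E"
  have sub: "subalgebra M (nat_filtration M X s)" by (rule nat_filtration_sub[OF Xm])
  interpret finite_measure_subalgebra M "nat_filtration M X s" by unfold_locales (rule sub)
  have A'[measurable]: "A \<in> sets M" using sub A by (auto simp: subalgebra_def)
  have [measurable]: "X t \<in> borel_measurable M" "X s \<in> borel_measurable M" using st by (auto intro!: Xm)
  define V where "V = (\<lambda>w. mean c \<theta> (t - s) (X s w))"
  have Vm[measurable]: "V \<in> borel_measurable M" unfolding V_def by measurable
  have V: "V w \<in> quadrant" if "w \<in> space M" for w
    using P st c \<theta> that by (auto simp: V_def infinite_rate_MCB_def intro!: mean_E)
  define Y where "Y = (\<lambda>p. exit_point (V (fst p)) (snd p))"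
  have Ym[measurable]: "Y \<in> borel_measurable (M \<Otimes>\<^sub>M \<Omega>W)"
    using measurable_compose[OF measurable_Pair[OF measurable_compose[OF measurable_fst Vm] measurable_snd] exit_point_pair_measurable]
    by (simp add: Y_def)
  have eq: "distr (density M (indicator A)) borel (X t) = distr (density (M \<Otimes>\<^sub>M \<Omega>W) (\<lambda>p. indicator A (fst p))) borel Y"
  proof (rule measure_eqI)
    fix C assume "C \<in> sets (distr (density M (indicator A)) borel (X t))"
    then have C[measurable]: "C \<in> sets borel" by simp
    let ?k = "\<lambda>w. measure (Q (V w)) C"
    have emk: "emeasure (Q (V w)) C = ennreal (?k w)" if "w \<in> space M" for w
      using Q_prob[OF V[OF that]] by (intro finite_measure.emeasure_eq_measure prob_space.finite_measure)
    have ei: "(\<integral>\<^sup>+y. indicator C y \<partial>Q (V w)) = ennreal (?k w)" if "w \<in> space M" for w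
      using emk[OF that] sets_Q[OF V[OF that]] C by simp
    have [measurable]: "(\<lambda>w. ?k w) \<in> borel_measurable M"
    proof -
      have "(\<lambda>w. enn2real (\<integral>\<^sup>+y. indicator C y \<partial>Q (V w))) \<in> borel_measurable M"
        using kernel_measurable[OF _ Vm V, of "indicator C"] by simp
      then show ?thesis by (rule measurable_cong[THEN iffD1, rotated]) (simp add: ei)
    qed
    have ki: "integrable M ?k"
      by (rule integrable_const_bound[where B = 1]) (use Q_prob[OF V] in \<open>auto intro!: AE_I2 prob_space.prob_le_1\<close>)
    have ci: "integrable M (\<lambda>w'. indicator C (X t w') :: real)"
      by (rule integrable_const_bound[where B = 1]) (auto simp: indicator_def)
    have ce: "AE w in M. real_cond_exp M (nat_filtration M X s) (\<lambda>w'. indicator C (X t w')) w = ?k w"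
      using P st C unfolding infinite_rate_MCB_def kernel_eq V_def by blast
    have "set_lebesgue_integral M A (\<lambda>w'. indicator C (X t w')) = set_lebesgue_integral M A (real_cond_exp M (nat_filtration M X s) (\<lambda>w'. indicator C (X t w')))"
      by (rule real_cond_exp_intA[OF ci A])
    also have "\<dots> = set_lebesgue_integral M A ?k"
      unfolding set_lebesgue_integral_def
      by (rule integral_cong_AE) (use ce in \<open>auto intro: borel_measurable_cond_exp2\<close>)
    finally have I: "set_lebesgue_integral M A (\<lambda>w'. indicator C (X t w')) = set_lebesgue_integral M A ?k" .
    have "emeasure (distr (density M (indicator A)) borel (X t)) C = (\<integral>\<^sup>+w. indicator A w * indicator C (X t w) \<partial>M)"
      by (subst emeasure_distr) (auto simp: emeasure_density indicator_def intro!: nn_integral_cong)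
    also have "\<dots> = (\<integral>\<^sup>+w. ennreal (indicator A w * indicator C (X t w)) \<partial>M)"
      by (intro nn_integral_cong) (auto simp: indicator_def)
    also have "\<dots> = ennreal (set_lebesgue_integral M A (\<lambda>w'. indicator C (X t w')))"
      unfolding set_lebesgue_integral_def by (subst nn_integral_eq_integral) (auto intro!: integrable_const_bound[where B = 1] simp: indicator_def)
    also have "\<dots> = (\<integral>\<^sup>+w. ennreal (indicator A w * ?k w) \<partial>M)"
      unfolding I unfolding set_lebesgue_integral_def using ki
      by (subst nn_integral_eq_integral) (auto intro: integrable_mult_indicator[where 'b = real, simplified])
    also have "\<dots> = (\<integral>\<^sup>+w. indicator A w * (\<integral>\<^sup>+y. indicator C y \<partial>Q (V w)) \<partial>M)"
      by (intro nn_integral_cong) (subst ei, assumption, auto simp: indicator_def)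
    also have "\<dots> = (\<integral>\<^sup>+w. \<integral>\<^sup>+w'. indicator A w * indicator C (Y (w, w')) \<partial>\<Omega>W \<partial>M)"
    proof (intro nn_integral_cong)
      fix w assume "w \<in> space M"
      note v = V[OF this]
      have e: "(\<integral>\<^sup>+y. indicator C y \<partial>Q (V w)) = (\<integral>\<^sup>+w'. indicator C (Y (w, w')) \<partial>\<Omega>W)"
        unfolding Q_eq[OF v] Y_def by (subst nn_integral_distr[OF exit_point_law(1)[OF v]]) auto
      have "(\<lambda>w'. Y (w, w')) \<in> borel_measurable \<Omega>W" using exit_point_law(1)[OF v] by (simp add: Y_def)
      then show "indicator A w * (\<integral>\<^sup>+y. indicator C y \<partial>Q (V w)) = (\<integral>\<^sup>+w'. indicator A w * indicator C (Y (w, w')) \<partial>\<Omega>W)"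
        unfolding e by (subst nn_integral_cmult) auto
    qed
    also have "\<dots> = (\<integral>\<^sup>+p. indicator A (fst p) * indicator C (Y p) \<partial>(M \<Otimes>\<^sub>M \<Omega>W))"
      by (subst O.nn_integral_fst[symmetric]) auto
    also have "\<dots> = emeasure (distr (density (M \<Otimes>\<^sub>M \<Omega>W) (\<lambda>p. indicator A (fst p))) borel Y) C"
      by (subst emeasure_distr) (auto simp: emeasure_density indicator_def intro!: nn_integral_cong)
    finally show "emeasure (distr (density M (indicator A)) borel (X t)) C = emeasure (distr (density (M \<Otimes>\<^sub>M \<Omega>W) (\<lambda>p. indicator A (fst p))) borel Y) C" .
  qed simp
  have dM: "(CLINT w|M. indicator A w * f w) = (CLINT w|density M (indicator A). f w)" if "f \<in> borel_measurable M" for f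
  proof -
    have "(CLINT w|density M (\<lambda>w. ennreal (indicator A w)). f w) = (CLINT w|M. (indicator A w :: real) *\<^sub>R f w)"
      by (rule integral_density) (use that in auto)
    also have "\<dots> = (CLINT w|M. indicator A w * f w)"
      by (intro Bochner_Integration.integral_cong) (auto simp: indicator_def)
    finally show ?thesis by (simp add: ennreal_indicator)
  qed
  have Yb: "AE p in M \<Otimes>\<^sub>M \<Omega>W. Y p \<in> E"
    by (rule P.AE_pair_measure) (auto simp: Y_def intro!: AE_I2 exit_point_law(2) V)
  have "(CLINT w|M. indicator A w * F (X t w) z) = (CLINT y|distr (density M (indicator A)) borel (X t). F y z)"
    by (subst integral_distr) (auto simp: dM)
  also have "\<dots> = (CLINT p|density (M \<Otimes>\<^sub>M \<Omega>W) (\<lambda>p. ennreal (indicator A (fst p))). F (Y p) z)"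
    unfolding eq by (subst integral_distr) (auto simp: ennreal_indicator)
  also have "\<dots> = (CLINT p|M \<Otimes>\<^sub>M \<Omega>W. (indicator A (fst p) :: real) *\<^sub>R F (Y p) z)"
    by (subst integral_density) auto
  also have "\<dots> = (CLINT w|M. CLINT w'|\<Omega>W. (indicator A w :: real) *\<^sub>R F (Y (w, w')) z)"
  proof (subst P.integral_fst'[symmetric])
    show "integrable (M \<Otimes>\<^sub>M \<Omega>W) (\<lambda>p. (indicator A (fst p) :: real) *\<^sub>R F (Y p) z)"
      by (rule P.integrable_const_bound[where B = 1])
        (use Yb z in \<open>auto elim!: eventually_mono intro!: mult_le_one norm_F_le E_subset_quadrant simp: indicator_def\<close>)
  qed simp
  also have "\<dots> = (CLINT w|M. indicator A w * F (V w) z)"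
  proof (rule Bochner_Integration.integral_cong[OF refl])
    fix w assume "w \<in> space M"
    from exit_point_law(3)[OF V[OF this] z] show "(CLINT w'|\<Omega>W. (indicator A w :: real) *\<^sub>R F (Y (w, w')) z) = indicator A w * F (V w) z"
      by (simp add: Y_def indicator_def)
  qed
  finally show "(CLINT w|M. indicator A w * F (X t w) z) = (CLINT w|M. indicator A w * F (mean c \<theta> (t - s) (X s w)) z)"
    by (simp add: V_def)
qed (use P in \<open>auto simp: infinite_rate_MCB_def\<close>)

text \<open>Induction on the largest time b: what happens after b is integrated out by the kernel
  and absorbed into a function of X b. The free test function at a later time u is there to receive
  it.\<close>

lemma tmarkov_fdd_integral:
  assumes TX: "tmarkov c \<theta> M X" and TY: "tmarkov c \<theta> N Y" and c: "c \<ge> 0" and \<theta>: "\<theta> \<in> quadrant"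
    and init: "distr M borel (X 0) = distr N borel (Y 0)"
    and J: "finite J" "J \<subseteq> {0..}" and A: "\<And>s. A s \<in> sets borel" and u: "0 \<le> u" "\<And>s. s \<in> J \<Longrightarrow> s \<le> u"
    and f: "f \<in> borel_measurable borel"
  shows "(\<integral>\<^sup>+w. (\<Prod>s\<in>J. indicator (A s) (X s w)) * f (X u w) \<partial>M) = (\<integral>\<^sup>+w. (\<Prod>s\<in>J. indicator (A s) (Y s w)) * f (Y u w) \<partial>N)"
  using J u f
proof (induction J arbitrary: u f rule: finite_linorder_max_induct)
  case empty
  have "(\<integral>\<^sup>+w. f (X u w) \<partial>M) = (\<integral>\<^sup>+x. (if x \<in> E then \<integral>\<^sup>+y. f y \<partial>kernel c \<theta> u x else 0) \<partial>distr M borel (X 0))"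
    if TX: "tmarkov c \<theta> M X" for M :: "'c measure" and X
  proof -
    have "(\<integral>\<^sup>+w. f (X u w) \<partial>M) = (\<integral>\<^sup>+w. indicator (space M) w * f (X u w) \<partial>M)"
      by (intro nn_integral_cong) auto
    also have "\<dots> = (\<integral>\<^sup>+w. indicator (space M) w * (\<integral>\<^sup>+y. f y \<partial>kernel c \<theta> (u - 0) (X 0 w)) \<partial>M)"
      by (rule tmarkov_kernel[OF TX c \<theta>])
        (use empty sets.top[of "nat_filtration M X 0"] in auto)
    also have "\<dots> = (\<integral>\<^sup>+w. (if X 0 w \<in> E then \<integral>\<^sup>+y. f y \<partial>kernel c \<theta> u (X 0 w) else 0) \<partial>M)"
      using TX by (intro nn_integral_cong) (auto simp: tmarkov_def)
    also have "\<dots> = (\<integral>\<^sup>+x. (if x \<in> E then \<integral>\<^sup>+y. f y \<partial>kernel c \<theta> u x else 0) \<partial>distr M borel (X 0))"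
      using TX empty c \<theta> by (subst nn_integral_distr) (auto simp: tmarkov_def intro!: kernel_integral_E_measurable)
    finally show ?thesis .
  qed
  from this[OF TX] this[OF TY] init show ?case by simp
next
  case (insert b J)
  then have b0: "0 \<le> b" and bu: "b \<le> u" by auto
  define g where "g = (\<lambda>x. if x \<in> E then \<integral>\<^sup>+y. f y \<partial>kernel c \<theta> (u - b) x else 0)"
  have gm: "g \<in> borel_measurable borel"
    unfolding g_def using insert.prems bu c \<theta> by (intro kernel_integral_E_measurable) auto
  have step: "(\<integral>\<^sup>+w. (\<Prod>s\<in>insert b J. indicator (A s) (X s w)) * f (X u w) \<partial>M) = (\<integral>\<^sup>+w. (\<Prod>s\<in>J. indicator (A s) (X s w)) * (indicator (A b) (X b w) * g (X b w)) \<partial>M)"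
    if TX: "tmarkov c \<theta> M X" for M :: "'c measure" and X
  proof -
    define B where "B = {w\<in>space M. \<forall>s\<in>insert b J. X s w \<in> A s}"
    have BJ: "(\<Prod>s\<in>insert b J. indicator (A s) (X s w)) = (indicator B w :: ennreal)" if "w \<in> space M" for w
      proof (cases "w \<in> B")
      case True
      then have "(\<Prod>s\<in>insert b J. indicator (A s) (X s w) :: ennreal) = 1"
        by (intro prod.neutral) (auto simp: B_def)
      then show ?thesis using True by simp
    next
      case False
      then have "\<exists>s\<in>insert b J. (indicator (A s) (X s w) :: ennreal) = 0" using that by (auto simp: B_def indicator_def)
      then have "(\<Prod>s\<in>insert b J. indicator (A s) (X s w) :: ennreal) = 0"
        using insert.hyps(1) by (intro prod_zero) auto
      then show ?thesis using False by simp
    qed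
    have "B \<in> sets (nat_filtration M X b)"
    proof -
      have "{w\<in>space (nat_filtration M X b). \<forall>s\<in>insert b J. X s w \<in> A s} \<in> sets (nat_filtration M X b)"
      proof (rule sets.sets_Collect_finite_All)
        fix s assume "s \<in> insert b J"
        then have "X s \<in> borel_measurable (nat_filtration M X b)"
          using insert.hyps insert.prems b0 by (intro measurable_nat_filtration) auto
        from measurable_sets[OF this A[of s]]
        show "{w\<in>space (nat_filtration M X b). X s w \<in> A s} \<in> sets (nat_filtration M X b)"
          by (auto simp: vimage_def Int_def conj_commute)
      qed (use insert.hyps in simp)
      then show ?thesis by (simp add: B_def)
    qed
    note k = tmarkov_kernel[OF TX c \<theta> b0 bu this insert.prems(4)]
    have "(\<integral>\<^sup>+w. (\<Prod>s\<in>insert b J. indicator (A s) (X s w)) * f (X u w) \<partial>M) = (\<integral>\<^sup>+w. indicator B w * f (X u w) \<partial>M)"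
      by (intro nn_integral_cong) (simp only: BJ)
    also have "\<dots> = (\<integral>\<^sup>+w. indicator B w * g (X b w) \<partial>M)"
      unfolding k using TX b0 by (intro nn_integral_cong) (auto simp: g_def tmarkov_def)
    also have "\<dots> = (\<integral>\<^sup>+w. (\<Prod>s\<in>insert b J. indicator (A s) (X s w)) * g (X b w) \<partial>M)"
      by (intro nn_integral_cong) (simp only: BJ)
    also have "\<dots> = (\<integral>\<^sup>+w. (\<Prod>s\<in>J. indicator (A s) (X s w)) * (indicator (A b) (X b w) * g (X b w)) \<partial>M)"
      using insert.hyps by (intro nn_integral_cong, subst prod.insert) (auto simp: ac_simps)
    finally show ?thesis .
  qed
  have "(\<integral>\<^sup>+w. (\<Prod>s\<in>J. indicator (A s) (X s w)) * (\<lambda>x. indicator (A b) x * g x) (X b w) \<partial>M) = (\<integral>\<^sup>+w. (\<Prod>s\<in>J. indicator (A s) (Y s w)) * (\<lambda>x. indicator (A b) x * g x) (Y b w) \<partial>N)"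
    using insert.hyps insert.prems b0 gm A by (intro insert.IH) (auto intro: less_imp_le)
  then show ?case unfolding step[OF TX] step[OF TY] .
qed

lemma tmarkov_unique:
  assumes TX: "tmarkov c \<theta> M X" and TY: "tmarkov c \<theta> N Y" and c: "c \<ge> 0" and \<theta>: "\<theta> \<in> quadrant"
    and init: "distr M borel (X 0) = distr N borel (Y 0)"
  shows "same_fdd M X N Y"
  unfolding same_fdd_def
proof (intro allI impI)
  fix J :: "real set" assume J: "finite J \<and> J \<subseteq> {0..}"
  have Jf: "finite J" using J by simp
  interpret M: prob_space M using TX by (simp add: tmarkov_def)
  have m: "(\<lambda>w. \<lambda>t\<in>J. X t w) \<in> M \<rightarrow>\<^sub>M PiM J (\<lambda>_. borel)" if "tmarkov c \<theta> M X" for M :: "'c measure" and X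
    using J that by (intro measurable_restrict) (auto simp: tmarkov_def)
  have e: "emeasure (distr M (PiM J (\<lambda>_. borel)) (\<lambda>w. \<lambda>t\<in>J. X t w)) (Pi\<^sub>E J A) = (\<integral>\<^sup>+w. (\<Prod>s\<in>J. indicator (A s) (X s w)) * 1 \<partial>M)"
    if "tmarkov c \<theta> M X" and A: "\<And>s. A s \<in> sets borel" for M :: "'c measure" and X and A :: "real \<Rightarrow> (real \<times> real) set"
  proof -
    have P: "Pi\<^sub>E J A \<in> sets (PiM J (\<lambda>_. borel))" using Jf A by (intro sets_PiM_I_finite) auto
    have "emeasure (distr M (PiM J (\<lambda>_. borel)) (\<lambda>w. \<lambda>t\<in>J. X t w)) (Pi\<^sub>E J A) = emeasure M ((\<lambda>w. \<lambda>t\<in>J. X t w) -` Pi\<^sub>E J A \<inter> space M)"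
      by (rule emeasure_distr[OF m[OF that(1)] P])
    also have "\<dots> = (\<integral>\<^sup>+w. indicator ((\<lambda>w. \<lambda>t\<in>J. X t w) -` Pi\<^sub>E J A \<inter> space M) w \<partial>M)"
      by (rule nn_integral_indicator[symmetric], rule measurable_sets[OF m[OF that(1)] P])
    also have "\<dots> = (\<integral>\<^sup>+w. (\<Prod>s\<in>J. indicator (A s) (X s w)) * 1 \<partial>M)"
      using Jf by (intro nn_integral_cong) (auto simp: indicator_def prod_zero_iff PiE_iff)
    finally show ?thesis .
  qed
  show "distr M (PiM J (\<lambda>_. borel)) (\<lambda>w. \<lambda>t\<in>J. X t w) = distr N (PiM J (\<lambda>_. borel)) (\<lambda>w. \<lambda>t\<in>J. Y t w)"
  proof (rule measure_eqI_PiM_finite[OF Jf])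
    fix A :: "real \<Rightarrow> (real \<times> real) set" assume A: "\<And>i. i \<in> J \<Longrightarrow> A i \<in> sets borel"
    \<comment> \<open>The integral lemma asks for Borel sets at all indices, also outside J.\<close>
    define A' where "A' = (\<lambda>s. if s \<in> J then A s else {})"
    have A': "A' s \<in> sets borel" for s using A by (auto simp: A'_def)
    have pe: "Pi\<^sub>E J A = Pi\<^sub>E J A'" by (auto simp: A'_def PiE_iff)
    define u where "u = (if J = {} then 0 else Max J)"
    have u: "0 \<le> u" "\<And>s. s \<in> J \<Longrightarrow> s \<le> u"
      using Jf J Max_in[OF Jf] Max_ge[OF Jf] by (fastforce simp: u_def)+
    have "(\<integral>\<^sup>+w. (\<Prod>s\<in>J. indicator (A' s) (X s w)) * (\<lambda>_. 1) (X u w) \<partial>M) = (\<integral>\<^sup>+w. (\<Prod>s\<in>J. indicator (A' s) (Y s w)) * (\<lambda>_. 1) (Y u w) \<partial>N)"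
      by (rule tmarkov_fdd_integral[OF TX TY c \<theta> init]) (use J A' u in auto)
    then show "emeasure (distr M (PiM J (\<lambda>_. borel)) (\<lambda>w. \<lambda>t\<in>J. X t w)) (Pi\<^sub>E J A) = emeasure (distr N (PiM J (\<lambda>_. borel)) (\<lambda>w. \<lambda>t\<in>J. Y t w)) (Pi\<^sub>E J A)"
      unfolding pe e[OF TX A'] e[OF TY A'] .
  next
    show "range (\<lambda>_::nat. Pi\<^sub>E J (\<lambda>_. UNIV)) \<subseteq> prod_algebra J (\<lambda>_. borel :: (real \<times> real) measure)"
      using prod_algebraI_finite[OF Jf, of "\<lambda>_. UNIV" "\<lambda>_. borel"] by auto
    show "(\<Union>i::nat. Pi\<^sub>E J (\<lambda>_. UNIV)) = space (PiM J (\<lambda>_. borel :: (real \<times> real) measure))" by (simp add: space_PiM)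
    interpret D: prob_space "distr M (PiM J (\<lambda>_. borel)) (\<lambda>w. \<lambda>t\<in>J. X t w)" by (rule M.prob_space_distr[OF m[OF TX]])
    show "emeasure (distr M (PiM J (\<lambda>_. borel)) (\<lambda>w. \<lambda>t\<in>J. X t w)) (Pi\<^sub>E J (\<lambda>_. UNIV)) \<noteq> \<infinity>" for i :: nat by simp
  qed auto
qed

section \<open>The martingale problem\<close>

lemma bounded_indicator_integral:
  fixes Y :: "'a \<Rightarrow> complex"
  assumes M: "prob_space M" and Y: "Y \<in> borel_measurable M" and K: "\<And>w. w \<in> space M \<Longrightarrow> norm (Y w) \<le> K" and A: "A \<in> sets M"
  shows "integrable M (\<lambda>w. indicator A w * Y w)" "norm (CLINT w|M. indicator A w * Y w) \<le> K"
proof -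
  interpret prob_space M by fact
  have b: "norm (indicator A w * Y w) \<le> K" if "w \<in> space M" for w
    using K[OF that] order_trans[OF norm_ge_zero K[OF that]] by (auto simp: indicator_def)
  show i: "integrable M (\<lambda>w. indicator A w * Y w)"
    by (rule integrable_const_bound[where B = K]) (use b Y A in auto)
  have "norm (CLINT w|M. indicator A w * Y w) \<le> (LINT w|M. norm (indicator A w * Y w))"
    by (rule integral_norm_bound)
  also have "\<dots> \<le> (LINT w|M. K)"
    by (rule integral_mono[OF integrable_norm[OF i]]) (use b in auto)
  finally show "norm (CLINT w|M. indicator A w * Y w) \<le> K" by (simp add: prob_space)
qed

lemma genF_kf: "F \<theta> ((1 - l) *\<^sub>R z) * genF c \<theta> (l *\<^sub>R z) x = - of_real (c * l) * (((x - \<theta>) \<diamondop> z) * kf \<theta> z l x)"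
  unfolding kf_F_split genF_def by (simp add: diamond_scale diamond_scale_right diamond_diff algebra_simps)

lemma kf_1: "kf \<theta> z 1 x = F x z" by (simp add: kf_F)

lemma genF_bound:
  assumes "x \<in> quadrant" "\<theta> \<in> quadrant" "z \<in> E" "c \<ge> 0"
  shows "norm (genF c \<theta> z x) \<le> c * C1 \<theta> z 1"
proof -
  have "genF c \<theta> z x = - of_real c * (((x - \<theta>) \<diamondop> z) * kf \<theta> z 1 x)"
    by (simp add: kf_1 genF_def diamond_scale diamond_diff algebra_simps)
  then have "norm (genF c \<theta> z x) = c * norm (((x - \<theta>) \<diamondop> z) * kf \<theta> z 1 x)"
    using assms by (simp add: norm_mult)
  also have "\<dots> \<le> c * C1 \<theta> z 1"
    by (rule mult_left_mono[OF kf_bounds(1)]) (use assms in auto)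
  finally show ?thesis .
qed

lemma genF_measurable[measurable]: "genF c \<theta> z \<in> borel_measurable borel"
  unfolding genF_def diamond_def F_def by (auto intro!: borel_measurable_continuous_onI continuous_intros)

lemma Icc_integral_split:
  fixes f :: "real \<Rightarrow> complex"
  assumes "set_integrable lborel {a..c} f" "a \<le> b" "b \<le> c"
  shows "(CLINT r:{a..c}|lborel. f r) = (CLINT r:{a..b}|lborel. f r) + (CLINT r:{b..c}|lborel. f r)"
proof -
  have "{a..c} = {a..b} \<union> {b..c}" using assms by auto
  moreover have "(CLINT r:{a..b} \<union> {b..c}|lborel. f r) = (CLINT r:{a..b}|lborel. f r) + (CLINT r:{b..c}|lborel. f r)"
  proof (rule set_integral_Un_AE)
    show "AE x in lborel. \<not> (x \<in> {a..b} \<and> x \<in> {b..c})" using AE_lborel_singleton[of b] by eventually_elim auto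
    show "set_integrable lborel {a..b} f" "set_integrable lborel {b..c} f"
      by (rule set_integrable_subset[OF assms(1)]; use assms in auto)+
  qed auto
  ultimately show ?thesis by simp
qed

lemma fubini_bounded:
  fixes g :: "real \<Rightarrow> 'a \<Rightarrow> complex"
  assumes M: "prob_space M" and uv: "u \<le> v"
    and m: "(\<lambda>(r, w). indicator {u..v} r *\<^sub>R g r w) \<in> borel_measurable (lborel \<Otimes>\<^sub>M M)"
    and K: "\<And>r w. u \<le> r \<Longrightarrow> r \<le> v \<Longrightarrow> w \<in> space M \<Longrightarrow> norm (g r w) \<le> K"
  shows "(CLINT w|M. (CLINT r:{u..v}|lborel. g r w)) = (CLINT r:{u..v}|lborel. CLINT w|M. g r w)"
    and "integrable M (\<lambda>w. CLINT r:{u..v}|lborel. g r w)"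
    and "set_integrable lborel {u..v} (\<lambda>r. CLINT w|M. g r w)"
    and "\<And>w. w \<in> space M \<Longrightarrow> set_integrable lborel {u..v} (\<lambda>r. g r w)"
proof -
  interpret M: prob_space M by fact
  interpret P: pair_sigma_finite lborel M ..
  have S: "{u..v} \<times> space M \<in> sets (lborel \<Otimes>\<^sub>M M)" by auto
  have "emeasure (lborel \<Otimes>\<^sub>M M) ({u..v} \<times> space M) = ennreal (v - u)"
    using uv by (subst M.emeasure_pair_measure_Times) (auto simp: M.emeasure_space_1)
  then have S': "integrable (lborel \<Otimes>\<^sub>M M) (\<lambda>p. K * indicator ({u..v} \<times> space M) p)"
    using S by (intro integrable_mult_right integrable_real_indicator) auto
  have i: "integrable (lborel \<Otimes>\<^sub>M M) (\<lambda>(r, w). indicator {u..v} r *\<^sub>R g r w)"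
    by (rule Bochner_Integration.integrable_bound[OF S' m])
      (auto intro!: AE_I2 order_trans[OF K abs_ge_self] simp: indicator_def space_pair_measure)
  show "(CLINT w|M. (CLINT r:{u..v}|lborel. g r w)) = (CLINT r:{u..v}|lborel. CLINT w|M. g r w)"
    using P.Fubini_integral[OF i] by (simp add: set_lebesgue_integral_def)
  show "integrable M (\<lambda>w. CLINT r:{u..v}|lborel. g r w)"
    using P.integrable_snd[OF i] by (simp add: set_lebesgue_integral_def)
  show "set_integrable lborel {u..v} (\<lambda>r. CLINT w|M. g r w)"
    using P.integrable_fst[OF i] by (simp add: set_integrable_def)
  fix w assume w: "w \<in> space M"
  have K': "integrable lborel (\<lambda>r. K * indicator {u..v} r)"
    using uv by (intro integrable_mult_right integrable_real_indicator) auto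
  have m': "(\<lambda>r. indicator {u..v} r *\<^sub>R g r w) \<in> borel_measurable lborel"
    using measurable_compose[OF measurable_Pair2'[OF w] m] by simp
  show "set_integrable lborel {u..v} (\<lambda>r. g r w)"
    unfolding set_integrable_def
    by (rule Bochner_Integration.integrable_bound[OF K' m'])
      (auto intro!: AE_I2 order_trans[OF K abs_ge_self] w simp: indicator_def)
qed

text \<open>This and \<open>complex_martingaleI\<close> translate between conditional expectations
  of real and imaginary parts and complex integrals over past events, the form in which transforms
  appear.\<close>

lemma complex_martingale_integral:
  assumes M: "prob_space M" and mart: "complex_martingale M FF Y" and uv: "0 \<le> u" "u \<le> v" and A: "A \<in> sets (FF u)"
  shows "(CLINT w|M. indicator A w * Y v w) = (CLINT w|M. indicator A w * Y u w)"
proof -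
  interpret prob_space M by fact
  have real: "integrable M (y t)" "(LINT w|M. indicator A w * y v w) = (LINT w|M. indicator A w * y u w)"
    if "real_martingale M FF y" "t \<ge> 0" for y t
  proof -
    have sub: "subalgebra M (FF u)" using that uv by (simp add: real_martingale_def filtration_def)
    then have [measurable]: "A \<in> sets M" using A by (auto simp: subalgebra_def)
    interpret finite_measure_subalgebra M "FF u" by unfold_locales (rule sub)
    have i: "integrable M (y t)" if "t \<ge> 0" for t using \<open>real_martingale M FF y\<close> that by (simp add: real_martingale_def)
    then show "integrable M (y t)" using that by simp
    have "set_lebesgue_integral M A (y v) = set_lebesgue_integral M A (real_cond_exp M (FF u) (y v))"
      by (rule real_cond_exp_intA[OF i A]) (use uv in auto)
    moreover have ce: "AE w in M. real_cond_exp M (FF u) (y v) w = y u w"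
      using that uv by (simp add: real_martingale_def)
    have "set_lebesgue_integral M A (real_cond_exp M (FF u) (y v)) = set_lebesgue_integral M A (y u)"
      unfolding set_lebesgue_integral_def
    proof (rule integral_cong_AE)
      show "AE w in M. indicator A w *\<^sub>R real_cond_exp M (FF u) (y v) w = indicator A w *\<^sub>R y u w"
        using ce by eventually_elim simp
    qed (use borel_measurable_integrable[OF i] uv in auto)
    ultimately show "(LINT w|M. indicator A w * y v w) = (LINT w|M. indicator A w * y u w)"
      by (simp add: set_lebesgue_integral_def)
  qed
  have "subalgebra M (FF u)" using mart uv by (simp add: complex_martingale_def real_martingale_def filtration_def)
  then have [measurable]: "A \<in> sets M" using A by (auto simp: subalgebra_def)
  have R: "real_martingale M FF (\<lambda>t w. Re (Y t w))" "real_martingale M FF (\<lambda>t w. Im (Y t w))"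
    using mart by (auto simp: complex_martingale_def)
  have Yi: "integrable M (Y t)" if "t \<ge> 0" for t
  proof -
    have "integrable M (\<lambda>w. complex_of_real (Re (Y t w)) + \<i> * complex_of_real (Im (Y t w)))"
      by (intro Bochner_Integration.integrable_add integrable_mult_right integrable_of_real real(1)[OF R(1) that] real(1)[OF R(2) that])
    then show ?thesis by (simp flip: complex_eq)
  qed
  have i: "integrable M (\<lambda>w. indicator A w * Y t w)" if "t \<ge> 0" for t
    by (rule Bochner_Integration.integrable_bound[OF Yi[OF that]])
      (use borel_measurable_integrable[OF Yi[OF that]] in \<open>auto simp: indicator_def\<close>)
  have ri: "Re (indicator A w * Y t w) = indicator A w * Re (Y t w)" "Im (indicator A w * Y t w) = indicator A w * Im (Y t w)" for t w
    by (auto simp: indicator_def)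
  have re: "Re (CLINT w|M. indicator A w * Y t w) = (LINT w|M. indicator A w * Re (Y t w))"
    and im: "Im (CLINT w|M. indicator A w * Y t w) = (LINT w|M. indicator A w * Im (Y t w))" if "t \<ge> 0" for t
    using integral_Re[OF i[OF that]] integral_Im[OF i[OF that]] unfolding ri by simp_all
  have "u \<ge> 0" "v \<ge> 0" using uv by auto
  then show ?thesis
    using real(2)[OF R(1), of 0] real(2)[OF R(2), of 0] by (intro complex_eqI) (simp_all only: re im order_refl)
qed

lemma complex_martingaleI:
  fixes Y :: "real \<Rightarrow> 'a \<Rightarrow> complex"
  assumes M: "prob_space M" and fil: "filtration M FF"
    and Y: "\<And>t. t \<ge> 0 \<Longrightarrow> Y t \<in> borel_measurable (FF t)" "\<And>t. t \<ge> 0 \<Longrightarrow> integrable M (Y t)"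
    and eq: "\<And>u v A. 0 \<le> u \<Longrightarrow> u \<le> v \<Longrightarrow> A \<in> sets (FF u) \<Longrightarrow> (CLINT w|M. indicator A w * Y v w) = (CLINT w|M. indicator A w * Y u w)"
  shows "complex_martingale M FF Y"
proof -
  interpret prob_space M by fact
  have real: "real_martingale M FF y"
    if y: "\<And>t. t \<ge> 0 \<Longrightarrow> y t \<in> borel_measurable (FF t)" "\<And>t. t \<ge> 0 \<Longrightarrow> integrable M (y t)"
      and e: "\<And>u v A. 0 \<le> u \<Longrightarrow> u \<le> v \<Longrightarrow> A \<in> sets (FF u) \<Longrightarrow> (LINT w|M. indicator A w * y v w) = (LINT w|M. indicator A w * y u w)" for y :: "real \<Rightarrow> 'a \<Rightarrow> real"
    unfolding real_martingale_def
  proof (intro conjI allI impI)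
    fix s t :: real assume st: "0 \<le> s \<and> s \<le> t"
    have sub: "subalgebra M (FF s)" using fil st by (simp add: filtration_def)
    interpret finite_measure_subalgebra M "FF s" by unfold_locales (rule sub)
    show "AE w in M. real_cond_exp M (FF s) (y t) w = y s w"
      by (rule real_cond_exp_charact) (use e st y in \<open>auto simp: set_lebesgue_integral_def\<close>)
  qed (use y fil in auto)
  have i: "integrable M (\<lambda>w. indicator A w * Y t w)" if "t \<ge> 0" "A \<in> sets (FF s)" "s \<ge> 0" for t A s
  proof -
    have [measurable]: "A \<in> sets M" using fil that by (auto simp: filtration_def subalgebra_def)
    show ?thesis
      by (rule Bochner_Integration.integrable_bound[OF Y(2)[OF that(1)]])
        (use borel_measurable_integrable[OF Y(2)[OF that(1)]] in \<open>auto simp: indicator_def\<close>)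
  qed
  have ri: "indicator A w * Re (Y t w) = Re (indicator A w * Y t w)" "indicator A w * Im (Y t w) = Im (indicator A w * Y t w)" for t w and A :: "'a set"
    by (auto simp: indicator_def)
  show ?thesis
    unfolding complex_martingale_def
  proof
    show "real_martingale M FF (\<lambda>t w. Re (Y t w))"
    proof (rule real)
      fix u v :: real and A assume uvA: "0 \<le> u" "u \<le> v" "A \<in> sets (FF u)"
      then have "integrable M (\<lambda>w. indicator A w * Y v w)" "integrable M (\<lambda>w. indicator A w * Y u w)"
        using i[of v A u] i[of u A u] by simp_all
      then show "(LINT w|M. indicator A w * Re (Y v w)) = (LINT w|M. indicator A w * Re (Y u w))"
        unfolding ri by (simp only: integral_Re eq[OF uvA])
    qed (use Y in \<open>auto intro: measurable_compose[OF _ borel_measurable_Re]\<close>)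
    show "real_martingale M FF (\<lambda>t w. Im (Y t w))"
    proof (rule real)
      fix u v :: real and A assume uvA: "0 \<le> u" "u \<le> v" "A \<in> sets (FF u)"
      then have "integrable M (\<lambda>w. indicator A w * Y v w)" "integrable M (\<lambda>w. indicator A w * Y u w)"
        using i[of v A u] i[of u A u] by simp_all
      then show "(LINT w|M. indicator A w * Im (Y v w)) = (LINT w|M. indicator A w * Im (Y u w))"
        unfolding ri by (simp only: integral_Im eq[OF uvA])
    qed (use Y in \<open>auto intro: measurable_compose[OF _ borel_measurable_Im]\<close>)
  qed
qed

section \<open>From the martingale problem to the transforms\<close>

abbreviation jointly_measurable :: "'a measure \<Rightarrow> (real \<Rightarrow> 'a \<Rightarrow> real \<times> real) \<Rightarrow> bool" where
  "jointly_measurable M X \<equiv> (\<lambda>(t, w). X t w) \<in> borel_measurable (restrict_space borel {0..} \<Otimes>\<^sub>M M)"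

lemma jointly_measurable_comp:
  fixes h :: "real \<times> real \<Rightarrow> complex"
  assumes X: "jointly_measurable M X" and h[measurable]: "h \<in> borel_measurable borel" and A[measurable]: "A \<in> sets M" and u: "0 \<le> u"
  shows "(\<lambda>(r, w). indicator {u..v} r *\<^sub>R (indicator A w * h (X r w))) \<in> borel_measurable (lborel \<Otimes>\<^sub>M M)"
proof -
  \<comment> \<open>Joint measurability is assumed on nonnegative times only, so time is first sent
    into the half-line; on [u, v] this changes nothing because 0 <= u.\<close>
  have 1: "(\<lambda>p. max (fst p) (0 :: real)) \<in> lborel \<Otimes>\<^sub>M M \<rightarrow>\<^sub>M restrict_space borel {0..}"
  proof (rule measurable_restrict_space2)
    have "(\<lambda>p. max (fst p) (0 :: real)) \<in> borel_measurable (borel \<Otimes>\<^sub>M M)"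
      by (rule borel_measurable_max[OF borel_measurable_const measurable_fst])
    then show "(\<lambda>p. max (fst p) (0 :: real)) \<in> borel_measurable (lborel \<Otimes>\<^sub>M M)"
      unfolding measurable_cong_sets[OF sets_pair_measure_cong[OF sets_lborel refl] refl] .
  qed (auto simp: le_max_iff_disj)
  have [measurable]: "(\<lambda>p. X (max (fst p) 0) (snd p)) \<in> borel_measurable (lborel \<Otimes>\<^sub>M M)"
    using measurable_compose[OF measurable_Pair[OF 1 measurable_snd] X] by simp
  have "(\<lambda>p. indicator {u..v} (fst p) *\<^sub>R (indicator A (snd p) * h (X (max (fst p) 0) (snd p)))) \<in> borel_measurable (lborel \<Otimes>\<^sub>M M)"
    by measurable
  moreover have "(\<lambda>p. indicator {u..v} (fst p) *\<^sub>R (indicator A (snd p) * h (X (max (fst p) 0) (snd p)))) = (\<lambda>(r, w). indicator {u..v} r *\<^sub>R (indicator A w * h (X r w)))"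
    using u by (auto simp: fun_eq_iff indicator_def max_absorb1)
  ultimately show ?thesis by simp
qed

lemma jointly_measurable_comp_UNIV:
  fixes h :: "real \<times> real \<Rightarrow> complex"
  assumes "jointly_measurable M X" "h \<in> borel_measurable borel" "0 \<le> u"
  shows "(\<lambda>(r, w). indicator {u..v} r *\<^sub>R h (X r w)) \<in> borel_measurable (lborel \<Otimes>\<^sub>M M)"
  using jointly_measurable_comp[OF assms(1,2) sets.top assms(3), of v]
  by (rule measurable_cong[THEN iffD1, rotated]) (auto simp: space_pair_measure)

lemma jointly_measurable_section:
  assumes X: "jointly_measurable M X" and t: "t \<ge> 0"
  shows "X t \<in> borel_measurable M"
proof -
  have "(\<lambda>w. (t, w)) \<in> M \<rightarrow>\<^sub>M restrict_space borel {0..} \<Otimes>\<^sub>M M" using t by (intro measurable_Pair) (auto simp: space_restrict_space)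
  from measurable_compose[OF this X] show ?thesis by simp
qed

lemma nat_subset_mp_filtration: "sets (nat_filtration M X t) \<subseteq> sets (mp_filtration M X t)"
  unfolding nat_filtration_def mp_filtration_def
  by (subst (1 2) sets_measure_of) (auto intro!: sigma_sets_mono' )

text \<open>The drift term of the martingale at \<open>l z\<close> is \<open>- c l \<partial>\<^sub>l\<close> applied to \<open>l \<mapsto> kf \<theta> z l\<close>, up to the
  factor \<open>F(\<theta>, (1 - l) z)\<close>, so the expectations solve a transport equation.\<close>

lemma mp_imp_tmarkov:
  assumes P: "mp_solution c \<theta> M X" and c: "c \<ge> 0" and \<theta>: "\<theta> \<in> quadrant"
  shows "tmarkov c \<theta> M X"
  unfolding tmarkov_def
proof (intro conjI allI impI ballI)
  show M: "prob_space M" using P by (simp add: mp_solution_def)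
  interpret prob_space M by fact
  have jm: "jointly_measurable M X" using P by (simp add: mp_solution_def)
  show Xm: "X t \<in> borel_measurable M" if "t \<ge> 0" for t by (rule jointly_measurable_section[OF jm that])
  show XE: "X t w \<in> E" if "t \<ge> 0" "w \<in> space M" for t w using P that by (simp add: mp_solution_def)
  note Xq = E_subset_quadrant[OF XE]
  fix s T :: real and A z assume st: "0 \<le> s \<and> s \<le> T" and A: "A \<in> sets (nat_filtration M X s)" and z: "z \<in> E"
  have AM[measurable]: "A \<in> sets M" using nat_filtration_sub[of X M s, OF Xm] A by (auto simp: subalgebra_def)
  \<comment> \<open>Half of the smallest value of l on the characteristic between s and T. It keeps
    l away from 0, where the derivative bounds blow up.\<close>
  define l0 where "l0 = exp (- c * (T - s)) / 2"
  have l0: "0 < l0" by (simp add: l0_def)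
  define f where "f = (\<lambda>u l. CLINT w|M. indicator A w * kf \<theta> z l (X u w))"
  define d where "d = (\<lambda>l x. ((x - \<theta>) \<diamondop> z) * kf \<theta> z l x)"
  have dm[measurable]: "d l \<in> borel_measurable borel" for l unfolding d_def by measurable
  define g where "g = (\<lambda>u l. CLINT w|M. indicator A w * d l (X u w))"
  have db: "norm (d l x) \<le> C1 \<theta> z l0" if "l0 \<le> l" "l \<le> 1" "x \<in> quadrant" for l x
    unfolding d_def by (rule kf_bounds(1)[OF that(3) \<theta> z l0 that(1,2)])
  have kb: "norm (kf \<theta> z l x) \<le> 1" if "l0 \<le> l" "l \<le> 1" "x \<in> quadrant" for l x
    by (rule kf_bounds(3)[OF that(3) \<theta> z l0 that(1,2)])
  have comp: "(\<lambda>w. h (X t w)) \<in> borel_measurable M" if "h \<in> borel_measurable borel" "t \<ge> 0" for h :: "_ \<Rightarrow> complex" and t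
    by (rule measurable_compose[OF Xm[OF that(2)] that(1)])
  have ki: "integrable M (\<lambda>w. indicator A w * kf \<theta> z l (X u w))" if "l0 \<le> l" "l \<le> 1" "u \<ge> 0" for l u
    by (rule bounded_indicator_integral(1)[OF M comp _ AM, where K = 1]) (use that Xq kb in auto)
  have di: "integrable M (\<lambda>w. indicator A w * d l (X u w))" if "l0 \<le> l" "l \<le> 1" "u \<ge> 0" for l u
    by (rule bounded_indicator_integral(1)[OF M comp _ AM, where K = "C1 \<theta> z l0"]) (use that Xq db in auto)
  \<comment> \<open>Transport from l = 1 at time T, where \<open>kf\<close> is F itself, to l =
    exp(-c (T - s)) at time s, where it is F at the mean.\<close>
  have "f T 1 = f s (exp (- c * (T - s)))"
  proof (rule transport_constant[OF c _ l0])
    show "s \<le> T" "2 * l0 \<le> exp (- c * (T - s))" using st by (auto simp: l0_def)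
    fix u l assume u: "s \<le> u" "u \<le> T" and l: "l0 \<le> l" "l \<le> 1"
    have u0: "u \<ge> 0" using st u by simp
    show "norm (g u l) \<le> C1 \<theta> z l0"
      unfolding g_def by (rule bounded_indicator_integral(2)[OF M comp _ AM]) (use u0 l Xq db in auto)
    fix m assume m: "l0 \<le> m" "m \<le> 1"
    let ?D = "\<lambda>x. kf \<theta> z m x - kf \<theta> z l x - of_real (m - l) * d l x"
    have "f u m - f u l - of_real (m - l) * g u l = (CLINT w|M. indicator A w * kf \<theta> z m (X u w) - indicator A w * kf \<theta> z l (X u w) - of_real (m - l) * (indicator A w * d l (X u w)))"
      unfolding f_def g_def using ki[OF l u0] ki[OF m u0] di[OF l u0] by simp
    also have "\<dots> = (CLINT w|M. indicator A w * ?D (X u w))"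
      by (intro Bochner_Integration.integral_cong) (auto simp: algebra_simps)
    also have "norm \<dots> \<le> C2 \<theta> z l0 * (m - l)\<^sup>2"
      by (rule bounded_indicator_integral(2)[OF M comp _ AM])
        (use u0 kf_taylor[OF Xq \<theta> z l0 l m] in \<open>auto simp: d_def\<close>)
    finally show "norm (f u m - f u l - of_real (m - l) * g u l) \<le> C2 \<theta> z l0 * (m - l)\<^sup>2" .
  next
    fix l assume l: "l0 \<le> l" "l \<le> 1"
    have db': "norm (indicator A w * d l (X r w)) \<le> C1 \<theta> z l0" if "s \<le> r" "w \<in> space M" for r w
    proof -
      have "norm (d l (X r w)) \<le> C1 \<theta> z l0" using that st l by (intro db Xq) auto
      then show ?thesis using order_trans[OF norm_ge_zero, of "d l (X r w)"] by (auto simp: indicator_def)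
    qed
    show "set_integrable lborel {s..T} (\<lambda>r. g r l)"
      unfolding g_def
      by (rule fubini_bounded(3)[OF M _ jointly_measurable_comp[OF jm dm AM] db']) (use st in auto)
    fix u v assume uv: "s \<le> u" "u \<le> v" "v \<le> T"
    have u0: "0 \<le> u" and v0: "0 \<le> v" using st uv by auto
    define z' where "z' = l *\<^sub>R z"
    have z': "z' \<in> E" using z l l0 by (auto simp: z'_def intro: scale_in_E)
    define k where "k = F \<theta> ((1 - l) *\<^sub>R z)"
    have gb: "norm (indicator A w * genF c \<theta> z' (X r w)) \<le> c * C1 \<theta> z' 1" "norm (genF c \<theta> z' (X r w)) \<le> c * C1 \<theta> z' 1" if "0 \<le> r" "w \<in> space M" for r w
    proof -
      show n: "norm (genF c \<theta> z' (X r w)) \<le> c * C1 \<theta> z' 1" by (rule genF_bound[OF Xq[OF that] \<theta> z' c])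
      show "norm (indicator A w * genF c \<theta> z' (X r w)) \<le> c * C1 \<theta> z' 1" using n order_trans[OF norm_ge_zero n] by (auto simp: indicator_def)
    qed
    note jmg = jointly_measurable_comp_UNIV[OF jm genF_measurable[of c \<theta> z']]
    have si: "set_integrable lborel {0..v} (\<lambda>r. genF c \<theta> z' (X r w))" if "w \<in> space M" for w
      by (rule fubini_bounded(4)[OF M v0 jmg gb(2) that]) auto
    define I where "I = (\<lambda>t w. CLINT r:{0..t}|lborel. genF c \<theta> z' (X r w))"
    have Ii: "integrable M (\<lambda>w. indicator A w * I t w)" if "t \<ge> 0" for t
    proof -
      have "integrable M (I t)" unfolding I_def by (rule fubini_bounded(2)[OF M that jmg gb(2)]) auto
      from Bochner_Integration.integrable_bound[OF this, of "\<lambda>w. indicator A w * I t w"] borel_measurable_integrable[OF this]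
      show ?thesis by (auto simp: indicator_def)
    qed
    have Fi: "integrable M (\<lambda>w. indicator A w * F (X t w) z')" if "t \<ge> 0" for t
      by (rule bounded_indicator_integral(1)[OF M comp _ AM, where K = 1]) (use that Xq z' norm_F_le in auto)
    \<comment> \<open>The martingale property refers to the larger filtration, which contains the
      event A as well.\<close>
    have "A \<in> sets (mp_filtration M X u)"
      using A nat_filtration_mono[of s u M X] nat_subset_mp_filtration[of M X u] uv by auto
    moreover have "complex_martingale M (mp_filtration M X) (\<lambda>t w. F (X t w) z' - I t w)"
      using P z' by (auto simp: mp_solution_def I_def)
    ultimately have "(CLINT w|M. indicator A w * (F (X v w) z' - I v w)) = (CLINT w|M. indicator A w * (F (X u w) z' - I u w))"
      by (intro complex_martingale_integral[OF M _ u0 uv(2)])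
    then have "(CLINT w|M. indicator A w * F (X v w) z') - (CLINT w|M. indicator A w * I v w) =
      (CLINT w|M. indicator A w * F (X u w) z') - (CLINT w|M. indicator A w * I u w)"
      using Fi[OF u0] Fi[OF v0] Ii[OF u0] Ii[OF v0] by (simp add: right_diff_distrib)
    then have "(CLINT w|M. indicator A w * F (X v w) z') - (CLINT w|M. indicator A w * F (X u w) z') =
      (CLINT w|M. indicator A w * I v w) - (CLINT w|M. indicator A w * I u w)" by (simp add: algebra_simps)
    also have "\<dots> = (CLINT w|M. indicator A w * I v w - indicator A w * I u w)"
      using Ii[OF u0] Ii[OF v0] by simp
    also have "\<dots> = (CLINT w|M. CLINT r:{u..v}|lborel. indicator A w * genF c \<theta> z' (X r w))"
    proof (rule Bochner_Integration.integral_cong[OF refl])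
      fix w assume "w \<in> space M"
      from Icc_integral_split[OF si[OF this] u0 uv(2)]
      show "indicator A w * I v w - indicator A w * I u w = (CLINT r:{u..v}|lborel. indicator A w * genF c \<theta> z' (X r w))"
        by (simp add: I_def algebra_simps)
    qed
    also have "\<dots> = (CLINT r:{u..v}|lborel. CLINT w|M. indicator A w * genF c \<theta> z' (X r w))"
      by (rule fubini_bounded(1)[OF M uv(2) jointly_measurable_comp[OF jm _ AM u0] gb(1)]) (use u0 in auto)
    finally have inc: "(CLINT w|M. indicator A w * F (X v w) z') - (CLINT w|M. indicator A w * F (X u w) z') =
      (CLINT r:{u..v}|lborel. CLINT w|M. indicator A w * genF c \<theta> z' (X r w))" .
    \<comment> \<open>Multiplication by the constant k turns F(_, l z) into \<open>kf\<close>, so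
      the martingale increments at l z become the transport equation for f.\<close>
    have fF: "f t l = k * (CLINT w|M. indicator A w * F (X t w) z')" for t
      unfolding f_def kf_F_split k_def z'_def by (simp add: ac_simps flip: integral_mult_right_zero)
    have gg: "k * (CLINT w|M. indicator A w * genF c \<theta> z' (X r w)) = - of_real (c * l) * g r l" for r
    proof -
      have "k * (CLINT w|M. indicator A w * genF c \<theta> z' (X r w)) = (CLINT w|M. indicator A w * (k * genF c \<theta> z' (X r w)))"
        by (simp add: ac_simps flip: integral_mult_right_zero)
      also have "\<dots> = (CLINT w|M. - of_real (c * l) * (indicator A w * d l (X r w)))"
        unfolding k_def z'_def genF_kf d_def by (intro Bochner_Integration.integral_cong) (auto simp: algebra_simps)
      also have "\<dots> = - of_real (c * l) * g r l"
        unfolding g_def by (rule integral_mult_right_zero)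
      finally show ?thesis .
    qed
    have "f v l - f u l = k * (CLINT r:{u..v}|lborel. CLINT w|M. indicator A w * genF c \<theta> z' (X r w))"
      unfolding fF inc[symmetric] by (simp add: right_diff_distrib)
    also have "\<dots> = (CLINT r:{u..v}|lborel. k * (CLINT w|M. indicator A w * genF c \<theta> z' (X r w)))"
      by (rule set_integral_mult_right[symmetric])
    also have "\<dots> = - of_real (c * l) * (CLINT r:{u..v}|lborel. g r l)"
      unfolding gg by (rule set_integral_mult_right)
    finally show "f v l - f u l = - of_real (c * l) * (CLINT r:{u..v}|lborel. g r l)" .
  qed
  then show "(CLINT w|M. indicator A w * F (X T w) z) = (CLINT w|M. indicator A w * F (mean c \<theta> (T - s) (X s w)) z)"
    by (simp add: f_def kf_1 kf_F mean_def)
qed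

section \<open>From the transforms back to the martingale problem\<close>

lemma right_continuous_jointly_measurable:
  assumes X: "\<And>t. t \<ge> 0 \<Longrightarrow> X t \<in> borel_measurable M"
    and rc: "\<And>w t. w \<in> space M \<Longrightarrow> t \<ge> 0 \<Longrightarrow> continuous (at_right t) (\<lambda>t. X t w)"
  shows "jointly_measurable M X"
proof -
  have r: "(\<lambda>x. x) \<in> borel_measurable (restrict_space borel {0::real..})"
    by (rule measurable_restrict_space1) simp
  have "(\<lambda>(t, w). X (max t 0) w) \<in> borel_measurable (borel \<Otimes>\<^sub>M M)"
  proof (rule borel_measurable_LIMSEQ_metric[where f = "\<lambda>n (t, w). X (min (max t 0) (real n)) w"])
    show "(\<lambda>(t, w). X (min (max t 0) (real n)) w) \<in> borel_measurable (borel \<Otimes>\<^sub>M M)" for n :: nat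
      by (rule right_continuous_measurable) (use X rc in auto)
    fix p :: "real \<times> 'a"
    obtain n0 :: nat where n0: "max (fst p) 0 \<le> real n0" using real_arch_simple by blast
    have "eventually (\<lambda>n. (case p of (t, w) \<Rightarrow> X (min (max t 0) (real n)) w) = (case p of (t, w) \<Rightarrow> X (max t 0) w)) sequentially"
      using eventually_ge_at_top[of n0]
    proof eventually_elim
      case (elim n)
      then have "min (max (fst p) 0) (real n) = max (fst p) 0" using n0 by simp
      then show ?case by (simp add: case_prod_beta)
    qed
    then show "(\<lambda>n. case p of (t, w) \<Rightarrow> X (min (max t 0) (real n)) w) \<longlonglongrightarrow> (case p of (t, w) \<Rightarrow> X (max t 0) w)"
      by (rule tendsto_eventually)
  qed
  moreover have "(\<lambda>p. (fst p, snd p)) \<in> restrict_space borel {0::real..} \<Otimes>\<^sub>M M \<rightarrow>\<^sub>M borel \<Otimes>\<^sub>M M"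
    by (intro measurable_Pair measurable_compose[OF measurable_fst r] measurable_snd)
  ultimately have "(\<lambda>p. case (fst p, snd p) of (t, w) \<Rightarrow> X (max t 0) w) \<in> borel_measurable (restrict_space borel {0..} \<Otimes>\<^sub>M M)"
    by (rule measurable_compose[rotated])
  then show ?thesis
    by (rule measurable_cong[THEN iffD1, rotated]) (auto simp: space_pair_measure space_restrict_space max_absorb1)
qed

text \<open>Right continuity makes the process progressively measurable, so Fubini's theorem works
  with the information at t alone. Values in a Banach space cover both the real functions in
  \<open>mp_filtration\<close> and the complex drift.\<close>

lemma progressive_integral:
  fixes h :: "real \<times> real \<Rightarrow> 'c :: {banach, second_countable_topology}"
  assumes rc: "\<And>w t. w \<in> space M \<Longrightarrow> t \<ge> 0 \<Longrightarrow> continuous (at_right t) (\<lambda>t. X t w)"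
    and st: "0 \<le> s" "s \<le> t" and h: "h \<in> borel_measurable borel"
  shows "(\<lambda>w. LINT u:{0..s}|lborel. h (X u w)) \<in> borel_measurable (nat_filtration M X t)"
proof -
  let ?N = "nat_filtration M X t"
  have "(\<lambda>(u, w). X (min (max u 0) t) w) \<in> borel_measurable (borel \<Otimes>\<^sub>M ?N)"
    by (rule right_continuous_measurable) (use st rc in \<open>auto intro: measurable_nat_filtration\<close>)
  then have "(\<lambda>p. X (min (max (fst p) 0) t) (snd p)) \<in> borel_measurable (borel \<Otimes>\<^sub>M ?N)" by (simp add: case_prod_beta')
  from measurable_compose[OF measurable_pair_swap'[of ?N borel] this]
  have [measurable]: "(\<lambda>p. X (min (max (snd p) 0) t) (fst p)) \<in> borel_measurable (?N \<Otimes>\<^sub>M borel)" by (simp add: case_prod_beta')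
  note [measurable] = h
  have "(\<lambda>p. indicator {0..s} (snd p) *\<^sub>R h (X (min (max (snd p) 0) t) (fst p))) \<in> borel_measurable (?N \<Otimes>\<^sub>M borel)"
    by measurable
  then have "(\<lambda>(w, u). indicator {0..s} u *\<^sub>R h (X (min (max u 0) t) w)) \<in> borel_measurable (?N \<Otimes>\<^sub>M lborel)"
    unfolding measurable_cong_sets[OF sets_pair_measure_cong[OF refl sets_lborel] refl] by (simp add: case_prod_beta')
  from lborel.borel_measurable_lebesgue_integral[OF this]
  have "(\<lambda>w. LINT u|lborel. indicator {0..s} u *\<^sub>R h (X (min (max u 0) t) w)) \<in> borel_measurable ?N" .
  moreover have "indicator {0..s} u *\<^sub>R h (X (min (max u 0) t) w) = indicator {0..s} u *\<^sub>R h (X u w)" for u w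
    using st by (auto simp: indicator_def max_absorb1 min_absorb1)
  ultimately show ?thesis by (simp add: set_lebesgue_integral_def)
qed

lemma mp_filtration_eq:
  assumes rc: "\<And>w t. w \<in> space M \<Longrightarrow> t \<ge> 0 \<Longrightarrow> continuous (at_right t) (\<lambda>t. X t w)"
  shows "mp_filtration M X t = nat_filtration M X t"
  unfolding mp_filtration_def nat_filtration_def
proof (rule sigma_eqI)
  let ?G = "{X s -` A \<inter> space M | s A. 0 \<le> s \<and> s \<le> t \<and> A \<in> sets borel}"
  let ?H = "{(\<lambda>w. LINT u:{0..s}|lborel. h (X u w)) -` A \<inter> space M
          | s (h :: real \<times> real \<Rightarrow> real) A. 0 \<le> s \<and> s \<le> t \<and> h \<in> borel_measurable borel \<and> bounded (range h) \<and> A \<in> sets borel}"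
  have "?H \<subseteq> sigma_sets (space M) ?G"
  proof safe
    fix s and h :: "real \<times> real \<Rightarrow> real" and A :: "real set"
    assume "0 \<le> s" "s \<le> t" "h \<in> borel_measurable borel" "A \<in> sets borel"
    from measurable_sets[OF progressive_integral[OF rc this(1-3)] this(4)]
    show "(\<lambda>w. LINT u:{0..s}|lborel. h (X u w)) -` A \<inter> space M \<in> sigma_sets (space M) ?G"
      by (simp add: sets_nat_filtration)
  qed
  moreover have "?G \<subseteq> sigma_sets (space M) ?G" by (rule sigma_sets_superset_generator)
  ultimately have "?G \<union> ?H \<subseteq> sigma_sets (space M) ?G" by blast
  then show "sigma_sets (space M) (?G \<union> ?H) = sigma_sets (space M) ?G"
    by (intro antisym sigma_sets_mono sigma_sets_mono') auto
qed auto

text \<open>The mean, as a function of time, is the flow of the linear equation y' = c (\<theta> -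
  y), along which F(_, z) has derivative \<open>genF\<close>. So this is the fundamental theorem of
  calculus.\<close>

lemma F_mean_integral:
  assumes uv: "u \<le> v"
  shows "(CLINT r:{u..v}|lborel. genF c \<theta> z (mean c \<theta> (r - u) x)) = F (mean c \<theta> (v - u) x) z - F x z"
proof -
  define \<phi> where "\<phi> = (\<lambda>r. \<theta> \<diamondop> z + complex_of_real (exp (- c * (r - u))) * ((x - \<theta>) \<diamondop> z))"
  have e: "F (mean c \<theta> (r - u) x) z = exp (\<phi> r)" for r
    using kf_F[of \<theta> z "exp (- c * (r - u))" x] by (simp add: mean_def kf_def \<phi>_def)
  have g: "genF c \<theta> z (mean c \<theta> (r - u) x) = complex_of_real (- c * exp (- c * (r - u))) * ((x - \<theta>) \<diamondop> z) * exp (\<phi> r)" for r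
    unfolding genF_def e by (simp add: mean_def diamond_add diamond_diff diamond_scale algebra_simps)
  have "(LINT r|lborel. indicator {u..v} r *\<^sub>R genF c \<theta> z (mean c \<theta> (r - u) x)) = exp (\<phi> v) - exp (\<phi> u)"
    unfolding g
  proof (rule integral_FTC_atLeastAtMost[OF uv])
    fix r
    have 1: "((\<lambda>r. exp (- c * (r - u))) has_vector_derivative - c * exp (- c * (r - u))) (at r within {u..v})"
      unfolding has_real_derivative_iff_has_vector_derivative[symmetric] by (auto intro!: derivative_eq_intros)
    have "(\<phi> has_vector_derivative complex_of_real (- c * exp (- c * (r - u))) * ((x - \<theta>) \<diamondop> z)) (at r within {u..v})"
      unfolding \<phi>_def
      using has_vector_derivative_add[OF has_vector_derivative_const bounded_linear.has_vector_derivative[OF bounded_linear_mult_left bounded_linear.has_vector_derivative[OF bounded_linear_of_real 1]]]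
      by simp
    from field_vector_diff_chain_within[OF this DERIV_subset[OF DERIV_exp subset_UNIV]]
    show "((\<lambda>r. exp (\<phi> r)) has_vector_derivative complex_of_real (- c * exp (- c * (r - u))) * ((x - \<theta>) \<diamondop> z) * exp (\<phi> r)) (at r within {u..v})"
      by (simp add: o_def)
  qed (auto simp: \<phi>_def intro!: continuous_intros)
  then show ?thesis using e[of v] e[of u] by (simp add: set_lebesgue_integral_def mean_def)
qed

text \<open>The drift contains the unbounded factor x \<diamondop> z and is not among the functions
  tested in \<open>tmarkov\<close>. It is recovered from the derivative of F x (l z) at l = 1, with
  a Taylor error that is uniform in x.\<close>

lemma tmarkov_genF:
  assumes T: "tmarkov c \<theta> M X" and c: "c \<ge> 0" and \<theta>: "\<theta> \<in> quadrant" and st: "0 \<le> s" "s \<le> t"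
    and A: "A \<in> sets (nat_filtration M X s)" and z: "z \<in> E"
  shows "(CLINT w|M. indicator A w * genF c \<theta> z (X t w)) = (CLINT w|M. indicator A w * genF c \<theta> z (mean c \<theta> (t - s) (X s w)))"
proof -
  have M: "prob_space M" and Xm: "\<And>t. t \<ge> 0 \<Longrightarrow> X t \<in> borel_measurable M" and XE: "\<And>t w. t \<ge> 0 \<Longrightarrow> w \<in> space M \<Longrightarrow> X t w \<in> E"
    using T by (auto simp: tmarkov_def)
  interpret prob_space M by (rule M)
  have AM[measurable]: "A \<in> sets M" using nat_filtration_sub[of X M s, OF Xm] A by (auto simp: subalgebra_def)
  define V where "V = (\<lambda>w. mean c \<theta> (t - s) (X s w))"
  have t0: "t \<ge> 0" using st by simp
  have Vm: "V \<in> borel_measurable M" unfolding V_def by (rule measurable_compose[OF Xm[OF st(1)] mean_measurable])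
  have Vq: "V w \<in> quadrant" if "w \<in> space M" for w using st XE that c \<theta> by (auto simp: V_def intro!: mean_E)
  have Xq: "X t w \<in> quadrant" if "w \<in> space M" for w using E_subset_quadrant[OF XE[OF t0 that]] .
  \<comment> \<open>With \<theta> replaced by 0, \<open>kf\<close> is F x (l z) without a constant
    factor.\<close>
  define f where "f = (\<lambda>l Y. CLINT w|M. indicator A w * kf 0 z l (Y w))"
  define d where "d = (\<lambda>x. ((x - 0) \<diamondop> z) * kf 0 z 1 x)"
  have dm[measurable]: "d \<in> borel_measurable borel" unfolding d_def by measurable
  define D where "D = (\<lambda>Y. CLINT w|M. indicator A w * d (Y w))"
  define e2 where "e2 = C2 0 z (1/2)"
  have q0: "0 \<in> quadrant" by (rule E_subset_quadrant[OF zero_in_E])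
  have db: "norm (d x) \<le> C1 0 z 1" if "x \<in> quadrant" for x unfolding d_def by (rule kf_bounds(1)[OF that q0 z]) auto
  have kb: "norm (kf 0 z l x) \<le> 1" if "x \<in> quadrant" "1/2 \<le> l" "l \<le> 1" for x l
    by (rule kf_bounds(3)[OF that(1) q0 z _ that(2,3)]) auto
  \<comment> \<open>Difference quotients are taken from below, because the bounds on
    \<open>kf\<close> hold for l <= 1.\<close>
  have key: "norm (f (1 - e) Y - f 1 Y + of_real e * D Y) \<le> e2 * e\<^sup>2"
    if Y: "Y \<in> borel_measurable M" "\<And>w. w \<in> space M \<Longrightarrow> Y w \<in> quadrant" and e: "0 < e" "e \<le> 1/2" for Y e
  proof -
    have ki: "integrable M (\<lambda>w. indicator A w * kf 0 z l (Y w))" if "1/2 \<le> l" "l \<le> 1" for l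
      by (rule bounded_indicator_integral(1)[OF M measurable_compose[OF Y(1)] _ AM, where K = 1]) (use that Y kb in auto)
    have di: "integrable M (\<lambda>w. indicator A w * d (Y w))"
      by (rule bounded_indicator_integral(1)[OF M measurable_compose[OF Y(1)] _ AM, where K = "C1 0 z 1"]) (use Y db in auto)
    let ?D = "\<lambda>x. kf 0 z (1 - e) x - kf 0 z 1 x - of_real (1 - e - 1) * d x"
    have "f (1 - e) Y - f 1 Y + of_real e * D Y = (CLINT w|M. indicator A w * kf 0 z (1 - e) (Y w) - indicator A w * kf 0 z 1 (Y w) + of_real e * (indicator A w * d (Y w)))"
      unfolding f_def D_def using ki[of "1 - e"] ki[of 1] di e by simp
    also have "\<dots> = (CLINT w|M. indicator A w * ?D (Y w))"
      by (intro Bochner_Integration.integral_cong) (auto simp: algebra_simps)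
    also have "norm \<dots> \<le> e2 * (1 - e - 1)\<^sup>2"
    proof (rule bounded_indicator_integral(2)[OF M _ _ AM])
      show "(\<lambda>w. ?D (Y w)) \<in> borel_measurable M" by (rule measurable_compose[OF Y(1)]) measurable
      fix w assume "w \<in> space M"
      from kf_taylor[OF Y(2)[OF this] q0 z, of "1/2" 1 "1 - e"] e
      show "norm (?D (Y w)) \<le> e2 * (1 - e - 1)\<^sup>2" by (simp add: d_def e2_def)
    qed
    finally show ?thesis by simp
  qed
  have feq: "f l (X t) = f l V" if "l \<ge> 0" for l
  proof -
    have "l *\<^sub>R z \<in> E" by (rule scale_in_E[OF z that])
    then have "(CLINT w|M. indicator A w * F (X t w) (l *\<^sub>R z)) = (CLINT w|M. indicator A w * F (V w) (l *\<^sub>R z))"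
      unfolding V_def by (rule tmarkovD[OF T st A])
    moreover have "kf 0 z l x = F x (l *\<^sub>R z)" for x unfolding kf_F_split by (simp add: F_def diamond_def)
    ultimately show ?thesis by (simp add: f_def)
  qed
  have "norm (D (X t) - D V) \<le> 2 * e2 * e" if e: "0 < e" "e \<le> 1/2" for e
  proof -
    have "of_real e * (D (X t) - D V) = (f (1 - e) (X t) - f 1 (X t) + of_real e * D (X t)) - (f (1 - e) V - f 1 V + of_real e * D V)"
      using feq[of "1 - e"] feq[of 1] e by (simp add: algebra_simps)
    then have "norm (of_real e * (D (X t) - D V)) \<le> e2 * e\<^sup>2 + e2 * e\<^sup>2"
      using norm_triangle_ineq4 key[OF Xm[OF t0] Xq e] key[OF Vm Vq e] by (smt (verit))
    moreover have "norm (of_real e * (D (X t) - D V)) = e * norm (D (X t) - D V)"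
      unfolding norm_mult using e by simp
    ultimately have "e * norm (D (X t) - D V) \<le> e * (2 * e2 * e)" by (simp add: power2_eq_square algebra_simps)
    then show ?thesis using e by simp
  qed
  note bd = this
  have "norm (D (X t) - D V) \<le> 2 * e2 * 0"
  proof (rule LIMSEQ_le_const)
    have "(\<lambda>n. (1/2) / real (Suc n)) \<longlonglongrightarrow> 0" by (rule LIMSEQ_Suc[OF lim_const_over_n])
    then show "(\<lambda>n. 2 * e2 * ((1/2) / real (Suc n))) \<longlonglongrightarrow> 2 * e2 * 0" by (intro tendsto_intros)
    show "\<exists>N. \<forall>n\<ge>N. norm (D (X t) - D V) \<le> 2 * e2 * ((1/2) / real (Suc n))"
      by (intro exI[of _ 0] allI impI bd) (auto simp: field_simps)
  qed
  then have DD: "D (X t) = D V" by simp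
  have "(CLINT w|M. indicator A w * genF c \<theta> z (Y w)) = of_real c * (\<theta> \<diamondop> z) * f 1 Y - of_real c * D Y"
    if Y: "Y \<in> borel_measurable M" "\<And>w. w \<in> space M \<Longrightarrow> Y w \<in> quadrant" for Y
  proof -
    have ki: "integrable M (\<lambda>w. indicator A w * kf 0 z 1 (Y w))"
      by (rule bounded_indicator_integral(1)[OF M measurable_compose[OF Y(1)] _ AM, where K = 1]) (use Y kb in auto)
    have di: "integrable M (\<lambda>w. indicator A w * d (Y w))"
      by (rule bounded_indicator_integral(1)[OF M measurable_compose[OF Y(1)] _ AM, where K = "C1 0 z 1"]) (use Y db in auto)
    have "(CLINT w|M. indicator A w * genF c \<theta> z (Y w)) = (CLINT w|M. of_real c * (\<theta> \<diamondop> z) * (indicator A w * kf 0 z 1 (Y w)) - of_real c * (indicator A w * d (Y w)))"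
      by (intro Bochner_Integration.integral_cong) (auto simp: genF_def d_def kf_1 diamond_diff diamond_scale algebra_simps)
    then show ?thesis unfolding f_def D_def using ki di by simp
  qed
  from this[OF Xm[OF t0] Xq] this[OF Vm Vq] DD feq[of 1] show ?thesis by (simp add: V_def)
qed

text \<open>Over an event of the past of u, the drift at X r may be evaluated at the mean started
  from X u instead. Along the mean the drift integrates to F at the mean minus F at X u, and the
  Markov identity turns the former into F at X v.\<close>

lemma tmarkov_imp_mp:
  assumes T: "tmarkov c \<theta> M X" and c: "c \<ge> 0" and \<theta>: "\<theta> \<in> quadrant"
    and rc: "\<And>w t. w \<in> space M \<Longrightarrow> t \<ge> 0 \<Longrightarrow> continuous (at_right t) (\<lambda>t. X t w)"
  shows "mp_solution c \<theta> M X"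
  unfolding mp_solution_def
proof (intro conjI ballI)
  show M: "prob_space M" using T by (simp add: tmarkov_def)
  interpret prob_space M by fact
  have Xm: "\<And>t. t \<ge> 0 \<Longrightarrow> X t \<in> borel_measurable M" and XE: "\<And>t w. t \<ge> 0 \<Longrightarrow> w \<in> space M \<Longrightarrow> X t w \<in> E"
    using T by (auto simp: tmarkov_def)
  then show "\<forall>t\<ge>0. \<forall>w\<in>space M. X t w \<in> E" by simp
  show jm: "jointly_measurable M X" by (rule right_continuous_jointly_measurable[OF Xm rc])
  fix z assume z: "z \<in> E"
  have mpf: "mp_filtration M X = nat_filtration M X" by (rule ext) (rule mp_filtration_eq[OF rc])
  have sub: "subalgebra M (nat_filtration M X t)" for t by (rule nat_filtration_sub[OF Xm])
  define I where "I = (\<lambda>t w. CLINT r:{0..t}|lborel. genF c \<theta> z (X r w))"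
  have gb: "norm (genF c \<theta> z x) \<le> c * C1 \<theta> z 1" if "x \<in> quadrant" for x by (rule genF_bound[OF that \<theta> z c])
  have gbA: "norm (indicator A w * genF c \<theta> z x) \<le> c * C1 \<theta> z 1" if "x \<in> quadrant" for x and A :: "'a set" and w
    using gb[OF that] order_trans[OF norm_ge_zero gb[OF that]] by (auto simp: indicator_def)
  note jmg = jointly_measurable_comp_UNIV[OF jm genF_measurable[of c \<theta> z]]
  have Ii0: "integrable M (I t)" if "t \<ge> 0" for t
    unfolding I_def by (rule fubini_bounded(2)[OF M that jmg gb]) (auto intro: E_subset_quadrant XE)
  have si: "set_integrable lborel {0..v} (\<lambda>r. genF c \<theta> z (X r w))" if "w \<in> space M" "v \<ge> 0" for w v
    by (rule fubini_bounded(4)[OF M that(2) jmg gb that(1)]) (auto intro: E_subset_quadrant XE)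
  have Fb: "norm (F (X t w) z) \<le> 1" if "t \<ge> 0" "w \<in> space M" for t w
    by (rule norm_F_le[OF E_subset_quadrant[OF XE[OF that]] z])
  have Fm: "(\<lambda>w. F (X t w) z) \<in> borel_measurable M" if "t \<ge> 0" for t
    by (rule measurable_compose[OF Xm[OF that] F_measurable])
  have "complex_martingale M (nat_filtration M X) (\<lambda>t w. F (X t w) z - I t w)"
  proof (rule complex_martingaleI[OF M])
    show "filtration M (nat_filtration M X)"
      unfolding filtration_def using sub nat_filtration_mono[of _ _ M X] by blast
    fix t :: real assume t: "t \<ge> 0"
    have "X t \<in> borel_measurable (nat_filtration M X t)" by (rule measurable_nat_filtration[OF t order_refl])
    from measurable_compose[OF this F_measurable, of z]
    show "(\<lambda>w. F (X t w) z - I t w) \<in> borel_measurable (nat_filtration M X t)"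
      unfolding I_def by (intro borel_measurable_diff progressive_integral[where M = M, OF rc t order_refl genF_measurable])
    show "integrable M (\<lambda>w. F (X t w) z - I t w)"
      by (intro Bochner_Integration.integrable_diff Ii0[OF t] integrable_const_bound[where B = 1]) (use Fb Fm t in auto)
  next
    fix u v :: real and A assume u: "0 \<le> u" and uv: "u \<le> v" and A: "A \<in> sets (nat_filtration M X u)"
    have v: "0 \<le> v" using u uv by simp
    have AM[measurable]: "A \<in> sets M" using sub[of u] A by (auto simp: subalgebra_def)
    have Ii: "integrable M (\<lambda>w. indicator A w * I t w)" if "t \<ge> 0" for t
      using Bochner_Integration.integrable_bound[OF Ii0[OF that], of "\<lambda>w. indicator A w * I t w"] borel_measurable_integrable[OF Ii0[OF that]]
      by (auto simp: indicator_def)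
    have Fi: "integrable M (\<lambda>w. indicator A w * F (X t w) z)" if "t \<ge> 0" for t
      by (rule bounded_indicator_integral(1)[OF M Fm _ AM, where K = 1]) (use that Fb in auto)
    define V where "V = (\<lambda>r w. mean c \<theta> (r - u) (X u w))"
    have Vm: "V r \<in> borel_measurable M" for r unfolding V_def by (rule measurable_compose[OF Xm[OF u] mean_measurable])
    have Vq: "V r w \<in> quadrant" if "u \<le> r" "w \<in> space M" for r w using u XE that c \<theta> by (auto simp: V_def intro!: mean_E)
    have FVi: "integrable M (\<lambda>w. indicator A w * F (V v w) z)"
      by (rule bounded_indicator_integral(1)[OF M measurable_compose[OF Vm F_measurable] _ AM, where K = 1]) (use uv Vq norm_F_le z in auto)
    have jmV: "(\<lambda>(r, w). indicator {u..v} r *\<^sub>R (indicator A w * genF c \<theta> z (V r w))) \<in> borel_measurable (lborel \<Otimes>\<^sub>M M)"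
    proof -
      note [measurable] = Xm[OF u]
      have [measurable]: "(\<lambda>p. mean c \<theta> (fst p - u) (X u (snd p))) \<in> borel_measurable (borel \<Otimes>\<^sub>M M)"
        unfolding mean_def by measurable
      have "(\<lambda>p. indicator {u..v} (fst p) *\<^sub>R (indicator A (snd p) * genF c \<theta> z (mean c \<theta> (fst p - u) (X u (snd p))))) \<in> borel_measurable (borel \<Otimes>\<^sub>M M)"
        by measurable
      then show ?thesis
        unfolding measurable_cong_sets[OF sets_pair_measure_cong[OF sets_lborel refl] refl] by (simp add: case_prod_beta' V_def)
    qed
    have "(CLINT w|M. indicator A w * I v w) - (CLINT w|M. indicator A w * I u w) = (CLINT w|M. indicator A w * I v w - indicator A w * I u w)"
      using Ii[OF u] Ii[OF v] by simp
    also have "\<dots> = (CLINT w|M. CLINT r:{u..v}|lborel. indicator A w * genF c \<theta> z (X r w))"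
    proof (rule Bochner_Integration.integral_cong[OF refl])
      fix w assume "w \<in> space M"
      from Icc_integral_split[OF si[OF this v] u uv]
      show "indicator A w * I v w - indicator A w * I u w = (CLINT r:{u..v}|lborel. indicator A w * genF c \<theta> z (X r w))"
        by (simp add: I_def algebra_simps)
    qed
    also have "\<dots> = (CLINT r:{u..v}|lborel. CLINT w|M. indicator A w * genF c \<theta> z (X r w))"
      by (rule fubini_bounded(1)[OF M uv jointly_measurable_comp[OF jm _ AM u] gbA]) (use u XE E_subset_quadrant in auto)
    also have "\<dots> = (CLINT r:{u..v}|lborel. CLINT w|M. indicator A w * genF c \<theta> z (V r w))"
    proof (rule set_lebesgue_integral_cong)
      show "\<forall>r. r \<in> {u..v} \<longrightarrow> (CLINT w|M. indicator A w * genF c \<theta> z (X r w)) = (CLINT w|M. indicator A w * genF c \<theta> z (V r w))"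
        using tmarkov_genF[OF T c \<theta> u _ A z] by (simp add: V_def)
    qed simp
    also have "\<dots> = (CLINT w|M. CLINT r:{u..v}|lborel. indicator A w * genF c \<theta> z (V r w))"
      by (rule fubini_bounded(1)[OF M uv jmV gbA, symmetric]) (use Vq in auto)
    also have "\<dots> = (CLINT w|M. indicator A w * F (V v w) z - indicator A w * F (X u w) z)"
      by (intro Bochner_Integration.integral_cong refl) (simp add: V_def F_mean_integral[OF uv] right_diff_distrib)
    also have "\<dots> = (CLINT w|M. indicator A w * F (V v w) z) - (CLINT w|M. indicator A w * F (X u w) z)"
      using FVi Fi[OF u] by simp
    also have "(CLINT w|M. indicator A w * F (V v w) z) = (CLINT w|M. indicator A w * F (X v w) z)"
      unfolding V_def by (rule tmarkovD[OF T u uv A z, symmetric])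
    finally show "(CLINT w|M. indicator A w * (F (X v w) z - I v w)) = (CLINT w|M. indicator A w * (F (X u w) z - I u w))"
      using Fi[OF u] Fi[OF v] Ii[OF u] Ii[OF v] by (simp add: right_diff_distrib algebra_simps)
  qed
  then show "complex_martingale M (mp_filtration M X) (\<lambda>t w. F (X t w) z - (CLINT s:{0..t}|lborel. genF c \<theta> z (X s w)))"
    unfolding mpf I_def .
qed

section \<open>Existence\<close>

text \<open>\<open>e\<^sup>c\<^sup>t (X\<^sub>t - \<theta>)\<close> is \<open>B\<close> stopped at its exit from the quadrant with corner \<open>- e\<^sup>c\<^sup>t \<theta>\<close>. This corner moves
  down as \<open>t\<close> grows, so the exit times are monotone in \<open>t\<close>; the strict inequality \<open>t' > t\<close> in \<open>H\<close> makes
  them right continuous.\<close>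

locale moving_quadrant =
  fixes M :: "'a measure" and B :: "real \<Rightarrow> 'a \<Rightarrow> real \<times> real" and c :: real and \<theta> :: "real \<times> real"
  assumes bm: "bm M B" and c: "c \<ge> 0" and \<theta>: "\<theta> \<in> quadrant"
    and initE: "\<And>w. w \<in> space M \<Longrightarrow> B 0 w + \<theta> \<in> E"
    and unbounded: "\<And>w n. w \<in> space M \<Longrightarrow> \<exists>u>0. fst (B u w) + real n \<le> 0"
begin

sublocale prob_space M by (rule bm_prob[OF bm])

definition G :: "real \<Rightarrow> real \<Rightarrow> 'a \<Rightarrow> real" where "G t u w = mc (B u w + exp (c * t) *\<^sub>R \<theta>)"
definition H :: "real \<Rightarrow> 'a \<Rightarrow> real set" where "H t w = {u. 0 < u \<and> (\<exists>t'>t. G t' u w \<le> 0)}"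
definition S :: "real \<Rightarrow> 'a \<Rightarrow> real" where "S t w = Inf (H t w)"
definition X :: "real \<Rightarrow> 'a \<Rightarrow> real \<times> real" where "X t w = exp (- c * t) *\<^sub>R B (S t w) w + \<theta>"

lemma \<theta>_nonneg: "fst \<theta> \<ge> 0" "snd \<theta> \<ge> 0" using \<theta> by (auto simp: quadrant_def)

lemma cont: "w \<in> space M \<Longrightarrow> continuous_on {0..} (\<lambda>u. B u w)" by (rule bm_continuous[OF bm])

lemma G_cont: "w \<in> space M \<Longrightarrow> continuous_on {0..} (\<lambda>u. G t u w)"
  unfolding G_def by (intro continuous_on_mc continuous_intros cont)

lemma exp_mono: "s \<le> t \<Longrightarrow> exp (c * s) \<le> exp (c * t)" using c by (simp add: mult_left_mono)

lemma G_mono: "s \<le> t \<Longrightarrow> G s u w \<le> G t u w"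
  using mult_right_mono[OF exp_mono \<theta>_nonneg(1)] mult_right_mono[OF exp_mono \<theta>_nonneg(2)]
  unfolding G_def mc_def by (intro min.mono) auto

lemma H_sub: "H t w \<subseteq> {0..}" by (auto simp: H_def)
lemma H_bdd: "bdd_below (H t w)" by (rule bdd_belowI[of _ 0]) (auto simp: H_def)

lemma H_antimono: "s \<le> t \<Longrightarrow> H t w \<subseteq> H s w" by (auto simp: H_def intro: le_less_trans)

text \<open>A far enough excursion of the first coordinate to the left leaves even the quadrant of
  time t + 1.\<close>

lemma H_ne: assumes "w \<in> space M" shows "H t w \<noteq> {}"
proof -
  obtain n :: nat where n: "exp (c * (t + 1)) * fst \<theta> \<le> real n" using real_arch_simple by blast
  obtain u where "u > 0" "fst (B u w) + real n \<le> 0" using unbounded[OF assms] by blast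
  then have "G (t + 1) u w \<le> 0" using n by (simp add: G_def mc_def min_le_iff_disj)
  then have "u \<in> H t w" using \<open>u > 0\<close> by (auto simp: H_def intro!: exI[of _ "t + 1"])
  then show ?thesis by blast
qed

text \<open>As G is monotone in its time argument, the times t' > t can be restricted to a sequence
  decreasing to t. This makes the hitting events countable unions.\<close>

lemma H_eq: "H t w = (\<Union>n. {u. 0 < u \<and> G (t + 1 / real (Suc n)) u w \<le> 0})"
proof safe
  fix u assume "u \<in> H t w"
  then obtain t' where t': "0 < u" "t < t'" "G t' u w \<le> 0" by (auto simp: H_def)
  obtain n where "inverse (real (Suc n)) < t' - t" using reals_Archimedean[of "t' - t"] t' by auto
  then have "G (t + 1 / real (Suc n)) u w \<le> G t' u w" by (intro G_mono) (simp add: inverse_eq_divide)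
  then have "G (t + 1 / real (Suc n)) u w \<le> 0" using t'(3) by linarith
  then show "u \<in> (\<Union>n. {u. 0 < u \<and> G (t + 1 / real (Suc n)) u w \<le> 0})" using t'(1) by blast
next
  fix u n assume "0 < u" "G (t + 1 / real (Suc n)) u w \<le> 0"
  then show "u \<in> H t w" by (auto simp: H_def intro!: exI[of _ "t + 1 / real (Suc n)"])
qed

lemma S_nonneg: "w \<in> space M \<Longrightarrow> S t w \<ge> 0"
  unfolding S_def by (rule cInf_greatest[OF H_ne]) (auto simp: H_def)

lemma S_mono: "w \<in> space M \<Longrightarrow> s \<le> t \<Longrightarrow> S s w \<le> S t w"
  unfolding S_def by (rule cInf_superset_mono[OF H_ne H_bdd H_antimono])

text \<open>For every t' > t the path has not left the quadrant with corner -exp(c t') \<theta> by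
  then; letting t' decrease to t gives the closed quadrant of time t.\<close>

lemma before_H:
  assumes w: "w \<in> space M" and t: "t \<ge> 0" and u: "u \<ge> 0" "\<And>h. h \<in> H t w \<Longrightarrow> u \<le> h"
  shows "B u w + exp (c * t) *\<^sub>R \<theta> \<in> quadrant"
proof (cases "u = 0")
  case True
  have "0 = G 0 0 w" using initE[OF w] by (simp add: G_def mc_E)
  also have "\<dots> \<le> G t 0 w" by (rule G_mono[OF t])
  finally show ?thesis using True by (simp add: G_def mc_quadrant)
next
  case False
  then have u0: "0 < u" using u by simp
  have pos: "G (t + 1 / real (Suc n)) u w \<ge> 0" for n
  proof (rule nonneg_before_hit[OF G_cont[OF w] u0])
    fix h :: real assume "0 < h" "G (t + 1 / real (Suc n)) h w \<le> 0"
    then show "u \<le> h" by (intro u(2)) (auto simp: H_eq)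
  qed
  have "(\<lambda>n. G (t + 1 / real (Suc n)) u w) \<longlonglongrightarrow> G (t + 0) u w"
    unfolding G_def mc_def by (intro tendsto_intros LIMSEQ_Suc[OF lim_const_over_n])
  then have "0 \<le> G (t + 0) u w" by (rule LIMSEQ_le_const) (use pos in auto)
  then show ?thesis by (simp add: G_def mc_quadrant)
qed

lemma at_S: assumes w: "w \<in> space M" and t: "t \<ge> 0" shows "B (S t w) w + exp (c * t) *\<^sub>R \<theta> \<in> E"
proof -
  have "B (S t w) w + exp (c * t) *\<^sub>R \<theta> \<in> quadrant"
    by (rule before_H[OF w t S_nonneg[OF w]]) (unfold S_def, rule cInf_lower[OF _ H_bdd])
  moreover have "G t (S t w) w \<le> 0"
    unfolding S_def
  proof (rule nonpos_at_hit[OF G_cont[OF w] H_ne[OF w] H_sub])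
    fix h assume "h \<in> H t w"
    then obtain t' where "t' > t" "G t' h w \<le> 0" by (auto simp: H_def)
    then show "G t h w \<le> 0" using G_mono[of t t' h w] by linarith
  qed
  ultimately show ?thesis by (simp add: mc_E mc_quadrant G_def)
qed

lemma X_eq: "X t w = exp (- c * t) *\<^sub>R (B (S t w) w + exp (c * t) *\<^sub>R \<theta>)"
  by (simp add: X_def scaleR_add_right flip: exp_add)

lemma X_E: "w \<in> space M \<Longrightarrow> t \<ge> 0 \<Longrightarrow> X t w \<in> E"
  unfolding X_eq by (rule scale_in_E[OF at_S]) auto

text \<open>A monotone time change of a continuous path: left limits come from the monotonicity of S
  alone, right continuity from the strict inequality in H.\<close>

lemma cadlag_X: assumes w: "w \<in> space M" shows "cadlag (\<lambda>t. X t w)"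
  unfolding cadlag_def
proof (intro conjI allI impI)
  fix t :: real
  have "((\<lambda>t'. S t' w) \<longlongrightarrow> S t w) (at_right t)"
  proof (rule order_tendstoI)
    fix a assume "a < S t w"
    show "eventually (\<lambda>t'. a < S t' w) (at_right t)"
      using eventually_at_right_less[of t]
      by eventually_elim (use \<open>a < S t w\<close> S_mono[OF w] in \<open>auto intro: less_le_trans less_imp_le\<close>)
  next
    fix a assume "S t w < a"
    then obtain h where h: "h \<in> H t w" "h < a" using cInf_less_iff[OF H_ne[OF w] H_bdd] by (auto simp: S_def)
    \<comment> \<open>A hit h that is due to some t' > t also belongs to H r for every r < t', so
      that S r <= h < a.\<close>
    then obtain t' where t': "t < t'" "0 < h" "G t' h w \<le> 0" by (auto simp: H_def)
    show "eventually (\<lambda>t'. S t' w < a) (at_right t)"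
      using eventually_at_right_real[OF t'(1)]
    proof eventually_elim
      case (elim r)
      then have "h \<in> H r w" using t' by (auto simp: H_def)
      then have "S r w \<le> h" unfolding S_def by (rule cInf_lower[OF _ H_bdd])
      then show ?case using h by simp
    qed
  qed
  then have "((\<lambda>t'. B (S t' w) w) \<longlongrightarrow> B (S t w) w) (at_right t)"
    by (rule continuous_on_tendsto_compose[OF cont[OF w]]) (use S_nonneg[OF w] in auto)
  then show "continuous (at_right t) (\<lambda>t. X t w)"
    unfolding continuous_within X_def by (intro tendsto_intros)
next
  fix t :: real
  define L where "L = Sup ((\<lambda>t'. S t' w) ` ({..<t} \<inter> UNIV))"
  have "((\<lambda>t'. S t' w) \<longlongrightarrow> L) (at t within ({..<t} \<inter> UNIV))"
    unfolding L_def by (rule Lim_left_bound[where K = "S t w"]) (auto intro: S_mono[OF w])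
  then have lim: "((\<lambda>t'. S t' w) \<longlongrightarrow> L) (at_left t)" by simp
  then have "L \<ge> 0" by (rule tendsto_lowerbound) (use S_nonneg[OF w] in auto)
  with lim have "((\<lambda>t'. B (S t' w) w) \<longlongrightarrow> B L w) (at_left t)"
    by (intro continuous_on_tendsto_compose[OF cont[OF w]]) (use S_nonneg[OF w] in auto)
  then have "((\<lambda>t. X t w) \<longlongrightarrow> exp (- c * t) *\<^sub>R B L w + \<theta>) (at_left t)"
    unfolding X_def by (intro tendsto_intros)
  then show "\<exists>l. ((\<lambda>t. X t w) \<longlongrightarrow> l) (at_left t)" ..
qed

lemma H_meas: "{w\<in>space M. \<exists>h\<in>H t w. h < q} \<in> sets (nat_filtration M B q)"
proof -
  let ?N = "nat_filtration M B q"
  have "{w\<in>space ?N. \<exists>u. 0 < u \<and> u < q \<and> G (t + 1 / real (Suc n)) u w \<le> 0} \<in> sets ?N" for n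
  proof (rule hit_measurable)
    fix u assume "0 < u" "u < q"
    then have [measurable]: "B u \<in> borel_measurable ?N" by (intro measurable_nat_filtration) auto
    show "G (t + 1 / real (Suc n)) u \<in> borel_measurable ?N" unfolding G_def by measurable
  qed (use G_cont in auto)
  then have "(\<Union>n. {w\<in>space ?N. \<exists>u. 0 < u \<and> u < q \<and> G (t + 1 / real (Suc n)) u w \<le> 0}) \<in> sets ?N" by blast
  also have "(\<Union>n. {w\<in>space ?N. \<exists>u. 0 < u \<and> u < q \<and> G (t + 1 / real (Suc n)) u w \<le> 0}) = {w\<in>space M. \<exists>h\<in>H t w. h < q}"
    by (auto simp: H_eq)
  finally show ?thesis .
qed

lemma S_min_measurable: "(\<lambda>w. min (S t w) q) \<in> borel_measurable (nat_filtration M B q)"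
  unfolding S_def
proof (rule hitting_time_measurable)
  fix a assume "a \<le> q"
  then show "{w\<in>space (nat_filtration M B q). \<exists>h\<in>H t w. h < a} \<in> sets (nat_filtration M B q)"
    using H_meas[of t a] nat_filtration_mono[of a q M B] by auto
qed (use H_ne H_sub in auto)

lemma H_less: "w \<in> space M \<Longrightarrow> (\<exists>h\<in>H t w. h < q) \<longleftrightarrow> S t w < q"
  unfolding S_def by (simp add: cInf_less_iff[OF H_ne H_bdd])

text \<open>On the event that the hit occurs before q, X r is computed from the path stopped at
  \<open>min (S r w) q\<close>, which the information of B up to q determines.\<close>

lemma X_before_measurable:
  assumes q: "q > 0" and C: "C \<in> sets borel"
  shows "X r -` C \<inter> {w\<in>space M. \<exists>h\<in>H r w. h < q} \<in> sets (nat_filtration M B q)"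
proof -
  let ?N = "nat_filtration M B q"
  have "(\<lambda>(u, w). B (min (max u 0) q) w) \<in> borel_measurable (borel \<Otimes>\<^sub>M ?N)"
    by (rule right_continuous_measurable)
      (use q cont in \<open>auto intro: measurable_nat_filtration continuous_imp_right\<close>)
  from measurable_compose[OF measurable_Pair[OF S_min_measurable[of r q] measurable_ident] this]
  have bmeas: "(\<lambda>w. B (min (max (min (S r w) q) 0) q) w) \<in> borel_measurable ?N" by simp
  define f where "f = (\<lambda>w. exp (- c * r) *\<^sub>R B (min (max (min (S r w) q) 0) q) w + \<theta>)"
  have "f \<in> borel_measurable ?N" unfolding f_def using bmeas by measurable
  from sets.Int[OF measurable_sets[OF this C] H_meas[of r q]]
  have "(f -` C \<inter> space ?N) \<inter> {w\<in>space M. \<exists>h\<in>H r w. h < q} \<in> sets ?N" .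
  moreover have fe: "f w = X r w" if "w \<in> space M" "\<exists>h\<in>H r w. h < q" for w
    using S_nonneg[OF that(1), of r] that H_less[OF that(1), of r q] by (simp add: f_def X_def)
  have "(f -` C \<inter> space ?N) \<inter> {w\<in>space M. \<exists>h\<in>H r w. h < q} = X r -` C \<inter> {w\<in>space M. \<exists>h\<in>H r w. h < q}"
  proof (rule set_eqI)
    fix w
    show "w \<in> (f -` C \<inter> space ?N) \<inter> {w\<in>space M. \<exists>h\<in>H r w. h < q} \<longleftrightarrow> w \<in> X r -` C \<inter> {w\<in>space M. \<exists>h\<in>H r w. h < q}"
    proof (cases "w \<in> space M \<and> (\<exists>h\<in>H r w. h < q)")
      case True
      then have "f w = X r w" by (intro fe) auto
      then show ?thesis using True by simp
    qed blast
  qed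
  ultimately show ?thesis by simp
qed

lemma X_measurable: "X r \<in> borel_measurable M"
proof (rule measurableI)
  fix C :: "(real \<times> real) set" assume C: "C \<in> sets borel"
  have "X r -` C \<inter> {w\<in>space M. \<exists>h\<in>H r w. h < real (Suc n)} \<in> sets M" for n
    by (rule mem_sets_of_nat_filtration[OF bm X_before_measurable[OF _ C]]) simp
  then have "(\<Union>n. X r -` C \<inter> {w\<in>space M. \<exists>h\<in>H r w. h < real (Suc n)}) \<in> sets M" by blast
  moreover have "\<exists>n. \<exists>h\<in>H r w. h < real (Suc n)" if "w \<in> space M" for w
  proof -
    obtain n where "S r w < real n" using reals_Archimedean2 by blast
    then show ?thesis using H_less[OF that, of r "real (Suc n)"] by (intro exI[of _ n]) simp
  qed
  then have "(\<Union>n. X r -` C \<inter> {w\<in>space M. \<exists>h\<in>H r w. h < real (Suc n)}) = X r -` C \<inter> space M" by blast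
  ultimately show "X r -` C \<inter> space M \<in> sets M" by simp
qed simp

text \<open>Events of the past of X live at random times of B. Restricted to the event that S t lies
  before q they belong to the past of B up to q, as optional stopping requires.\<close>

lemma nat_filtration_stopped:
  assumes A: "A \<in> sets (nat_filtration M X s)" and st: "s \<le> t" and q: "q > 0"
  shows "{w\<in>A. \<exists>h\<in>H t w. h < q} \<in> sets (nat_filtration M B q)"
proof -
  let ?N = "nat_filtration M B q"
  define D where "D = {w\<in>space M. \<exists>h\<in>H t w. h < q}"
  have D: "D \<in> sets ?N" unfolding D_def by (rule H_meas)
  have "A \<inter> D \<in> sets ?N"
    using A[unfolded sets_nat_filtration]
  proof (induction rule: sigma_sets.induct)
    case (Basic A)
    then obtain r C where r: "A = X r -` C \<inter> space M" "r \<le> s" "C \<in> sets borel" by auto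
    have "D \<subseteq> {w\<in>space M. \<exists>h\<in>H r w. h < q}" using H_antimono[of r t] r st by (auto simp: D_def)
    then have "A \<inter> D = (X r -` C \<inter> {w\<in>space M. \<exists>h\<in>H r w. h < q}) \<inter> D" using r(1) by auto
    then show ?case using X_before_measurable[OF q r(3), of r] D by auto
  next
    case Empty
    then show ?case by simp
  next
    case (Compl A)
    have "(space M - A) \<inter> D = D - (A \<inter> D)" by (auto simp: D_def)
    then show ?case using Compl D by auto
  next
    case (Union A)
    have "(\<Union>i. A i \<inter> D) \<in> sets ?N" using Union.IH by (intro sets.countable_UN) auto
    then show ?case by (simp add: Int_UN_distrib2)
  qed
  moreover have "A \<subseteq> space M" using sets.sets_into_space[OF A] by simp
  then have "A \<inter> D = {w\<in>A. \<exists>h\<in>H t w. h < q}" by (auto simp: D_def)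
  ultimately show ?thesis by simp
qed

text \<open>In the shifted quadrant F(_, y) need not be bounded by 1, but its product with the
  constant F(exp(c t) \<theta>, y) is; this yields the bound C.\<close>

lemma stopping:
  assumes y: "y \<in> E" and t: "t \<ge> 0" and A: "A \<in> sets M" and H': "\<And>w. H t w \<subseteq> H' w" "\<And>w. H' w \<subseteq> {0..}"
    and meas: "\<And>q. 0 < q \<Longrightarrow> {w\<in>A. \<exists>h\<in>H t w. h < q} \<in> sets (nat_filtration M B q)"
    and meas': "\<And>q. 0 < q \<Longrightarrow> {w\<in>A. \<exists>h\<in>H' w. h < q} \<in> sets (nat_filtration M B q)"
  shows "(CLINT w|M. indicator A w * F (B (S t w) w) y) = (CLINT w|M. indicator A w * F (B (Inf (H' w)) w) y)"
proof -
  define C where "C = 1 / norm (F (exp (c * t) *\<^sub>R \<theta>) y)"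
  have Fb: "norm (F x y) \<le> C" if "x + exp (c * t) *\<^sub>R \<theta> \<in> quadrant" for x
  proof -
    have "F (x + exp (c * t) *\<^sub>R \<theta>) y = F x y * F (exp (c * t) *\<^sub>R \<theta>) y" by (simp add: F_def diamond_add exp_add)
    then have "norm (F x y) * norm (F (exp (c * t) *\<^sub>R \<theta>) y) \<le> 1" using norm_F_le[OF that y] by (simp add: norm_mult)
    moreover have "norm (F (exp (c * t) *\<^sub>R \<theta>) y) > 0" by (simp add: F_def)
    ultimately show ?thesis by (simp add: C_def field_simps)
  qed
  have "(CLINT w|M. if H t w = {} then 0 else indicator A w * expmart (F_a y) (cnj (F_a y)) 0 (B (Inf (H t w)) w)) =
    (CLINT w|M. if H t w = {} then 0 else indicator A w * expmart (F_a y) (cnj (F_a y)) 0 (B (Inf (H' w)) w))"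
  proof (rule optional_stopping[OF bm F_a_isotropic[OF y] _ A H' _ meas meas'])
    show "AE w in M. H t w \<noteq> {}" by (rule AE_I2) (rule H_ne)
    show "norm (expmart (F_a y) (cnj (F_a y)) 0 (B u w)) \<le> C" if "w \<in> space M" "u \<ge> 0" "\<And>h. h \<in> H t w \<Longrightarrow> u \<le> h" for w u
      unfolding F_expmart[symmetric] by (rule Fb[OF before_H[OF that(1) t that(2,3)]])
    show "norm (expmart (F_a y) (cnj (F_a y)) 0 (B 0 w)) \<le> C" if "w \<in> space M" for w
      unfolding F_expmart[symmetric] by (rule Fb[OF before_H[OF that t order_refl]]) (auto simp: H_def)
  qed
  moreover have "(CLINT w|M. if H t w = {} then 0 else indicator A w * expmart (F_a y) (cnj (F_a y)) 0 (B (T w) w)) =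
    (CLINT w|M. indicator A w * F (B (T w) w) y)" for T
    by (intro Bochner_Integration.integral_cong refl) (simp add: H_ne F_expmart)
  ultimately show ?thesis by (simp add: S_def)
qed

text \<open>As H t is contained in H s, optional stopping compares S t with the earlier S s. For y =
  exp(-c t) z, both F(X t, z) and F at the mean of X s are F(\<theta>, z) times F(_, y) at the
  stopped path.\<close>

lemma tmarkov_X: "tmarkov c \<theta> M X"
  unfolding tmarkov_def
proof (intro conjI allI impI ballI)
  fix s t :: real and A z assume st: "0 \<le> s \<and> s \<le> t" and A: "A \<in> sets (nat_filtration M X s)" and z: "z \<in> E"
  have AM: "A \<in> sets M" using nat_filtration_sub[of X M s, OF X_measurable] A by (auto simp: subalgebra_def)
  define y where "y = exp (- c * t) *\<^sub>R z"
  have y: "y \<in> E" unfolding y_def by (rule scale_in_E[OF z]) simp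
  have "(CLINT w|M. indicator A w * F (B (S t w) w) y) = (CLINT w|M. indicator A w * F (B (Inf (H s w)) w) y)"
    by (rule stopping[OF y _ AM H_antimono H_sub nat_filtration_stopped[OF A] nat_filtration_stopped[OF A order_refl]]) (use st in auto)
  then have eq: "F \<theta> z * (CLINT w|M. indicator A w * F (B (S t w) w) y) = F \<theta> z * (CLINT w|M. indicator A w * F (B (S s w) w) y)"
    by (simp add: S_def)
  have k: "F (exp (- c * t) *\<^sub>R b + \<theta>) z = F \<theta> z * F b y" for b
    by (simp add: F_def y_def diamond_add diamond_scale diamond_scale_right add.commute flip: exp_add)
  have m: "mean c \<theta> (t - s) (X s w) = exp (- c * t) *\<^sub>R B (S s w) w + \<theta>" for w
  proof -
    have "exp (- c * (t - s)) * exp (- c * s) = exp (- c * t)" by (simp add: algebra_simps flip: exp_add)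
    then show ?thesis by (simp add: mean_def X_def scaleR_add_right scaleR_diff_left)
  qed
  show "(CLINT w|M. indicator A w * F (X t w) z) = (CLINT w|M. indicator A w * F (mean c \<theta> (t - s) (X s w)) z)"
    unfolding m unfolding X_def k using eq by (simp add: mult.left_commute[of _ "F \<theta> z"])
qed (use X_measurable X_E prob_space_axioms in auto)

text \<open>The laws are compared through their transforms, by stopping at S 0 and at the constant
  time 0. This avoids the question whether S 0 vanishes almost surely.\<close>

lemma distr_X_0: "distr M borel (X 0) = distr M borel (\<lambda>w. B 0 w + \<theta>)"
proof (rule F_determines_prob)
  have [measurable]: "X 0 \<in> borel_measurable M" "B 0 \<in> borel_measurable M"
    using X_measurable bm_measurable[OF bm] by auto
  show "prob_space (distr M borel (X 0))" "prob_space (distr M borel (\<lambda>w. B 0 w + \<theta>))"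
    by (auto intro!: prob_space_distr)
  show "AE y in distr M borel (X 0). y \<in> E" "AE y in distr M borel (\<lambda>w. B 0 w + \<theta>). y \<in> E"
    by (auto simp: AE_distr_iff intro!: AE_I2 X_E initE)
  fix z assume z: "z \<in> E"
  have "(CLINT w|M. indicator (space M) w * F (B (S 0 w) w) z) = (CLINT w|M. indicator (space M) w * F (B (Inf {0..}) w) z)"
  proof (rule stopping[OF z order_refl sets.top H_sub order_refl H_meas])
    show "{w\<in>space M. \<exists>h\<in>{0..}. h < q} \<in> sets (nat_filtration M B q)" if "0 < q" for q :: real
    proof -
      have "{w\<in>space M. \<exists>h\<in>{0..}. h < q} = space (nat_filtration M B q)" using that by auto
      then show ?thesis by (simp only: sets.top)
    qed
  qed
  moreover have "(CLINT w|M. indicator (space M) w * f w) = (CLINT w|M. f w)" for f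
    by (intro Bochner_Integration.integral_cong refl) simp
  ultimately have eq: "(CLINT w|M. F (B (S 0 w) w) z) * F \<theta> z = (CLINT w|M. F (B 0 w) z) * F \<theta> z"
    by simp
  have k: "F (b + \<theta>) z = F b z * F \<theta> z" for b by (simp add: F_def diamond_add exp_add)
  show "(CLINT y|distr M borel (X 0). F y z) = (CLINT y|distr M borel (\<lambda>w. B 0 w + \<theta>). F y z)"
    using eq by (simp add: integral_distr X_def k)
qed simp_all

end

text \<open>The locale demands its properties at every sample point, while Brownian motion has them
  only almost surely. Two modifications on null events repair this, one for the initial value and
  one for the unboundedness.\<close>

lemma tmarkov_exists:
  assumes c: "c \<ge> 0" and \<theta>: "\<theta> \<in> quadrant" and \<mu>: "prob_on_E \<mu>"
  shows "\<exists>(M :: path measure) X. tmarkov c \<theta> M X \<and> (\<forall>w\<in>space M. cadlag (\<lambda>t. X t w)) \<and> distr M borel (X 0) = \<mu>"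
proof -
  have mu: "prob_space \<mu>" "sets \<mu> = sets borel" "emeasure \<mu> E = 1" using \<mu> by (auto simp: prob_on_E_def)
  interpret mu: prob_space \<mu> by fact
  note [measurable_cong] = mu(2)
  have [measurable]: "(\<lambda>x. x - \<theta>) \<in> \<mu> \<rightarrow>\<^sub>M borel" unfolding measurable_cong_sets[OF mu(2) refl] by measurable
  then have "prob_space (distr \<mu> borel (\<lambda>x. x - \<theta>))" by (rule mu.prob_space_distr)
  from bm_exists[OF this] obtain M :: "path measure" and B0 where bm0: "bm M B0" and B0: "distr M borel (B0 0) = distr \<mu> borel (\<lambda>x. x - \<theta>)"
    by auto
  interpret prob_space M by (rule bm_prob[OF bm0])
  have m0[measurable]: "B0 0 \<in> borel_measurable M" by (rule bm_measurable[OF bm0]) simp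
  have "AE x in \<mu>. x \<in> E" using mu by (subst mu.AE_in_set_eq_1) (auto simp: mu.emeasure_eq_measure)
  then have "AE x in distr \<mu> borel (\<lambda>x. x - \<theta>). x + \<theta> \<in> E" by (subst AE_distr_iff) auto
  then have AE0: "AE w in M. B0 0 w + \<theta> \<in> E" unfolding B0[symmetric] by (subst (asm) AE_distr_iff) auto
  \<comment> \<open>A deterministic path with both properties: it starts at -\<theta>, so that the
    shifted start is the origin of E, and its first coordinate tends to minus infinity.\<close>
  define b where "b = (\<lambda>(t::real) (w::path). (- t, 0) - \<theta>)"
  have b: "continuous_on {0..} (\<lambda>t. b t w)" "b t \<in> borel_measurable M" for t w
    unfolding b_def by (auto intro!: continuous_intros)
  define G1 where "G1 = {w\<in>space M. B0 0 w + \<theta> \<in> E}"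
  have G1: "G1 \<in> sets M" "AE w in M. w \<in> G1"
  proof -
    show "G1 \<in> sets M" unfolding G1_def by measurable
    show "AE w in M. w \<in> G1" using AE0 AE_space by eventually_elim (simp add: G1_def)
  qed
  define B1 where "B1 = (\<lambda>t w. if w \<in> G1 then B0 t w else b t w)"
  have bm1: "bm M B1" unfolding B1_def by (rule bm_modify[OF bm0 G1 b])
  have init1: "B1 0 w + \<theta> \<in> E" if "w \<in> space M" for w
    using that zero_in_E by (auto simp: B1_def G1_def b_def zero_prod_def)
  define K where "K = (\<lambda>(n::nat) w. {u. 0 < u \<and> fst (B1 u w) + real n \<le> 0})"
  have Km: "{w\<in>space M. \<exists>h\<in>K n w. h < q} \<in> sets (nat_filtration M B1 q)" for n q
  proof -
    have "{w\<in>space (nat_filtration M B1 q). \<exists>u. 0 < u \<and> u < q \<and> fst (B1 u w) + real n \<le> 0} \<in> sets (nat_filtration M B1 q)"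
    proof (rule hit_measurable)
      fix u assume "0 < u" "u < q"
      then have "B1 u \<in> borel_measurable (nat_filtration M B1 q)" by (intro measurable_nat_filtration) auto
      then show "(\<lambda>w. fst (B1 u w) + real n) \<in> borel_measurable (nat_filtration M B1 q)"
        by (intro borel_measurable_add borel_measurable_const) (metis measurable_compose measurable_fst borel_prod)
    qed (use bm_continuous[OF bm1] in \<open>auto intro!: continuous_intros\<close>)
    then show ?thesis by (simp add: K_def Bex_def conj_ac)
  qed
  have Kne: "AE w in M. K n w \<noteq> {}" for n
  proof -
    \<comment> \<open>For \<open>hit_AE\<close> the level must lie below the starting point. The
      start is at least -(fst \<theta>), so -max n m is low enough, and reaching it also settles the
      level -n.\<close>
    obtain m :: nat where m: "fst \<theta> \<le> real m" using real_arch_simple by blast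
    have "AE w in M. K (max n m) w \<noteq> {}"
    proof (rule hit_AE[OF bm1 _ Km, where \<alpha> = "real (max n m)"])
      show "K (max n m) w \<subseteq> {0..}" for w by (auto simp: K_def)
      have 0: "fst (B1 0 w) \<ge> - real (max n m)" if "w \<in> space M" for w
      proof -
        have "0 \<le> fst (B1 0 w + \<theta>)" using init1[OF that] unfolding E_def quadrant_def by (auto simp del: fst_add)
        then show ?thesis using m by simp
      qed
      then show "fst (B1 0 w) \<ge> - real (max n m)" if "w \<in> space M" for w using that .
      fix w u assume w: "w \<in> space M" and u: "u \<ge> 0" "\<And>h. h \<in> K (max n m) w \<Longrightarrow> u \<le> h"
      show "fst (B1 u w) \<ge> - real (max n m)"
      proof (cases "u = 0")
        case False
        have "fst (B1 u w) + real (max n m) \<ge> 0"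
          by (rule nonneg_before_hit[where f = "\<lambda>u. fst (B1 u w) + real (max n m)"])
            (use u False bm_continuous[OF bm1 w] in \<open>auto simp: K_def intro!: continuous_intros\<close>)
        then show ?thesis by linarith
      qed (use 0[OF w] in simp)
    qed
    then show ?thesis
    proof eventually_elim
      case (elim w)
      then obtain u where u: "0 < u" "fst (B1 u w) + real (max n m) \<le> 0" unfolding K_def by blast
      have "real n \<le> real (max n m)" by simp
      then have "fst (B1 u w) + real n \<le> 0" using u(2) by linarith
      then show ?case using u(1) unfolding K_def by blast
    qed
  qed
  define G2 where "G2 = {w\<in>space M. \<forall>n. K n w \<noteq> {}}"
  have "G2 = (\<Inter>n. \<Union>q::nat. {w\<in>space M. \<exists>h\<in>K n w. h < real (Suc q)})"
  proof -
    have "K n w \<noteq> {} \<longleftrightarrow> (\<exists>q::nat. \<exists>h\<in>K n w. h < real (Suc q))" for n w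
    proof -
      have "\<exists>q::nat. h < real (Suc q)" for h :: real using reals_Archimedean2[of h] by (meson less_trans lessI of_nat_less_iff)
      then show ?thesis by blast
    qed
    then show ?thesis unfolding G2_def by auto
  qed
  moreover have "{w\<in>space M. \<exists>h\<in>K n w. h < real (Suc q)} \<in> sets M" for n q
    by (rule mem_sets_of_nat_filtration[OF bm1 Km])
  ultimately have G2: "G2 \<in> sets M" by simp
  have G2': "AE w in M. w \<in> G2"
    using AE_all_countable[THEN iffD2, OF allI, OF Kne] AE_space unfolding G2_def by eventually_elim simp
  define B where "B = (\<lambda>t w. if w \<in> G2 then B1 t w else b t w)"
  have bm: "bm M B" unfolding B_def by (rule bm_modify[OF bm1 G2 G2' b])
  interpret moving_quadrant M B c \<theta>
  proof
    show "bm M B" "c \<ge> 0" "\<theta> \<in> quadrant" by fact+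
    fix w assume w: "w \<in> space M"
    show "B 0 w + \<theta> \<in> E" using init1[OF w] zero_in_E by (auto simp: B_def b_def zero_prod_def)
    fix n
    show "\<exists>u>0. fst (B u w) + real n \<le> 0"
    proof (cases "w \<in> G2")
      case True
      then have "K n w \<noteq> {}" by (simp add: G2_def)
      then show ?thesis using True by (auto simp: K_def B_def)
    next
      case False
      have "fst \<theta> \<ge> 0" using \<theta> by (auto simp: quadrant_def)
      then show ?thesis using False by (intro exI[of _ "real n + 1"]) (auto simp: B_def b_def)
    qed
  qed
  have "distr M borel (X 0) = distr M borel (\<lambda>w. B 0 w + \<theta>)" by (rule distr_X_0)
  also have "\<dots> = distr M borel (\<lambda>w. B0 0 w + \<theta>)"
  proof (rule distr_cong_AE)
    show "AE w in M. B 0 w + \<theta> = B0 0 w + \<theta>" using G2' G1(2) by eventually_elim (simp add: B_def B1_def)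
  qed (use bm_measurable[OF bm, of 0] in auto)
  also have "\<dots> = distr (distr M borel (B0 0)) borel (\<lambda>x. x + \<theta>)" by (subst distr_distr) (auto simp: o_def)
  also have "\<dots> = distr \<mu> borel (\<lambda>x. x)" unfolding B0 by (subst distr_distr) (auto simp: o_def)
  also have "\<dots> = \<mu>" by (rule distr_id2[OF mu(2)[symmetric]])
  finally show ?thesis using tmarkov_X cadlag_X by blast
qed

text \<open>Solutions and the process are both reduced to \<open>tmarkov\<close>, whose
  finite-dimensional distributions are fixed by the initial law. Regular paths are used for the way
  back to the martingale problem, where right continuity supplies joint measurability and identifies
  the two filtrations.\<close>

theorem theorem5p4:
  fixes c :: real and \<theta> :: "real \<times> real"
  assumes "0 \<le> c" and "\<theta> \<in> quadrant"
  shows "mp_well_posed TYPE('a) TYPE('b) c \<theta> \<and>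
    (\<forall>\<mu>. prob_on_E \<mu> \<longrightarrow>
       (\<exists>(M :: path measure) X. infinite_rate_MCB c \<theta> M X \<and> distr M borel (X 0) = \<mu>)) \<and>
    (\<forall>(M :: 'a measure) X. infinite_rate_MCB c \<theta> M X \<longrightarrow> mp_solution c \<theta> M X) \<and>
    (\<forall>(M :: 'a measure) X (N :: 'b measure) Y.
       mp_solution c \<theta> M X \<and> infinite_rate_MCB c \<theta> N Y \<and> distr M borel (X 0) = distr N borel (Y 0)
       \<longrightarrow> same_fdd M X N Y)"
proof (intro conjI allI impI)
  note c = assms(1) and \<theta> = assms(2)
  \<comment> \<open>Stated for a fresh type variable, since it is applied to sample spaces of type
    \<open>path\<close> and of type \<open>'a\<close>.\<close>
  have mp_of_MCB: "mp_solution c \<theta> M X" if "infinite_rate_MCB c \<theta> M X" for M :: "'c measure" and X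
  proof (rule tmarkov_imp_mp[OF MCB_imp_tmarkov[OF that c \<theta>] c \<theta>])
    show "continuous (at_right t) (\<lambda>t. X t w)" if "w \<in> space M" "t \<ge> 0" for w t
      using \<open>infinite_rate_MCB c \<theta> M X\<close> that by (simp add: infinite_rate_MCB_def cadlag_def)
  qed
  show MCB: "\<exists>(M :: path measure) X. infinite_rate_MCB c \<theta> M X \<and> distr M borel (X 0) = \<mu>" if "prob_on_E \<mu>" for \<mu>
    using tmarkov_exists[OF c \<theta> that] tmarkov_imp_MCB[OF _ c \<theta>] by blast
  show "mp_well_posed TYPE('a) TYPE('b) c \<theta>"
    unfolding mp_well_posed_def
  proof (intro conjI allI impI)
    show "\<exists>(M :: path measure) X. mp_solution c \<theta> M X \<and> distr M borel (X 0) = \<mu>" if "prob_on_E \<mu>" for \<mu>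
      using MCB[OF that] mp_of_MCB by blast
    show "same_fdd M X N Y"
      if "mp_solution c \<theta> M X \<and> mp_solution c \<theta> N Y \<and> distr M borel (X 0) = distr N borel (Y 0)"
      for M :: "'a measure" and X and N :: "'b measure" and Y
      using that by (intro tmarkov_unique[OF _ _ c \<theta>] mp_imp_tmarkov[OF _ c \<theta>]) auto
  qed
  show "mp_solution c \<theta> M X" if "infinite_rate_MCB c \<theta> M X" for M :: "'a measure" and X
    by (rule mp_of_MCB[OF that])
  show "same_fdd M X N Y"
    if "mp_solution c \<theta> M X \<and> infinite_rate_MCB c \<theta> N Y \<and> distr M borel (X 0) = distr N borel (Y 0)"
    for M :: "'a measure" and X and N :: "'b measure" and Y
    using that by (intro tmarkov_unique[OF _ _ c \<theta>] mp_imp_tmarkov[OF _ c \<theta>] MCB_imp_tmarkov[OF _ c \<theta>]) auto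
qed

end
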